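(* Let $k$ be a field and let $\Lambda$ be a representation-finite bound path $k$-algebra of rank $n$ which is of left local-colocal type. Then the magnitude of the module category of $\Lambda$ satisfies $\chi(\Lambda\text{-}\mathrm{mod}) = n$. In particular, this holds when $\Lambda$ is a Nakayama $k$-algebra.
   Context: All modules are finitely generated left modules. A bound path $k$-algebra is an algebra $\Lambda=kQ/I$ with $Q$ a finite quiver and $I$ an admissible ideal of the path algebra $kQ$. The rank of $\Lambda$ is the number of isomorphism classes of indecomposable projective $\Lambda$-modules (equivalently $|Q_0|$). A finite-dimensional $k$-algebra is representation-finite if it has only finitely many indecomposable modules up to isomorphism. A finite-dimensional $k$-algebra $\Lambda$ is of left local-colocal type if every indecomposable left $\Lambda$-module has a simple top or a simple socle. It is a Nakayama algebra if every indecomposable left $\Lambda$-module is uniserial (has a unique composition series). Magnitude: for a finite-dimensional $k$-algebra $\Gamma$ with indecomposable projective modules $P_1,\dots,P_N$ (up to isomorphism), put $\mathbf{Z}_\Gamma=(\dim_k\mathrm{Hom}_\Gamma(P_i,P_j))_{i,j}$. If $\mathbf{Z}_\Gamma$ is invertible over $\mathbb{Q}$, the magnitude $\chi(\Gamma)$ is the sum of all entries of $\mathbf{Z}_\Gamma^{-1}$. For $\Lambda$ representation-finite with indecomposable modules $M_1,\dots,M_N$ (up to isomorphism), the Auslander algebra is $\mathrm{Aus}(\Lambda)=\mathrm{End}_\Lambda(M_1\oplus\cdots\oplus M_N)$; its matrix is always invertible over $\mathbb{Q}$ (it has finite global dimension), and the magnitude of the module category is $\chi(\Lambda\text{-}\mathrm{mod}):=\chi(\mathrm{Aus}(\Lambda))$.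 Equivalently, $\chi(\Lambda\text{-}\mathrm{mod})$ is the sum of all entries of the inverse of the matrix $(\dim_k\mathrm{Hom}_\Lambda(M_i,M_j))_{i,j}$. *)

theory Defs
  imports
    "HOL-Algebra.Ideal_Product"
    "HOL-Algebra.QuotRing"
    "Graph_Theory.Arc_Walk"
    "Jordan_Normal_Form.Missing_VectorSpace"
    "Jordan_Normal_Form.Matrix"
begin

hide_const (open) Multiset.mult  (* restores the ring multiplication field mult *)

text \<open>
  Throughout, a \<open>K\<close>-algebra is a record of type \<open>('k, 'a) module\<close>: its ring fields form a
  not necessarily commutative ring and \<open>smult\<close> is the scalar action of \<open>K\<close>.  A module over an
  algebra \<open>R\<close> is again a \<open>module\<close> record, of type \<open>('a, 'm) module\<close>, where \<open>smult\<close> is the action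
  of \<open>R\<close> and the fields \<open>mult\<close> and \<open>one\<close> carry no meaning.
\<close>

section \<open>Bound path algebras\<close>

text \<open>A path is a triple of source, list of arcs in order of traversal, and target.\<close>

definition paths :: "('v, 'e) pre_digraph \<Rightarrow> ('v \<times> 'e list \<times> 'v) set" where
  "paths Q = {(u, p, v). pre_digraph.awalk Q u p v}"

definition factorizations ::
  "('v, 'e) pre_digraph \<Rightarrow> 'v \<times> 'e list \<times> 'v \<Rightarrow> (('v \<times> 'e list \<times> 'v) \<times> ('v \<times> 'e list \<times> 'v)) set"
where
  "factorizations Q w =
     {(p, q). p \<in> paths Q \<and> q \<in> paths Q \<and>
        (\<exists>u a v b x. p = (u, a, v) \<and> q = (v, b, x) \<and> w = (u, a @ b, x))}"

text \<open>
  Elements are finitely supported coefficient functions that vanish off \<open>paths Q\<close>.  The product of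
  two basis paths is their concatenation, read from left to right.  The opposite convention
  replaces \<open>Q\<close> by the opposite quiver.
\<close>

definition path_algebra ::
  "('k, 'c) ring_scheme \<Rightarrow> ('v, 'e) pre_digraph \<Rightarrow> ('k, 'v \<times> 'e list \<times> 'v \<Rightarrow> 'k) module"
where
  "path_algebra K Q =
     \<lparr>carrier = {x. range x \<subseteq> carrier K \<and> finite {p. x p \<noteq> \<zero>\<^bsub>K\<^esub>} \<and> {p. x p \<noteq> \<zero>\<^bsub>K\<^esub>} \<subseteq> paths Q},
      mult = (\<lambda>x y w. finsum K (\<lambda>(p, q). x p \<otimes>\<^bsub>K\<^esub> y q) (factorizations Q w)),
      one = (\<lambda>w. if \<exists>v\<in>verts Q. w = (v, [], v) then \<one>\<^bsub>K\<^esub> else \<zero>\<^bsub>K\<^esub>),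
      zero = (\<lambda>w. \<zero>\<^bsub>K\<^esub>),
      add = (\<lambda>x y w. x w \<oplus>\<^bsub>K\<^esub> y w),
      smult = (\<lambda>c x w. c \<otimes>\<^bsub>K\<^esub> x w)\<rparr>"

definition arrow_ideal ::
  "('k, 'c) ring_scheme \<Rightarrow> ('v, 'e) pre_digraph \<Rightarrow> ('v \<times> 'e list \<times> 'v \<Rightarrow> 'k) set"
where
  "arrow_ideal K Q =
     Idl\<^bsub>path_algebra K Q\<^esub>
       {\<lambda>w. if w = (tail Q e, [e], head Q e) then \<one>\<^bsub>K\<^esub> else \<zero>\<^bsub>K\<^esub> | e. e \<in> arcs Q}"

text \<open>Powers of ideals are taken in the library monoid \<^const>\<open>ideals_set\<close> of two-sided ideals.\<close>

definition admissible_ideal ::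
  "('k, 'c) ring_scheme \<Rightarrow> ('v, 'e) pre_digraph \<Rightarrow> ('v \<times> 'e list \<times> 'v \<Rightarrow> 'k) set \<Rightarrow> bool"
where
  "admissible_ideal K Q I \<longleftrightarrow>
     ideal I (path_algebra K Q) \<and>
     (\<exists>m::nat\<ge>2. arrow_ideal K Q [^]\<^bsub>ideals_set (path_algebra K Q)\<^esub> m \<subseteq> I) \<and>
     I \<subseteq> arrow_ideal K Q [^]\<^bsub>ideals_set (path_algebra K Q)\<^esub> (2::nat)"

text \<open>
  Used both for \<open>M / N\<close> with \<open>N\<close> a submodule and for the algebra \<open>A / I\<close> with \<open>I\<close> a two-sided
  ideal.
\<close>

definition quotient_module :: "('a, 'm, 'z) module_scheme \<Rightarrow> 'm set \<Rightarrow> ('a, 'm set) module" where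
  "quotient_module M N =
     ring.extend (M Quot N) (module.fields (\<lambda>r X. \<Union>x\<in>X. N +>\<^bsub>M\<^esub> (r \<odot>\<^bsub>M\<^esub> x)))"

definition bound_path_algebra ::
  "('k, 'c) ring_scheme \<Rightarrow> ('v, 'e) pre_digraph \<Rightarrow> ('v \<times> 'e list \<times> 'v \<Rightarrow> 'k) set \<Rightarrow>
     ('k, ('v \<times> 'e list \<times> 'v \<Rightarrow> 'k) set) module"
where
  "bound_path_algebra K Q I = quotient_module (path_algebra K Q) I"


section \<open>Finitely generated left modules\<close>

text \<open>
  The locale \<^locale>\<open>module\<close> of the library assumes a commutative ring; the following is the
  same without commutativity.
\<close>

locale left_module = R?: ring R + M?: abelian_group M
  for R :: "('a, 'r) ring_scheme" (structure) and M :: "('a, 'm, 'z) module_scheme" (structure) +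
  assumes smult_closed: "\<lbrakk>a \<in> carrier R; x \<in> carrier M\<rbrakk> \<Longrightarrow> a \<odot>\<^bsub>M\<^esub> x \<in> carrier M"
    and smult_l_distr: "\<lbrakk>a \<in> carrier R; b \<in> carrier R; x \<in> carrier M\<rbrakk> \<Longrightarrow>
      (a \<oplus>\<^bsub>R\<^esub> b) \<odot>\<^bsub>M\<^esub> x = a \<odot>\<^bsub>M\<^esub> x \<oplus>\<^bsub>M\<^esub> b \<odot>\<^bsub>M\<^esub> x"
    and smult_r_distr: "\<lbrakk>a \<in> carrier R; x \<in> carrier M; y \<in> carrier M\<rbrakk> \<Longrightarrow>
      a \<odot>\<^bsub>M\<^esub> (x \<oplus>\<^bsub>M\<^esub> y) = a \<odot>\<^bsub>M\<^esub> x \<oplus>\<^bsub>M\<^esub> a \<odot>\<^bsub>M\<^esub> y"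
    and smult_assoc: "\<lbrakk>a \<in> carrier R; b \<in> carrier R; x \<in> carrier M\<rbrakk> \<Longrightarrow>
      (a \<otimes>\<^bsub>R\<^esub> b) \<odot>\<^bsub>M\<^esub> x = a \<odot>\<^bsub>M\<^esub> (b \<odot>\<^bsub>M\<^esub> x)"
    and smult_one: "x \<in> carrier M \<Longrightarrow> \<one>\<^bsub>R\<^esub> \<odot>\<^bsub>M\<^esub> x = x"

definition generated_submodule ::
  "('a, 'r) ring_scheme \<Rightarrow> ('a, 'm) module \<Rightarrow> 'm set \<Rightarrow> 'm set"
where
  "generated_submodule R M S = \<Inter>{N. Module.submodule N R M \<and> S \<subseteq> N}"

definition fin_gen_module :: "('a, 'r) ring_scheme \<Rightarrow> ('a, 'm) module \<Rightarrow> bool" where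
  "fin_gen_module R M \<longleftrightarrow>
     left_module R M \<and>
     (\<exists>S. finite S \<and> S \<subseteq> carrier M \<and> generated_submodule R M S = carrier M)"

definition isomorphic_modules ::
  "('a, 'r) ring_scheme \<Rightarrow> ('a, 'm) module \<Rightarrow> ('a, 'n) module \<Rightarrow> bool"
where
  "isomorphic_modules R M N \<longleftrightarrow> (\<exists>f\<in>module_hom R M N. bij_betw f (carrier M) (carrier N))"

definition simple_module :: "('a, 'r) ring_scheme \<Rightarrow> ('a, 'm) module \<Rightarrow> bool" where
  "simple_module R M \<longleftrightarrow>
     left_module R M \<and> carrier M \<noteq> {\<zero>\<^bsub>M\<^esub>} \<and>
     (\<forall>N. Module.submodule N R M \<longrightarrow> N = {\<zero>\<^bsub>M\<^esub>} \<or> N = carrier M)"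

definition indecomposable :: "('a, 'r) ring_scheme \<Rightarrow> ('a, 'm) module \<Rightarrow> bool" where
  "indecomposable R M \<longleftrightarrow>
     fin_gen_module R M \<and> carrier M \<noteq> {\<zero>\<^bsub>M\<^esub>} \<and>
     (\<forall>N N'. Module.submodule N R M \<and> Module.submodule N' R M \<and>
        N \<inter> N' = {\<zero>\<^bsub>M\<^esub>} \<and> set_add M N N' = carrier M \<longrightarrow>
        N = {\<zero>\<^bsub>M\<^esub>} \<or> N' = {\<zero>\<^bsub>M\<^esub>})"

definition maximal_submodule :: "('a, 'r) ring_scheme \<Rightarrow> ('a, 'm) module \<Rightarrow> 'm set \<Rightarrow> bool" where
  "maximal_submodule R M N \<longleftrightarrow>
     Module.submodule N R M \<and> N \<noteq> carrier M \<and>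
     (\<forall>N'. Module.submodule N' R M \<and> N \<subseteq> N' \<longrightarrow> N' = N \<or> N' = carrier M)"

definition radical :: "('a, 'r) ring_scheme \<Rightarrow> ('a, 'm) module \<Rightarrow> 'm set" where
  "radical R M = {x \<in> carrier M. \<forall>N. maximal_submodule R M N \<longrightarrow> x \<in> N}"

definition module_top :: "('a, 'r) ring_scheme \<Rightarrow> ('a, 'm) module \<Rightarrow> ('a, 'm set) module" where
  "module_top R M = quotient_module M (radical R M)"

definition module_socle :: "('a, 'r) ring_scheme \<Rightarrow> ('a, 'm) module \<Rightarrow> ('a, 'm) module" where
  "module_socle R M =
     M\<lparr>carrier := generated_submodule R M
        (\<Union>{S. Module.submodule S R M \<and> simple_module R (M\<lparr>carrier := S\<rparr>)})\<rparr>"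

definition composition_series ::
  "('a, 'r) ring_scheme \<Rightarrow> ('a, 'm) module \<Rightarrow> 'm set list \<Rightarrow> bool"
where
  "composition_series R M Ns \<longleftrightarrow>
     Ns \<noteq> [] \<and> hd Ns = {\<zero>\<^bsub>M\<^esub>} \<and> last Ns = carrier M \<and>
     (\<forall>N\<in>set Ns. Module.submodule N R M) \<and>
     (\<forall>i. Suc i < length Ns \<longrightarrow> Ns ! i \<subseteq> Ns ! Suc i \<and>
        simple_module R (quotient_module (M\<lparr>carrier := Ns ! Suc i\<rparr>) (Ns ! i)))"

definition uniserial :: "('a, 'r) ring_scheme \<Rightarrow> ('a, 'm) module \<Rightarrow> bool" where
  "uniserial R M \<longleftrightarrow> left_module R M \<and> (\<exists>!Ns. composition_series R M Ns)"


section \<open>The category of finitely generated modules over a finite-dimensional algebra\<close>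

text \<open>
  To speak of all modules we need a type that has room for all of them.  A finitely generated module
  over a finite-dimensional algebra over a field \<open>K\<close> with elements in \<open>'k\<close> has finite dimension
  over \<open>K\<close>, so its underlying set embeds into \<open>nat \<Rightarrow> 'k\<close> by coordinates; transporting its structure
  along the embedding, it is isomorphic to a module of the following type.
\<close>

type_synonym ('k, 'a) fd_module = "('a, nat \<Rightarrow> 'k) module"

definition projective :: "('k, 'a, 'z) module_scheme \<Rightarrow> ('k, 'a) fd_module \<Rightarrow> bool" where
  "projective R P \<longleftrightarrow>
     fin_gen_module R P \<and>
     (\<forall>(X :: ('k, 'a) fd_module) (Y :: ('k, 'a) fd_module) g f.
        fin_gen_module R X \<and> fin_gen_module R Y \<and>
        g \<in> module_hom R X Y \<and> g ` carrier X = carrier Y \<and> f \<in> module_hom R P Y \<longrightarrow>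
        (\<exists>h\<in>module_hom R P X. \<forall>p\<in>carrier P. g (h p) = f p))"

definition iso_classes ::
  "('k, 'a, 'z) module_scheme \<Rightarrow> (('k, 'a) fd_module \<Rightarrow> bool) \<Rightarrow> ('k, 'a) fd_module set set"
where
  "iso_classes R P = {M. P M} // {(M, N). P M \<and> P N \<and> isomorphic_modules R M N}"

definition representatives ::
  "('k, 'a, 'z) module_scheme \<Rightarrow> (('k, 'a) fd_module \<Rightarrow> bool) \<Rightarrow> ('k, 'a) fd_module list \<Rightarrow> bool"
where
  "representatives R P Ms \<longleftrightarrow>
     (\<forall>M\<in>set Ms. P M) \<and>
     (\<forall>M. P M \<longrightarrow> (\<exists>!i. i < length Ms \<and> isomorphic_modules R M (Ms ! i)))"

definition indecomposable_projective ::
  "('k, 'a, 'z) module_scheme \<Rightarrow> ('k, 'a) fd_module \<Rightarrow> bool"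
where
  "indecomposable_projective R P \<longleftrightarrow> indecomposable R P \<and> projective R P"

definition algebra_rank :: "('k, 'a, 'z) module_scheme \<Rightarrow> nat" where
  "algebra_rank R = card (iso_classes R (indecomposable_projective R))"

definition representation_finite :: "('k, 'a, 'z) module_scheme \<Rightarrow> bool" where
  "representation_finite R \<longleftrightarrow> finite (iso_classes R (indecomposable R))"

definition left_local_colocal_type :: "('k, 'a, 'z) module_scheme \<Rightarrow> bool" where
  "left_local_colocal_type R \<longleftrightarrow>
     (\<forall>M :: ('k, 'a) fd_module. indecomposable R M \<longrightarrow>
        simple_module R (module_top R M) \<or> simple_module R (module_socle R M))"

definition nakayama_algebra :: "('k, 'a, 'z) module_scheme \<Rightarrow> bool" where
  "nakayama_algebra R \<longleftrightarrow>
     (\<forall>M :: ('k, 'a) fd_module. indecomposable R M \<longrightarrow> uniserial R M)"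


section \<open>Magnitude\<close>

text \<open>
  \<open>Hom\<^sub>R(M, N)\<close> as a \<open>K\<close>-vector space; \<open>K\<close> acts on \<open>N\<close> through \<open>c \<mapsto> c \<cdot> 1\<^sub>R\<close>.  The functions are
  taken extensional on \<open>carrier M\<close>, so that distinct elements are distinct homomorphisms.
\<close>

definition hom_space ::
  "('k, 'a, 'z) module_scheme \<Rightarrow> ('a, 'm) module \<Rightarrow> ('a, 'n) module \<Rightarrow> ('k, 'm \<Rightarrow> 'n) module"
where
  "hom_space R M N =
     \<lparr>carrier = module_hom R M N \<inter> extensional (carrier M),
      mult = undefined,
      one = undefined,
      zero = (\<lambda>x\<in>carrier M. \<zero>\<^bsub>N\<^esub>),
      add = (\<lambda>f g. \<lambda>x\<in>carrier M. f x \<oplus>\<^bsub>N\<^esub> g x),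
      smult = (\<lambda>c f. \<lambda>x\<in>carrier M. (c \<odot>\<^bsub>R\<^esub> \<one>\<^bsub>R\<^esub>) \<odot>\<^bsub>N\<^esub> f x)\<rparr>"

definition end_algebra ::
  "('k, 'a, 'z) module_scheme \<Rightarrow> ('a, 'm) module \<Rightarrow> ('k, 'm \<Rightarrow> 'm) module"
where
  "end_algebra R M =
     (hom_space R M M)\<lparr>mult := compose (carrier M), one := (\<lambda>x\<in>carrier M. x)\<rparr>"

definition direct_sum_list :: "('a, 'm) module list \<Rightarrow> ('a, nat \<Rightarrow> 'm) module" where
  "direct_sum_list Ms =
     \<lparr>carrier = (\<Pi>\<^sub>E i\<in>{..<length Ms}. carrier (Ms ! i)),
      mult = undefined,
      one = undefined,
      zero = (\<lambda>i\<in>{..<length Ms}. \<zero>\<^bsub>Ms ! i\<^esub>),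
      add = (\<lambda>x y. \<lambda>i\<in>{..<length Ms}. x i \<oplus>\<^bsub>Ms ! i\<^esub> y i),
      smult = (\<lambda>r x. \<lambda>i\<in>{..<length Ms}. r \<odot>\<^bsub>Ms ! i\<^esub> x i)\<rparr>"

definition auslander_algebra ::
  "('k, 'a, 'z) module_scheme \<Rightarrow> ('k, 'a) fd_module list \<Rightarrow>
     ('k, (nat \<Rightarrow> nat \<Rightarrow> 'k) \<Rightarrow> (nat \<Rightarrow> nat \<Rightarrow> 'k)) module"
where
  "auslander_algebra R Ms = end_algebra R (direct_sum_list Ms)"

definition hom_matrix ::
  "('k, 'c) ring_scheme \<Rightarrow> ('k, 'a, 'z) module_scheme \<Rightarrow> ('k, 'a) fd_module list \<Rightarrow> rat mat"
where
  "hom_matrix K R Ps =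
     mat (length Ps) (length Ps)
       (\<lambda>(i, j). of_nat (vectorspace.dim K (hom_space R (Ps ! i) (Ps ! j))))"

text \<open>
  Magnitude is defined as a relation, since it need not exist.  It asserts that there are finitely
  many indecomposable projectives up to isomorphism, and that for every choice of representatives
  the matrix is invertible over the rationals with entries of the inverse summing to \<open>\<chi>\<close>.
\<close>

definition has_magnitude ::
  "('k, 'c) ring_scheme \<Rightarrow> ('k, 'a, 'z) module_scheme \<Rightarrow> rat \<Rightarrow> bool"
where
  "has_magnitude K R \<chi> \<longleftrightarrow>
     (\<exists>Ps. representatives R (indecomposable_projective R) Ps) \<and>
     (\<forall>Ps. representatives R (indecomposable_projective R) Ps \<longrightarrow>
        (\<exists>W\<in>carrier_mat (length Ps) (length Ps).
           inverts_mat (hom_matrix K R Ps) W \<and> inverts_mat W (hom_matrix K R Ps) \<and>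
           \<chi> = (\<Sum>i<length Ps. \<Sum>j<length Ps. W $$ (i, j))))"

definition has_module_category_magnitude ::
  "('k, 'c) ring_scheme \<Rightarrow> ('k, 'a, 'z) module_scheme \<Rightarrow> rat \<Rightarrow> bool"
where
  "has_module_category_magnitude K R \<chi> \<longleftrightarrow>
     (\<exists>Ms. representatives R (indecomposable R) Ms) \<and>
     (\<forall>Ms. representatives R (indecomposable R) Ms \<longrightarrow>
        has_magnitude K (auslander_algebra R Ms) \<chi>)"

end

theory Submission
  imports Defs "Jordan_Normal_Form.Determinant"
begin

text \<open>
  Call a module hollow if it is not a sum of two proper submodules, and uniform if any two nonzero
  submodules meet.  The matrix of the dimensions of \<open>Hom(M_i, M_j)\<close> is invertible, so the magnitude is
  the sum of the weights \<open>w_j\<close> with \<open>\<Sum>j. dim Hom(M_i, M_j) w_j = 1\<close>, and then \<open>\<Sum>j. dim Hom(F, M_j) w_j = 1\<close> for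
  every indecomposable \<open>F\<close>.  An indecomposable \<open>M\<close> that is not uniform is hollow.  Gluing it to
  another hollow module along a simple submodule gives a module that decomposes, which
  yields homomorphisms with prescribed values on the socle.  These force the socle of \<open>M\<close> to be a sum of two
  lines \<open>a\<close>, \<open>b\<close>, and every nonisomorphism \<open>M \<rightarrow> X\<close> to be a sum of one killing \<open>a\<close> and one killing \<open>b\<close>.
  Hence \<open>dim Hom(M/a, X) + dim Hom(M/b, X) - dim Hom(M, X) - dim Hom(M/(a+b), X)\<close> vanishes unless \<open>X\<close> is
  isomorphic to \<open>M\<close>, and summing against the weights shows that \<open>M\<close> has weight \<open>0\<close>.  A uniform \<open>X\<close>
  has exactly one line in its socle, so the \<open>n\<close> simple modules \<open>S_v\<close> satisfy \<open>\<Sum>v. dim Hom(S_v, X) = 1\<close>, and the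
  weights sum to \<open>n\<close>.
\<close>

text \<open>The type hypothesis constrains indecomposable modules, and the gluing turns it into a
  supply of maps. Unless one embedding is onto, the pushout of two hollow modules along a simple
  submodule is a sum of two proper submodules, and it is not uniform if one of the two is not. Its
  two summands have total dimension one less than the two modules together, so one of the modules is
  isomorphic to a summand. This yields a map in one of two directions, and the direction cannot be
  prescribed. The main obstacle is the bound on the socle: in a counterexample of least dimension
  the socle has dimension three and quotients by a line gain no new socle, so that a map onto such a
  quotient is recognised on the socle, while its kernel has to be a line. Two isomorphic simple
  submodules need extra care: the endomorphism linking them is made nilpotent by subtracting a
  scalar, which is possible since the endomorphism ring of a hollow module has residue field
  \<open>K\<close>. Invertibility of the matrix comes from a sign argument on a vector in its
  kernel, in place of almost split sequences.\<close>

hide_const (open) Multiset.mult Polynomial.smult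

abbreviation (input) car :: "('a, 'b) partial_object_scheme \<Rightarrow> 'a set" where "car \<equiv> carrier"
abbreviation (input) mhom where "mhom \<equiv> module_hom"
abbreviation (input) submodule_on (infixl "on" 95) where "M on A \<equiv> M\<lparr>carrier := A\<rparr>"
abbreviation (input) ring_zero ("0[_]") where "0[M] \<equiv> \<zero>\<^bsub>M\<^esub>"
abbreviation (input) ring_one ("1[_]") where "1[M] \<equiv> \<one>\<^bsub>M\<^esub>"
abbreviation (input) ring_add ("(_ +[_] _)" [65, 0, 66] 65) where "x +[M] y \<equiv> x \<oplus>\<^bsub>M\<^esub> y"
abbreviation (input) ring_diff ("(_ -[_] _)" [65, 0, 66] 65) where "x -[M] y \<equiv> x \<ominus>\<^bsub>M\<^esub> y"
abbreviation (input) ring_neg ("-[_] _" [0, 81] 80) where "-[M] x \<equiv> \<ominus>\<^bsub>M\<^esub> x"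
abbreviation (input) ring_mult ("(_ *[_] _)" [70, 0, 71] 70) where "x *[M] y \<equiv> x \<otimes>\<^bsub>M\<^esub> y"
abbreviation (input) module_smult ("(_ .[_] _)" [76, 0, 75] 75) where "r .[M] x \<equiv> r \<odot>\<^bsub>M\<^esub> x"

abbreviation is_sub :: "('a, 'r) ring_scheme => ('a, 'm, 'z) module_scheme => 'm set => bool" where
 "is_sub R M N \<equiv> Module.submodule N R M"

section \<open>Left modules\<close>

lemma left_moduleI:
 fixes R :: "('a, 'r) ring_scheme" and M :: "('a, 'm, 'z) module_scheme"
 assumes "ring R"
  and add: "!!x y. x : car M ==> y : car M ==> x +[M] y : car M"
  and zero: "0[M] : car M"
  and assoc: "!!x y z. x : car M ==> y : car M ==> z : car M ==>
   (x +[M] y) +[M] z = x +[M] (y +[M] z)"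
  and comm: "!!x y. x : car M ==> y : car M ==> x +[M] y = y +[M] x"
  and lzero: "!!x. x : car M ==> 0[M] +[M] x = x"
  and neg: "!!x. x : car M ==> \<exists>y\<in>car M. y +[M] x = 0[M]"
  and "!!a x. a : car R ==> x : car M ==> a .[M] x : car M"
  and "!!a b x. a : car R ==> b : car R ==> x : car M ==>
   (a +[R] b) .[M] x = a .[M] x +[M] b .[M] x"
  and "!!a x y. a : car R ==> x : car M ==> y : car M ==>
   a .[M] (x +[M] y) = a .[M] x +[M] a .[M] y"
  and "!!a b x. a : car R ==> b : car R ==> x : car M ==>
   (a *[R] b) .[M] x = a .[M] (b .[M] x)"
  and "!!x. x : car M ==> 1[R] .[M] x = x"
 shows "left_module R M"
proof -
 have "abelian_group M"
  by (rule abelian_groupI) (use assms in auto)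
 then show ?thesis
  using assms by (simp add: left_module_def left_module_axioms_def)
qed

context left_module
begin

lemma is_left_module: "left_module R M"
 by (rule left_module_axioms)

lemma smult_zero [simp]: "a : car R ==> a .[M] 0[M] = 0[M]"
 using smult_r_distr[of a "0[M]" "0[M]"] smult_closed[of a "0[M]"] M.add.r_cancel_one' by simp

lemma zero_smult [simp]: "x : car M ==> 0[R] .[M] x = 0[M]"
 using smult_l_distr[of "0[R]" "0[R]" x] smult_closed[of "0[R]" x] M.add.r_cancel_one' by simp

lemma minus_smult: "a : car R ==> x : car M ==> (-[R] a) .[M] x = -[M] (a .[M] x)"
 using smult_l_distr[of "-[R] a" a x] smult_closed
 by (metis M.minus_equality R.add.inv_closed R.l_neg zero_smult)

lemma smult_minus: "a : car R ==> x : car M ==> a .[M] (-[M] x) = -[M] (a .[M] x)"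
 using smult_r_distr[of a "-[M] x" x] smult_closed
 by (metis M.minus_equality M.add.inv_closed M.l_neg smult_zero)

lemma smult_diff:
 "a : car R ==> x : car M ==> y : car M ==>
  a .[M] (x -[M] y) = a .[M] x -[M] a .[M] y"
 by (simp add: a_minus_def smult_r_distr smult_minus)

text \<open>Negatives come from the action of \<open>-1\<close>, so the subgroup axioms reduce to
  zero and sums.\<close>

lemma is_sub_iff:
 "is_sub R M N \<longleftrightarrow> N <= car M \<and> 0[M] : N \<and> (\<forall>x\<in>N. \<forall>y\<in>N. x +[M] y : N) \<and>
  (\<forall>a\<in>car R. \<forall>x\<in>N. a .[M] x : N)" (is "_ \<longleftrightarrow> ?P")
proof
 assume "is_sub R M N"
 then show ?P
  by (auto simp: Module.submodule_def Module.submodule_axioms_def subgroup_def)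
next
 assume P: ?P
 have "-[M] x : N" if "x : N" for x
 proof -
  have "x : car M" using P that by auto
  then have "-[M] x = (-[R] 1[R]) .[M] x"
   by (simp add: minus_smult smult_one)
  then show ?thesis using P that by auto
 qed
 then have "subgroup N (add_monoid M)"
  using P by (auto simp: subgroup_def a_inv_def)
 then show "is_sub R M N"
  using P by (auto simp: Module.submodule_def Module.submodule_axioms_def)
qed

lemma subI:
 assumes "N <= car M" "0[M] : N" "!!x y. x : N ==> y : N ==> x +[M] y : N"
  "!!a x. a : car R ==> x : N ==> a .[M] x : N"
 shows "is_sub R M N"
 using assms is_sub_iff by auto

lemma sub_subset: "is_sub R M N ==> N <= car M"
 and sub_carrier: "is_sub R M N ==> x : N ==> x : car M"
 and sub_zero: "is_sub R M N ==> 0[M] : N"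
 and sub_add: "is_sub R M N ==> x : N ==> y : N ==> x +[M] y : N"
 and sub_smult: "is_sub R M N ==> a : car R ==> x : N ==> a .[M] x : N"
 by (auto simp: is_sub_iff)

lemma sub_neg: "is_sub R M N ==> x : N ==> -[M] x : N"
 using minus_smult[of "1[R]" x] smult_one[of x] sub_smult[of N "-[R] 1[R]" x] sub_carrier by auto

lemma sub_diff: "is_sub R M N ==> x : N ==> y : N ==> x -[M] y : N"
 by (simp add: a_minus_def sub_add sub_neg)

lemma sub_carrier_self: "is_sub R M (car M)"
 by (rule subI) (auto intro: smult_closed)

lemma sub_zero_self: "is_sub R M {0[M]}"
 by (rule subI) auto

lemma sub_Int: "is_sub R M N ==> is_sub R M N' ==> is_sub R M (N \<inter> N')"
 by (auto simp: is_sub_iff)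

lemma sub_left_module: "is_sub R M N ==> left_module R (M on N)"
proof (rule left_moduleI)
 fix x assume N: "is_sub R M N" and "x : car (M on N)"
 then have "x : N" "-[M] x : N" "x : car M" using sub_neg sub_carrier by auto
 then show "\<exists>y\<in>car (M on N). y +[M on N] x = 0[M on N]"
  by (intro bexI[of _ "-[M] x"]) (auto simp: M.l_neg)
qed (auto simp: is_sub_iff R.ring_axioms M.a_ac smult_l_distr smult_r_distr smult_assoc smult_one subset_iff)

lemma set_add_iff: "z : set_add M A B \<longleftrightarrow> (\<exists>a\<in>A. \<exists>b\<in>B. z = a +[M] b)"
 by (auto simp: set_add_def set_mult_def)

lemma sub_set_add:
 assumes A: "is_sub R M A" and B: "is_sub R M B"
 shows "is_sub R M (set_add M A B)"
proof (rule subI)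
 show "set_add M A B <= car M" using sub_carrier[OF A] sub_carrier[OF B] by (auto simp: set_add_iff)
 show "0[M] : set_add M A B" using sub_zero[OF A] sub_zero[OF B] by (force simp: set_add_iff)
next
 fix x y assume "x : set_add M A B" "y : set_add M A B"
 then obtain a b a' b' where *: "a : A" "b : B" "a' : A" "b' : B" "x = a +[M] b" "y = a' +[M] b'"
  by (auto simp: set_add_iff)
 have "x +[M] y = (a +[M] a') +[M] (b +[M] b')"
  using * sub_carrier[OF A] sub_carrier[OF B] by (simp add: M.a_ac)
 then show "x +[M] y : set_add M A B"
  using sub_add[OF A *(1,3)] sub_add[OF B *(2,4)] by (auto simp only: set_add_iff)
next
 fix r x assume r: "r : car R" and "x : set_add M A B"
 then obtain a b where *: "a : A" "b : B" "x = a +[M] b"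
  by (auto simp: set_add_iff)
 then show "r .[M] x : set_add M A B"
  using r sub_smult[OF A r] sub_smult[OF B r] sub_carrier[OF A] sub_carrier[OF B]
  by (auto simp: set_add_iff smult_r_distr)
qed

lemma set_add_upper1: "is_sub R M A ==> is_sub R M B ==> A <= set_add M A B"
 unfolding set_add_iff subset_iff using M.r_zero[symmetric] sub_zero sub_carrier by blast

lemma set_add_upper2: "is_sub R M A ==> is_sub R M B ==> B <= set_add M A B"
 unfolding set_add_iff subset_iff using M.l_zero[symmetric] sub_zero sub_carrier by blast

lemma set_add_least: "is_sub R M C ==> A <= C ==> B <= C ==> set_add M A B <= C"
 using sub_add[of C] by (auto simp: set_add_iff subset_iff)

lemma set_add_comm: "A <= car M ==> B <= car M ==> set_add M A B = set_add M B A"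
proof -
 have "set_add M A B <= set_add M B A" if "A <= car M" "B <= car M" for A B
 proof
  fix z assume "z : set_add M A B"
  then obtain a b where "a : A" "b : B" "z = a +[M] b" by (auto simp: set_add_iff)
  then show "z : set_add M B A" using that M.a_comm[of a b] by (auto simp: set_add_iff)
 qed
 then show "A <= car M ==> B <= car M ==> set_add M A B = set_add M B A" by blast
qed

lemma sub_of_sub: "is_sub R M N ==> is_sub R (M on N) A \<longleftrightarrow> is_sub R M A \<and> A <= N"
proof -
 assume N: "is_sub R M N"
 interpret N: left_module R "M on N" by (rule sub_left_module[OF N])
 show ?thesis using N by (auto simp: N.is_sub_iff is_sub_iff)
qed

lemma sub_cyclic: "x : car M ==> is_sub R M ((%r. r .[M] x) ` car R)"
proof (rule subI)
 assume x: "x : car M"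
 show "(%r. r .[M] x) ` car R <= car M" using x smult_closed by auto
 show "0[M] : (%r. r .[M] x) ` car R" using x by (intro image_eqI[of _ _ "0[R]"]) auto
next
 fix a b assume x: "x : car M" and "a : (%r. r .[M] x) ` car R" "b : (%r. r .[M] x) ` car R"
 then obtain r s where "r : car R" "s : car R" "a = r .[M] x" "b = s .[M] x" by auto
 then show "a +[M] b : (%r. r .[M] x) ` car R"
  using x by (intro image_eqI[of _ _ "r +[R] s"]) (auto simp: smult_l_distr)
next
 fix a b assume x: "x : car M" and a: "a : car R" and "b : (%r. r .[M] x) ` car R"
 then obtain r where "r : car R" "b = r .[M] x" by auto
 then show "a .[M] b : (%r. r .[M] x) ` car R"
  using x a by (intro image_eqI[of _ _ "a *[R] r"]) (auto simp: smult_assoc)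
qed

end

subsection \<open>Homomorphisms\<close>

lemma homI:
 assumes "!!x. x : car M ==> f x : car N"
  and "!!x y. x : car M ==> y : car M ==> f (x +[M] y) = f x +[N] f y"
  and "!!a x. a : car R ==> x : car M ==> f (a .[M] x) = a .[N] f x"
 shows "f : mhom R M N"
 using assms by (auto simp: module_hom_def)

lemma hom_closed: "f : mhom R M N ==> x : car M ==> f x : car N"
 and hom_add: "f : mhom R M N ==> x : car M ==> y : car M ==>
  f (x +[M] y) = f x +[N] f y"
 and hom_smult: "f : mhom R M N ==> a : car R ==> x : car M ==>
  f (a .[M] x) = a .[N] f x"
 by (auto simp: module_hom_def)

lemma hom_cong: "f : mhom R M N ==> (!!x. x : car M ==> g x = f x) ==>
  left_module R M ==> g : mhom R M N"
 by (rule homI) (auto simp: hom_closed hom_add hom_smult left_module.smult_closed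
   abelian_monoid.a_closed left_module_def abelian_group_def)

lemma hom_comp: "f : mhom R M N ==> g : mhom R N X ==> (%x. g (f x)) : mhom R M X"
 by (rule homI) (auto simp: hom_closed hom_add hom_smult)

lemma hom_id: "(%x. x) : mhom R M M"
 by (rule homI) auto

context
 fixes R :: "('a, 'r) ring_scheme"
  and M :: "('a, 'm, 'z) module_scheme" and N :: "('a, 'n, 'y) module_scheme"
 assumes M: "left_module R M" and N: "left_module R N"
begin

interpretation M: left_module R M by (rule M)
interpretation N: left_module R N by (rule N)

lemma hom_zero: "f : mhom R M N ==> f 0[M] = 0[N]"
 using hom_add[of f R M N "0[M]" "0[M]"] hom_closed[of f R M N "0[M]"]
  N.M.add.r_cancel_one' by simp

lemma hom_neg: "f : mhom R M N ==> x : car M ==> f (-[M] x) = -[N] f x"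
 using hom_add[of f R M N "-[M] x" x] hom_closed[of f R M N] hom_zero[of f]
 by (metis M.M.add.inv_closed M.M.l_neg N.M.minus_equality)

lemma hom_diff: "f : mhom R M N ==> x : car M ==> y : car M ==>
  f (x -[M] y) = f x -[N] f y"
 by (simp add: a_minus_def hom_add hom_neg)

lemma hom_const_zero: "(%x. 0[N]) : mhom R M N"
 by (rule homI) auto

lemma hom_plus: "f : mhom R M N ==> g : mhom R M N ==> (%x. f x +[N] g x) : mhom R M N"
 by (rule homI) (auto simp: hom_closed hom_add hom_smult N.M.a_ac N.smult_r_distr)

lemma hom_uminus: "f : mhom R M N ==> (%x. -[N] f x) : mhom R M N"
 by (rule homI) (auto simp: hom_closed hom_add hom_smult N.M.minus_add N.smult_minus)

lemma hom_minus: "f : mhom R M N ==> g : mhom R M N ==> (%x. f x -[N] g x) : mhom R M N"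
 unfolding a_minus_def by (intro hom_plus hom_uminus)

lemma hom_scalar:
 assumes f: "f : mhom R M N" and c: "c : car R"
  and central: "!!r. r : car R ==> c *[R] r = r *[R] c"
 shows "(%x. c .[N] f x) : mhom R M N"
proof (rule homI)
 fix a x assume "a : car R" "x : car M"
 then show "c .[N] f (a .[M] x) = a .[N] (c .[N] f x)"
  using f c central[of a] by (simp add: hom_smult hom_closed flip: N.smult_assoc)
qed (use f c in \<open>auto simp: hom_closed hom_add N.smult_r_distr N.smult_closed\<close>)

lemma sub_image: "f : mhom R M N ==> is_sub R M A ==> is_sub R N (f ` A)"
proof (rule N.subI)
 assume f: "f : mhom R M N" and A: "is_sub R M A"
 note [simp] = hom_closed[OF f] hom_add[OF f] hom_smult[OF f] M.sub_carrier[OF A]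
 show "f ` A <= car N" by auto
 show "0[N] : f ` A" using hom_zero[OF f] M.sub_zero[OF A] by force
next
 fix x y assume f: "f : mhom R M N" and A: "is_sub R M A" and "x : f ` A" "y : f ` A"
 then obtain a b where "a : A" "b : A" "x = f a" "y = f b" by auto
 then show "x +[N] y : f ` A"
  using f A by (intro image_eqI[of _ _ "a +[M] b"]) (auto simp: hom_add M.sub_carrier M.sub_add)
next
 fix r x assume f: "f : mhom R M N" and A: "is_sub R M A" and r: "r : car R" and "x : f ` A"
 then obtain a where "a : A" "x = f a" by auto
 then show "r .[N] x : f ` A"
  using f A r by (intro image_eqI[of _ _ "r .[M] a"]) (auto simp: hom_smult M.sub_carrier M.sub_smult)
qed

lemma sub_vimage: "f : mhom R M N ==> is_sub R N B ==> is_sub R M {x : car M. f x : B}"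
 by (rule M.subI) (auto simp: hom_closed hom_add hom_smult hom_zero N.sub_zero N.sub_add N.sub_smult M.smult_closed)

lemma sub_kernel: "f : mhom R M N ==> is_sub R M {x : car M. f x = 0[N]}"
 using sub_vimage[OF _ N.sub_zero_self, of f] by simp

lemma inj_iff_kernel: "f : mhom R M N ==>
  inj_on f (car M) \<longleftrightarrow> (\<forall>x\<in>car M. f x = 0[N] --> x = 0[M])"
proof
 assume f: "f : mhom R M N" and "inj_on f (car M)"
 then show "\<forall>x\<in>car M. f x = 0[N] --> x = 0[M]"
  using hom_zero[OF f] by (metis M.M.zero_closed inj_on_eq_iff)
next
 assume f: "f : mhom R M N" and *: "\<forall>x\<in>car M. f x = 0[N] --> x = 0[M]"
 show "inj_on f (car M)"
 proof (rule inj_onI)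
  fix x y assume xy: "x : car M" "y : car M" "f x = f y"
  then have "f (x -[M] y) = 0[N]" using hom_diff[OF f] hom_closed[OF f] by (simp add: N.M.r_neg a_minus_def)
  then have "x -[M] y = 0[M]" using * xy by simp
  moreover have "x = (x -[M] y) +[M] y" using xy by (simp add: a_minus_def M.M.a_assoc M.M.l_neg)
  ultimately show "x = y" using xy by simp
 qed
qed

lemma hom_restrict_sub: "f : mhom R M N ==> is_sub R M A ==> f : mhom R (M on A) N"
 by (rule homI) (auto simp: hom_closed hom_add hom_smult M.sub_carrier)

lemma hom_into_sub: "f : mhom R M N ==> (!!x. x : car M ==> f x : B) ==>
  f : mhom R M (N on B)"
 by (rule homI) (auto simp: hom_closed hom_add hom_smult)

lemma hom_from_sub_cod: "f : mhom R M (N on B) ==> B <= car N ==> f : mhom R M N"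
 by (auto simp: module_hom_def)

lemma hom_inv:
 assumes f: "f : mhom R M N" and bij: "bij_betw f (car M) (car N)"
 shows "inv_into (car M) f : mhom R N M"
proof (rule homI)
 let ?g = "inv_into (car M) f"
 have inj: "inj_on f (car M)" and im: "f ` car M = car N" using bij by (auto simp: bij_betw_def)
 have g: "?g y : car M" "f (?g y) = y" if "y : car N" for y
  using that im by (auto simp: inv_into_into f_inv_into_f)
 have eq: "?g y = x" if "x : car M" "f x = y" for x y using that inj by auto
 show "?g y : car M" if "y : car N" for y using g that by auto
 show "?g (x +[N] y) = ?g x +[M] ?g y" if "x : car N" "y : car N" for x y
  using that g by (intro eq) (auto simp: hom_add[OF f])
 show "?g (a .[N] x) = a .[M] ?g x" if "a : car R" "x : car N" for a x
  using that g by (intro eq) (auto simp: hom_smult[OF f] M.smult_closed)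
qed

text \<open>The factor is read off from an arbitrary choice of preimages under \<open>p\<close>. The
  kernel condition makes its values independent of the choice, and linearity is then inherited from
  \<open>f\<close>.\<close>

lemma factor_through:
 fixes X :: "('a, 'x, 'w) module_scheme"
 assumes X: "left_module R X" and p: "p : mhom R M N" and surj: "p ` car M = car N"
  and f: "f : mhom R M X" and ker: "!!x. x : car M ==> p x = 0[N] ==> f x = 0[X]"
 shows "\<exists>g\<in>mhom R N X. \<forall>x\<in>car M. g (p x) = f x"
proof -
 interpret X: left_module R X by (rule X)
 define g where "g y = f (inv_into (car M) p y)" for y
 have i: "inv_into (car M) p y : car M" "p (inv_into (car M) p y) = y" if "y : car N" for y
  using that surj by (auto simp: inv_into_into f_inv_into_f)
 have gp: "g (p x) = f x" if x: "x : car M" for x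
 proof -
  let ?x = "inv_into (car M) p (p x)"
  have x': "?x : car M" "p ?x = p x" using i[of "p x"] x p by (auto simp: hom_closed)
  then have "p (?x -[M] x) = 0[N]" using x hom_diff[OF p, of ?x x] hom_closed[OF p x]
   by (simp add: a_minus_def N.M.r_neg)
  then have "f (?x -[M] x) = 0[X]" using ker x x' by simp
  moreover have "?x = (?x -[M] x) +[M] x"
   using x x' by (simp add: a_minus_def M.M.a_assoc M.M.l_neg)
  then have "f ?x = f (?x -[M] x) +[X] f x"
   using hom_add[OF f, of "?x -[M] x" x] x x' by simp
  ultimately show ?thesis unfolding g_def using x hom_closed[OF f] by simp
 qed
 have "g : mhom R N X"
 proof (rule homI)
  fix y assume "y : car N" then show "g y : car X" using i f by (auto simp: g_def hom_closed)
 next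
  fix y z assume yz: "y : car N" "z : car N"
  then obtain a b where "a : car M" "b : car M" "p a = y" "p b = z"
   using surj by (metis imageE)
  then show "g (y +[N] z) = g y +[X] g z"
   using gp[of a] gp[of b] gp[of "a +[M] b"] hom_add[OF p] hom_add[OF f] by auto
 next
  fix r y assume yz: "r : car R" "y : car N"
  then obtain a where "a : car M" "p a = y" using surj by (metis imageE)
  then show "g (r .[N] y) = r .[X] g y"
   using gp[of a] gp[of "r .[M] a"] yz hom_smult[OF p] hom_smult[OF f] M.smult_closed by auto
 qed
 then show ?thesis using gp by auto
qed

end

text \<open>Transports the module axioms along a surjection that respects the operations of a bare
  record. It serves for quotients, for relabelled copies and for spaces that arise as subsets of an
  algebra.\<close>

lemma left_module_image:
 fixes M :: "('a, 'm, 'z) module_scheme" and N :: "('a, 'n, 'y) module_scheme"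
 assumes M: "left_module R M" and surj: "p ` car M = car N"
  and z: "p 0[M] = 0[N]"
  and a: "!!x y. x : car M ==> y : car M ==> p x +[N] p y = p (x +[M] y)"
  and s: "!!r x. r : car R ==> x : car M ==> r .[N] p x = p (r .[M] x)"
 shows "left_module R N" "p : mhom R M N"
proof -
 interpret M: left_module R M by (rule M)
 have cl: "p x : car N" if "x : car M" for x using that surj by blast
 have ob: thesis if "y : car N" "!!x. x : car M ==> y = p x ==> thesis" for y thesis
  using that surj by blast
 show "p : mhom R M N" by (rule homI) (auto simp: a s cl)
 show "left_module R N"
 proof (rule left_moduleI)
  show "ring R" by (rule M.R.ring_axioms)
  show "0[N] : car N" using cl[of "0[M]"] z by simp
 next
  fix x assume "x : car N"
  then obtain x' where "x' : car M" "x = p x'" by (rule ob)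
  then have "p (-[M] x') +[N] x = p 0[M]" "p (-[M] x') : car N"
   and *: "p 0[M] +[N] x = x" "1[R] .[N] x = x"
   by (simp_all add: a s cl M.M.l_neg M.smult_one)
  then show "\<exists>y\<in>car N. y +[N] x = 0[N]" using z by metis
  show "0[N] +[N] x = x" "1[R] .[N] x = x" using * z by simp_all
 next
  fix x y assume "x : car N" "y : car N"
  then obtain x' y' where "x' : car M" "x = p x'" "y' : car M" "y = p y'" by (elim ob)
  then show "x +[N] y : car N" "x +[N] y = y +[N] x" by (auto simp: a cl M.M.a_comm)
 next
  fix x y w assume "x : car N" "y : car N" "w : car N"
  then obtain x' y' w' where "x' : car M" "x = p x'" "y' : car M" "y = p y'" "w' : car M" "w = p w'"
   by (elim ob)
  then show "(x +[N] y) +[N] w = x +[N] (y +[N] w)" by (auto simp: a M.M.a_assoc)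
 next
  fix r x assume "r : car R" "x : car N"
  then obtain x' where "r : car R" "x' : car M" "x = p x'" by (elim ob)
  then show "r .[N] x : car N" by (auto simp: s cl M.smult_closed)
 next
  fix r t x assume "r : car R" "t : car R" "x : car N"
  then obtain x' where "r : car R" "t : car R" "x' : car M" "x = p x'" by (elim ob)
  then show "(r +[R] t) .[N] x = r .[N] x +[N] t .[N] x" "(r *[R] t) .[N] x = r .[N] (t .[N] x)"
   by (auto simp: s a M.smult_closed M.smult_l_distr M.smult_assoc)
 next
  fix r x y assume "r : car R" "x : car N" "y : car N"
  then obtain x' y' where "r : car R" "x' : car M" "x = p x'" "y' : car M" "y = p y'" by (elim ob)
  then show "r .[N] (x +[N] y) = r .[N] x +[N] r .[N] y"
   by (auto simp: s a M.smult_closed M.smult_r_distr)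
 qed
qed

text \<open>Moves a module onto another carrier type. The target is \<open>nat => 'k\<close>, the
  type over which \<open>fd_module\<close> quantifies.\<close>

definition transport :: "('m => 'n) => ('a, 'm, 'z) module_scheme => ('a, 'n) module" where
 "transport \<kappa> M = (|carrier = \<kappa> ` car M, mult = undefined, one = undefined, zero = \<kappa> 0[M],
  add = (%x y. \<kappa> (inv_into (car M) \<kappa> x +[M] inv_into (car M) \<kappa> y)),
  smult = (%a x. \<kappa> (a .[M] inv_into (car M) \<kappa> x))|)"

lemma transport:
 fixes M :: "('a, 'm, 'z) module_scheme"
 assumes M: "left_module R M" and inj: "inj_on \<kappa> (car M)"
 shows "left_module R (transport \<kappa> M)" "\<kappa> : mhom R M (transport \<kappa> M)"
  "bij_betw \<kappa> (car M) (car (transport \<kappa> M))"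
proof -
 interpret M: left_module R M by (rule M)
 have [simp]: "inv_into (car M) \<kappa> (\<kappa> x) = x" if "x : car M" for x using that inj by simp
 show "left_module R (transport \<kappa> M)" "\<kappa> : mhom R M (transport \<kappa> M)"
  by (rule left_module_image[OF M, where p = \<kappa> and N = "transport \<kappa> M"]; simp add: transport_def inj)+
 show "bij_betw \<kappa> (car M) (car (transport \<kappa> M))"
  using inj by (simp add: transport_def bij_betw_def)
qed

subsection \<open>Quotients and products\<close>

context left_module
begin

lemma sub_additive: "is_sub R M N ==> additive_subgroup N M"
 by (simp add: Module.submodule_def additive_subgroup_def)

lemma sub_abelian: "is_sub R M N ==> abelian_subgroup N M"
 by (rule abelian_subgroupI3) (auto simp: sub_additive M.abelian_group_axioms)

lemma mem_coset: "is_sub R M N ==> x : car M ==> y : N +>\<^bsub>M\<^esub> x \<longleftrightarrow> y : car M \<and> y -[M] x : N"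
proof -
 assume N: "is_sub R M N" and x: "x : car M"
 have 1: "(y -[M] x) +[M] x = y" if "y : car M"
  using that x by (simp add: a_minus_def M.a_assoc M.l_neg)
 have 2: "h +[M] x -[M] x = h" if "h : N" for h
  using that x sub_carrier[OF N] by (simp add: a_minus_def M.a_assoc M.r_neg)
 have "y : N +>\<^bsub>M\<^esub> x \<longleftrightarrow> (\<exists>h\<in>N. y = h +[M] x)"
  by (auto simp: a_r_coset_def r_coset_def)
 also have "\<dots> \<longleftrightarrow> y : car M \<and> y -[M] x : N"
 proof
  assume "\<exists>h\<in>N. y = h +[M] x"
  then show "y : car M \<and> y -[M] x : N"
   using 2 x sub_carrier[OF N] by auto
 next
  assume "y : car M \<and> y -[M] x : N"
  then show "\<exists>h\<in>N. y = h +[M] x" using 1 by metis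
 qed
 finally show ?thesis .
qed

lemma diff_zero [simp]: "x : car M ==> x -[M] 0[M] = x"
 using M.minus_equality[of "0[M]" "0[M]"] by (simp add: a_minus_def)

lemma coset_eq_iff: "is_sub R M N ==> x : car M ==> y : car M ==>
  N +>\<^bsub>M\<^esub> x = N +>\<^bsub>M\<^esub> y \<longleftrightarrow> x -[M] y : N"
proof
 assume *: "is_sub R M N" "x : car M" "y : car M"
 {
  assume "N +>\<^bsub>M\<^esub> x = N +>\<^bsub>M\<^esub> y"
  moreover have "x : N +>\<^bsub>M\<^esub> x" using * sub_zero by (simp add: mem_coset a_minus_def M.r_neg)
  ultimately show "x -[M] y : N" using * by (simp add: mem_coset)
 next
  assume d: "x -[M] y : N"
  have 1: "z -[M] b = (z -[M] a) +[M] (a -[M] b)"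
   if "z : car M" "a : car M" "b : car M" for z a b
   using that by (simp add: a_minus_def M.a_assoc M.r_neg1)
  have 2: "y -[M] x : N"
   using sub_neg[OF *(1) d] * by (simp add: a_minus_def M.minus_add M.a_comm)
  have "z -[M] x : N \<longleftrightarrow> z -[M] y : N" if "z : car M" for z
   using sub_add[OF *(1) _ d] sub_add[OF *(1) _ 2] 1[OF that *(2,3)] 1[OF that *(3,2)] by metis
  then show "N +>\<^bsub>M\<^esub> x = N +>\<^bsub>M\<^esub> y"
   using mem_coset[OF *(1,2)] mem_coset[OF *(1,3)] by blast
 }
qed

end

lemma quotient_sel:
 "car (quotient_module M N) = (%x. N +>\<^bsub>M\<^esub> x) ` car M"
 "0[quotient_module M N] = N"
 "x +[quotient_module M N] y = set_add M x y"
 "a .[quotient_module M N] X = (\<Union>x\<in>X. N +>\<^bsub>M\<^esub> (a .[M] x))"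
 by (auto simp: quotient_module_def ring.extend_def module.fields_def FactRing_def A_RCOSETS_def'
   a_r_coset_def r_coset_def)

lemma quotient_module:
 fixes M :: "('a, 'm, 'z) module_scheme"
 assumes M: "left_module R M" and N: "is_sub R M N"
 shows "left_module R (quotient_module M N)" (is ?A)
  "(%x. N +>\<^bsub>M\<^esub> x) : mhom R M (quotient_module M N)" (is ?B)
  "(%x. N +>\<^bsub>M\<^esub> x) ` car M = car (quotient_module M N)" (is ?C)
  "!!x. x : car M ==> N +>\<^bsub>M\<^esub> x = 0[quotient_module M N] \<longleftrightarrow> x : N"
proof -
 interpret M: left_module R M by (rule M)
 interpret S: abelian_subgroup N M by (rule M.sub_abelian[OF N])
 let ?p = "%x. N +>\<^bsub>M\<^esub> x"
 show C: ?C by (simp add: quotient_sel)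
 have add: "?p x +[quotient_module M N] ?p y = ?p (x +[M] y)" if "x : car M" "y : car M" for x y
  using that S.a_rcos_sum by (simp add: quotient_sel)
 \<comment> \<open>The union defining the action on a coset runs over equal cosets, and over at
   least one of them since \<open>x\<close> lies in its own coset.\<close>
 have sm: "a .[quotient_module M N] ?p x = ?p (a .[M] x)" if a: "a : car R" "x : car M" for a x
 proof -
  have "?p (a .[M] y) = ?p (a .[M] x)" if "y : ?p x" for y
   using that a M.sub_smult[OF N a(1), of "y -[M] x"] M.smult_diff[of a y x]
   by (simp add: M.mem_coset[OF N] M.coset_eq_iff[OF N] M.smult_closed)
  moreover have "x : ?p x" using a N M.sub_zero by (simp add: M.mem_coset a_minus_def M.M.r_neg)
  ultimately show ?thesis unfolding quotient_sel(4) by blast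
 qed
 have z: "?p 0[M] = 0[quotient_module M N]"
  using N by (auto simp: quotient_sel M.mem_coset M.sub_carrier)
 show ?A by (rule left_module_image(1)[OF M C z add sm])
 show ?B by (rule left_module_image(2)[OF M C z add sm])
 show "?p x = 0[quotient_module M N] \<longleftrightarrow> x : N" if "x : car M" for x
  using that N M.coset_eq_iff[OF N that, of "0[M]"] z by simp
qed

definition prod_module :: "('a, 'm, 'z) module_scheme => ('a, 'n, 'y) module_scheme => ('a, 'm \<times> 'n) module" where
 "prod_module M N = (|carrier = car M \<times> car N, mult = undefined, one = undefined,
  zero = (0[M], 0[N]), add = (%x y. (fst x +[M] fst y, snd x +[N] snd y)),
  smult = (%a x. (a .[M] fst x, a .[N] snd x))|)"

lemma prod_module:
 fixes M :: "('a, 'm, 'z) module_scheme" and N :: "('a, 'n, 'y) module_scheme"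
 assumes M: "left_module R M" and N: "left_module R N"
 shows "left_module R (prod_module M N)"
  "(%x. (x, 0[N])) : mhom R M (prod_module M N)"
  "(%x. (0[M], x)) : mhom R N (prod_module M N)"
  "fst : mhom R (prod_module M N) M" "snd : mhom R (prod_module M N) N"
proof -
 interpret M: left_module R M by (rule M)
 interpret N: left_module R N by (rule N)
 show "left_module R (prod_module M N)"
 proof (rule left_moduleI)
  fix x assume "x : car (prod_module M N)"
  then show "\<exists>y\<in>car (prod_module M N). y +[prod_module M N] x = 0[prod_module M N]"
   by (intro bexI[of _ "(-[M] fst x, -[N] snd x)"]) (auto simp: prod_module_def M.M.l_neg N.M.l_neg)
 qed (auto simp: prod_module_def M.R.ring_axioms M.M.a_ac M.smult_closed N.M.a_ac N.smult_closed
   M.smult_l_distr M.smult_r_distr M.smult_assoc M.smult_one N.smult_l_distr N.smult_r_distr N.smult_assoc N.smult_one)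
 show "(%x. (x, 0[N])) : mhom R M (prod_module M N)"
  "(%x. (0[M], x)) : mhom R N (prod_module M N)"
  "fst : mhom R (prod_module M N) M" "snd : mhom R (prod_module M N) N"
  by (auto intro!: homI simp: prod_module_def)
qed

section \<open>Finite-dimensional vector spaces\<close>

text \<open>Built on \<open>left_module\<close>, so that the same lemmas on submodules and quotients
  serve for \<open>K\<close>-spaces and for modules over an algebra; \<open>vectorspace_iff\<close>
  opens the way to bases and dimensions.\<close>

definition fdim :: "('k, 'c) ring_scheme => ('k, 'v, 'z) module_scheme => bool" where
 "fdim K V \<longleftrightarrow> field K \<and> left_module K V \<and> vectorspace.fin_dim K V"

lemma vectorspace_iff: "vectorspace K V \<longleftrightarrow> field K \<and> left_module K V"
proof
 assume "vectorspace K V"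
 then interpret vectorspace K V .
 show "field K \<and> left_module K V"
  using field_axioms ring_axioms by (auto intro!: left_moduleI simp: M.a_ac smult_l_distr smult_r_distr smult_assoc1)
next
 assume *: "field K \<and> left_module K V"
 then interpret field K by simp
 interpret left_module K V using * by simp
 show "vectorspace K V"
  unfolding vectorspace_def
  by (auto intro!: moduleI is_cring M.abelian_group_axioms field_axioms
    simp: smult_closed smult_l_distr smult_r_distr smult_assoc smult_one)
qed

lemma fdim_vectorspace: "fdim K V ==> vectorspace K V"
 by (simp add: fdim_def vectorspace_iff)

lemma fdim_left_module: "fdim K V ==> left_module K V"
 by (simp add: fdim_def)

lemma lincomb_submodule_iff:
 assumes "vectorspace K V"
 shows "LinearCombinations.submodule K S V \<longleftrightarrow> is_sub K V S"
proof -
 interpret left_module K V using assms by (simp add: vectorspace_iff)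
 interpret V: vectorspace K V by fact
 show ?thesis
  using V.module_axioms
  by (auto simp: is_sub_iff LinearCombinations.submodule_def)
qed

lemma linear_mapI:
 "vectorspace K V ==> vectorspace K W ==> T : mhom K V W ==> linear_map K V W T"
 by (simp add: linear_map_def mod_hom_def mod_hom_axioms_def vectorspace_def)

lemma rank_nullity_surj:
 fixes V :: "('k, 'v, 'z) module_scheme" and W :: "('k, 'w, 'y) module_scheme"
 assumes V: "fdim K V" and W: "left_module K W" and T: "T : mhom K V W"
  and surj: "T ` car V = car W"
 shows "fdim K W"
  "vectorspace.dim K V = vectorspace.dim K (V on {x : car V. T x = 0[W]}) + vectorspace.dim K W"
proof -
 have VV: "vectorspace K V" and WW: "vectorspace K W"
  using V W by (auto simp: fdim_def vectorspace_iff)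
 interpret linear_map K V W T by (rule linear_mapI[OF VV WW T])
 have fd: "V.fin_dim" using V by (simp add: fdim_def)
 show "fdim K W" using rank_nullity_main(2)[OF fd surj] WW by (simp add: fdim_def vectorspace_iff)
 have "imT = car W" using surj by (simp add: im_def)
 then show "vectorspace.dim K V = vectorspace.dim K (V on {x : car V. T x = 0[W]}) + vectorspace.dim K W"
  using rank_nullity_main(1)[OF fd] by (simp add: ker_def)
qed

text \<open>Independent subsets of \<open>S\<close> stay independent in \<open>V\<close>, which
  bounds their size; a maximal one is a finite basis of \<open>S\<close>.\<close>

lemma fdim_sub:
 assumes V: "fdim K V" and S: "is_sub K V S"
 shows "fdim K (V on S)"
proof -
 have VV: "vectorspace K V" using V by (rule fdim_vectorspace)
 interpret V: vectorspace K V by fact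
 interpret VL: left_module K V using V by (rule fdim_left_module)
 have sub: "LinearCombinations.submodule K S V" using S lincomb_submodule_iff[OF VV] by simp
 have L: "left_module K (V on S)" by (rule VL.sub_left_module[OF S])
 have SS: "vectorspace K (V on S)"
  using L V.field_axioms by (simp add: vectorspace_iff)
 interpret S: vectorspace K "V on S" by (rule SS)
 have sub_c: "S <= car V" using VL.sub_subset[OF S] .
 have fd: "V.fin_dim" using V by (simp add: fdim_def)
 have li: "V.lin_indpt A" if "A <= S" "S.lin_indpt A" for A
  using V.span_li_not_depend(2)[OF that(1) sub] that(2) by simp
 have ex: "\<exists>A. finite A \<and> maximal A (%A. A <= car (V on S) \<and> S.lin_indpt A)"
 proof (rule maximal_exists[where N = "V.dim" and B = "{}"])
  show "finite A \<and> card A \<le> V.dim"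
   if "A <= car (V on S) \<and> S.lin_indpt A" for A
   using V.li_le_dim[OF fd, of A] li[of A] that sub_c by auto
 qed (auto simp: S.lin_dep_def)
 then obtain A where A: "finite A" "maximal A (%A. A <= car (V on S) \<and> S.lin_indpt A)" by blast
 then have "S.basis A" using S.max_li_is_basis[OF A(2)] by simp
 then have "S.fin_dim" using A(1) by (auto simp: S.basis_def S.fin_dim_def)
 then show ?thesis using L V.field_axioms by (simp add: fdim_def)
qed

lemma dim_zero_iff:
 assumes V: "fdim K V"
 shows "vectorspace.dim K V = 0 \<longleftrightarrow> car V = {0[V]}"
proof -
 interpret V: vectorspace K V using V by (rule fdim_vectorspace)
 have fd: "V.fin_dim" using V by (simp add: fdim_def)
 show ?thesis
 proof
  assume 0: "V.dim = 0"
  obtain B where "finite B" "V.basis B" using V.finite_basis_exists[OF fd] by blast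
  then have "B = {}" using V.dim_basis 0 by force
  then show "car V = {0[V]}" using \<open>V.basis B\<close> by (simp add: V.basis_def V.span_empty)
 next
  assume "car V = {0[V]}"
  then show "V.dim = 0" using V.gen_ge_dim[of "{}"] by (simp add: V.span_empty)
 qed
qed

lemma fdim_zero: "field K ==> left_module K V ==> car V = {0[V]} ==> fdim K V"
proof -
 assume *: "field K" "left_module K V" "car V = {0[V]}"
 interpret V: vectorspace K V using * by (simp add: vectorspace_iff)
 have "V.fin_dim" unfolding V.fin_dim_def by (rule exI[of _ "{}"]) (simp add: V.span_empty *(3))
 then show ?thesis using * by (simp add: fdim_def)
qed

lemma dim_iso:
 fixes V :: "('k, 'v, 'z) module_scheme" and W :: "('k, 'w, 'y) module_scheme"
 assumes V: "fdim K V" and W: "left_module K W" and T: "T : mhom K V W"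
  and bij: "bij_betw T (car V) (car W)"
 shows "fdim K W" "vectorspace.dim K W = vectorspace.dim K V"
proof -
 have surj: "T ` car V = car W" using bij by (simp add: bij_betw_def)
 interpret VL: left_module K V using V by (rule fdim_left_module)
 show "fdim K W" by (rule rank_nullity_surj(1)[OF V W T surj])
 have "{x : car V. T x = 0[W]} = {0[V]}"
  using inj_iff_kernel[OF VL.is_left_module W T] hom_zero[OF VL.is_left_module W T] bij
  by (auto simp: bij_betw_def)
 moreover have "vectorspace.dim K (V on {0[V]}) = 0"
  using dim_zero_iff[OF fdim_sub[OF V VL.sub_zero_self]] by simp
 ultimately show "vectorspace.dim K W = vectorspace.dim K V"
  using rank_nullity_surj(2)[OF V W T surj] by simp
qed

text \<open>Rank-nullity for the projection onto the quotient: the missing dimension is that of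
  \<open>V/S\<close>.\<close>

lemma dim_sub_le:
 assumes V: "fdim K V" and S: "is_sub K V S"
 shows "vectorspace.dim K (V on S) \<le> vectorspace.dim K V"
  "vectorspace.dim K (V on S) = vectorspace.dim K V ==> S = car V"
proof -
 interpret VL: left_module K V using V by (rule fdim_left_module)
 let ?p = "%x. S +>\<^bsub>V\<^esub> x"
 note q = quotient_module[OF VL.is_left_module S]
 have ker: "{x : car V. ?p x = 0[quotient_module V S]} = S"
  using q(4) VL.sub_subset[OF S] by auto
 note rn = rank_nullity_surj[OF V q(1) q(2) q(3)]
 show "vectorspace.dim K (V on S) \<le> vectorspace.dim K V"
  using rn(2) ker by simp
 assume "vectorspace.dim K (V on S) = vectorspace.dim K V"
 then have "vectorspace.dim K (quotient_module V S) = 0" using rn(2) ker by simp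
 then have "car (quotient_module V S) = {0[quotient_module V S]}"
  using dim_zero_iff[OF rn(1)] by simp
 then have "?p x = 0[quotient_module V S]" if "x : car V" for x
  using hom_closed[OF q(2) that] by simp
 then have "x : S" if "x : car V" for x using q(4)[OF that] that by simp
 then show "S = car V" using VL.sub_subset[OF S] by auto
qed

lemma span_sub:
 assumes "vectorspace K V" "is_sub K V S" "A <= S"
 shows "module.span K V A <= S"
proof -
 interpret V: vectorspace K V by fact
 show ?thesis using V.span_is_subset assms lincomb_submodule_iff[OF assms(1)] by blast
qed

lemma sub_span:
 assumes "vectorspace K V" "A <= car V"
 shows "is_sub K V (module.span K V A)" "A <= module.span K V A"
proof -
 interpret V: vectorspace K V by fact
 show "is_sub K V (module.span K V A)" "A <= module.span K V A"
  using V.span_is_submodule[OF assms(2)] lincomb_submodule_iff[OF assms(1)] V.in_own_span[OF assms(2)] by auto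
qed

text \<open>Lifts of a spanning set of the image together with a spanning set of the kernel span
  \<open>V\<close>.\<close>

lemma fdim_extension:
 fixes V :: "('k, 'v, 'z) module_scheme" and W :: "('k, 'w, 'y) module_scheme"
 assumes V: "vectorspace K V" and W: "fdim K W" and T: "T : mhom K V W"
  and ker: "fdim K (V on {x : car V. T x = 0[W]})"
 shows "fdim K V"
proof -
 have VLm: "left_module K V" using V by (simp add: vectorspace_iff)
 interpret VL: left_module K V by fact
 interpret V: vectorspace K V by fact
 have WLm: "left_module K W" using W by (rule fdim_left_module)
 interpret WL: left_module K W by fact
 let ?N = "{x : car V. T x = 0[W]}"
 have N: "is_sub K V ?N" by (rule sub_kernel[OF VLm WLm T])
 have im: "is_sub K W (T ` car V)" by (rule sub_image[OF VLm WLm T VL.sub_carrier_self])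
 have imf: "fdim K (W on (T ` car V))" by (rule fdim_sub[OF W im])
 interpret I: vectorspace K "W on (T ` car V)" using imf by (rule fdim_vectorspace)
 interpret N: vectorspace K "V on ?N" using ker by (rule fdim_vectorspace)
 obtain B where B: "finite B" "B <= T ` car V" "I.span B = T ` car V"
  using imf by (auto simp: fdim_def I.fin_dim_def)
 obtain C where C: "finite C" "C <= ?N" "N.span C = ?N"
  using ker by (auto simp: fdim_def N.fin_dim_def)
 obtain B' where B': "B' <= car V" "finite B'" "B = T ` B'" using B(1,2) finite_subset_image by metis
 let ?S = "V.span (B' \<union> C)"
 have CV: "B' \<union> C <= car V" using B' C by auto
 have S: "is_sub K V ?S" "B' \<union> C <= ?S" by (rule sub_span[OF V CV])+
 have "?N <= ?S"
 proof -
  have "is_sub K (V on ?N) (?N \<inter> ?S)"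
   using VL.sub_of_sub[OF N] VL.sub_Int[OF N S(1)] by simp
  then have "N.span C <= ?N \<inter> ?S" using S(2) C(2) by (intro span_sub[OF N.vectorspace_axioms]) auto
  then show ?thesis using C(3) by auto
 qed
 have TS: "T ` car V <= T ` ?S"
 proof -
  have "is_sub K W (T ` ?S)" by (rule sub_image[OF VLm WLm T S(1)])
  moreover have "T ` ?S <= T ` car V" using VL.sub_subset[OF S(1)] by auto
  ultimately have "is_sub K (W on (T ` car V)) (T ` ?S)"
   using WL.sub_of_sub[OF im] by simp
  moreover have "B <= T ` ?S" using S(2) B' by auto
  ultimately have "I.span B <= T ` ?S" by (intro span_sub[OF I.vectorspace_axioms])
  then show ?thesis using B(3) by auto
 qed
 have "car V <= ?S"
 proof
  fix x assume x: "x : car V"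
  then obtain s where s: "s : ?S" "T x = T s" using TS by blast
  have sV: "s : car V" using s VL.sub_subset[OF S(1)] by auto
  have "T (x -[V] s) = 0[W]"
   using hom_diff[OF VLm WLm T x sV] s hom_closed[OF T sV] by (simp add: a_minus_def WL.M.r_neg)
  then have "x -[V] s : ?S" using \<open>?N <= ?S\<close> x sV by auto
  then have "(x -[V] s) +[V] s : ?S" using VL.sub_add[OF S(1)] s by auto
  moreover have "(x -[V] s) +[V] s = x" using x sV by (simp add: a_minus_def VL.M.a_assoc VL.M.l_neg)
  ultimately show "x : ?S" by simp
 qed
 then have "?S = car V" using VL.sub_subset[OF S(1)] by auto
 then have "V.fin_dim" unfolding V.fin_dim_def using CV B' C by blast
 then show ?thesis using VLm V.field_axioms by (simp add: fdim_def)
qed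

text \<open>\<open>A + B\<close> is an extension of a quotient of \<open>B\<close> by
  \<open>A\<close>.\<close>

lemma fdim_set_add:
 fixes V :: "('k, 'v, 'z) module_scheme"
 assumes V: "vectorspace K V" and A: "is_sub K V A" and B: "is_sub K V B"
  and fA: "fdim K (V on A)" and fB: "fdim K (V on B)"
 shows "fdim K (V on (set_add V A B))"
proof -
 have VL: "left_module K V" using V by (simp add: vectorspace_iff)
 interpret VL: left_module K V by fact
 let ?C = "set_add V A B"
 have C: "is_sub K V ?C" by (rule VL.sub_set_add[OF A B])
 have CL: "left_module K (V on ?C)" by (rule VL.sub_left_module[OF C])
 interpret CL: left_module K "V on ?C" by fact
 have AC: "is_sub K (V on ?C) A" using VL.sub_of_sub[OF C] A VL.set_add_upper1[OF A B] by simp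
 let ?W = "quotient_module (V on ?C) A"
 note q = quotient_module[OF CL AC]
 let ?p = "%x. A +>\<^bsub>V on ?C\<^esub> x"
 have BC: "is_sub K (V on ?C) B" using VL.sub_of_sub[OF C] B VL.set_add_upper2[OF A B] by simp
 have pB: "?p : mhom K (V on B) ?W"
  using hom_restrict_sub[OF CL q(1) q(2) BC] by simp
 have "?p ` B = car ?W"
 proof
  show "?p ` B <= car ?W" using q(3) VL.set_add_upper2[OF A B] by auto
  show "car ?W <= ?p ` B"
  proof
   fix y assume "y : car ?W"
   then obtain x where "x : ?C" "y = ?p x" using q(3) by auto
   then obtain a b where ab: "a : A" "b : B" "x = a +[V] b" by (auto simp: VL.set_add_iff)
   then have mem: "a : ?C" "b : ?C" using VL.set_add_upper1[OF A B] VL.set_add_upper2[OF A B] by auto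
   then have "?p x = ?p a +[?W] ?p b" using hom_add[OF q(2), of a b] ab by simp
   also have "?p a = 0[?W]" using q(4)[of a] ab mem by simp
   also have "0[?W] +[?W] ?p b = ?p b"
   proof -
    interpret W: left_module K ?W by (rule q(1))
    show ?thesis using hom_closed[OF q(2), of b] mem by simp
   qed
   finally show "y : ?p ` B" using ab \<open>y = ?p x\<close> by blast
  qed
 qed
 then have W: "fdim K ?W" using rank_nullity_surj(1)[OF fB q(1) pB] by simp
 have "{x : car (V on ?C). ?p x = 0[?W]} = A"
  using q(4) VL.set_add_upper1[OF A B] by auto
 then show ?thesis
  using fdim_extension[OF _ W q(2)] fA CL V by (simp add: vectorspace_iff)
qed

text \<open>The projection modulo \<open>B\<close> has the same image on \<open>A\<close> and on
  \<open>A + B\<close>, with kernels \<open>A \<inter> B\<close> and \<open>B\<close>; compare the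
  two rank formulas.\<close>

lemma dim_set_add:
 fixes V :: "('k, 'v, 'z) module_scheme"
 assumes V: "fdim K V" and A: "is_sub K V A" and B: "is_sub K V B"
 shows "vectorspace.dim K (V on (set_add V A B)) + vectorspace.dim K (V on (A \<inter> B)) =
  vectorspace.dim K (V on A) + vectorspace.dim K (V on B)"
proof -
 have VL: "left_module K V" using V by (rule fdim_left_module)
 interpret VL: left_module K V by fact
 let ?C = "set_add V A B" let ?Q = "quotient_module V B" let ?p = "%x. B +>\<^bsub>V\<^esub> x"
 note q = quotient_module[OF VL B]
 interpret Q: left_module K ?Q by (rule q(1))
 have C: "is_sub K V ?C" by (rule VL.sub_set_add[OF A B])
 have pA: "?p : mhom K (V on A) ?Q" and pC: "?p : mhom K (V on ?C) ?Q"
  using hom_restrict_sub[OF VL q(1) q(2)] A C by auto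
 have im: "?p ` ?C = ?p ` A"
 proof
  show "?p ` A <= ?p ` ?C" using VL.set_add_upper1[OF A B] by auto
  show "?p ` ?C <= ?p ` A"
  proof
   fix y assume "y : ?p ` ?C"
   then obtain a b where ab: "a : A" "b : B" "y = ?p (a +[V] b)" by (auto simp: VL.set_add_iff)
   have *: "a : car V" "b : car V" using ab VL.sub_carrier A B by auto
   then have "y = ?p a +[?Q] ?p b" using hom_add[OF q(2)] ab(3) by simp
   also have "?p b = 0[?Q]" using q(4) * ab by simp
   finally show "y : ?p ` A" using ab(1) hom_closed[OF q(2) *(1)] by simp
  qed
 qed
 have sA: "is_sub K ?Q (?p ` A)" by (rule sub_image[OF VL q(1) q(2) A])
 let ?W = "?Q on (?p ` A)"
 have W: "left_module K ?W" by (rule Q.sub_left_module[OF sA])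
 have "?p : mhom K (V on A) ?W" "?p : mhom K (V on ?C) ?W"
  using hom_into_sub[OF VL.sub_left_module[OF A] q(1) pA, of "?p ` A"]
   hom_into_sub[OF VL.sub_left_module[OF C] q(1) pC, of "?p ` A"] im by auto
 note r = rank_nullity_surj(2)[OF fdim_sub[OF V A] W this(1)] rank_nullity_surj(2)[OF fdim_sub[OF V C] W this(2)]
 have "{x : A. ?p x = 0[?Q]} = A \<inter> B" "{x : ?C. ?p x = 0[?Q]} = B"
  using q(4) VL.sub_carrier[OF A] VL.sub_carrier[OF C] VL.set_add_upper2[OF A B] by auto
 then show ?thesis using r im by simp
qed

section \<open>Finite-dimensional algebras and their modules\<close>

text \<open>Restriction of scalars along \<open>c \<mapsto> c .[R] 1[R]\<close>, the same action of
  \<open>K\<close> that \<open>hom_space\<close> uses.\<close>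

definition restr :: "('k, 'a, 'z) module_scheme => ('a, 'm, 'y) module_scheme => ('k, 'm) module" where
 "restr R M = (|carrier = car M, mult = undefined, one = undefined, zero = 0[M], add = add M,
  smult = (%c x. (c .[R] 1[R]) .[M] x)|)"

definition regular :: "('a, 'z) ring_scheme => ('a, 'a) module" where
 "regular R = (|carrier = car R, mult = undefined, one = undefined, zero = 0[R], add = add R, smult = mult R|)"

lemma restr_sel [simp]:
 "car (restr R M) = car M" "0[restr R M] = 0[M]" "x +[restr R M] y = x +[M] y"
 "c .[restr R M] x = (c .[R] 1[R]) .[M] x"
 by (simp_all add: restr_def)

lemma restr_update: "restr R (M on N) = (restr R M) on N"
 by (simp add: restr_def)

lemma regular_sel [simp]:
 "car (regular R) = car R" "0[regular R] = 0[R]" "x +[regular R] y = x +[R] y"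
 "r .[regular R] x = r *[R] x"
 by (simp_all add: regular_def)

lemma regular_left_module: "ring R ==> left_module R (regular R)"
proof -
 assume "ring R"
 then interpret ring R .
 show ?thesis
  by (rule left_moduleI) (auto simp: a_ac ring_axioms l_distr r_distr m_assoc intro: l_neg bexI[of _ "-[R] _"])
qed

text \<open>The assumptions say that \<open>c \<mapsto> c .[R] 1[R]\<close> is a ring homomorphism
  from \<open>K\<close> into the centre of \<open>R\<close>. Every module, \<open>R\<close>
  included, becomes a \<open>K\<close>-space through this map.\<close>

locale fd_algebra =
 fixes K :: "('k, 'c) ring_scheme" and R :: "('k, 'a, 'z) module_scheme"
 assumes field_K: "field K" and ring_R: "ring R"
  and sc_closed: "c : car K ==> c .[R] 1[R] : car R"
  and sc_add: "c : car K ==> d : car K ==> (c +[K] d) .[R] 1[R] = c .[R] 1[R] +[R] d .[R] 1[R]"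
  and sc_mult: "c : car K ==> d : car K ==> (c *[K] d) .[R] 1[R] = (c .[R] 1[R]) *[R] (d .[R] 1[R])"
  and sc_one: "1[K] .[R] 1[R] = 1[R]"
  and sc_central: "c : car K ==> r : car R ==> (c .[R] 1[R]) *[R] r = r *[R] (c .[R] 1[R])"
  and fdim_regular: "fdim K (restr R (regular R))"
begin

abbreviation lm :: "('a, 'm, 'y) module_scheme => bool" where "lm \<equiv> left_module R"
abbreviation sub :: "('a, 'm, 'y) module_scheme => 'm set => bool" where "sub M N \<equiv> Module.submodule N R M"

definition fd :: "('a, 'm, 'y) module_scheme => bool" where "fd M \<longleftrightarrow> lm M \<and> fdim K (restr R M)"

definition dm :: "('a, 'm, 'y) module_scheme => nat" where "dm M = vectorspace.dim K (restr R M)"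

text \<open>The letters stand for Hom-dimension. The list function of the same name is written
  \<open>List.hd\<close> where it is meant.\<close>

definition hd :: "('a, 'm) module => ('a, 'n) module => nat" where
 "hd M N = vectorspace.dim K (hom_space R M N)"

lemma fd_lm: "fd M ==> lm M"
 by (simp add: fd_def)

lemma ring_K: "ring K"
 using field_K by (simp add: field_def domain_def cring_def)

lemma restr_lm: "lm M ==> left_module K (restr R M)"
proof -
 assume "lm M"
 then interpret M: left_module R M .
 show ?thesis
 proof (rule left_moduleI)
  fix x assume "x : car (restr R M)"
  then show "\<exists>y\<in>car (restr R M). y +[restr R M] x = 0[restr R M]"
   by (intro bexI[of _ "-[M] x"]) (auto simp: M.M.l_neg)
 qed (auto simp: ring_K M.M.a_ac sc_closed sc_add sc_mult sc_one M.smult_closed M.smult_l_distr M.smult_r_distr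
   M.smult_assoc M.smult_one)
qed

lemma restr_sub: "lm M ==> sub M N ==> is_sub K (restr R M) N"
proof -
 assume M: "lm M" and N: "sub M N"
 interpret M: left_module R M by fact
 interpret M': left_module K "restr R M" by (rule restr_lm[OF M])
 show ?thesis using N by (auto simp: M'.is_sub_iff M.is_sub_iff sc_closed)
qed

lemma restr_hom: "f : mhom R M N ==> f : mhom K (restr R M) (restr R N)"
 by (rule homI) (auto simp: hom_closed hom_add hom_smult sc_closed)

lemma fd_sub: "fd M ==> sub M N ==> fd (M on N)"
 unfolding fd_def restr_update
 using fdim_sub restr_sub left_module.sub_left_module by blast

lemma dm_sub_le: "fd M ==> sub M N ==> dm (M on N) \<le> dm M"
 unfolding fd_def dm_def restr_update using dim_sub_le(1) restr_sub by blast

lemma dm_sub_eq: "fd M ==> sub M N ==> dm (M on N) = dm M ==> N = car M"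
 unfolding fd_def dm_def restr_update using dim_sub_le(2) restr_sub restr_sel(1) by metis

lemma dm_zero_iff: "fd M ==> dm M = 0 \<longleftrightarrow> car M = {0[M]}"
 unfolding fd_def dm_def using dim_zero_iff by fastforce

lemma fd_surj:
 assumes M: "fd M" and N: "lm N" and f: "f : mhom R M N" and surj: "f ` car M = car N"
 shows "fd N" "dm M = dm (M on {x : car M. f x = 0[N]}) + dm N"
proof -
 note r = rank_nullity_surj[of K "restr R M" "restr R N" f, OF _ restr_lm[OF N] restr_hom[OF f]]
 show "fd N" using r(1) M N surj by (simp add: fd_def)
 show "dm M = dm (M on {x : car M. f x = 0[N]}) + dm N"
  using r(2) M surj by (simp add: fd_def dm_def restr_update)
qed

lemma fd_iso:
 assumes M: "fd M" and N: "lm N" and f: "f : mhom R M N" and bij: "bij_betw f (car M) (car N)"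
 shows "fd N" "dm N = dm M"
 using dim_iso[of K "restr R M" "restr R N" f, OF _ restr_lm[OF N] restr_hom[OF f]] M N bij
 by (simp_all add: fd_def dm_def)

lemma dm_image:
 assumes M: "fd M" and N: "lm N" and f: "f : mhom R M N"
 shows "dm M = dm (M on {x : car M. f x = 0[N]}) + dm (N on (f ` car M))"
proof -
 interpret M: left_module R M using M by (rule fd_lm)
 interpret N: left_module R N by (rule N)
 have s: "sub N (f ` car M)" by (rule sub_image[OF M.is_left_module N f M.sub_carrier_self])
 show ?thesis
  using fd_surj(2)[OF M N.sub_left_module[OF s], of f] hom_into_sub[OF M.is_left_module N f, of "f ` car M"] by simp
qed

lemma inj_kernel: "lm M ==> lm N ==> f : mhom R M N ==>
  inj_on f (car M) \<longleftrightarrow> {x : car M. f x = 0[N]} = {0[M]}"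
 using inj_iff_kernel[of R M N f] hom_zero[of R M N f]
 by (auto simp: left_module_def abelian_group_def abelian_monoid.zero_closed)

lemma dm_zero_sub: "fd M ==> dm (M on {0[M]}) = 0"
 using dm_zero_iff[OF fd_sub[of M "{0[M]}"]] left_module.sub_zero_self[OF fd_lm, of M] by simp

lemma inj_iff_surj:
 assumes M: "fd M" and N: "fd N" and f: "f : mhom R M N" and eq: "dm M = dm N"
 shows "inj_on f (car M) \<longleftrightarrow> f ` car M = car N"
proof -
 interpret M: left_module R M using M by (rule fd_lm)
 interpret N: left_module R N using N by (rule fd_lm)
 let ?k = "{x : car M. f x = 0[N]}"
 have k: "sub M ?k" by (rule sub_kernel[OF M.is_left_module N.is_left_module f])
 have s: "sub N (f ` car M)" by (rule sub_image[OF M.is_left_module N.is_left_module f M.sub_carrier_self])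
 note e = dm_image[OF M N.is_left_module f]
 have "inj_on f (car M) \<longleftrightarrow> ?k = {0[M]}" by (rule inj_kernel[OF M.is_left_module N.is_left_module f])
 also have "\<dots> \<longleftrightarrow> dm (M on ?k) = 0"
  using dm_zero_iff[OF fd_sub[OF M k]] by simp
 also have "\<dots> \<longleftrightarrow> dm (N on (f ` car M)) = dm N" using e eq by linarith
 also have "\<dots> \<longleftrightarrow> f ` car M = car N"
  using dm_sub_eq[OF N s] by auto
 finally show ?thesis .
qed

lemma dm_inj_le:
 assumes M: "fd M" and N: "fd N" and f: "f : mhom R M N" and inj: "inj_on f (car M)"
 shows "dm M \<le> dm N" "dm M = dm N ==> f ` car M = car N"
proof -
 interpret M: left_module R M using M by (rule fd_lm)
 interpret N: left_module R N using N by (rule fd_lm)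
 have s: "sub N (f ` car M)" by (rule sub_image[OF M.is_left_module N.is_left_module f M.sub_carrier_self])
 have "{x : car M. f x = 0[N]} = {0[M]}" using inj inj_kernel[OF M.is_left_module N.is_left_module f] by simp
 then have "dm M = dm (N on (f ` car M))"
  using dm_image[OF M N.is_left_module f] dm_zero_sub[OF M] by simp
 then show "dm M \<le> dm N" using dm_sub_le[OF N s] by simp
 show "dm M = dm N ==> f ` car M = car N" using inj_iff_surj[OF M N f] inj by simp
qed

lemma dm_surj_le:
 assumes M: "fd M" and N: "fd N" and f: "f : mhom R M N" and surj: "f ` car M = car N"
 shows "dm N \<le> dm M" "dm M = dm N ==> inj_on f (car M)"
 using fd_surj(2)[OF M fd_lm[OF N] f surj] inj_iff_surj[OF M N f] surj by simp_all

lemma dm_set_add: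
 assumes M: "fd M" and A: "sub M A" and B: "sub M B"
 shows "dm (M on (set_add M A B)) + dm (M on (A \<inter> B)) = dm (M on A) + dm (M on B)"
proof -
 have "set_add (restr R M) A B = set_add M A B" by (simp add: set_add_def set_mult_def)
 then show ?thesis
  using dim_set_add[of K "restr R M" A B] M restr_sub[OF fd_lm[OF M]] A B by (simp add: fd_def dm_def restr_update)
qed

subsection \<open>Finite generation is finite dimension\<close>

lemma fd_cyclic_sub:
 assumes M: "lm M" and x: "x : car M"
 shows "fd (M on ((%r. r .[M] x) ` car R))"
proof -
 interpret M: left_module R M by fact
 let ?N = "M on ((%r. r .[M] x) ` car R)"
 have R: "fd (regular R)" using fdim_regular regular_left_module[OF ring_R] by (simp add: fd_def)
 have "(%r. r .[M] x) : mhom R (regular R) ?N"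
  by (rule homI) (use x in \<open>auto simp: M.smult_l_distr M.smult_assoc\<close>)
 then show ?thesis
  using fd_surj(1)[OF R M.sub_left_module[OF M.sub_cyclic[OF x]]] by simp
qed

lemma fd_set_add:
 assumes M: "lm M" and A: "sub M A" and B: "sub M B"
  and "fd (M on A)" "fd (M on B)"
 shows "fd (M on (set_add M A B))"
proof -
 have "set_add (restr R M) A B = set_add M A B" by (simp add: set_add_def set_mult_def)
 then show ?thesis
  using fdim_set_add[of K "restr R M" A B] assms restr_sub[OF M] restr_lm[OF M] field_K
   left_module.sub_left_module[OF M left_module.sub_set_add[OF M A B]]
  by (simp add: fd_def restr_update vectorspace_iff)
qed

text \<open>A cyclic module is an image of the finite-dimensional regular module, and finite sums of
  finite-dimensional submodules remain finite-dimensional. Conversely a finite spanning set over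
  \<open>K\<close> generates over \<open>R\<close>.\<close>

lemma fg_iff_fd: "fin_gen_module R M \<longleftrightarrow> fd M"
proof
 assume M: "fin_gen_module R M"
 then have lm: "lm M" by (simp add: fin_gen_module_def)
 interpret M: left_module R M by (rule lm)
 obtain S where S: "finite S" "S <= car M" "generated_submodule R M S = car M"
  using M by (auto simp: fin_gen_module_def)
 have "\<exists>N. sub M N \<and> S <= N \<and> fd (M on N)" using S(1,2)
 proof (induction S rule: finite_induct)
  case empty
  have "fd (M on {0[M]})"
   using M.sub_left_module[OF M.sub_zero_self]
    fdim_zero[OF field_K restr_lm, of "M on {0[M]}"] by (simp add: fd_def)
  then show ?case using M.sub_zero_self by blast
 next
  case (insert x S)
  then obtain N where N: "sub M N" "S <= N" "fd (M on N)" by auto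
  let ?C = "(%r. r .[M] x) ` car R"
  have x: "x : car M" using insert by simp
  have C: "sub M ?C" by (rule M.sub_cyclic[OF x])
  have "x : ?C" using M.smult_one[OF x] M.R.one_closed by (metis imageI)
  then have "insert x S <= set_add M ?C N"
   using M.set_add_upper1[OF C N(1)] M.set_add_upper2[OF C N(1)] N(2) by blast
  then show ?case using fd_set_add[OF lm C N(1) fd_cyclic_sub[OF lm x] N(3)] M.sub_set_add[OF C N(1)] by blast
 qed
 then obtain N where N: "sub M N" "S <= N" "fd (M on N)" by blast
 then have "generated_submodule R M S <= N" by (auto simp: generated_submodule_def)
 then have "N = car M" using S(3) M.sub_subset[OF N(1)] by auto
 then show "fd M" using N(3) by simp
next
 assume M: "fd M"
 interpret M: left_module R M using M by (rule fd_lm)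
 have V: "vectorspace K (restr R M)" using M by (simp add: fd_def fdim_vectorspace)
 interpret V: vectorspace K "restr R M" by (rule V)
 obtain S where S: "finite S" "S <= car M" "V.span S = car M"
  using M by (auto simp: fd_def fdim_def V.fin_dim_def)
 have "car M <= N" if "sub M N" "S <= N" for N
  using span_sub[OF V restr_sub[OF M.is_left_module that(1)] that(2)] S(3) by simp
 then have "generated_submodule R M S = car M"
  using M.sub_carrier_self S(2) by (auto simp: generated_submodule_def)
 then show "fin_gen_module R M" using S M.is_left_module by (auto simp: fin_gen_module_def)
qed

end

context fd_algebra
begin

subsection \<open>Modules with underlying set in a fixed type\<close>

text \<open>A chosen family of coefficients with respect to a finite spanning set, enumerated by
  natural numbers, determines the element. The spanning set may be dependent, since one fixed choice
  per element is enough for injectivity.\<close>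

lemma fd_coordinates:
 fixes M :: "('a, 'm, 'y) module_scheme"
 assumes M: "fd M"
 shows "\<exists>\<kappa> :: 'm => nat => 'k. inj_on \<kappa> (car M)"
proof -
 have V: "vectorspace K (restr R M)" using M by (simp add: fd_def fdim_vectorspace)
 interpret V: vectorspace K "restr R M" by (rule V)
 obtain S where S: "finite S" "S <= car M" "V.span S = car M"
  using M by (auto simp: fd_def fdim_def V.fin_dim_def)
 obtain h where h: "bij_betw h {0..<card S} S" using ex_bij_betw_nat_finite[OF S(1)] by blast
 define c where "c v = (SOME a. a : S \<rightarrow> car K \<and> V.lincomb a S = v)" for v
 have c: "c v : S \<rightarrow> car K" "V.lincomb (c v) S = v" if "v : car M" for v
 proof -
  have "v : V.span S" using that S(3) by simp
  then have ex: "\<exists>a. a : S \<rightarrow> car K \<and> V.lincomb a S = v"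
   using V.finite_in_span[OF S(1), of v] S(2) unfolding restr_sel by blast
  show "c v : S \<rightarrow> car K" "V.lincomb (c v) S = v"
   using someI_ex[OF ex] unfolding c_def by (rule conjunct1, rule conjunct2)
 qed
 have inj: "inj_on (%v i. c v (h i)) (car M)"
 proof (rule inj_onI)
  fix v w assume vw: "v : car M" "w : car M" "(%i. c v (h i)) = (%i. c w (h i))"
  have "c v s = c w s" if "s : S" for s
  proof -
   have "s : h ` {0..<card S}" using that h by (simp add: bij_betw_def)
   then obtain i where "s = h i" by (rule imageE)
   then show ?thesis using fun_cong[OF vw(3), of i] by simp
  qed
  then have "V.lincomb (c v) S = V.lincomb (c w) S"
   using c(1)[OF vw(2)] S(2) by (intro V.lincomb_cong) simp_all
  then show "v = w" using c(2) vw by simp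
 qed
 show ?thesis by (rule exI, rule inj)
qed

text \<open>Projectivity, isomorphism classes and the type hypothesis quantify over modules with
  carrier in \<open>nat => 'k\<close> only. Quotients, products and left ideals are therefore
  replaced by copies in that type.\<close>

lemma fd_copy:
 fixes M :: "('a, 'm, 'y) module_scheme"
 assumes M: "fd M"
 obtains M' :: "('k, 'a) fd_module" and f where "fd M'" "f : mhom R M M'"
  "bij_betw f (car M) (car M')" "dm M' = dm M"
proof -
 obtain \<kappa> :: "'m => nat => 'k" where inj: "inj_on \<kappa> (car M)"
  using fd_coordinates[OF M] by blast
 note t = transport[OF fd_lm[OF M] inj]
 show thesis using that[OF fd_iso(1)[OF M t] t(2,3) fd_iso(2)[OF M t]] .
qed

lemma fd_quotient:
 fixes M :: "('a, 'm, 'y) module_scheme"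
 assumes M: "fd M" and N: "sub M N"
 obtains Y :: "('k, 'a) fd_module" and p where "fd Y" "p : mhom R M Y" "p ` car M = car Y"
  "!!x. x : car M ==> p x = 0[Y] \<longleftrightarrow> x : N" "dm M = dm (M on N) + dm Y"
proof -
 interpret M: left_module R M by (rule fd_lm[OF M])
 note q = quotient_module[OF fd_lm[OF M] N]
 obtain Y :: "('k, 'a) fd_module" and f where Y: "fd Y" "f : mhom R (quotient_module M N) Y"
  "bij_betw f (car (quotient_module M N)) (car Y)"
  using fd_copy[OF fd_surj(1)[OF M q(1-3)]] by blast
 let ?p = "%x. f (N +>\<^bsub>M\<^esub> x)"
 have p: "?p : mhom R M Y" by (rule hom_comp[OF q(2) Y(2)])
 have surj: "?p ` car M = car Y" using q(3) Y(3) unfolding bij_betw_def by (metis image_image)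
 have inj: "inj_on f (car (quotient_module M N))" using Y(3) by (simp add: bij_betw_def)
 interpret Q: left_module R "quotient_module M N" by (rule q(1))
 have ker: "?p x = 0[Y] \<longleftrightarrow> x : N" if "x : car M" for x
  using inj_iff_kernel[OF q(1) fd_lm[OF Y(1)] Y(2)] inj hom_zero[OF q(1) fd_lm[OF Y(1)] Y(2)]
   q(4)[OF that] hom_closed[OF q(2) that] by metis
 have "{x : car M. ?p x = 0[Y]} = N" using ker M.sub_carrier[OF N] by blast
 then show thesis using that[OF Y(1) p surj ker] fd_surj(2)[OF M fd_lm[OF Y(1)] p surj] by simp
qed

lemma fd_prod:
 assumes M: "fd M" and N: "fd N"
 shows "fd (prod_module M N)" "dm (prod_module M N) = dm M + dm N"
proof -
 interpret M: left_module R M by (rule fd_lm[OF M])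
 interpret N: left_module R N by (rule fd_lm[OF N])
 let ?P = "prod_module M N"
 note p = prod_module[OF fd_lm[OF M] fd_lm[OF N]]
 interpret P: left_module R ?P by (rule p(1))
 let ?k = "{x : car ?P. snd x = 0[N]}"
 have k: "sub ?P ?k" by (rule sub_kernel[OF p(1) fd_lm[OF N] p(5)])
 have i: "(%x. (x, 0[N])) : mhom R M (?P on ?k)"
  by (rule hom_into_sub[OF fd_lm[OF M] p(1) p(2)]) (auto simp: prod_module_def)
 have b: "bij_betw (%x. (x, 0[N])) (car M) (car (?P on ?k))"
  by (auto simp: bij_betw_def inj_on_def prod_module_def)
 note iso = fd_iso[OF M P.sub_left_module[OF k] i b]
 have "fdim K ((restr R ?P) on {x : car (restr R ?P). snd x = 0[restr R N]})"
  using iso(1) by (simp add: fd_def restr_update)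
 then have "fdim K (restr R ?P)"
  using fdim_extension[of K "restr R ?P" "restr R N" snd] N restr_hom[OF p(5)] restr_lm[OF p(1)] field_K
  by (simp add: fd_def vectorspace_iff)
 then show P: "fd ?P" using p(1) by (simp add: fd_def)
 have "snd ` car ?P = car N" by (auto simp: prod_module_def image_iff)
 then show "dm ?P = dm M + dm N" using fd_surj(2)[OF P fd_lm[OF N] p(5)] iso(2) by simp
qed

lemma fd_biproduct:
 fixes M :: "('a, 'm, 'y) module_scheme" and N :: "('a, 'n, 'x) module_scheme"
 assumes M: "fd M" and N: "fd N"
 obtains B :: "('k, 'a) fd_module" and i1 i2 p1 p2 where "fd B"
  "i1 : mhom R M B" "i2 : mhom R N B" "p1 : mhom R B M" "p2 : mhom R B N"
  "!!x. x : car M ==> p1 (i1 x) = x" "!!x. x : car M ==> p2 (i1 x) = 0[N]"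
  "!!x. x : car N ==> p2 (i2 x) = x" "!!x. x : car N ==> p1 (i2 x) = 0[M]"
  "!!x. x : car B ==> i1 (p1 x) +[B] i2 (p2 x) = x" "dm B = dm M + dm N"
proof -
 interpret M: left_module R M by (rule fd_lm[OF M])
 interpret N: left_module R N by (rule fd_lm[OF N])
 let ?P = "prod_module M N"
 note p = prod_module[OF fd_lm[OF M] fd_lm[OF N]]
 obtain B :: "('k, 'a) fd_module" and f where B: "fd B" "f : mhom R ?P B"
  "bij_betw f (car ?P) (car B)" "dm B = dm ?P" using fd_copy[OF fd_prod(1)[OF M N]] by blast
 let ?g = "inv_into (car ?P) f"
 have g: "?g : mhom R B ?P" by (rule hom_inv[OF p(1) fd_lm[OF B(1)] B(2,3)])
 have gf: "?g (f x) = x" if "x : car ?P" for x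
  using that B(3) by (simp add: bij_betw_def)
 have fg: "f (?g x) = x" if "x : car B" for x
  using that B(3) by (simp add: bij_betw_def f_inv_into_f)
 have c: "(x, 0[N]) : car ?P" "(0[M], y) : car ?P" if "x : car M" "y : car N" for x y
  using that by (auto simp: prod_module_def)
 show thesis
 proof (rule that[OF B(1) hom_comp[OF p(2) B(2)] hom_comp[OF p(3) B(2)] hom_comp[OF g p(4)] hom_comp[OF g p(5)]])
  fix x assume "x : car B"
  then have gx: "?g x : car ?P" using hom_closed[OF g] by auto
  then have gx': "fst (?g x) : car M" "snd (?g x) : car N" by (auto simp: prod_module_def)
  then have "f (fst (?g x), 0[N]) +[B] f (0[M], snd (?g x)) = f ((fst (?g x), 0[N]) +[?P] (0[M], snd (?g x)))"
   using hom_add[OF B(2) c(1)[OF gx'] c(2)[OF gx']] by simp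
  also have "(fst (?g x), 0[N]) +[?P] (0[M], snd (?g x)) = ?g x"
   using gx' by (simp add: prod_module_def)
  finally show "f (fst (?g x), 0[N]) +[B] f (0[M], snd (?g x)) = x"
   using fg[OF \<open>x : car B\<close>] by simp
 qed (use gf c[OF _ N.M.zero_closed] c[OF M.M.zero_closed] fd_prod(2)[OF M N] B(4) in auto)
qed

subsection \<open>Spaces of homomorphisms\<close>

definition Hom :: "('a, 'm) module => ('a, 'n) module => ('m => 'n) set" where
 "Hom M N = mhom R M N \<inter> extensional (car M)"

lemma hom_space_sel [simp]:
 "car (hom_space R M N) = Hom M N"
 "0[hom_space R M N] = (\<lambda>x\<in>car M. 0[N])"
 "f +[hom_space R M N] g = (\<lambda>x\<in>car M. f x +[N] g x)"
 "c .[hom_space R M N] f = (\<lambda>x\<in>car M. (c .[R] 1[R]) .[N] f x)"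
 by (simp_all add: hom_space_def Hom_def)

lemma hom_space_update: "(hom_space R M N) on (Hom M N) = hom_space R M N"
 by (simp add: hom_space_def Hom_def)

lemma restrict_Hom: "lm M ==> f : mhom R M N ==> (\<lambda>x\<in>car M. f x) : Hom M N"
 unfolding Hom_def using hom_cong[of f R M N] by auto

lemma Hom_hom: "f : Hom M N ==> f : mhom R M N"
 by (simp add: Hom_def)

lemma Hom_eqI: "f : Hom M N ==> g : Hom M N ==> (!!x. x : car M ==> f x = g x) ==> f = g"
 unfolding Hom_def by (auto intro: extensionalityI)

lemma hom_sc: "lm M ==> lm N ==> f : mhom R M N ==> c : car K ==>
  (%x. (c .[R] 1[R]) .[N] f x) : mhom R M N"
 by (rule hom_scalar) (auto simp: sc_closed sc_central)

lemma hom_space_lm: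
 assumes M: "lm M" and N: "lm N"
 shows "left_module K (hom_space R M N)"
proof -
 interpret M: left_module R M by (rule M)
 interpret N: left_module R N by (rule N)
 note h = hom_closed[OF Hom_hom]
 show ?thesis
 proof (rule left_moduleI)
  show "ring K" by (rule ring_K)
  show "0[hom_space R M N] : car (hom_space R M N)"
   using restrict_Hom[OF M hom_const_zero[OF M N]] by simp
 next
  fix f assume f: "f : car (hom_space R M N)"
  then have "(\<lambda>x\<in>car M. -[N] f x) : Hom M N"
   using restrict_Hom[OF M hom_uminus[OF M N Hom_hom]] by simp
  moreover have "(\<lambda>x\<in>car M. -[N] f x) +[hom_space R M N] f = 0[hom_space R M N]"
   using f h[of f M N] by (auto simp: N.M.l_neg fun_eq_iff restrict_def)
  ultimately show "\<exists>g\<in>car (hom_space R M N). g +[hom_space R M N] f = 0[hom_space R M N]"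
   unfolding hom_space_sel(1) by blast
  show "0[hom_space R M N] +[hom_space R M N] f = f" "1[K] .[hom_space R M N] f = f"
   using f by (auto simp: h Hom_def sc_one N.smult_one fun_eq_iff restrict_def extensional_def hom_closed)
 next
  fix f g assume fg: "f : car (hom_space R M N)" "g : car (hom_space R M N)"
  show "f +[hom_space R M N] g : car (hom_space R M N)"
   using fg restrict_Hom[OF M hom_plus[OF M N Hom_hom Hom_hom]] by simp
  show "f +[hom_space R M N] g = g +[hom_space R M N] f"
   using fg by (auto simp: h N.M.a_comm cong: restrict_cong)
  fix k assume k: "k : car (hom_space R M N)"
  show "(f +[hom_space R M N] g) +[hom_space R M N] k = f +[hom_space R M N] (g +[hom_space R M N] k)"
   using fg k by (auto simp: h N.M.a_assoc cong: restrict_cong)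
 next
  fix c f assume cf: "c : car K" "f : car (hom_space R M N)"
  show "c .[hom_space R M N] f : car (hom_space R M N)"
   using cf restrict_Hom[OF M hom_sc[OF M N Hom_hom]] by simp
  fix g assume g: "g : car (hom_space R M N)"
  show "c .[hom_space R M N] (f +[hom_space R M N] g) = c .[hom_space R M N] f +[hom_space R M N] c .[hom_space R M N] g"
   using cf g by (auto simp: h N.smult_r_distr sc_closed cong: restrict_cong)
 next
  fix c d f assume cf: "c : car K" "d : car K" "f : car (hom_space R M N)"
  show "(c +[K] d) .[hom_space R M N] f = c .[hom_space R M N] f +[hom_space R M N] d .[hom_space R M N] f"
   "(c *[K] d) .[hom_space R M N] f = c .[hom_space R M N] (d .[hom_space R M N] f)"
   using cf by (auto simp: h N.smult_l_distr N.smult_assoc sc_add sc_mult sc_closed cong: restrict_cong)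
 qed
qed

text \<open>Evaluation at one generator takes values in the finite-dimensional \<open>N\<close>, and
  the maps it kills are determined by the remaining generators. The induction on the generators
  therefore runs over arbitrary subspaces \<open>U\<close> of the space of homomorphisms.\<close>

lemma fdim_hom:
 fixes M :: "('a, 'm) module" and N :: "('a, 'n) module"
 assumes M: "fd M" and N: "fd N"
 shows "fdim K (hom_space R M N)"
proof -
 note Ml = fd_lm[OF M] and Nl = fd_lm[OF N]
 interpret M: left_module R M by (rule Ml)
 interpret N: left_module R N by (rule Nl)
 let ?H = "hom_space R M N"
 have Hl: "left_module K ?H" by (rule hom_space_lm[OF Ml Nl])
 interpret H: left_module K ?H by (rule Hl)
 obtain S where S: "finite S" "S <= car M" "generated_submodule R M S = car M"
  using M fg_iff_fd[of M] by (auto simp: fin_gen_module_def)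
 have *: "fdim K (?H on U)" if "is_sub K ?H U" "!!f. f : U ==> \<forall>s\<in>S. f s = 0[N] ==> f = 0[?H]" for U
  using S(1,2) that
 proof (induction S arbitrary: U rule: finite_induct)
  case empty
  then have "U = {0[?H]}" using H.sub_zero[OF empty.prems(2)] empty.prems(3) by blast
  then show ?case using fdim_zero[OF field_K H.sub_left_module[OF empty.prems(2)]] by simp
 next
  case (insert x S)
  have x: "x : car M" using insert.prems by simp
  have UH: "f : Hom M N" if "f : U" for f using H.sub_carrier[OF insert.prems(2) that] by simp
  have Ul: "left_module K (?H on U)" by (rule H.sub_left_module[OF insert.prems(2)])
  have T: "(%f. f x) : mhom K (?H on U) (restr R N)"
   by (rule homI) (use x hom_closed[OF Hom_hom[OF UH]] in auto)
  let ?k = "{f : U. f x = 0[N]}"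
  have "is_sub K (?H on U) ?k" using sub_kernel[OF Ul restr_lm[OF Nl] T] by simp
  then have k: "is_sub K ?H ?k" using H.sub_of_sub[OF insert.prems(2)] by simp
  have "fdim K (?H on ?k)"
   by (rule insert.IH[OF _ k]) (use insert.prems in auto)
  then show ?case
   using fdim_extension[of K "?H on U" "restr R N" "%f. f x"] T N Ul field_K
   by (simp add: fd_def vectorspace_iff)
 qed
 have "fdim K (?H on (car ?H))"
 proof (rule *[OF H.sub_carrier_self])
  fix f assume "f : car ?H" and 0: "\<forall>s\<in>S. f s = 0[N]"
  then have f: "f : Hom M N" by simp
  have "sub M {x : car M. f x = 0[N]}" by (rule sub_kernel[OF Ml Nl Hom_hom[OF f]])
  then have "generated_submodule R M S <= {x : car M. f x = 0[N]}"
   using 0 S(2) by (auto simp: generated_submodule_def)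
  then have "f x = 0[N]" if "x : car M" for x using that S(3) by blast
  then show "f = 0[?H]" using f restrict_Hom[OF Ml hom_const_zero[OF Ml Nl]] by (intro Hom_eqI[of f M N]) auto
 qed
 then show ?thesis by (simp add: hom_space_update)
qed

lemma hom_space_sub_cod:
 assumes "A <= car N"
 shows "hom_space R M (N on A) = (hom_space R M N) on {f : Hom M N. \<forall>x\<in>car M. f x : A}"
proof -
 have "mhom R M (N on A) = {f : mhom R M N. \<forall>x\<in>car M. f x : A}"
  using assms by (auto simp: module_hom_def)
 then show ?thesis by (auto simp: hom_space_def Hom_def)
qed

lemma hom_post:
 assumes "lm M" "g : mhom R N N'" "lm N"
 shows "(%f. \<lambda>x\<in>car M. g (f x)) : mhom K (hom_space R M N) (hom_space R M N')"
proof (rule homI)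
 interpret M: left_module R M by fact
 fix f assume "f : car (hom_space R M N)"
 then have f: "f : mhom R M N" by (simp add: Hom_hom)
 show "(\<lambda>x\<in>car M. g (f x)) : car (hom_space R M N')"
  using restrict_Hom[OF assms(1) hom_comp[OF f assms(2)]] by simp
 fix f' assume "f' : car (hom_space R M N)"
 then have f': "f' : mhom R M N" by (simp add: Hom_hom)
 show "(\<lambda>x\<in>car M. g ((f +[hom_space R M N] f') x)) =
  (\<lambda>x\<in>car M. g (f x)) +[hom_space R M N'] (\<lambda>x\<in>car M. g (f' x))"
  using hom_add[OF assms(2)] hom_closed[OF f] hom_closed[OF f'] by (auto cong: restrict_cong)
next
 fix c f assume c: "c : car K" and "f : car (hom_space R M N)"
 then have f: "f : mhom R M N" by (simp add: Hom_hom)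
 show "(\<lambda>x\<in>car M. g ((c .[hom_space R M N] f) x)) = c .[hom_space R M N'] (\<lambda>x\<in>car M. g (f x))"
  using hom_smult[OF assms(2) sc_closed[OF c]] hom_closed[OF f] by (auto cong: restrict_cong)
qed

lemma hom_pre:
 assumes "lm M" "p : mhom R M M'"
 shows "(%f. \<lambda>x\<in>car M. f (p x)) : mhom K (hom_space R M' N) (hom_space R M N)"
proof (rule homI)
 fix f assume "f : car (hom_space R M' N)"
 then have f: "f : mhom R M' N" by (simp add: Hom_hom)
 show "(\<lambda>x\<in>car M. f (p x)) : car (hom_space R M N)"
  using restrict_Hom[OF assms(1) hom_comp[OF assms(2) f]] by simp
qed (use hom_closed[OF assms(2)] in \<open>auto cong: restrict_cong\<close>)

text \<open>Left exactness of \<open>Hom(M, -)\<close> on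
  \<open>0 \<rightarrow> ker g \<rightarrow> N \<rightarrow> N'\<close>. The defect of equality
  measures the maps into \<open>N'\<close> that do not lift along \<open>g\<close>.\<close>

lemma hd_kernel:
 assumes M: "fd M" and N: "fd N" and N': "fd N'" and g: "g : mhom R N N'"
 shows "hd M N \<le> hd M (N on {x : car N. g x = 0[N']}) + hd M N'"
  "hd M N = hd M (N on {x : car N. g x = 0[N']}) + hd M N' \<longleftrightarrow>
   (\<forall>f\<in>mhom R M N'. \<exists>h\<in>mhom R M N. \<forall>x\<in>car M. g (h x) = f x)"
proof -
 note Ml = fd_lm[OF M] and Nl = fd_lm[OF N] and Nl' = fd_lm[OF N']
 let ?T = "%f. \<lambda>x\<in>car M. g (f x)" and ?A = "{x : car N. g x = 0[N']}"
 let ?H = "hom_space R M N" and ?H' = "hom_space R M N'"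
 have Hl: "left_module K ?H" and Hl': "left_module K ?H'" using hom_space_lm Ml Nl Nl' by auto
 interpret H: left_module K ?H by (rule Hl)
 interpret H': left_module K ?H' by (rule Hl')
 have T: "?T : mhom K ?H ?H'" by (rule hom_post[OF Ml g Nl])
 have s: "is_sub K ?H' (?T ` car ?H)" by (rule sub_image[OF Hl Hl' T H.sub_carrier_self])
 have T': "?T : mhom K ?H (?H' on (?T ` car ?H))"
  by (rule hom_into_sub[OF Hl Hl' T]) blast
 have "?T f = 0[?H'] \<longleftrightarrow> (\<forall>x\<in>car M. f x : ?A)" if "f : Hom M N" for f
  using hom_closed[OF Hom_hom[OF that]] by (auto simp: fun_eq_iff restrict_def)
 then have "{f : car ?H. ?T f = 0[?H' on (?T ` car ?H)]} = {f : Hom M N. \<forall>x\<in>car M. f x : ?A}"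
  by auto
 then have e: "hd M N = hd M (N on ?A) + vectorspace.dim K (?H' on (?T ` car ?H))"
  using rank_nullity_surj(2)[OF fdim_hom[OF M N] H'.sub_left_module[OF s] T'] hom_space_sub_cod[of ?A N M]
  by (simp add: hd_def)
 note d = dim_sub_le[OF fdim_hom[OF M N'] s]
 show "hd M N \<le> hd M (N on ?A) + hd M N'" using e d(1) by (simp add: hd_def)
 have "?H' on (car ?H') = ?H'" by (simp add: hom_space_update)
 then have "vectorspace.dim K (?H' on (?T ` car ?H)) = vectorspace.dim K ?H' \<longleftrightarrow>
   ?T ` car ?H = car ?H'"
  using d(2) by metis
 then have "hd M N = hd M (N on ?A) + hd M N' \<longleftrightarrow> ?T ` car ?H = car ?H'"
  unfolding e by (simp only: hd_def add_left_cancel)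
 also have "\<dots> \<longleftrightarrow> (\<forall>f\<in>mhom R M N'. \<exists>h\<in>mhom R M N. \<forall>x\<in>car M. g (h x) = f x)"
 proof
  assume eq: "?T ` car ?H = car ?H'"
  show "\<forall>f\<in>mhom R M N'. \<exists>h\<in>mhom R M N. \<forall>x\<in>car M. g (h x) = f x"
  proof
   fix f assume "f : mhom R M N'"
   then have "(\<lambda>x\<in>car M. f x) : ?T ` car ?H" using eq restrict_Hom[OF Ml] by simp
   then obtain h where h: "h : Hom M N" "(\<lambda>x\<in>car M. f x) = ?T h" by auto
   have "g (h x) = f x" if "x : car M" for x using fun_cong[OF h(2), of x] that by simp
   then show "\<exists>h\<in>mhom R M N. \<forall>x\<in>car M. g (h x) = f x" using Hom_hom[OF h(1)] by blast
  qed
 next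
  assume *: "\<forall>f\<in>mhom R M N'. \<exists>h\<in>mhom R M N. \<forall>x\<in>car M. g (h x) = f x"
  have "f : ?T ` car ?H" if f: "f : Hom M N'" for f
  proof -
   obtain h where h: "h : mhom R M N" "\<forall>x\<in>car M. g (h x) = f x" using * Hom_hom[OF f] by blast
   then have "f = ?T (\<lambda>x\<in>car M. h x)"
    using f by (auto simp: Hom_def extensional_def fun_eq_iff)
   then show ?thesis using restrict_Hom[OF Ml h(1)] by (intro image_eqI[of f ?T]) auto
  qed
  then show "?T ` car ?H = car ?H'" using H'.sub_subset[OF s] by auto
 qed
 finally show "hd M N = hd M (N on ?A) + hd M N' \<longleftrightarrow>
   (\<forall>f\<in>mhom R M N'. \<exists>h\<in>mhom R M N. \<forall>x\<in>car M. g (h x) = f x)" .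
qed

definition vanishing :: "('a, 'm) module => ('a, 'n) module => 'm set => ('m => 'n) set" where
 "vanishing M N A = {f : Hom M N. \<forall>a\<in>A. f a = 0[N]}"

lemma sub_vanishing:
 assumes "lm M" "lm N" "A <= car M" shows "is_sub K (hom_space R M N) (vanishing M N A)"
proof -
 interpret N: left_module R N by fact
 interpret H: left_module K "hom_space R M N" using assms(1,2) by (rule hom_space_lm)
 show ?thesis
 proof (rule H.subI)
  fix f g assume "f : vanishing M N A" "g : vanishing M N A"
  moreover from this have "f +[hom_space R M N] g : car (hom_space R M N)"
   by (intro H.M.a_closed) (auto simp: vanishing_def)
  ultimately show "f +[hom_space R M N] g : vanishing M N A"
   using assms(3) by (auto simp: vanishing_def subset_iff)
 next
  fix c f assume "c : car K" "f : vanishing M N A"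
  moreover from this have "c .[hom_space R M N] f : car (hom_space R M N)"
   by (intro H.smult_closed) (auto simp: vanishing_def)
  ultimately show "c .[hom_space R M N] f : vanishing M N A"
   using assms(3) by (auto simp: vanishing_def subset_iff sc_closed)
 qed (use assms H.M.zero_closed in \<open>auto simp: vanishing_def subset_iff\<close>)
qed

text \<open>Precomposition with \<open>p\<close> identifies maps out of the quotient with the maps
  out of \<open>M\<close> that vanish on \<open>A\<close>.\<close>

lemma hd_quotient:
 assumes M: "fd M" and M': "fd M'" and N: "fd N" and p: "p : mhom R M M'"
  and surj: "p ` car M = car M'" and A: "A <= car M" "!!x. x : car M ==> p x = 0[M'] \<longleftrightarrow> x : A"
 shows "hd M' N = vectorspace.dim K ((hom_space R M N) on (vanishing M N A))"
proof -
 note Ml = fd_lm[OF M] and Nl = fd_lm[OF N] and Ml' = fd_lm[OF M']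
 let ?T = "%f. \<lambda>x\<in>car M. f (p x)"
 let ?H = "hom_space R M N" and ?H' = "hom_space R M' N"
 have Hl: "left_module K ?H" using hom_space_lm Ml Nl by auto
 interpret H: left_module K ?H by (rule Hl)
 have T: "?T : mhom K ?H' ?H" by (rule hom_pre[OF Ml p])
 have s: "is_sub K ?H (vanishing M N A)" by (rule sub_vanishing[OF Ml Nl A(1)])
 have in_van: "?T f : vanishing M N A" if "f : car ?H'" for f
 proof -
  have "?T f : Hom M N" using hom_closed[OF T that] by simp
  moreover have "f 0[M'] = 0[N]" using hom_zero[OF Ml' Nl Hom_hom] that by simp
  moreover have "f (p a) = 0[N]" "a : car M" if "a : A" for a
  proof -
   show "a : car M" using that A(1) by blast
   then have "p a = 0[M']" using A(2) that by blast
   then show "f (p a) = 0[N]" using calculation(2) by simp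
  qed
  ultimately show ?thesis by (simp add: vanishing_def)
 qed
 have T': "?T : mhom K ?H' (?H on (vanishing M N A))"
  by (rule hom_into_sub[OF hom_space_lm[OF Ml' Nl] Hl T]) (rule in_van)
 have inj: "inj_on ?T (car ?H')"
 proof (rule inj_onI)
  fix f g assume fg: "f : car ?H'" "g : car ?H'" "?T f = ?T g"
  have "f y = g y" if y: "y : car M'" for y
  proof -
   obtain x where "x : car M" "p x = y" using y surj by (metis imageE)
   then show ?thesis using fun_cong[OF fg(3), of x] by simp
  qed
  then show "f = g" using fg(1,2) by (intro Hom_eqI[of f M' N]) auto
 qed
 have "vanishing M N A <= ?T ` car ?H'"
 proof
  fix f assume f: "f : vanishing M N A"
  then have fH: "f : Hom M N" by (simp add: vanishing_def)
  obtain g where g: "g : mhom R M' N" "\<forall>x\<in>car M. g (p x) = f x"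
   using factor_through[OF Ml Ml' Nl p surj Hom_hom[OF fH]] A(2) f by (auto simp: vanishing_def)
  have "f = ?T (\<lambda>x\<in>car M'. g x)"
   using g(2) hom_closed[OF p] fH by (auto simp: Hom_def extensional_def fun_eq_iff)
  then show "f : ?T ` car ?H'" using restrict_Hom[OF Ml' g(1)] by (intro image_eqI[of f ?T]) auto
 qed
 then have "bij_betw ?T (car ?H') (car (?H on (vanishing M N A)))"
  using inj in_van by (auto simp: bij_betw_def)
 then show ?thesis
  using dim_iso(2)[OF fdim_hom[OF M' N] H.sub_left_module[OF s] T'] by (simp add: hd_def)
qed

lemma hd_iso_left:
 assumes M: "fd M" and M': "fd M'" and N: "fd N" and p: "p : mhom R M M'"
  and bij: "bij_betw p (car M) (car M')"
 shows "hd M' N = hd M N"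
proof -
 interpret M: left_module R M by (rule fd_lm[OF M])
 have ker: "p x = 0[M'] \<longleftrightarrow> x : {0[M]}" if "x : car M" for x
  using inj_iff_kernel[OF fd_lm[OF M] fd_lm[OF M'] p] hom_zero[OF fd_lm[OF M] fd_lm[OF M'] p] bij that
  by (auto simp: bij_betw_def)
 have "vanishing M N {0[M]} = car (hom_space R M N)"
  using hom_zero[OF fd_lm[OF M] fd_lm[OF N] Hom_hom] by (auto simp: vanishing_def)
 then show ?thesis
  using hd_quotient[OF M M' N p _ _ ker] bij by (simp add: bij_betw_def hd_def del: hom_space_sel)
qed

lemma hom_zero_module:
 assumes "car X = {0[X]}" "fd M" "fd X" shows "hd M X = 0"
proof -
 note Ml = fd_lm[OF assms(2)] and Xl = fd_lm[OF assms(3)]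
 let ?c = "\<lambda>x\<in>car M. 0[X]"
 have c: "?c : Hom M X" by (rule restrict_Hom[OF Ml hom_const_zero[OF Ml Xl]])
 have "Hom M X <= {?c}"
 proof
  fix f assume f: "f : Hom M X"
  have "f = ?c" by (rule Hom_eqI[OF f c]) (use hom_closed[OF Hom_hom[OF f]] assms(1) in simp)
  then show "f : {?c}" by simp
 qed
 then have "Hom M X = {?c}" using c by (simp add: subset_singleton_iff) blast
 then have "car (hom_space R M X) = {0[hom_space R M X]}" unfolding hom_space_sel .
 then show ?thesis
  unfolding hd_def by (rule iffD2[OF dim_zero_iff[OF fdim_hom[OF assms(2,3)]]])
qed

lemma hd_iso_right:
 assumes M: "fd M" and N: "fd N" and N': "fd N'" and g: "g : mhom R N N'"
  and bij: "bij_betw g (car N) (car N')"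
 shows "hd M N = hd M N'"
proof -
 note Nl = fd_lm[OF N] and Nl' = fd_lm[OF N']
 interpret N: left_module R N by (rule Nl)
 have ker: "{x : car N. g x = 0[N']} = {0[N]}"
  using inj_kernel[OF Nl Nl' g] bij_betw_imp_inj_on[OF bij] by simp
 let ?i = "inv_into (car N) g"
 have i: "?i : mhom R N' N" by (rule hom_inv[OF Nl Nl' g bij])
 have gi: "g (?i x) = x" if "x : car N'" for x
  using that bij by (simp add: bij_betw_def f_inv_into_f)
 have "\<forall>f\<in>mhom R M N'. \<exists>h\<in>mhom R M N. \<forall>x\<in>car M. g (h x) = f x"
 proof
  fix f assume f: "f : mhom R M N'"
  show "\<exists>h\<in>mhom R M N. \<forall>x\<in>car M. g (h x) = f x"
   by (rule bexI[OF _ hom_comp[OF f i]]) (simp add: gi hom_closed[OF f])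
 qed
 then have "hd M N = hd M (N on {0[N]}) + hd M N'"
  unfolding hd_kernel(2)[OF M N N' g, unfolded ker] .
 moreover have "hd M (N on {0[N]}) = 0"
  using hom_zero_module[of "N on {0[N]}", OF _ M fd_sub[OF N N.sub_zero_self]] by simp
 ultimately show ?thesis by simp
qed

text \<open>Inside \<open>Hom(M, N)\<close> the maps out of \<open>F1\<close>, \<open>F2\<close> and
  \<open>F3\<close> are the subspaces vanishing on \<open>A\<close>, on \<open>B\<close> and on
  both. The dimension formula for a sum of two subspaces gives the inequality, with equality exactly
  when the first two span everything.\<close>

lemma hd_mesh:
 assumes M: "fd M" and N: "fd N" and A: "sub M A" and B: "sub M B"
  and F1: "fd F1" "p1 : mhom R M F1" "p1 ` car M = car F1" "!!x. x : car M ==> p1 x = 0[F1] \<longleftrightarrow> x : A"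
  and F2: "fd F2" "p2 : mhom R M F2" "p2 ` car M = car F2" "!!x. x : car M ==> p2 x = 0[F2] \<longleftrightarrow> x : B"
  and F3: "fd F3" "p3 : mhom R M F3" "p3 ` car M = car F3" "!!x. x : car M ==> p3 x = 0[F3] \<longleftrightarrow> x : set_add M A B"
 shows "hd F1 N + hd F2 N \<le> hd M N + hd F3 N"
  "hd F1 N + hd F2 N = hd M N + hd F3 N \<longleftrightarrow>
   (\<forall>f\<in>mhom R M N. \<exists>f1\<in>mhom R M N. \<exists>f2\<in>mhom R M N.
    (\<forall>a\<in>A. f1 a = 0[N]) \<and> (\<forall>b\<in>B. f2 b = 0[N]) \<and> (\<forall>x\<in>car M. f x = f1 x +[N] f2 x))"
proof -
 note Ml = fd_lm[OF M] and Nl = fd_lm[OF N]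
 interpret M: left_module R M by (rule Ml)
 interpret N: left_module R N by (rule Nl)
 let ?H = "hom_space R M N"
 have H: "fdim K ?H" by (rule fdim_hom[OF M N])
 interpret H: left_module K ?H by (rule hom_space_lm[OF Ml Nl])
 let ?U = "vanishing M N A" and ?V = "vanishing M N B"
 have AB: "A <= car M" "B <= car M" "set_add M A B <= car M"
  using M.sub_subset A B M.sub_set_add by auto
 have U: "is_sub K ?H ?U" and V: "is_sub K ?H ?V" by (rule sub_vanishing[OF Ml Nl AB(1)], rule sub_vanishing[OF Ml Nl AB(2)])
 have "vanishing M N (set_add M A B) = ?U \<inter> ?V"
 proof
  show "vanishing M N (set_add M A B) <= ?U \<inter> ?V"
   using M.set_add_upper1[OF A B] M.set_add_upper2[OF A B] by (auto simp: vanishing_def)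
  show "?U \<inter> ?V <= vanishing M N (set_add M A B)"
  proof
   fix f assume f: "f : ?U \<inter> ?V"
   then have "f (a +[M] b) = 0[N]" if "a : A" "b : B" for a b
    using that AB hom_add[OF Hom_hom, of f M N a b] by (auto simp: vanishing_def subset_iff)
   then show "f : vanishing M N (set_add M A B)" using f by (auto simp: vanishing_def M.set_add_iff)
  qed
 qed
 then have e: "vectorspace.dim K (?H on (set_add ?H ?U ?V)) + hd F3 N = hd F1 N + hd F2 N"
  using dim_set_add[OF H U V] hd_quotient[OF M F1(1) N F1(2,3) AB(1) F1(4)]
   hd_quotient[OF M F2(1) N F2(2,3) AB(2) F2(4)] hd_quotient[OF M F3(1) N F3(2,3) AB(3) F3(4)] by simp
 have UV: "is_sub K ?H (set_add ?H ?U ?V)" by (rule H.sub_set_add[OF U V])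
 note d = dim_sub_le[OF H UV]
 show "hd F1 N + hd F2 N \<le> hd M N + hd F3 N" using e d(1) by (simp add: hd_def)
 have "?H on (car ?H) = ?H" by (simp add: hom_space_update)
 then have "vectorspace.dim K (?H on (set_add ?H ?U ?V)) = vectorspace.dim K ?H \<longleftrightarrow>
   set_add ?H ?U ?V = car ?H"
  using d(2) by metis
 then have "hd F1 N + hd F2 N = hd M N + hd F3 N \<longleftrightarrow> set_add ?H ?U ?V = car ?H"
  unfolding e[symmetric] by (simp only: hd_def add_right_cancel)
 also have "\<dots> \<longleftrightarrow> (\<forall>f\<in>mhom R M N. \<exists>f1\<in>mhom R M N. \<exists>f2\<in>mhom R M N.
    (\<forall>a\<in>A. f1 a = 0[N]) \<and> (\<forall>b\<in>B. f2 b = 0[N]) \<and> (\<forall>x\<in>car M. f x = f1 x +[N] f2 x))"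
  (is "_ \<longleftrightarrow> ?P")
 proof
  assume eq: "set_add ?H ?U ?V = car ?H"
  show ?P
  proof
   fix f assume "f : mhom R M N"
   then have "(\<lambda>x\<in>car M. f x) : set_add ?H ?U ?V" using eq restrict_Hom[OF Ml] by simp
   then obtain u v where uv: "u : ?U" "v : ?V" "(\<lambda>x\<in>car M. f x) = (\<lambda>x\<in>car M. u x +[N] v x)"
    by (auto simp: H.set_add_iff)
   have "f x = u x +[N] v x" if "x : car M" for x using fun_cong[OF uv(3), of x] that by simp
   then show "\<exists>f1\<in>mhom R M N. \<exists>f2\<in>mhom R M N.
    (\<forall>a\<in>A. f1 a = 0[N]) \<and> (\<forall>b\<in>B. f2 b = 0[N]) \<and> (\<forall>x\<in>car M. f x = f1 x +[N] f2 x)"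
    using uv(1,2) by (intro bexI[of _ u] bexI[of _ v]) (auto simp: vanishing_def Hom_hom)
  qed
 next
  assume P: ?P
  have "f : set_add ?H ?U ?V" if f: "f : Hom M N" for f
  proof -
   obtain u v where uv: "u : mhom R M N" "v : mhom R M N"
    "\<forall>a\<in>A. u a = 0[N]" "\<forall>b\<in>B. v b = 0[N]" "\<forall>x\<in>car M. f x = u x +[N] v x"
    using bspec[OF P Hom_hom[OF f]] by (elim bexE conjE)
   let ?u = "\<lambda>x\<in>car M. u x" and ?v = "\<lambda>x\<in>car M. v x"
   have "?u : ?U" "?v : ?V" using restrict_Hom[OF Ml uv(1)] restrict_Hom[OF Ml uv(2)] uv(3,4) AB
    by (auto simp: vanishing_def subset_iff)
   moreover have "f = ?u +[?H] ?v" using uv(5) f by (auto simp: Hom_def extensional_def fun_eq_iff)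
   ultimately show ?thesis unfolding H.set_add_iff by blast
  qed
  then show "set_add ?H ?U ?V = car ?H" using H.sub_subset[OF UV] by auto
 qed
 finally show "hd F1 N + hd F2 N = hd M N + hd F3 N \<longleftrightarrow> ?P" .
qed

end

lemma set_addI: "a : A ==> b : B ==> a +[M] b : set_add M A B"
 by (auto simp: set_add_def set_mult_def)

lemma set_addE:
 assumes "x : set_add M A B"
 obtains a b where "a : A" "b : B" "x = a +[M] b"
 using assms by (auto simp: set_add_def set_mult_def)

context fd_algebra
begin

subsection \<open>Indecomposable modules\<close>

abbreviation indec :: "('a, 'm) module => bool" where "indec \<equiv> indecomposable R"

lemma indec_iff: "indec M \<longleftrightarrow> fd M \<and> car M ~= {0[M]} \<and>
  (\<forall>A B. sub M A \<and> sub M B \<and> A \<inter> B = {0[M]} \<and> set_add M A B = car M --> A = {0[M]} \<or> B = {0[M]})"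
 by (simp add: indecomposable_def fg_iff_fd)

lemma indec_fd: "indec M ==> fd M"
 and indec_nonzero: "indec M ==> car M ~= {0[M]}"
 and indecD: "indec M ==> sub M A ==> sub M B ==> A \<inter> B = {0[M]} ==> set_add M A B = car M ==>
  A = {0[M]} \<or> B = {0[M]}"
 by (simp_all add: indec_iff)

lemma decomposition:
 assumes X: "lm X" and A: "sub X A" and B: "sub X B" and int: "A \<inter> B = {0[X]}" and sum: "set_add X A B = car X"
 obtains p q where "p : mhom R X X" "q : mhom R X X"
  "!!x. x : car X ==> p x : A" "!!x. x : car X ==> q x : B"
  "!!x. x : car X ==> p x +[X] q x = x"
  "!!a. a : A ==> p a = a" "!!b. b : B ==> q b = b"
  "!!b. b : B ==> p b = 0[X]" "!!a. a : A ==> q a = 0[X]"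
proof -
 interpret X: left_module R X by (rule X)
 note Ac = X.sub_carrier[OF A] and Bc = X.sub_carrier[OF B]
 have uniq: "a = a' \<and> b = b'" if "a : A" "b : B" "a' : A" "b' : B" "a +[X] b = a' +[X] b'" for a b a' b'
 proof -
  note c = Ac[OF that(1)] Bc[OF that(2)] Ac[OF that(3)] Bc[OF that(4)]
  have "a -[X] a' = (a +[X] b) +[X] (-[X] a' +[X] -[X] b)"
   using c by (simp add: a_minus_def X.M.a_ac X.M.r_neg1 X.M.r_neg2 X.M.r_neg)
  also have "\<dots> = (a' +[X] b') +[X] (-[X] a' +[X] -[X] b)" by (simp only: that(5))
  also have "\<dots> = b' -[X] b"
   using c X.M.a_lcomm[of b' "-[X] a'" "-[X] b"] by (simp add: a_minus_def X.M.a_assoc X.M.r_neg2)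
  finally have e: "a -[X] a' = b' -[X] b" .
  have "a -[X] a' : A" by (rule X.sub_diff[OF A that(1,3)])
  moreover have "b' -[X] b : B" by (rule X.sub_diff[OF B that(4,2)])
  ultimately have "a -[X] a' = 0[X]" using int e by (metis IntI singletonD)
  moreover have "a = (a -[X] a') +[X] a'" using c by (simp add: a_minus_def X.M.a_assoc X.M.l_neg)
  ultimately have "a = a'" using c by (metis X.M.l_zero)
  moreover from this have "b = b'" using that(5) c by (metis X.M.r_neg1)
  ultimately show ?thesis by simp
 qed
 have ex: "\<exists>ab. fst ab : A \<and> snd ab : B \<and> x = fst ab +[X] snd ab" if "x : car X" for x
 proof -
  have "x : set_add X A B" using that sum by simp
  then obtain a b where "a : A" "b : B" "x = a +[X] b" unfolding X.set_add_iff by (elim bexE)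
  then show ?thesis by (intro exI[of _ "(a, b)"]) simp
 qed
 define ab where "ab x = (SOME ab. fst ab : A \<and> snd ab : B \<and> x = fst ab +[X] snd ab)" for x
 have ab: "fst (ab x) : A" "snd (ab x) : B" "fst (ab x) +[X] snd (ab x) = x" if "x : car X" for x
  using someI_ex[OF ex[OF that]] unfolding ab_def[symmetric] by auto
 have ab_eq: "fst (ab x) = a \<and> snd (ab x) = b" if "a : A" "b : B" "x = a +[X] b" for x a b
 proof (rule uniq[OF _ _ that(1,2)])
  have "x : car X" using that Ac Bc by simp
  then show "fst (ab x) : A" "snd (ab x) : B" "fst (ab x) +[X] snd (ab x) = a +[X] b"
   using ab that(3) by simp_all
 qed
 have abc: "fst (ab x) : car X" "snd (ab x) : car X" if "x : car X" for x
  using ab(1,2)[OF that] Ac Bc by auto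
 have addv: "fst (ab (x +[X] y)) = fst (ab x) +[X] fst (ab y) \<and> snd (ab (x +[X] y)) = snd (ab x) +[X] snd (ab y)"
  if "x : car X" "y : car X" for x y
 proof (rule ab_eq)
  show "fst (ab x) +[X] fst (ab y) : A" by (rule X.sub_add[OF A ab(1)[OF that(1)] ab(1)[OF that(2)]])
  show "snd (ab x) +[X] snd (ab y) : B" by (rule X.sub_add[OF B ab(2)[OF that(1)] ab(2)[OF that(2)]])
  have "x +[X] y = (fst (ab x) +[X] snd (ab x)) +[X] (fst (ab y) +[X] snd (ab y))"
   using ab(3) that by simp
  also have "\<dots> = fst (ab x) +[X] fst (ab y) +[X] (snd (ab x) +[X] snd (ab y))"
   using abc[OF that(1)] abc[OF that(2)] by (simp add: X.M.a_ac)
  finally show "x +[X] y = fst (ab x) +[X] fst (ab y) +[X] (snd (ab x) +[X] snd (ab y))" .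
 qed
 have smv: "fst (ab (r .[X] x)) = r .[X] fst (ab x) \<and> snd (ab (r .[X] x)) = r .[X] snd (ab x)"
  if "r : car R" "x : car X" for r x
 proof (rule ab_eq)
  show "r .[X] fst (ab x) : A" by (rule X.sub_smult[OF A that(1) ab(1)[OF that(2)]])
  show "r .[X] snd (ab x) : B" by (rule X.sub_smult[OF B that(1) ab(2)[OF that(2)]])
  show "r .[X] x = r .[X] fst (ab x) +[X] r .[X] snd (ab x)"
   using X.smult_r_distr[OF that(1) abc[OF that(2)]] ab(3)[OF that(2)] by simp
 qed
 show thesis
 proof (rule that)
  show "(%x. fst (ab x)) : mhom R X X" "(%x. snd (ab x)) : mhom R X X"
   by (rule homI; simp add: abc addv smv)+
  fix x assume x: "x : car X"
  show "fst (ab x) : A" "snd (ab x) : B" "fst (ab x) +[X] snd (ab x) = x" using ab[OF x] by auto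
 next
  fix a assume a: "a : A"
  have "a = a +[X] 0[X]" using Ac[OF a] by simp
  from ab_eq[OF a X.sub_zero[OF B] this] show "fst (ab a) = a" "snd (ab a) = 0[X]" by auto
 next
  fix b assume b: "b : B"
  have "b = 0[X] +[X] b" using Bc[OF b] by simp
  from ab_eq[OF X.sub_zero[OF A] b this] show "snd (ab b) = b" "fst (ab b) = 0[X]" by auto
 qed
qed

text \<open>The projection onto \<open>A\<close> has kernel \<open>B\<close>, and every map into
  \<open>A\<close> lifts along it as itself, so the defect in \<open>hd_kernel\<close> is
  zero.\<close>

lemma hd_split:
 assumes M: "fd M" and X: "fd X" and A: "sub X A" and B: "sub X B" and int: "A \<inter> B = {0[X]}"
  and sum: "set_add X A B = car X"
 shows "hd M X = hd M (X on A) + hd M (X on B)"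
proof -
 note Xl = fd_lm[OF X]
 interpret X: left_module R X by (rule Xl)
 obtain p q where pq: "p : mhom R X X" "q : mhom R X X"
  "!!x. x : car X ==> p x : A" "!!x. x : car X ==> q x : B"
  "!!x. x : car X ==> p x +[X] q x = x"
  "!!a. a : A ==> p a = a" "!!b. b : B ==> q b = b"
  "!!b. b : B ==> p b = 0[X]" "!!a. a : A ==> q a = 0[X]"
  by (rule decomposition[OF Xl A B int sum], rule that)
 have p: "p : mhom R X (X on A)" by (rule hom_into_sub[OF Xl Xl pq(1,3)])
 have ker: "{x : car X. p x = 0[X on A]} = B"
 proof (intro equalityI subsetI)
  fix x assume "x : {x : car X. p x = 0[X on A]}"
  then have x: "x : car X" "p x = 0[X]" by auto
  have "q x = x" using pq(5)[OF x(1)] x(2) X.sub_carrier[OF B pq(4)[OF x(1)]] by simp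
  then show "x : B" using pq(4)[OF x(1)] by simp
 next
  fix x assume "x : B" then show "x : {x : car X. p x = 0[X on A]}"
   using pq(8) X.sub_carrier[OF B] by simp
 qed
 have "\<forall>f\<in>mhom R M (X on A). \<exists>h\<in>mhom R M X. \<forall>x\<in>car M. p (h x) = f x"
 proof
  fix f assume f: "f : mhom R M (X on A)"
  show "\<exists>h\<in>mhom R M X. \<forall>x\<in>car M. p (h x) = f x"
  proof (rule bexI)
   show "f : mhom R M X" by (rule hom_from_sub_cod[OF fd_lm[OF M] Xl f X.sub_subset[OF A]])
   show "\<forall>x\<in>car M. p (f x) = f x" using hom_closed[OF f] pq(6) by simp
  qed
 qed
 then show ?thesis using hd_kernel(2)[OF M X fd_sub[OF X A] p] unfolding ker by simp
qed

text \<open>The existence part of the Krull-Schmidt theorem as an induction rule: both summands of a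
  proper decomposition have smaller dimension.\<close>

lemma fd_decomposition_induct:
 fixes X :: "('a, 'm) module"
 assumes X: "fd X"
  and zero: "!!X :: ('a, 'm) module. fd X ==> car X = {0[X]} ==> P X"
  and ind: "!!X :: ('a, 'm) module. indec X ==> P X"
  and step: "!!(X :: ('a, 'm) module) A B. fd X ==> sub X A ==> sub X B ==> A \<inter> B = {0[X]} ==>
   set_add X A B = car X ==> P (X on A) ==> P (X on B) ==> P X"
 shows "P X"
 using X
proof (induction "dm X" arbitrary: X rule: less_induct)
 case less
 interpret X: left_module R X by (rule fd_lm[OF less.prems])
 show ?case
 proof (cases "car X = {0[X]} \<or> indec X")
  case True
  then show ?thesis using zero[OF less.prems] ind by blast
 next
  case False
  then obtain A B where AB: "sub X A" "sub X B" "A \<inter> B = {0[X]}" "set_add X A B = car X"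
   "A ~= {0[X]}" "B ~= {0[X]}" using less.prems by (auto simp: indec_iff)
  have e: "dm X = dm (X on A) + dm (X on B)"
   using dm_set_add[OF less.prems AB(1,2)] AB(3,4) dm_zero_sub[OF less.prems] by simp
  have "dm (X on A) ~= 0" "dm (X on B) ~= 0"
   using dm_zero_iff[OF fd_sub[OF less.prems AB(1)]] dm_zero_iff[OF fd_sub[OF less.prems AB(2)]] AB(5,6) by simp_all
  then have "dm (X on A) < dm X" "dm (X on B) < dm X" using e by linarith+
  then show ?thesis
   using step[OF less.prems AB(1-4)] less.hyps fd_sub[OF less.prems AB(1)] fd_sub[OF less.prems AB(2)] by blast
 qed
qed

subsection \<open>Fitting's lemma\<close>

lemma hom_funpow: "f : mhom R M M ==> f ^^ n : mhom R M M"
proof (induction n)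
 case 0 then show ?case using hom_id[of R M] by (simp add: id_def)
next
 case (Suc n) then show ?case using hom_comp[of "f ^^ n" R M M f M] by (simp add: comp_def)
qed

lemma inj_imp_bij:
 assumes "fd M" "fd N" "f : mhom R M N" "dm M = dm N" "inj_on f (car M)"
 shows "bij_betw f (car M) (car N)"
 using assms inj_iff_surj[of M N f] by (simp add: bij_betw_def)

lemma surj_imp_bij:
 assumes "fd M" "fd N" "f : mhom R M N" "dm M = dm N" "f ` car M = car N"
 shows "bij_betw f (car M) (car N)"
 using assms inj_iff_surj[of M N f] by (simp add: bij_betw_def)

text \<open>A power of \<open>f\<close> whose image has least dimension has the same image as its
  square, hence is injective on that image. So \<open>M\<close> is the direct sum of the kernel and
  the image of this power, and one of them is zero.\<close>

lemma fitting:
 fixes M :: "('a, 'm) module"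
 assumes M: "indec M" and f: "f : mhom R M M"
 shows "bij_betw f (car M) (car M) \<or> (\<exists>n. \<forall>x\<in>car M. (f ^^ n) x = 0[M])"
proof -
 note Mf = indec_fd[OF M] note Ml = fd_lm[OF Mf]
 interpret M: left_module R M by (rule Ml)
 let ?I = "%n. (f ^^ n) ` car M"
 define D where "D n = dm (M on (?I n))" for n
 have hn: "f ^^ n : mhom R M M" for n by (rule hom_funpow[OF f])
 have In: "sub M (?I n)" for n by (rule sub_image[OF Ml Ml hn M.sub_carrier_self])
 obtain n where n: "!!m. D n \<le> D m" using ex_has_least_nat[of "%_. True" 0 D] by auto
 let ?g = "f ^^ n"
 let ?G = "M on (?I n)"
 have G: "fd ?G" by (rule fd_sub[OF Mf In])
 interpret G: left_module R ?G by (rule fd_lm[OF G])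
 have gg: "?g ` (?I n) = ?I (n + n)" by (simp add: funpow_add image_comp)
 have gI: "?I (n + n) <= ?I n" unfolding gg[symmetric] using hom_closed[OF hn] by blast
 have sG: "sub ?G (?I (n + n))" using M.sub_of_sub[OF In] In gI by blast
 have "dm (?G on (?I (n + n))) = dm ?G"
  using dm_sub_le[OF G sG] n[of "n + n"] by (simp add: D_def)
 then have eq: "?I (n + n) = ?I n" using dm_sub_eq[OF G sG] by simp
 have gG: "?g : mhom R ?G ?G"
 proof (rule hom_into_sub[OF fd_lm[OF G] Ml hom_restrict_sub[OF Ml Ml hn In]])
  fix x assume "x : car ?G"
  then have "?g x : ?g ` (?I n)" by simp
  then show "?g x : ?I n" using gg gI by blast
 qed
 have "?g ` car ?G = car ?G" using eq gg by simp
 then have inj: "inj_on ?g (?I n)" using inj_iff_surj[OF G G gG] by simp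
 let ?k = "{x : car M. ?g x = 0[M]}"
 have k: "sub M ?k" by (rule sub_kernel[OF Ml Ml hn])
 have int: "?k \<inter> ?I n = {0[M]}"
 proof (intro equalityI subsetI)
  fix x assume x: "x : ?k \<inter> ?I n"
  then have "?g x = ?g 0[M]" using hom_zero[OF Ml Ml hn] by simp
  then show "x : {0[M]}" using inj_onD[OF inj, of x "0[M]"] x M.sub_zero[OF In] by blast
 qed (use M.sub_zero[OF k] M.sub_zero[OF In] in blast)
 have "car M <= set_add M ?k (?I n)"
 proof
  fix x assume x: "x : car M"
  then have "?g x : ?g ` (?I n)" using eq gg by simp
  then obtain y where y: "y : ?I n" "?g x = ?g y" by (rule imageE)
  have yM: "y : car M" by (rule M.sub_carrier[OF In y(1)])
  have "?g (x -[M] y) = 0[M]"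
   using hom_diff[OF Ml Ml hn x yM] y(2) hom_closed[OF hn yM] by (simp add: a_minus_def M.M.r_neg)
  then have "x -[M] y : ?k" using x yM by simp
  moreover have "x = (x -[M] y) +[M] y" using x yM by (simp add: a_minus_def M.M.a_assoc M.M.l_neg)
  ultimately show "x : set_add M ?k (?I n)" using y(1) unfolding M.set_add_iff by blast
 qed
 then have "set_add M ?k (?I n) = car M" using M.sub_subset[OF M.sub_set_add[OF k In]] by blast
 then consider "?k = {0[M]}" | "?I n = {0[M]}" using indecD[OF M k In int] by blast
 then show ?thesis
 proof cases
  case 1
  then have "D n = dm M"
   using dm_image[OF Mf Ml hn[of n]] dm_zero_sub[OF Mf] by (simp add: D_def)
  then have "dm (M on (f ` car M)) = dm M"
   using n[of 1] dm_sub_le[OF Mf In[of 1]] by (simp add: D_def)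
  then have "f ` car M = car M" using dm_sub_eq[OF Mf In[of 1]] by simp
  then show ?thesis using surj_imp_bij[OF Mf Mf f] by simp
 next
  case 2
  then have "\<forall>x\<in>car M. ?g x = 0[M]" by blast
  then show ?thesis by blast
 qed
qed

text \<open>If \<open>f\<close> is not bijective, then \<open>f\<close> followed by the inverse of
  \<open>f + g\<close> is nilpotent by Fitting's lemma. That composite fixes the kernel of
  \<open>g\<close> pointwise, so the kernel is zero.\<close>

lemma local_End:
 fixes M :: "('a, 'm) module"
 assumes M: "indec M" and f: "f : mhom R M M" and g: "g : mhom R M M"
  and u: "bij_betw (%x. f x +[M] g x) (car M) (car M)"
 shows "bij_betw f (car M) (car M) \<or> bij_betw g (car M) (car M)"
proof (cases "bij_betw f (car M) (car M)")
 case nf: False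
 note Mf = indec_fd[OF M] note Ml = fd_lm[OF Mf]
 interpret M: left_module R M by (rule Ml)
 let ?u = "%x. f x +[M] g x" let ?v = "inv_into (car M) ?u"
 have v: "?v : mhom R M M" by (rule hom_inv[OF Ml Ml hom_plus[OF Ml Ml f g] u])
 let ?h = "%x. ?v (f x)"
 have h: "?h : mhom R M M" by (rule hom_comp[OF f v])
 have "\<not> bij_betw ?h (car M) (car M)"
 proof
  assume "bij_betw ?h (car M) (car M)"
  then have "inj_on ?h (car M)" by (rule bij_betw_imp_inj_on)
  then have "inj_on f (car M)" by (auto simp: inj_on_def)
  then show False using nf inj_imp_bij[OF Mf Mf f] by simp
 qed
 then obtain n where n: "!!x. x : car M ==> (?h ^^ n) x = 0[M]" using fitting[OF M h] by blast
 have "x = 0[M]" if x: "x : car M" "g x = 0[M]" for x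
 proof -
  have "?u x = f x" using x hom_closed[OF f x(1)] by simp
  then have "?h x = x" using inv_into_f_f[OF bij_betw_imp_inj_on[OF u] x(1)] by simp
  then have "(?h ^^ n) x = x" for n by (induction n) simp_all
  then show ?thesis using n[OF x(1)] by simp
 qed
 then have "inj_on g (car M)" using inj_iff_kernel[OF Ml Ml g] by blast
 then have "bij_betw g (car M) (car M)" by (rule inj_imp_bij[OF Mf Mf g refl])
 then show ?thesis ..
qed simp

text \<open>Inverting the composite turns \<open>g\<close> into a retraction of \<open>f\<close>, so
  the image of \<open>f\<close> is a nonzero direct summand of the indecomposable
  \<open>X\<close>.\<close>

lemma split_mono_bij:
 fixes M :: "('a, 'm) module" and X :: "('a, 'n) module"
 assumes M: "fd M" "car M ~= {0[M]}" and X: "indec X" and f: "f : mhom R M X" and g: "g : mhom R X M"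
  and gf: "bij_betw (%x. g (f x)) (car M) (car M)"
 shows "bij_betw f (car M) (car X)"
proof -
 note Xf = indec_fd[OF X] note Ml = fd_lm[OF M(1)] and Xl = fd_lm[OF Xf]
 interpret M: left_module R M by (rule Ml)
 interpret X: left_module R X by (rule Xl)
 let ?v = "inv_into (car M) (%x. g (f x))"
 have v: "?v : mhom R M M" by (rule hom_inv[OF Ml Ml hom_comp[OF f g] gf])
 let ?h = "%x. ?v (g x)"
 have h: "?h : mhom R X M" by (rule hom_comp[OF g v])
 have hf: "?h (f x) = x" if "x : car M" for x
  by (rule inv_into_f_f[OF bij_betw_imp_inj_on[OF gf] that])
 let ?k = "{x : car X. ?h x = 0[M]}"
 have k: "sub X ?k" by (rule sub_kernel[OF Xl Ml h])
 have i: "sub X (f ` car M)" by (rule sub_image[OF Ml Xl f M.sub_carrier_self])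
 have inj: "inj_on f (car M)" using hf by (rule inj_on_inverseI)
 have int: "f ` car M \<inter> ?k = {0[X]}"
 proof (intro equalityI subsetI)
  fix x assume "x : f ` car M \<inter> ?k"
  then obtain m where m: "m : car M" "x = f m" "?h x = 0[M]" by blast
  then have "m = 0[M]" using hf[OF m(1)] by simp
  then show "x : {0[X]}" using m hom_zero[OF Ml Xl f] by simp
 qed (use X.sub_zero[OF k] X.sub_zero[OF i] in blast)
 have dec: "x -[X] f (?h x) : ?k \<and> x = f (?h x) +[X] (x -[X] f (?h x))" if x: "x : car X" for x
 proof -
  have c: "?h x : car M" "f (?h x) : car X" using hom_closed[OF h x] hom_closed[OF f] by auto
  have "?h (x -[X] f (?h x)) = ?h x -[M] ?h (f (?h x))" by (rule hom_diff[OF Xl Ml h x c(2)])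
  also have "\<dots> = 0[M]" using hf[OF c(1)] c(1) by (simp add: a_minus_def M.M.r_neg)
  finally show ?thesis using x c
   by (simp add: a_minus_def X.M.a_lcomm X.M.r_neg)
 qed
 have "car X <= set_add X (f ` car M) ?k"
 proof
  fix x assume x: "x : car X"
  have "f (?h x) : f ` car M" using hom_closed[OF h x] by blast
  then show "x : set_add X (f ` car M) ?k" using dec[OF x] unfolding X.set_add_iff by blast
 qed
 then have "set_add X (f ` car M) ?k = car X" using X.sub_subset[OF X.sub_set_add[OF i k]] by blast
 then have "f ` car M = {0[X]} \<or> ?k = {0[X]}" by (rule indecD[OF X i k int])
 moreover have "f ` car M ~= {0[X]}"
 proof
  assume z: "f ` car M = {0[X]}"
  have "x = 0[M]" if "x : car M" for x
  proof -
   have "f x : {0[X]}" unfolding z[symmetric] using that by (rule imageI)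
   then have "f x = f 0[M]" using hom_zero[OF Ml Xl f] by simp
   then show ?thesis using inj_onD[OF inj] that by simp
  qed
  then show False using M(2) M.M.zero_closed by blast
 qed
 ultimately have kz: "?k = {0[X]}" by simp
 have "car X <= f ` car M"
 proof
  fix x assume x: "x : car X"
  have c: "?h x : car M" "f (?h x) : car X" using hom_closed[OF h x] hom_closed[OF f] by auto
  have "x -[X] f (?h x) = 0[X]" using dec[OF x] kz by blast
  then have "x = f (?h x)" using dec[OF x] c(2) by (metis X.M.r_zero)
  then show "x : f ` car M" using c(1) by (metis imageI)
 qed
 then have "f ` car M = car X" using X.sub_subset[OF i] by blast
 then show ?thesis using inj by (simp add: bij_betw_def)
qed

lemma iso_refl: "isomorphic_modules R M M"
 unfolding isomorphic_modules_def by (rule bexI[OF _ hom_id]) (simp add: bij_betw_def)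

lemma isoI: "f : mhom R M N ==> bij_betw f (car M) (car N) ==> isomorphic_modules R M N"
 unfolding isomorphic_modules_def by (rule bexI)

lemma isoE:
 assumes "isomorphic_modules R M N"
 obtains f where "f : mhom R M N" "bij_betw f (car M) (car N)"
 using assms unfolding isomorphic_modules_def by blast

lemma iso_sym:
 assumes "lm M" "lm N" and i: "isomorphic_modules R M N"
 shows "isomorphic_modules R N M"
proof -
 obtain f where f: "f : mhom R M N" "bij_betw f (car M) (car N)" by (rule isoE[OF i])
 show ?thesis by (rule isoI[OF hom_inv[OF assms(1,2) f] bij_betw_inv_into[OF f(2)]])
qed

lemma iso_trans:
 assumes MN: "isomorphic_modules R M N" and NX: "isomorphic_modules R N X"
 shows "isomorphic_modules R M X"
proof -
 obtain f where f: "f : mhom R M N" "bij_betw f (car M) (car N)" by (rule isoE[OF MN])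
 obtain g where g: "g : mhom R N X" "bij_betw g (car N) (car X)" by (rule isoE[OF NX])
 have "bij_betw (%x. g (f x)) (car M) (car X)"
  using bij_betw_trans[OF f(2) g(2)] by (simp add: comp_def)
 then show ?thesis by (rule isoI[OF hom_comp[OF f(1) g(1)]])
qed

lemma hd_cong:
 assumes i: "isomorphic_modules R M M'" and M: "fd M" "fd M'" and i': "isomorphic_modules R N N'" and N: "fd N" "fd N'"
 shows "hd M N = hd M' N'"
proof -
 obtain f where f: "f : mhom R M M'" "bij_betw f (car M) (car M')" by (rule isoE[OF i])
 obtain g where g: "g : mhom R N N'" "bij_betw g (car N) (car N')" by (rule isoE[OF i'])
 show ?thesis using hd_iso_left[OF M N(1) f] hd_iso_right[OF M(2) N g] by simp
qed

end


context fd_algebra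
begin

subsection \<open>Invertibility of the matrix of dimensions of homomorphism spaces\<close>

text \<open>The maps to \<open>A\<close> that are not split epimorphisms. For \<open>A\<close>
  indecomposable these are the maps in the radical of the module category.\<close>

definition radical_hom :: "('a, 'm) module => ('a, 'n) module => ('m => 'n) => bool" where
 "radical_hom X A f \<longleftrightarrow> f : mhom R X A \<and> (\<forall>g\<in>mhom R A X. \<not> bij_betw (%x. f (g x)) (car A) (car A))"

lemma radical_homD: "radical_hom X A f ==> g : mhom R A X ==>
  \<not> bij_betw (%x. f (g x)) (car A) (car A)"
 unfolding radical_hom_def by blast

text \<open>A substitute for the right almost split map ending in \<open>A\<close>, relative to
  finitely many given maps: the sum of the maps, defined on the direct sum of their sources, is
  again radical because \<open>End(A)\<close> is local.\<close>

lemma universal_radical_hom: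
 fixes A :: "('k, 'a) fd_module" and F :: "(('k, 'a) fd_module \<times> ((nat => 'k) => nat => 'k)) set"
 assumes A: "indec A" and fin: "finite F" and F: "!!X f. (X, f) : F ==> fd X \<and> radical_hom X A f"
 shows "\<exists>(B :: ('k, 'a) fd_module) \<beta>. fd B \<and> radical_hom B A \<beta> \<and>
  (\<forall>(X, f)\<in>F. \<exists>h\<in>mhom R X B. \<forall>x\<in>car X. \<beta> (h x) = f x)"
 using fin F
proof (induction F rule: finite_induct)
 case empty
 note Af = indec_fd[OF A] note Al = fd_lm[OF Af]
 interpret A: left_module R A by (rule Al)
 have "\<not> bij_betw (%x. 0[A]) (car A) (car A)"
 proof
  assume "bij_betw (%x. 0[A]) (car A) (car A)"
  then have "(%x. 0[A]) ` car A = car A" by (simp add: bij_betw_def)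
  moreover have "(%x. 0[A]) ` car A = {0[A]}" using A.M.zero_closed by (rule image_constant)
  ultimately show False using indec_nonzero[OF A] by simp
 qed
 then have "radical_hom A A (%x. 0[A])" using hom_const_zero[OF Al Al] by (simp add: radical_hom_def)
 then show ?case using Af by blast
next
 case (insert Y F)
 note Af = indec_fd[OF A] note Al = fd_lm[OF Af]
 interpret A: left_module R A by (rule Al)
 obtain X f where Y: "Y = (X, f)" by (cases Y)
 have X: "fd X" and rf: "radical_hom X A f" using insert.prems Y by auto
 obtain B :: "('k, 'a) fd_module" and \<beta> where B: "fd B" and r\<beta>: "radical_hom B A \<beta>"
  and fac: "\<forall>(X, f)\<in>F. \<exists>h\<in>mhom R X B. \<forall>x\<in>car X. \<beta> (h x) = f x"
 proof -
  have "\<exists>(B :: ('k, 'a) fd_module) \<beta>. fd B \<and> radical_hom B A \<beta> \<and>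
    (\<forall>(X, f)\<in>F. \<exists>h\<in>mhom R X B. \<forall>x\<in>car X. \<beta> (h x) = f x)"
   by (rule insert.IH, rule insert.prems, rule insertI2)
  then show thesis using that by blast
 qed
 have \<beta>: "\<beta> : mhom R B A" and f: "f : mhom R X A" using r\<beta> rf by (simp_all add: radical_hom_def)
 obtain C :: "('k, 'a) fd_module" and i1 i2 p1 p2 where C: "fd C"
  and i1: "i1 : mhom R B C" and i2: "i2 : mhom R X C"
  and p1: "p1 : mhom R C B" and p2: "p2 : mhom R C X"
  and e: "!!x. x : car B ==> p1 (i1 x) = x" "!!x. x : car B ==> p2 (i1 x) = 0[X]"
  "!!x. x : car X ==> p2 (i2 x) = x" "!!x. x : car X ==> p1 (i2 x) = 0[B]"
  "!!x. x : car C ==> i1 (p1 x) +[C] i2 (p2 x) = x" "dm C = dm B + dm X"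
  by (rule fd_biproduct[OF B X], rule that)
 let ?\<gamma> = "%x. \<beta> (p1 x) +[A] f (p2 x)"
 note Cl = fd_lm[OF C] and Bl = fd_lm[OF B] and Xl = fd_lm[OF X]
 have \<gamma>: "?\<gamma> : mhom R C A" by (rule hom_plus[OF Cl Al hom_comp[OF p1 \<beta>] hom_comp[OF p2 f]])
 have "\<not> bij_betw (%x. ?\<gamma> (g x)) (car A) (car A)" if g: "g : mhom R A C" for g
 proof
  assume "bij_betw (%x. ?\<gamma> (g x)) (car A) (car A)"
  then have "bij_betw (%x. \<beta> (p1 (g x))) (car A) (car A) \<or> bij_betw (%x. f (p2 (g x))) (car A) (car A)"
   by (rule local_End[OF A hom_comp[OF hom_comp[OF g p1] \<beta>] hom_comp[OF hom_comp[OF g p2] f]])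
  then show False
  proof
   assume "bij_betw (%x. \<beta> (p1 (g x))) (car A) (car A)"
   then show False using radical_homD[OF r\<beta> hom_comp[OF g p1]] by contradiction
  next
   assume "bij_betw (%x. f (p2 (g x))) (car A) (car A)"
   then show False using radical_homD[OF rf hom_comp[OF g p2]] by contradiction
  qed
 qed
 then have r\<gamma>: "radical_hom C A ?\<gamma>" using \<gamma> by (simp add: radical_hom_def)
 have 1: "?\<gamma> (i1 x) = \<beta> x" if "x : car B" for x
  using e(1,2)[OF that] hom_zero[OF Xl Al f] hom_closed[OF \<beta> that] by simp
 have 2: "?\<gamma> (i2 x) = f x" if "x : car X" for x
  using e(3,4)[OF that] hom_zero[OF Bl Al \<beta>] hom_closed[OF f that] by simp
 have "\<exists>h\<in>mhom R X' C. \<forall>x\<in>car X'. ?\<gamma> (h x) = f' x" if mem: "(X', f') : insert Y F" for X' f'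
 proof (cases "(X', f') = Y")
  case True
  then show ?thesis using i2 2 Y by (intro bexI[of _ i2]) simp_all
 next
  case False
  then have "(X', f') : F" using mem by simp
  then obtain h where h: "h : mhom R X' B" "!!x. x : car X' ==> \<beta> (h x) = f' x" using fac by blast
  show ?thesis
   by (rule bexI[OF _ hom_comp[OF h(1) i1]]) (simp add: 1[OF hom_closed[OF h(1)]] h(2))
 qed
 then have "\<forall>(X', f')\<in>insert Y F. \<exists>h\<in>mhom R X' C. \<forall>x\<in>car X'. ?\<gamma> (h x) = f' x" by blast
 then show ?case using C r\<gamma> by blast
qed

lemma representatives_indec:
 fixes X :: "('k, 'a) fd_module"
 assumes "representatives R indec Ms"
 shows "i < length Ms ==> indec (Ms ! i)"
  "i < length Ms ==> j < length Ms ==> isomorphic_modules R (Ms ! i) (Ms ! j) ==> i = j"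
  "indec X ==> \<exists>i<length Ms. isomorphic_modules R X (Ms ! i)"
proof -
 show 1: "indec (Ms ! i)" if "i < length Ms" for i using assms that by (simp add: representatives_def)
 show "i = j" if "i < length Ms" "j < length Ms" "isomorphic_modules R (Ms ! i) (Ms ! j)"
  using assms 1[OF that(1)] that iso_refl[of "Ms ! i"] unfolding representatives_def by blast
 assume X: "indec X"
 have "\<exists>!i. i < length Ms \<and> isomorphic_modules R X (Ms ! i)"
  by (rule mp[OF spec[OF conjunct2[OF assms[unfolded representatives_def]]] X])
 then show "\<exists>i<length Ms. isomorphic_modules R X (Ms ! i)" by (rule ex1_implies_ex)
qed

text \<open>Let \<open>A\<close> be the module at \<open>i0\<close>. A radical map
  \<open>\<beta>\<close> into \<open>A\<close> is built through which all maps from the modules with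
  negative coefficient factor. The lifting defects \<open>\<delta>\<close> along
  \<open>\<beta>\<close> are non-negative and vanish at negative coefficients, so the vanishing sum
  of \<open>c j * \<delta> j\<close> has no negative term. Hence the defect at \<open>i0\<close> is
  zero and the identity of \<open>A\<close> lifts along a radical map, which is absurd.\<close>

lemma hom_matrix_kernel_aux:
 fixes Ms :: "('k, 'a) fd_module list" and c :: "nat => rat"
 assumes rep: "representatives R indec Ms"
  and c: "!!j. j < length Ms ==> (\<Sum>i<length Ms. c i * of_nat (hd (Ms ! i) (Ms ! j))) = 0"
  and i0: "i0 < length Ms"
 shows "\<not> c i0 > 0"
proof
 assume pos: "c i0 > 0"
 let ?N = "length Ms"
 note ind = representatives_indec(1)[OF rep]
 have fdM: "fd (Ms ! i)" if "i < ?N" for i using indec_fd[OF ind[OF that]] .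
 \<comment> \<open>Additivity on direct sums extends the relations from the listed modules to all
   finite-dimensional ones, in particular to \<open>B\<close> and to the kernel of
   \<open>\<beta>\<close> below.\<close>
 have total: "(\<Sum>i<?N. c i * of_nat (hd (Ms ! i) X)) = 0" if X: "fd X" for X :: "('k, 'a) fd_module"
  using X
 proof (rule fd_decomposition_induct[where P = "%X. (\<Sum>i<length Ms. c i * of_nat (hd (Ms ! i) X)) = 0"])
  fix X :: "('k, 'a) fd_module" assume "fd X" "car X = {0[X]}"
  then have "hd (Ms ! i) X = 0" if "i < ?N" for i using hom_zero_module[of X, OF _ fdM[OF that]] by simp
  then show "(\<Sum>i<?N. c i * of_nat (hd (Ms ! i) X)) = 0" by simp
 next
  fix X :: "('k, 'a) fd_module" assume X: "indec X"
  obtain j where j: "j < ?N" "isomorphic_modules R X (Ms ! j)" using representatives_indec(3)[OF rep X] by blast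
  have "hd (Ms ! i) X = hd (Ms ! i) (Ms ! j)" if "i < ?N" for i
   by (rule hd_cong[OF iso_refl fdM[OF that] fdM[OF that] j(2) indec_fd[OF X] fdM[OF j(1)]])
  then show "(\<Sum>i<?N. c i * of_nat (hd (Ms ! i) X)) = 0" using c[OF j(1)] by simp
 next
  fix X :: "('k, 'a) fd_module" and A B
  assume X: "fd X" and AB: "sub X A" "sub X B" "A \<inter> B = {0[X]}" "set_add X A B = car X"
   and IH: "(\<Sum>i<?N. c i * of_nat (hd (Ms ! i) (X on A))) = 0"
   "(\<Sum>i<?N. c i * of_nat (hd (Ms ! i) (X on B))) = 0"
  have "hd (Ms ! i) X = hd (Ms ! i) (X on A) + hd (Ms ! i) (X on B)" if "i < ?N" for i
   by (rule hd_split[OF fdM[OF that] X AB])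
  then have "(\<Sum>i<?N. c i * of_nat (hd (Ms ! i) X)) =
   (\<Sum>i<?N. c i * of_nat (hd (Ms ! i) (X on A)) + c i * of_nat (hd (Ms ! i) (X on B)))"
   by (intro sum.cong) (simp_all add: algebra_simps)
  then show "(\<Sum>i<?N. c i * of_nat (hd (Ms ! i) X)) = 0" using IH by (simp add: sum.distrib)
 qed
 let ?A = "Ms ! i0"
 note A = ind[OF i0] note Af = indec_fd[OF A] note Al = fd_lm[OF Af]
 interpret A: left_module R ?A by (rule Al)
 let ?Neg = "{j. j < ?N \<and> c j < 0}"
 have ex_span: "\<exists>S. finite S \<and> S <= Hom (Ms ! j) ?A \<and> module.span K (hom_space R (Ms ! j) ?A) S = Hom (Ms ! j) ?A"
  if "j < ?N" for j
 proof -
  have f: "fdim K (hom_space R (Ms ! j) ?A)" by (rule fdim_hom[OF fdM[OF that] Af])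
  interpret V: vectorspace K "hom_space R (Ms ! j) ?A" by (rule fdim_vectorspace[OF f])
  show ?thesis using f unfolding fdim_def V.fin_dim_def by simp
 qed
 define S where "S j = (SOME S. finite S \<and> S <= Hom (Ms ! j) ?A \<and> module.span K (hom_space R (Ms ! j) ?A) S = Hom (Ms ! j) ?A)" for j
 have S: "finite (S j) \<and> S j <= Hom (Ms ! j) ?A \<and> module.span K (hom_space R (Ms ! j) ?A) (S j) = Hom (Ms ! j) ?A"
  if "j < ?N" for j
  unfolding S_def by (rule someI_ex[OF ex_span[OF that]])
 \<comment> \<open>Finite, since each Hom space contributes a finite spanning set only. Its members
   are radical, since an index with negative coefficient differs from \<open>i0\<close>.\<close>
 define F where "F = (\<Union>j\<in>?Neg. (%f. (Ms ! j, f)) ` S j)"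
 have "finite F" unfolding F_def using S by simp
 moreover have "fd X \<and> radical_hom X ?A f" if "(X, f) : F" for X f
 proof -
  obtain j where j: "j < ?N" "c j < 0" "X = Ms ! j" "f : S j" using \<open>(X, f) : F\<close> unfolding F_def by blast
  have fH: "f : mhom R (Ms ! j) ?A" using S[OF j(1)] j(4) Hom_hom by blast
  have "\<not> bij_betw (%x. f (g x)) (car ?A) (car ?A)" if g: "g : mhom R ?A (Ms ! j)" for g
  proof
   assume "bij_betw (%x. f (g x)) (car ?A) (car ?A)"
   then have "bij_betw g (car ?A) (car (Ms ! j))"
    by (rule split_mono_bij[OF Af indec_nonzero[OF A] ind[OF j(1)] g fH])
   then have "i0 = j" using representatives_indec(2)[OF rep i0 j(1) isoI[OF g]] by simp
   then show False using pos j(2) by simp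
  qed
  then show ?thesis using fdM[OF j(1)] fH j(3) by (simp add: radical_hom_def)
 qed
 ultimately obtain B :: "('k, 'a) fd_module" and \<beta> where B: "fd B" and r\<beta>: "radical_hom B ?A \<beta>"
  and fac: "\<forall>(X, f)\<in>F. \<exists>h\<in>mhom R X B. \<forall>x\<in>car X. \<beta> (h x) = f x"
  using universal_radical_hom[OF A, of F] by blast
 have \<beta>: "\<beta> : mhom R B ?A" using r\<beta> by (simp add: radical_hom_def)
 note Bl = fd_lm[OF B]
 interpret B: left_module R B by (rule Bl)
 let ?k = "{x : car B. \<beta> x = 0[?A]}"
 have k: "fd (B on ?k)" by (rule fd_sub[OF B sub_kernel[OF Bl Al \<beta>]])
 define \<delta> where "\<delta> j = (of_nat (hd (Ms ! j) (B on ?k)) + of_nat (hd (Ms ! j) ?A) - of_nat (hd (Ms ! j) B) :: rat)" for j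
 have \<delta>_nonneg: "\<delta> j \<ge> 0" if "j < ?N" for j
  using hd_kernel(1)[OF fdM[OF that] B Af \<beta>] unfolding \<delta>_def by (simp flip: of_nat_add)
 have \<delta>_zero: "\<delta> j = 0 \<longleftrightarrow> (\<forall>f\<in>mhom R (Ms ! j) ?A. \<exists>h\<in>mhom R (Ms ! j) B. \<forall>x\<in>car (Ms ! j). \<beta> (h x) = f x)"
  if "j < ?N" for j
 proof -
  have "\<delta> j = 0 \<longleftrightarrow> hd (Ms ! j) B = hd (Ms ! j) (B on ?k) + hd (Ms ! j) ?A"
   unfolding \<delta>_def by (auto simp flip: of_nat_add)
  then show ?thesis unfolding hd_kernel(2)[OF fdM[OF that] B Af \<beta>] .
 qed
 have \<delta>_neg: "\<delta> j = 0" if j: "j < ?N" "c j < 0" for j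
 proof -
  let ?M = "Ms ! j" let ?H = "hom_space R ?M ?A"
  note Ml = fd_lm[OF fdM[OF j(1)]]
  have V: "vectorspace K ?H" by (rule fdim_vectorspace[OF fdim_hom[OF fdM[OF j(1)] Af]])
  have HB: "left_module K (hom_space R ?M B)" and HA: "left_module K ?H" using hom_space_lm Ml Bl Al by blast+
  interpret HB: left_module K "hom_space R ?M B" by (rule HB)
  let ?T = "%f. \<lambda>x\<in>car ?M. \<beta> (f x)"
  have T: "?T : mhom K (hom_space R ?M B) ?H" by (rule hom_post[OF Ml \<beta> Bl])
  have im: "is_sub K ?H (?T ` car (hom_space R ?M B))" by (rule sub_image[OF HB HA T HB.sub_carrier_self])
  have Sj: "S j <= ?T ` car (hom_space R ?M B)"
  proof
   fix f assume f: "f : S j"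
   then have fH: "f : Hom ?M ?A" using S[OF j(1)] by blast
   have "(?M, f) : F" using f j unfolding F_def by blast
   then obtain h where h: "h : mhom R ?M B" "!!x. x : car ?M ==> \<beta> (h x) = f x" using fac by blast
   have "f = ?T (\<lambda>x\<in>car ?M. h x)"
    using h(2) fH by (auto simp: Hom_def extensional_def fun_eq_iff)
   then show "f : ?T ` car (hom_space R ?M B)"
    using restrict_Hom[OF Ml h(1)] by (intro image_eqI[of f ?T]) simp_all
  qed
  \<comment> \<open>The maps that lift along \<open>\<beta>\<close> form a subspace, so it is enough
    that a spanning set lifts.\<close>
  then have im2: "Hom ?M ?A <= ?T ` car (hom_space R ?M B)"
   using span_sub[OF V im Sj] S[OF j(1)] by simp
  have "\<exists>h\<in>mhom R ?M B. \<forall>x\<in>car ?M. \<beta> (h x) = f x" if f: "f : mhom R ?M ?A" for f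
  proof -
   have "(\<lambda>x\<in>car ?M. f x) : ?T ` car (hom_space R ?M B)" using im2 restrict_Hom[OF Ml f] by blast
   then obtain h where h: "h : Hom ?M B" "(\<lambda>x\<in>car ?M. f x) = ?T h" by auto
   have "\<beta> (h x) = f x" if "x : car ?M" for x using fun_cong[OF h(2), of x] that by simp
   then show ?thesis using Hom_hom[OF h(1)] by blast
  qed
  then show ?thesis using \<delta>_zero[OF j(1)] by blast
 qed
 have "(\<Sum>j<?N. c j * \<delta> j) = (\<Sum>j<?N. c j * of_nat (hd (Ms ! j) (B on ?k))) +
   (\<Sum>j<?N. c j * of_nat (hd (Ms ! j) ?A)) - (\<Sum>j<?N. c j * of_nat (hd (Ms ! j) B))"
  unfolding \<delta>_def by (simp add: algebra_simps sum.distrib sum_subtractf)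
 then have sum0: "(\<Sum>j<?N. c j * \<delta> j) = 0" using total[OF k] total[OF Af] total[OF B] by simp
 have nn: "c j * \<delta> j \<ge> 0" if "j < ?N" for j
  using \<delta>_nonneg[OF that] \<delta>_neg[OF that] by (cases "c j < 0") simp_all
 have "c i0 * \<delta> i0 = 0" using sum0 sum_nonneg_eq_0_iff[of "{..<?N}" "%j. c j * \<delta> j"] nn i0 by simp
 then have d0: "\<delta> i0 = 0" using pos by simp
 obtain h where h: "h : mhom R ?A B" "!!x. x : car ?A ==> \<beta> (h x) = x"
  using bspec[OF iffD1[OF \<delta>_zero[OF i0] d0] hom_id[of R ?A]] by blast
 have "bij_betw (%x. \<beta> (h x)) (car ?A) (car ?A) \<longleftrightarrow> bij_betw id (car ?A) (car ?A)"
  by (rule bij_betw_cong) (simp add: h(2))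
 then show False using radical_homD[OF r\<beta> h(1)] by simp
qed

lemma hom_matrix_kernel:
 fixes Ms :: "('k, 'a) fd_module list" and c :: "nat => rat"
 assumes rep: "representatives R indec Ms"
  and c: "!!j. j < length Ms ==> (\<Sum>i<length Ms. c i * of_nat (hd (Ms ! i) (Ms ! j))) = 0"
  and i: "i < length Ms"
 shows "c i = 0"
proof -
 have "\<not> c i > 0" by (rule hom_matrix_kernel_aux[OF rep c i])
 moreover have "(\<Sum>i<length Ms. (- c i) * of_nat (hd (Ms ! i) (Ms ! j))) = 0" if "j < length Ms" for j
  using c[OF that] by (simp add: sum_negf)
 then have "\<not> - c i > 0" by (rule hom_matrix_kernel_aux[OF rep _ i])
 ultimately show ?thesis by simp
qed

end

lemma mat_inverse_exists:
 fixes f :: "nat => nat => 'a :: field"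
 assumes "!!c i. (!!j. j < n ==> (\<Sum>i<n. c i * f i j) = 0) ==> i < n ==> c i = 0"
 shows "\<exists>W\<in>carrier_mat n n. mat n n (%(i, j). f i j) * W = 1\<^sub>m n \<and> W * mat n n (%(i, j). f i j) = 1\<^sub>m n"
proof -
 let ?A = "mat n n (%(i, j). f i j)"
 let ?B = "transpose_mat ?A"
 have B: "?B : carrier_mat n n" and A: "?A : carrier_mat n n" by simp_all
 have "det ?B ~= 0"
 proof
  assume "det ?B = 0"
  then obtain v where v: "v : carrier_vec n" "v ~= 0\<^sub>v n" "?B *\<^sub>v v = 0\<^sub>v n"
   using det_0_iff_vec_prod_zero[OF B] by blast
  have "(\<Sum>i<n. v $ i * f i j) = 0" if j: "j < n" for j
  proof -
   have "(?B *\<^sub>v v) $ j = (\<Sum>i = 0..<n. f i j * v $ i)"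
    using v(1) j by (simp add: scalar_prod_def)
   then show ?thesis using v(3) j by (simp add: mult.commute lessThan_atLeast0)
  qed
  then have "v $ i = 0" if "i < n" for i using assms[of "%i. v $ i" i] that by blast
  then have "v = 0\<^sub>v n" using v(1) by (intro eq_vecI) simp_all
  then show False using v(2) by simp
 qed
 then have "det ?A ~= 0" using det_transpose[OF A] by simp
 then have "?A : Units (ring_mat TYPE('a) n ())" by (rule det_non_zero_imp_unit[OF A])
 then show ?thesis by (auto simp: Units_def ring_mat_def)
qed

context left_module
begin

lemma diff_add_cancel: "x : car M ==> y : car M ==> (x -[M] y) +[M] y = x"
 by (simp add: a_minus_def M.a_assoc M.l_neg)

lemma add_diff_cancel: "x : car M ==> y : car M ==> x +[M] (y -[M] x) = y"
 by (simp add: a_minus_def M.a_comm[of y] M.r_neg2)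

lemma diff_self: "x : car M ==> x -[M] x = 0[M]"
 by (simp add: a_minus_def M.r_neg)

lemma sub_diff_mem:
 assumes "is_sub R M N" "x : car M" "y : N" "x -[M] y : N" shows "x : N"
 using sub_add[OF assms(1,4,3)] diff_add_cancel[OF assms(2) sub_carrier[OF assms(1,3)]] by simp

lemma sub_add_mem:
 assumes N: "is_sub R M N" and x: "x : car M" and y: "y : N" and s: "x +[M] y : N" shows "x : N"
proof -
 have yc: "y : car M" by (rule sub_carrier[OF N y])
 have "(x +[M] y) -[M] y = x" using x yc by (simp add: a_minus_def M.a_assoc M.r_neg)
 then show ?thesis using sub_diff[OF N s y] by simp
qed

end

context fd_algebra
begin

section \<open>Hollow and uniform modules\<close>

text \<open>A module of finite length has simple top iff it is hollow, and simple socle iff it is uniform.\<close>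

definition hollow_sub :: "('a, 'm) module => 'm set => bool" where
 "hollow_sub M A \<longleftrightarrow> A ~= {0[M]} \<and>
  (\<forall>B C. sub M B \<and> sub M C \<and> set_add M B C = A --> B = A \<or> C = A)"

abbreviation hollow :: "('a, 'm) module => bool" where "hollow M \<equiv> hollow_sub M (car M)"

definition uniform :: "('a, 'm) module => bool" where
 "uniform M \<longleftrightarrow> car M ~= {0[M]} \<and>
  (\<forall>A B. sub M A \<and> sub M B \<and> A \<inter> B = {0[M]} --> A = {0[M]} \<or> B = {0[M]})"

lemma hollow_subD: "hollow_sub M A ==> sub M B ==> sub M C ==> set_add M B C = A ==> B = A \<or> C = A"
 and hollow_sub_nonzero: "hollow_sub M A ==> A ~= {0[M]}"
 by (simp_all add: hollow_sub_def)

lemma hollow_indec: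
 assumes M: "fd M" and h: "hollow M" shows "indec M"
 unfolding indec_iff
proof (intro conjI allI impI)
 interpret M: left_module R M by (rule fd_lm[OF M])
 show "fd M" "car M ~= {0[M]}" using M hollow_sub_nonzero[OF h] by auto
 fix A B assume *: "sub M A \<and> sub M B \<and> A \<inter> B = {0[M]} \<and> set_add M A B = car M"
 then have "A = car M \<or> B = car M" using hollow_subD[OF h] by blast
 then show "A = {0[M]} \<or> B = {0[M]}"
  using * M.sub_subset[of A] M.sub_subset[of B] by (metis inf.absorb1 inf.absorb2)
qed

text \<open>A decomposition of the image pulls back to one of \<open>A\<close>: an element whose
  image is \<open>b + c\<close> differs from a preimage of \<open>b\<close> in \<open>A\<close> by
  an element over \<open>c\<close>.\<close>

lemma hollow_image:
 assumes M: "lm M" and N: "lm N" and p: "p : mhom R M N" and A: "sub M A" and h: "hollow_sub M A"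
  and nz: "p ` A ~= {0[N]}"
 shows "hollow_sub N (p ` A)"
 unfolding hollow_sub_def
proof (intro conjI allI impI)
 interpret M: left_module R M by (rule M)
 interpret N: left_module R N by (rule N)
 show "p ` A ~= {0[N]}" by (rule nz)
 fix B C assume "sub N B \<and> sub N C \<and> set_add N B C = p ` A"
 then have B: "sub N B" and C: "sub N C" and BC: "set_add N B C = p ` A" by auto
 let ?P = "%B. A \<inter> {x : car M. p x : B}"
 have P: "sub M (?P B)" if "sub N B" for B
  by (rule M.sub_Int[OF A sub_vimage[OF M N p that]])
 have "set_add M (?P B) (?P C) = A"
 proof (intro equalityI subsetI)
  fix x assume "x : set_add M (?P B) (?P C)"
  then obtain b c where "b : ?P B" "c : ?P C" "x = b +[M] c" by (rule set_addE)
  then show "x : A" using M.sub_add[OF A, of b c] by simp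
 next
  fix x assume x: "x : A"
  have xc: "x : car M" by (rule M.sub_carrier[OF A x])
  have "p x : set_add N B C" unfolding BC using x by (rule imageI)
  then obtain b c where bc: "b : B" "c : C" "p x = b +[N] c" by (rule set_addE)
  have "b : p ` A" using N.set_add_upper1[OF B C] bc(1) BC by blast
  then obtain y where y: "y : A" "b = p y" by blast
  have yc: "y : car M" by (rule M.sub_carrier[OF A y(1)])
  have cc: "b : car N" "c : car N" using N.sub_carrier[OF B bc(1)] N.sub_carrier[OF C bc(2)] .
  have "p (x -[M] y) = (b +[N] c) -[N] b" using hom_diff[OF M N p xc yc] bc(3) y(2) by simp
  also have "\<dots> = c" using cc by (simp add: a_minus_def N.M.a_comm[of b c] N.M.a_assoc N.M.r_neg)
  finally have "x -[M] y : ?P C" using M.sub_diff[OF A x y(1)] bc(2) xc yc by simp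
  moreover have "y : ?P B" using y yc bc(1) by simp
  ultimately have "y +[M] (x -[M] y) : set_add M (?P B) (?P C)" by (intro set_addI)
  then show "x : set_add M (?P B) (?P C)" using M.add_diff_cancel[OF yc xc] by simp
 qed
 then have "?P B = A \<or> ?P C = A" by (rule hollow_subD[OF h P[OF B] P[OF C]])
 moreover have "B = p ` A" if "?P B = A"
 proof -
  have "p ` A <= B" using that by blast
  moreover have "B <= p ` A" using N.set_add_upper1[OF B C] BC by simp
  ultimately show ?thesis by blast
 qed
 moreover have "C = p ` A" if "?P C = A"
 proof -
  have "p ` A <= C" using that by blast
  moreover have "C <= p ` A" using N.set_add_upper2[OF B C] BC by simp
  ultimately show ?thesis by blast
 qed
 ultimately show "B = p ` A \<or> C = p ` A" by blast
qed

lemma hollow_surj: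
 assumes "fd M" "fd N" "p : mhom R M N" "hollow M" "p ` car M = car N" "car N ~= {0[N]}"
 shows "hollow N"
 using hollow_image[OF fd_lm[OF assms(1)] fd_lm[OF assms(2)] assms(3) left_module.sub_carrier_self[OF fd_lm[OF assms(1)]] assms(4)]
  assms(5,6) by simp

text \<open>The image of \<open>f\<close> lies in the sum of the images of \<open>f - g\<close> and
  \<open>g\<close>, and the latter is proper in a hollow module.\<close>

lemma hollow_diff_surj:
 assumes M: "lm M" and N: "lm N" and h: "hollow N" and f: "f : mhom R M N" and g: "g : mhom R M N"
  and fs: "f ` car M = car N" and gs: "g ` car M ~= car N"
 shows "(%x. f x -[N] g x) ` car M = car N"
proof -
 interpret M: left_module R M by (rule M)
 interpret N: left_module R N by (rule N)
 let ?d = "%x. f x -[N] g x"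
 have d: "?d : mhom R M N" by (rule hom_minus[OF M N f g])
 have s: "sub N (?d ` car M)" "sub N (g ` car M)"
  by (rule sub_image[OF M N d M.sub_carrier_self], rule sub_image[OF M N g M.sub_carrier_self])
 have "set_add N (?d ` car M) (g ` car M) = car N"
 proof (intro equalityI subsetI)
  fix y assume "y : car N"
  then have "y : f ` car M" using fs by simp
  then obtain x where x: "y = f x" "x : car M" by (rule imageE)
  have "?d x +[N] g x : set_add N (?d ` car M) (g ` car M)"
   using x(2) by (intro set_addI imageI)
  then show "y : set_add N (?d ` car M) (g ` car M)"
   using N.diff_add_cancel[OF hom_closed[OF f x(2)] hom_closed[OF g x(2)]] x(1) by simp
 next
  fix y assume "y : set_add N (?d ` car M) (g ` car M)"
  then show "y : car N" using N.sub_carrier[OF N.sub_set_add[OF s]] by simp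
 qed
 then show ?thesis using hollow_subD[OF h s] gs by blast
qed

text \<open>If the composite were onto, the image of \<open>\<rho>\<close> and the kernel of
  \<open>g\<close> would together span \<open>M\<close>. The first is proper, so the kernel would be
  all of \<open>M\<close>.\<close>

lemma hollow_comp_not_surj:
 assumes M: "lm M" and Y: "lm Y" and X: "lm X" and h: "hollow M" and r: "\<rho> : mhom R X M" and g: "g : mhom R M Y"
  and rs: "\<rho> ` car X ~= car M" and nz: "car Y ~= {0[Y]}"
 shows "(%x. g (\<rho> x)) ` car X ~= car Y"
proof
 interpret M: left_module R M by (rule M)
 interpret Y: left_module R Y by (rule Y)
 interpret X: left_module R X by (rule X)
 assume e: "(%x. g (\<rho> x)) ` car X = car Y"
 let ?k = "{x : car M. g x = 0[Y]}"
 have s: "sub M (\<rho> ` car X)" "sub M ?k"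
  by (rule sub_image[OF X M r X.sub_carrier_self], rule sub_kernel[OF M Y g])
 have "set_add M (\<rho> ` car X) ?k = car M"
 proof (intro equalityI subsetI)
  fix x assume x: "x : car M"
  then have "g x : (%x. g (\<rho> x)) ` car X" unfolding e by (rule hom_closed[OF g])
  then obtain z where z: "g x = g (\<rho> z)" "z : car X" by (rule imageE)
  have rz: "\<rho> z : car M" by (rule hom_closed[OF r z(2)])
  have "g (x -[M] \<rho> z) = 0[Y]"
   using hom_diff[OF M Y g x rz] z(1) Y.diff_self[OF hom_closed[OF g rz]] by simp
  then have "x -[M] \<rho> z : ?k" using x rz by simp
  then have "\<rho> z +[M] (x -[M] \<rho> z) : set_add M (\<rho> ` car X) ?k" using z(2) by (intro set_addI imageI)
  then show "x : set_add M (\<rho> ` car X) ?k" using M.add_diff_cancel[OF rz x] by simp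
 next
  fix y assume "y : set_add M (\<rho> ` car X) ?k"
  then show "y : car M" using M.sub_carrier[OF M.sub_set_add[OF s]] by simp
 qed
 then have "?k = car M" using hollow_subD[OF h s] rs by blast
 then have "y = 0[Y]" if "y : car Y" for y
 proof -
  have "y : (%x. g (\<rho> x)) ` car X" using that e by simp
  then obtain z where "y = g (\<rho> z)" "z : car X" by (rule imageE)
  then show ?thesis using hom_closed[OF r, of z] \<open>?k = car M\<close> by blast
 qed
 then show False using nz Y.M.zero_closed by blast
qed

text \<open>Modulo \<open>A\<close>, the module \<open>N\<close> is an image of the hollow
  \<open>B\<close> and is the sum of the images of \<open>N1\<close> and \<open>N2\<close>, so one
  of these is everything. The argument is carried out inside \<open>B\<close>, with the parts of
  \<open>B\<close> lying in \<open>A + N1\<close> and in \<open>A + N2\<close>.\<close>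

lemma hollow_pair_cover:
 assumes N: "lm N" and A: "sub N A" and B: "sub N B" and hB: "hollow_sub N B" and AB: "set_add N A B = car N"
  and N1: "sub N N1" and N2: "sub N N2" and sum: "set_add N N1 N2 = car N"
 shows "set_add N A N1 = car N \<or> set_add N A N2 = car N"
proof -
 interpret N: left_module R N by (rule N)
 let ?C1 = "set_add N A N1" and ?C2 = "set_add N A N2"
 have C1: "sub N ?C1" and C2: "sub N ?C2" using N.sub_set_add A N1 N2 by auto
 have D: "sub N (B \<inter> ?C1)" "sub N (B \<inter> ?C2)" using N.sub_Int B C1 C2 by auto
 have "set_add N (B \<inter> ?C1) (B \<inter> ?C2) = B"
 proof (intro equalityI subsetI)
  fix x assume "x : set_add N (B \<inter> ?C1) (B \<inter> ?C2)"
  then obtain b c where "b : B \<inter> ?C1" "c : B \<inter> ?C2" "x = b +[N] c" by (rule set_addE)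
  then show "x : B" using N.sub_add[OF B, of b c] by simp
 next
  fix b assume b: "b : B"
  have bc: "b : car N" by (rule N.sub_carrier[OF B b])
  then have "b : set_add N N1 N2" using sum by simp
  then obtain n1 n2 where n: "n1 : N1" "n2 : N2" "b = n1 +[N] n2" by (rule set_addE)
  have nc: "n1 : car N" "n2 : car N" using N.sub_carrier[OF N1 n(1)] N.sub_carrier[OF N2 n(2)] .
  have "n1 : set_add N A B" using AB nc by simp
  then obtain a b' where ab: "a : A" "b' : B" "n1 = a +[N] b'" by (rule set_addE)
  have c: "a : car N" "b' : car N" using N.sub_carrier[OF A ab(1)] N.sub_carrier[OF B ab(2)] .
  have aC1: "a : ?C1" and aC2: "a : ?C2" and n1C: "n1 : ?C1" and n2C: "n2 : ?C2"
   using N.set_add_upper1[OF A N1] N.set_add_upper1[OF A N2] N.set_add_upper2[OF A N1] N.set_add_upper2[OF A N2] ab(1) n(1,2)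
   by auto
  have "b' = n1 -[N] a" using c ab(3) by (simp add: a_minus_def N.M.a_comm[of a b'] N.M.a_assoc N.M.r_neg)
  then have b'1: "b' : B \<inter> ?C1" using N.sub_diff[OF C1 n1C aC1] ab(2) by simp
  have "b -[N] b' = a +[N] n2"
  proof -
   have "b = (a +[N] n2) +[N] b'" using n(3) ab(3) c nc by (simp add: N.M.a_ac)
   then show ?thesis using c nc by (simp add: a_minus_def N.M.a_assoc N.M.r_neg)
  qed
  then have "b -[N] b' : B \<inter> ?C2" using N.sub_add[OF C2 aC2 n2C] N.sub_diff[OF B b ab(2)] by simp
  then have "b' +[N] (b -[N] b') : set_add N (B \<inter> ?C1) (B \<inter> ?C2)" by (intro set_addI b'1)
  then show "b : set_add N (B \<inter> ?C1) (B \<inter> ?C2)" using N.add_diff_cancel[OF c(2) bc] by simp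
 qed
 then have "B \<inter> ?C1 = B \<or> B \<inter> ?C2 = B" by (rule hollow_subD[OF hB D])
 moreover have "C = car N" if "B \<inter> C = B" "sub N C" "A <= C" for C
 proof -
  have "set_add N A B <= C" using that by (intro N.set_add_least) auto
  then show ?thesis using AB N.sub_subset[OF that(2)] by blast
 qed
 ultimately show ?thesis
  using C1 C2 N.set_add_upper1[OF A N1] N.set_add_upper1[OF A N2] by blast
qed

text \<open>By \<open>A2\<close> the summand \<open>N1\<close> is an image of \<open>A\<close>,
  hence hollow. For \<open>n = a + b\<close> in \<open>N1\<close> the part \<open>a\<close> lies in
  \<open>B + N1\<close> and \<open>b\<close> in \<open>A + N1\<close>, so the projections of
  \<open>A \<inter> (B + N1)\<close> and \<open>B \<inter> (A + N1)\<close> span \<open>N1\<close>.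
  If both conclusions failed, each of these projections would be proper.\<close>

lemma hollow_pair_not_both:
 assumes N: "lm N" and A: "sub N A" and B: "sub N B" and hA: "hollow_sub N A" and hB: "hollow_sub N B"
  and AB: "set_add N A B = car N"
  and N1: "sub N N1" and N2: "sub N N2" and int: "N1 \<inter> N2 = {0[N]}" and sum: "set_add N N1 N2 = car N"
  and nz: "N1 ~= {0[N]}" "N2 ~= {0[N]}"
  and A2: "set_add N A N2 = car N" and B2: "set_add N B N2 = car N"
 shows "set_add N A N1 = car N \<or> set_add N B N1 = car N"
proof (rule ccontr)
 assume neg: "\<not> (set_add N A N1 = car N \<or> set_add N B N1 = car N)"
 interpret N: left_module R N by (rule N)
 obtain p q where pq: "p : mhom R N N" "q : mhom R N N"
  "!!x. x : car N ==> p x : N1" "!!x. x : car N ==> q x : N2"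
  "!!x. x : car N ==> p x +[N] q x = x"
  "!!a. a : N1 ==> p a = a" "!!b. b : N2 ==> q b = b"
  "!!b. b : N2 ==> p b = 0[N]" "!!a. a : N1 ==> q a = 0[N]"
  by (rule decomposition[OF N N1 N2 int sum], rule that)
 let ?C = "set_add N A N1" and ?D = "set_add N B N1"
 have C: "sub N ?C" and D: "sub N ?D" using N.sub_set_add A B N1 by auto
 \<comment> \<open>If the projection were onto, \<open>A\<close> would be the sum of
   \<open>A \<inter> D\<close> and \<open>A \<inter> N2\<close>, and hollowness would put
   \<open>A\<close> inside \<open>D\<close> or inside \<open>N2\<close>. The first contradicts that
   \<open>D\<close> is proper, the second that \<open>N1\<close> is nonzero.\<close>
 have key: "\<not> N1 <= p ` (A \<inter> D)" if A: "sub N A" and hA: "hollow_sub N A" and B: "sub N B" and AB: "set_add N A B = car N"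
  and A2: "set_add N A N2 = car N" and D: "sub N D" "D ~= car N" "B <= D" for A B D
 proof
  assume s: "N1 <= p ` (A \<inter> D)"
  have subs: "sub N (A \<inter> D)" "sub N (A \<inter> N2)" using N.sub_Int A D N2 by auto
  have "set_add N (A \<inter> D) (A \<inter> N2) = A"
  proof (intro equalityI subsetI)
   fix x assume "x : set_add N (A \<inter> D) (A \<inter> N2)"
   then obtain b c where "b : A \<inter> D" "c : A \<inter> N2" "x = b +[N] c" by (rule set_addE)
   then show "x : A" using N.sub_add[OF A, of b c] by simp
  next
   fix a assume a: "a : A"
   have ac: "a : car N" by (rule N.sub_carrier[OF A a])
   have "p a : p ` (A \<inter> D)" using s pq(3)[OF ac] by blast
   then obtain d where d: "p a = p d" "d : A \<inter> D" by (rule imageE)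
   have dc: "d : car N" using N.sub_carrier[OF A] d(2) by blast
   have ad: "a -[N] d : car N" using ac dc by simp
   have "p (a -[N] d) = 0[N]"
    using hom_diff[OF N N pq(1) ac dc] d(1) N.diff_self[OF hom_closed[OF pq(1) dc]] by simp
   then have "q (a -[N] d) = a -[N] d" using pq(5)[OF ad] hom_closed[OF pq(2) ad] by simp
   then have "a -[N] d : N2" using pq(4)[OF ad] by simp
   moreover have "a -[N] d : A" using N.sub_diff[OF A a, of d] d(2) by blast
   ultimately have "d +[N] (a -[N] d) : set_add N (A \<inter> D) (A \<inter> N2)" using d(2) by (intro set_addI) auto
   then show "a : set_add N (A \<inter> D) (A \<inter> N2)" using N.add_diff_cancel[OF dc ac] by simp
  qed
  then have "A \<inter> D = A \<or> A \<inter> N2 = A" by (rule hollow_subD[OF hA subs])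
  then show False
  proof
   assume "A \<inter> D = A"
   then have "set_add N A B <= D" using D by (intro N.set_add_least) auto
   then show False using AB D N.sub_subset[OF D(1)] by blast
  next
   assume "A \<inter> N2 = A"
   then have "set_add N A N2 <= N2" using N2 by (intro N.set_add_least) auto
   then have "N1 <= N2" using A2 N.sub_subset[OF N1] by blast
   then show False using int nz(1) by blast
  qed
 qed
 have subs: "sub N (p ` (A \<inter> ?D))" "sub N (p ` (B \<inter> ?C))"
  using sub_image[OF N N pq(1)] N.sub_Int A B C D by auto
 have "set_add N (p ` (A \<inter> ?D)) (p ` (B \<inter> ?C)) = N1"
 proof (intro equalityI subsetI)
  fix x assume "x : set_add N (p ` (A \<inter> ?D)) (p ` (B \<inter> ?C))"
  then obtain b c where bc: "b : p ` (A \<inter> ?D)" "c : p ` (B \<inter> ?C)" "x = b +[N] c" by (rule set_addE)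
  then have "b : N1" "c : N1" using pq(3) N.sub_carrier[OF A] N.sub_carrier[OF B] by blast+
  then show "x : N1" using N.sub_add[OF N1] bc(3) by simp
 next
  fix n assume n: "n : N1"
  have nc: "n : car N" by (rule N.sub_carrier[OF N1 n])
  then have "n : set_add N A B" using AB by simp
  then obtain a b where ab: "a : A" "b : B" "n = a +[N] b" by (rule set_addE)
  have c: "a : car N" "b : car N" using N.sub_carrier[OF A ab(1)] N.sub_carrier[OF B ab(2)] .
  have nD: "n : ?D" "b : ?D" "n : ?C" "a : ?C"
   using N.set_add_upper1[OF A N1] N.set_add_upper1[OF B N1] N.set_add_upper2[OF A N1] N.set_add_upper2[OF B N1] ab n by auto
  have "a : ?D" by (rule N.sub_add_mem[OF D c(1) nD(2)]) (use ab(3) nD(1) in simp)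
  moreover have "b : ?C" by (rule N.sub_add_mem[OF C c(2) nD(4)]) (use ab(3) nD(3) c in \<open>simp add: N.M.a_comm\<close>)
  ultimately have "p a +[N] p b : set_add N (p ` (A \<inter> ?D)) (p ` (B \<inter> ?C))"
   using ab by (intro set_addI imageI) auto
  then show "n : set_add N (p ` (A \<inter> ?D)) (p ` (B \<inter> ?C))"
   using hom_add[OF pq(1) c] ab(3) pq(6)[OF n] by simp
 qed
 moreover have "hollow_sub N N1"
 proof -
  have "p ` A = N1"
  proof (intro equalityI subsetI)
   fix x assume "x : p ` A" then show "x : N1" using pq(3) N.sub_carrier[OF A] by blast
  next
   fix x assume x: "x : N1"
   then have "x : set_add N A N2" using A2 N.sub_carrier[OF N1] by simp
   then obtain a b where ab: "a : A" "b : N2" "x = a +[N] b" by (rule set_addE)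
   then have "p x = p a" using hom_add[OF pq(1), of a b] N.sub_carrier[OF A] N.sub_carrier[OF N2] pq(8) hom_closed[OF pq(1), of a] by simp
   then show "x : p ` A" using pq(6)[OF x] ab(1) by (metis imageI)
  qed
  then show ?thesis using hollow_image[OF N N pq(1) A hA] nz(1) by simp
 qed
 ultimately have "p ` (A \<inter> ?D) = N1 \<or> p ` (B \<inter> ?C) = N1" using hollow_subD subs by blast
 moreover have "\<not> N1 <= p ` (A \<inter> ?D)"
  by (rule key[OF A hA B AB A2 D _ N.set_add_upper1[OF B N1]]) (use neg in blast)
 moreover have "\<not> N1 <= p ` (B \<inter> ?C)"
  by (rule key[OF B hB A _ B2 C _ N.set_add_upper1[OF A N1]])
   (use neg AB N.set_add_comm[OF N.sub_subset[OF A] N.sub_subset[OF B]] in auto)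
 ultimately show False by blast
qed

text \<open>A sum of two hollow submodules has at most two indecomposable summands, and these are images of
 the two submodules.\<close>

lemma hollow_pair_summands:
 assumes N: "lm N" and A: "sub N A" and B: "sub N B" and hA: "hollow_sub N A" and hB: "hollow_sub N B"
  and AB: "set_add N A B = car N"
  and N1: "sub N N1" and N2: "sub N N2" and int: "N1 \<inter> N2 = {0[N]}" and sum: "set_add N N1 N2 = car N"
  and nz: "N1 ~= {0[N]}" "N2 ~= {0[N]}"
 shows "set_add N A N2 = car N \<and> set_add N B N1 = car N \<or>
    set_add N A N1 = car N \<and> set_add N B N2 = car N"
proof -
 interpret N: left_module R N by (rule N)
 have BA: "set_add N B A = car N" and sum': "set_add N N2 N1 = car N" and int': "N2 \<inter> N1 = {0[N]}"
  using AB sum int N.set_add_comm N.sub_subset A B N1 N2 by auto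
 note a = hollow_pair_cover[OF N A B hB AB N1 N2 sum] hollow_pair_cover[OF N B A hA BA N1 N2 sum]
 note b = hollow_pair_not_both[OF N A B hA hB AB N1 N2 int sum nz]
  hollow_pair_not_both[OF N A B hA hB AB N2 N1 int' sum' nz(2,1)]
 show ?thesis using a b by blast
qed

end

section \<open>Split basic algebras\<close>

text \<open>Bound path algebras, with \<open>e i\<close> the trivial paths and \<open>J\<close> the ideal generated by the arrows.\<close>

locale split_algebra = fd_algebra K R
 for K :: "('k, 'c) ring_scheme" and R :: "('k, 'a, 'z) module_scheme" +
 fixes I :: "'i set" and e :: "'i => 'a" and J :: "'a set"
 assumes finite_I: "finite I"
  and e_closed: "i : I ==> e i : car R"
  and e_idem: "i : I ==> e i *[R] e i = e i"
  and e_orth: "i : I ==> j : I ==> i ~= j ==> e i *[R] e j = 0[R]"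
  and e_sum: "finsum R e I = 1[R]"
  and J_ideal: "ideal J R"
  and e_notin: "i : I ==> e i ~: J"
  and J_nilp: "\<exists>n. \<forall>rs. set rs <= J \<and> length rs = n --> foldr (mult R) rs 1[R] = 0[R]"
  and split: "r : car R ==> i : I ==> \<exists>c\<in>car K. \<exists>j\<in>J. r *[R] e i = (c .[R] 1[R]) *[R] e i +[R] j"
begin

definition scl :: "('a, 'm) module => 'k => 'm => 'm" where
 "scl M c x = (c .[R] 1[R]) .[M] x"

text \<open>\<open>J\<close> is nilpotent and \<open>R/J\<close> is a product of copies of
  \<open>K\<close>, so this annihilator of \<open>J\<close> is the largest semisimple
  submodule.\<close>

definition soc :: "('a, 'm) module => 'm set" where
 "soc M = {x : car M. \<forall>j\<in>J. j .[M] x = 0[M]}"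

text \<open>The isotypic component of the socle for the simple module at \<open>i\<close>. As
  \<open>R\<close> acts on it by scalars, its subspaces are submodules.\<close>

definition socv :: "'i => ('a, 'm) module => 'm set" where
 "socv i M = {x : soc M. e i .[M] x = x}"

text \<open>For a nonzero \<open>x\<close> in some \<open>socv i M\<close> this is a simple
  submodule of dimension one; all simple submodules that enter the proof are given in this
  form.\<close>

definition line :: "('a, 'm) module => 'm => 'm set" where
 "line M x = (%c. scl M c x) ` car K"

lemma J_carrier: "j : J ==> j : car R"
 using J_ideal by (simp add: ideal.Icarr)

lemma socvD: "x : socv i M ==> x : car M" "x : socv i M ==> x : soc M"
  "x : socv i M ==> e i .[M] x = x" "x : socv i M ==> j : J ==> j .[M] x = 0[M]"
 by (simp_all add: socv_def soc_def)

context
 fixes M :: "('a, 'm) module" assumes M: "lm M"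
begin

interpretation M: left_module R M by (rule M)

lemma scl_closed: "c : car K ==> x : car M ==> scl M c x : car M"
 by (simp add: scl_def M.smult_closed sc_closed)

lemma scl_one: "x : car M ==> scl M 1[K] x = x"
 by (simp add: scl_def sc_one M.smult_one)

lemma scl_scl: "c : car K ==> d : car K ==> x : car M ==> scl M c (scl M d x) = scl M (c *[K] d) x"
 by (simp add: scl_def sc_mult sc_closed M.smult_assoc)

lemma scl_smult: "c : car K ==> r : car R ==> x : car M ==> r .[M] scl M c x = scl M c (r .[M] x)"
 by (simp add: scl_def sc_closed sc_central flip: M.smult_assoc)

lemma scl_zero: "c : car K ==> scl M c 0[M] = 0[M]"
 by (simp add: scl_def sc_closed)

lemma zero_scl: "x : car M ==> scl M 0[K] x = 0[M]"
proof -
 interpret K: field K by (rule field_K)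
 assume x: "x : car M"
 have "scl M 0[K] x +[M] scl M 0[K] x = scl M 0[K] x"
  using x sc_add[of "0[K]" "0[K]"] by (simp add: scl_def M.smult_l_distr[symmetric] sc_closed)
 then show ?thesis using scl_closed[OF K.zero_closed x] M.M.add.r_cancel_one' by simp
qed

lemma scl_sub: "sub M A ==> c : car K ==> x : A ==> scl M c x : A"
 by (simp add: scl_def sc_closed M.sub_smult)

lemma scl_cancel:
 assumes A: "sub M A" and c: "c : car K" "c ~= 0[K]" and x: "x : car M" "scl M c x : A"
 shows "x : A"
proof -
 interpret K: field K by (rule field_K)
 have i: "inv\<^bsub>K\<^esub> c : car K" "inv\<^bsub>K\<^esub> c *[K] c = 1[K]" using c K.field_Units by auto
 have "scl M (inv\<^bsub>K\<^esub> c) (scl M c x) : A" by (rule scl_sub[OF A i(1) x(2)])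
 then show ?thesis using i c x by (simp add: scl_scl scl_one)
qed

lemma sub_soc: "sub M (soc M)"
proof (rule M.subI)
 fix r x assume r: "r : car R" and x: "x : soc M"
 have "j .[M] (r .[M] x) = 0[M]" if j: "j : J" for j
 proof -
  have "j *[R] r : J" by (rule ideal.I_r_closed[OF J_ideal j r])
  then show ?thesis using x r M.smult_assoc[OF J_carrier[OF j] r, of x] by (simp add: soc_def)
 qed
 then show "r .[M] x : soc M" using r x by (simp add: soc_def M.smult_closed)
qed (auto simp: soc_def J_carrier M.smult_r_distr)

text \<open>The element \<open>x\<close> is fixed by \<open>e i\<close>, so \<open>r\<close> may be
  replaced by \<open>r e_i\<close>, which is a multiple of \<open>e i\<close> up to an element of
  \<open>J\<close>, and \<open>J\<close> kills \<open>x\<close>.\<close>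

lemma socv_scalar:
 assumes x: "x : socv i M" and i: "i : I" and r: "r : car R"
 shows "\<exists>c\<in>car K. r .[M] x = scl M c x"
proof -
 obtain c j where c: "c : car K" "j : J" "r *[R] e i = (c .[R] 1[R]) *[R] e i +[R] j"
  using split[OF r i] by blast
 note xc = socvD(1)[OF x]
 have "r .[M] x = r .[M] (e i .[M] x)" using socvD(3)[OF x] by simp
 also have "\<dots> = ((c .[R] 1[R]) *[R] e i +[R] j) .[M] x"
  using r xc e_closed[OF i] by (simp add: M.smult_assoc[symmetric] c(3))
 also have "\<dots> = scl M c x"
  using c xc e_closed[OF i] socvD(3,4)[OF x] J_carrier[OF c(2)] sc_closed[OF c(1)]
  by (simp add: M.smult_l_distr M.smult_assoc scl_def M.smult_closed)
 finally show ?thesis using c(1) by blast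
qed

lemma sub_socv: assumes i: "i : I" shows "sub M (socv i M)"
proof (rule M.subI)
 fix x y assume "x : socv i M" "y : socv i M"
 then show "x +[M] y : socv i M"
  using M.sub_add[OF sub_soc, of x y] by (simp add: socv_def M.smult_r_distr e_closed[OF i] M.sub_carrier[OF sub_soc])
next
 fix r x assume r: "r : car R" and x: "x : socv i M"
 obtain c where c: "c : car K" "r .[M] x = scl M c x" using socv_scalar[OF x i r] by blast
 have "e i .[M] scl M c x = scl M c x" using c socvD[OF x] e_closed[OF i] by (simp add: scl_smult)
 then show "r .[M] x : socv i M" using c(2) M.sub_smult[OF sub_soc r socvD(2)[OF x]] by (simp add: socv_def)
qed (use M.sub_zero[OF sub_soc] e_closed[OF i] M.sub_carrier[OF sub_soc] in \<open>auto simp: socv_def\<close>)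

lemma e_in_socv:
 assumes i: "i : I" and x: "x : soc M" shows "e i .[M] x : socv i M"
 using M.sub_smult[OF sub_soc e_closed[OF i] x] M.sub_carrier[OF sub_soc x] e_closed[OF i] e_idem[OF i]
 by (simp add: socv_def M.smult_assoc[symmetric])

lemma e_other:
 assumes x: "x : socv i M" and "i : I" "k : I" "k ~= i" shows "e k .[M] x = 0[M]"
proof -
 have "e k .[M] x = e k .[M] (e i .[M] x)" using socvD(3)[OF x] by simp
 then show ?thesis using assms socvD(1)[OF x] by (simp add: M.smult_assoc[symmetric] e_closed e_orth)
qed

lemma socv_inter: "i : I ==> k : I ==> k ~= i ==> x : socv i M ==> x : socv k M ==> x = 0[M]"
 using e_other[of x i k] socvD(3)[of x k M] by simp

text \<open>The idempotents sum to \<open>1\<close>, so \<open>x\<close> is the sum of its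
  components \<open>e i .[M] x\<close>.\<close>

lemma ex_component:
 assumes A: "sub M A" and x: "x : car M" "x ~: A"
 shows "\<exists>i\<in>I. e i .[M] x ~: A"
proof (rule ccontr)
 interpret R: ring R by (rule ring_R)
 assume neg: "\<not> ?thesis"
 have "finsum R e F .[M] x : A" if "finite F" "F <= I" for F
  using that
 proof (induction F rule: finite_induct)
  case empty then show ?case using x M.sub_zero[OF A] by simp
 next
  case (insert i F)
  have Pi: "e : F \<rightarrow> car R" "e i : car R" using insert.prems e_closed by auto
  have "e i .[M] x : A" using neg insert.prems by blast
  then show ?case using insert Pi x M.sub_add[OF A]
   by (simp add: M.R.finsum_insert M.smult_l_distr M.R.finsum_closed)
 qed
 from this[OF finite_I] show False using e_sum x M.smult_one by simp
qed

lemma foldr_smult: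
 assumes "x : car M" "set rs <= car R"
 shows "foldr (mult R) rs 1[R] : car R \<and> foldr (smult M) rs x = foldr (mult R) rs 1[R] .[M] x \<and> foldr (smult M) rs x : car M"
 using assms by (induction rs) (auto simp: M.smult_one M.smult_assoc M.smult_closed)

text \<open>Multiplying a nonzero element of \<open>A\<close> by elements of \<open>J\<close> as
  long as the result is nonzero must stop, by nilpotency, at an element of the socle. Some vertex
  component of it is nonzero.\<close>

lemma ex_socv:
 assumes A: "sub M A" and nz: "A ~= {0[M]}"
 obtains i a where "i : I" "a : socv i M" "a : A" "a ~= 0[M]"
proof -
 have *: "\<exists>y\<in>A. y ~= 0[M] \<and> y : soc M"
  if "x : A" "x ~= 0[M]" "!!rs. set rs <= J ==> length rs = n ==> foldr (smult M) rs x = 0[M]" for n x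
  using that
 proof (induction n arbitrary: x)
  case 0 then show ?case by (metis empty_subsetI foldr.simps(1) id_apply length_0_conv list.set(1))
 next
  case (Suc n)
  show ?case
  proof (cases "\<forall>j\<in>J. j .[M] x = 0[M]")
   case True then show ?thesis using Suc.prems(1,2) M.sub_carrier[OF A] by (auto simp: soc_def)
  next
   case False
   then obtain j where j: "j : J" "j .[M] x ~= 0[M]" by blast
   show ?thesis
   proof (rule Suc.IH[OF M.sub_smult[OF A J_carrier[OF j(1)] Suc.prems(1)] j(2)])
    fix rs assume "set rs <= J" "length rs = n"
    then show "foldr (smult M) rs (j .[M] x) = 0[M]" using Suc.prems(3)[of "rs @ [j]"] j(1) by simp
   qed
  qed
 qed
 obtain n where n: "!!rs. set rs <= J ==> length rs = n ==> foldr (mult R) rs 1[R] = 0[R]" using J_nilp by blast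
 obtain x where x: "x : A" "x ~= 0[M]" using nz M.sub_zero[OF A] by blast
 have "foldr (smult M) rs x = 0[M]" if "set rs <= J" "length rs = n" for rs
 proof -
  have xc: "x : car M" by (rule M.sub_carrier[OF A x(1)])
  have "set rs <= car R" using that J_carrier by blast
  then show ?thesis using foldr_smult[OF xc] n[OF that] xc by simp
 qed
 then obtain y where y: "y : A" "y ~= 0[M]" "y : soc M" using *[OF x] by blast
 obtain i where i: "i : I" "e i .[M] y ~: {0[M]}"
  using ex_component[OF M.sub_zero_self] y M.sub_carrier[OF A] by blast
 show thesis
  using that[OF i(1) e_in_socv[OF i(1) y(3)] M.sub_smult[OF A e_closed[OF i(1)] y(1)]] i(2) by simp
qed

lemma line_sub:
 assumes x: "x : socv i M" and i: "i : I" shows "sub M (line M x)"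
proof (rule M.subI)
 interpret K: field K by (rule field_K)
 note xc = socvD(1)[OF x]
 show "line M x <= car M" using scl_closed xc unfolding line_def by blast
 show "0[M] : line M x" unfolding line_def by (rule image_eqI[of _ _ "0[K]"]) (simp_all add: zero_scl xc)
 fix y z assume "y : line M x" "z : line M x"
 then obtain c d where "c : car K" "y = scl M c x" "d : car K" "z = scl M d x" unfolding line_def by blast
 then show "y +[M] z : line M x" unfolding line_def
  by (intro image_eqI[of _ _ "c +[K] d"]) (simp_all add: scl_def sc_add sc_closed M.smult_l_distr xc)
next
 interpret K: field K by (rule field_K)
 note xc = socvD(1)[OF x]
 fix r y assume r: "r : car R" and "y : line M x"
 then obtain c where c: "c : car K" "y = scl M c x" unfolding line_def by blast
 obtain d where d: "d : car K" "r .[M] x = scl M d x" using socv_scalar[OF x i r] by blast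
 have "r .[M] y = scl M (c *[K] d) x" using c d r xc by (simp add: scl_smult scl_scl)
 then show "r .[M] y : line M x" unfolding line_def using c d by (intro image_eqI[of _ _ "c *[K] d"]) simp_all
qed

lemma line_self: "x : car M ==> x : line M x"
 unfolding line_def using scl_one field_K
 by (intro image_eqI[of _ _ "1[K]"]) (simp_all add: ring_K ring.ring_simprules)

lemma line_least: "sub M A ==> x : A ==> line M x <= A"
 unfolding line_def using scl_sub by blast

lemma line_sym:
 assumes x: "x : car M" and y: "y : line M x" "y ~= 0[M]" and A: "sub M A" "y : A"
 shows "x : A"
proof -
 obtain c where c: "c : car K" "y = scl M c x" using y(1) unfolding line_def by blast
 then have "c ~= 0[K]" using y(2) zero_scl[OF x] by blast
 then show ?thesis using scl_cancel[OF A(1) c(1) _ x] A(2) c(2) by simp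
qed

lemma line_socv: "x : socv i M ==> i : I ==> y : line M x ==> y : socv i M"
 using line_least[OF sub_socv] by blast

lemma line_inter:
 assumes x: "x : socv i M" "i : I" and A: "sub M A" and nx: "x ~: A"
 shows "line M x \<inter> A = {0[M]}"
 using line_sym[OF socvD(1)[OF x(1)] _ _ A] M.sub_zero[OF line_sub[OF x]] M.sub_zero[OF A] nx by blast

lemma dm_line:
 assumes M': "fd M" and x: "x : socv i M" "i : I" "x ~= 0[M]" shows "dm (M on (line M x)) = 1"
proof -
 have f: "fdim K (restr R (M on (line M x)))" using fd_sub[OF M' line_sub[OF x(1,2)]] by (simp add: fd_def)
 interpret V: vectorspace K "restr R (M on (line M x))" by (rule fdim_vectorspace[OF f])
 have xl: "x : line M x" by (rule line_self[OF socvD(1)[OF x(1)]])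
 note s = sub_span[OF V.vectorspace_axioms, of "{x}"]
 have s1: "is_sub K (restr R (M on (line M x))) (V.span {x})" using s(1) xl by simp
 interpret VL: left_module K "restr R (M on (line M x))" by (rule fdim_left_module[OF f])
 have "x : V.span {x}" using s(2) xl by simp
 then have "scl M c x : V.span {x}" if "c : car K" for c
  using VL.sub_smult[OF s1 that] by (simp add: scl_def)
 then have "line M x <= V.span {x}" unfolding line_def by blast
 then have "V.span {x} = car (restr R (M on (line M x)))"
  using VL.sub_subset[OF s1] by simp
 then show ?thesis unfolding dm_def by (rule V.dim1I) (simp_all add: x(3) xl)
qed

lemma not_uniformI:
 assumes a: "a : socv i M" "i : I" "a ~= 0[M]" and b: "b : socv k M" "k : I" "b ~: line M a"
 shows "\<not> uniform M"
proof
 assume u: "uniform M"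
 have s: "sub M (line M b)" "sub M (line M a)" using line_sub a b by auto
 have "line M b = {0[M]} \<or> line M a = {0[M]}"
  using u line_inter[OF b(1,2) s(2) b(3)] s unfolding uniform_def by blast
 moreover have "b ~= 0[M]" using b(3) M.sub_zero[OF s(2)] by blast
 ultimately show False using line_self[OF socvD(1)[OF a(1)]] line_self[OF socvD(1)[OF b(1)]] a(3) by blast
qed

lemma not_uniformE:
 assumes "\<not> uniform M" "car M ~= {0[M]}"
 obtains i a k b where "i : I" "a : socv i M" "a ~= 0[M]" "k : I" "b : socv k M" "b ~: line M a"
proof -
 obtain A B where AB: "sub M A" "sub M B" "A \<inter> B = {0[M]}" "A ~= {0[M]}" "B ~= {0[M]}"
  using assms unfolding uniform_def by blast
 obtain i a where a: "i : I" "a : socv i M" "a : A" "a ~= 0[M]" by (rule ex_socv[OF AB(1,4)])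
 obtain k b where b: "k : I" "b : socv k M" "b : B" "b ~= 0[M]" by (rule ex_socv[OF AB(2,5)])
 have "b ~: line M a" using line_least[OF AB(1) a(3)] AB(3) b by blast
 then show thesis using that[OF a(1,2,4) b(1,2)] by blast
qed

text \<open>A proper submodule \<open>N\<close> of greatest dimension contains every proper
  submodule, because its sum with another one is still proper. An element \<open>m\<close> outside
  \<open>N\<close>, chosen at one vertex, generates \<open>M\<close>; since \<open>J\<close> maps
  \<open>m\<close> into \<open>N\<close>, the top \<open>M/N\<close> is one-dimensional.\<close>

lemma hollow_top:
 assumes M': "fd M" and h: "hollow M"
 obtains N i m where "sub M N" "N ~= car M" "i : I" "m : car M" "e i .[M] m = m"
  "(%r. r .[M] m) ` car R = car M"
  "!!y. y : car M ==> \<exists>c\<in>car K. \<exists>n\<in>N. y = scl M c m +[M] n"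
  "!!A. sub M A ==> A ~= car M ==> A <= N"
proof -
 let ?P = "%N. sub M N \<and> N ~= car M"
 have "?P {0[M]}" using M.sub_zero_self hollow_sub_nonzero[OF h] by blast
 moreover have "\<forall>N. ?P N --> dm (M on N) < Suc (dm M)" using dm_sub_le[OF M'] by (simp add: less_Suc_eq_le)
 ultimately obtain N where N: "?P N" "!!A. ?P A ==> dm (M on A) \<le> dm (M on N)"
  using ex_has_greatest_nat[of ?P "{0[M]}" "%N. dm (M on N)" "Suc (dm M)"] by blast
 have max: "A <= N" if A: "sub M A" "A ~= car M" for A
 proof -
  have s: "sub M (set_add M A N)" using M.sub_set_add A N(1) by blast
  have "set_add M A N ~= car M" using hollow_subD[OF h A(1), of N] N(1) A(2) by blast
  then have "dm (M on (set_add M A N)) \<le> dm (M on N)" using N(2) s by blast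
  moreover have "N <= set_add M A N" using M.set_add_upper2 A N(1) by blast
  then have sN: "sub (M on (set_add M A N)) N" using M.sub_of_sub[OF s] N(1) by blast
  ultimately have "N = set_add M A N"
   using dm_sub_eq[OF fd_sub[OF M' s] sN] dm_sub_le[OF fd_sub[OF M' s] sN] by simp
  then show "A <= N" using M.set_add_upper1[OF A(1), of N] N(1) by blast
 qed
 obtain x where x: "x : car M" "x ~: N" using N(1) M.sub_subset[of N] by blast
 obtain i where i: "i : I" "e i .[M] x ~: N" using ex_component[OF _ x] N(1) by blast
 let ?m = "e i .[M] x"
 have m: "?m : car M" by (rule M.smult_closed[OF e_closed[OF i(1)] x(1)])
 have em: "e i .[M] ?m = ?m" using x(1) e_closed[OF i(1)] e_idem[OF i(1)] by (simp add: M.smult_assoc[symmetric])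
 have gen: "(%r. r .[M] z) ` car R = car M" if z: "z : car M" "z ~: N" for z
 proof (rule ccontr)
  assume "\<not> ?thesis"
  then have "(%r. r .[M] z) ` car R <= N" using max M.sub_cyclic[OF z(1)] by blast
  moreover have "z : (%r. r .[M] z) ` car R" using M.smult_one[OF z(1)] M.R.one_closed by (metis imageI)
  ultimately show False using z(2) by blast
 qed
 \<comment> \<open>Otherwise \<open>j m\<close> generates, so \<open>m = (r j) m\<close> for some
   \<open>r\<close>. As \<open>r j\<close> lies in \<open>J\<close>, iterating contradicts
   nilpotency.\<close>
 have Jm: "j .[M] ?m : N" if j: "j : J" for j
 proof (rule ccontr)
  assume "j .[M] ?m ~: N"
  then have "?m : (%r. r .[M] (j .[M] ?m)) ` car R"
   using gen[OF M.smult_closed[OF J_carrier[OF j] m]] m by simp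
  then obtain r where r: "?m = r .[M] (j .[M] ?m)" "r : car R" by (rule imageE)
  let ?j = "r *[R] j"
  have jJ: "?j : J" by (rule ideal.I_l_closed[OF J_ideal j r(2)])
  have jm: "?j .[M] ?m = ?m" using r J_carrier[OF j] m by (simp add: M.smult_assoc)
  obtain n where n: "!!rs. set rs <= J ==> length rs = n ==> foldr (mult R) rs 1[R] = 0[R]" using J_nilp by blast
  have "foldr (smult M) (replicate n ?j) ?m = ?m" for n by (induction n) (simp_all add: jm)
  moreover have s: "set (replicate n ?j) <= car R" "set (replicate n ?j) <= J"
   using J_carrier[OF jJ] jJ by (simp_all add: set_replicate_conv_if)
  have "foldr (smult M) (replicate n ?j) ?m = foldr (mult R) (replicate n ?j) 1[R] .[M] ?m"
   using foldr_smult[OF m s(1)] by blast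
  then have "foldr (smult M) (replicate n ?j) ?m = 0[M]"
   unfolding n[OF s(2) length_replicate] using M.zero_smult[OF m] by (rule trans)
  ultimately have "?m = 0[M]" by metis
  then show False using i(2) M.sub_zero[of N] N(1) by simp
 qed
 have dec: "\<exists>c\<in>car K. \<exists>n\<in>N. y = scl M c ?m +[M] n" if y: "y : car M" for y
 proof -
  have "y : (%r. r .[M] ?m) ` car R" using gen[OF m i(2)] y by simp
  then obtain r where r: "y = r .[M] ?m" "r : car R" by (rule imageE)
  obtain c j where c: "c : car K" "j : J" "r *[R] e i = (c .[R] 1[R]) *[R] e i +[R] j"
   using split[OF r(2) i(1)] by blast
  have "y = (r *[R] e i) .[M] ?m" using r m em by (simp add: M.smult_assoc e_closed[OF i(1)])
  also have "\<dots> = (c .[R] 1[R]) .[M] (e i .[M] ?m) +[M] j .[M] ?m"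
   unfolding c(3) using c m e_closed[OF i(1)] J_carrier[OF c(2)] sc_closed[OF c(1)]
   by (simp only: M.smult_l_distr M.smult_assoc M.R.m_closed)
  finally show ?thesis using c(1) Jm[OF c(2)] em by (auto simp: scl_def)
 qed
 show thesis by (rule that[OF _ _ i(1) m em gen[OF m i(2)] dec max]) (use N(1) in blast)+
qed

text \<open>The endomorphism \<open>\<phi>\<close> acts on the one-dimensional top by a scalar
  \<open>c\<close>. The difference \<open>\<phi> - c\<close> sends the generator, hence all of
  \<open>M\<close>, into the maximal submodule.\<close>

lemma End_residue:
 assumes M': "fd M" and h: "hollow M" and \<phi>: "\<phi> : mhom R M M"
 obtains c where "c : car K" "(%x. \<phi> x -[M] scl M c x) : mhom R M M"
  "(%x. \<phi> x -[M] scl M c x) ` car M ~= car M"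
proof -
 obtain N i m where N: "sub M N" "N ~= car M" and m: "m : car M" "(%r. r .[M] m) ` car R = car M"
  and dec: "!!y. y : car M ==> \<exists>c\<in>car K. \<exists>n\<in>N. y = scl M c m +[M] n"
  by (rule hollow_top[OF M' h], rule that)
 obtain c n where c: "c : car K" "n : N" "\<phi> m = scl M c m +[M] n" using dec[OF hom_closed[OF \<phi> m(1)]] by blast
 have sc: "(%x. scl M c x) : mhom R M M"
  unfolding scl_def by (rule hom_sc[OF M M hom_id c(1)])
 let ?\<psi> = "%x. \<phi> x -[M] scl M c x"
 have \<psi>: "?\<psi> : mhom R M M" by (rule hom_minus[OF M M \<phi> sc])
 have "?\<psi> m = n" using c scl_closed[OF c(1) m(1)] M.sub_carrier[OF N(1) c(2)]
  by (simp add: a_minus_def M.M.a_comm[of "scl M c m" n] M.M.a_assoc M.M.r_neg)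
 have "?\<psi> ` car M <= N"
 proof
  fix y assume "y : ?\<psi> ` car M"
  then obtain x where x: "y = ?\<psi> x" "x : car M" by (rule imageE)
  have "x : (%r. r .[M] m) ` car R" using x(2) m(2) by simp
  then obtain r where r: "x = r .[M] m" "r : car R" by (rule imageE)
  have "y = r .[M] n" unfolding x(1) r(1) hom_smult[OF \<psi> r(2) m(1)] \<open>?\<psi> m = n\<close> ..
  then show "y : N" using M.sub_smult[OF N(1) r(2) c(2)] by simp
 qed
 then have "?\<psi> ` car M ~= car M" using N M.sub_subset[OF N(1)] by blast
 then show thesis by (rule that[OF c(1) \<psi>])
qed

text \<open>By Fitting's lemma \<open>\<rho>\<close> is nilpotent, and the eigenvalue of a nilpotent
  map on an eigenvector is zero.\<close>

lemma End_nonsurj_nilpotent: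
 assumes M': "fd M" and h: "hollow M" and \<rho>: "\<rho> : mhom R M M" and ns: "\<rho> ` car M ~= car M"
  and x: "x : car M" "x ~= 0[M]" and c: "c : car K" "\<rho> x = scl M c x"
 shows "\<rho> x = 0[M]"
proof (rule ccontr)
 assume nz: "\<rho> x ~= 0[M]"
 then have c0: "c ~= 0[K]" using c zero_scl[OF x(1)] by auto
 obtain n where n: "!!x. x : car M ==> (\<rho> ^^ n) x = 0[M]"
  using fitting[OF hollow_indec[OF M' h] \<rho>] ns by (auto simp: bij_betw_def)
 have sc: "\<rho> (scl M c y) = scl M c (\<rho> y)" if "y : car M" for y
  using hom_smult[OF \<rho> sc_closed[OF c(1)] that] by (simp add: scl_def)
 have "(\<rho> ^^ n) x : car M \<and> (\<rho> ^^ n) x ~= 0[M] \<and> \<rho> ((\<rho> ^^ n) x) = scl M c ((\<rho> ^^ n) x)" for n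
 proof (induction n)
  case 0 then show ?case using x c by simp
 next
  case (Suc n)
  let ?y = "(\<rho> ^^ n) x"
  have y: "?y : car M" "?y ~= 0[M]" "\<rho> ?y = scl M c ?y" using Suc by auto
  have "scl M c ?y ~= 0[M]" using scl_cancel[OF M.sub_zero_self c(1) c0 y(1)] y(2) by blast
  then show ?case using y sc[OF y(1)] scl_closed[OF c(1) y(1)] by simp
 qed
 then show False using n[OF x(1)] by blast
qed

end

lemma hom_scl: "f : mhom R M N ==> c : car K ==> x : car M ==> f (scl M c x) = scl N c (f x)"
 by (simp add: scl_def hom_smult sc_closed)

lemma hom_soc: "lm M ==> lm N ==> f : mhom R M N ==> x : soc M ==> f x : soc N"
 using hom_smult[of f R M N _ x] hom_zero[of R M N f] by (simp add: soc_def hom_closed J_carrier flip: hom_smult)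

lemma hom_socv: "lm M ==> lm N ==> i : I ==> f : mhom R M N ==> x : socv i M ==> f x : socv i N"
 using hom_soc[of M N f x] hom_smult[of f R M N "e i" x] socvD(1,3)[of x i M] by (simp add: socv_def e_closed)

text \<open>A nonzero kernel would contain a nonzero socle element at some vertex.\<close>

lemma inj_on_socle:
 assumes M: "lm M" and N: "lm N" and f: "f : mhom R M N"
  and i: "!!i a. i : I ==> a : socv i M ==> f a = 0[N] ==> a = 0[M]"
 shows "inj_on f (car M)"
proof (rule ccontr)
 assume "\<not> ?thesis"
 then have nz: "{x : car M. f x = 0[N]} ~= {0[M]}" using inj_kernel[OF M N f] by simp
 obtain i a where "i : I" "a : socv i M" "a : {x : car M. f x = 0[N]}" "a ~= 0[M]"
  by (rule ex_socv[OF M sub_kernel[OF M N f] nz])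
 then show False using i by blast
qed

end

section \<open>Algebras of local-colocal type\<close>

text \<open>The hypothesis is phrased by submodules alone, so that local-colocal type and the
  Nakayama property both supply it.\<close>

locale lc_algebra = split_algebra K R I e J
 for K :: "('k, 'c) ring_scheme" and R :: "('k, 'a, 'z) module_scheme" and I :: "'i set" and e and J +
 assumes local_colocal: "indec (X :: ('k, 'a) fd_module) ==> hollow X \<or> uniform X"
begin

text \<open>The pushout over the simple module embedded through \<open>a\<close> and through
  \<open>b\<close>: the biproduct modulo the line of \<open>a - b\<close>. This line is a submodule
  because both elements belong to the same vertex \<open>i\<close>.\<close>

lemma glue:
 fixes M M' :: "('k, 'a) fd_module"
 assumes M: "fd M" and M': "fd M'" and i: "i : I" and a: "a : socv i M" and b: "b : socv i M'" "b ~= 0[M']" "a ~= 0[M]"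
 obtains N :: "('k, 'a) fd_module" and i1 i2 where "fd N" "i1 : mhom R M N" "i2 : mhom R M' N"
  "inj_on i1 (car M)" "inj_on i2 (car M')" "set_add N (i1 ` car M) (i2 ` car M') = car N"
  "i1 a = i2 b" "dm N + 1 = dm M + dm M'"
proof -
 note Ml = fd_lm[OF M] and Ml' = fd_lm[OF M']
 interpret M: left_module R M by (rule Ml)
 interpret M': left_module R M' by (rule Ml')
 obtain B :: "('k, 'a) fd_module" and j1 j2 p1 p2 where B: "fd B"
  and j1: "j1 : mhom R M B" and j2: "j2 : mhom R M' B"
  and p1: "p1 : mhom R B M" and p2: "p2 : mhom R B M'"
  and pj: "!!x. x : car M ==> p1 (j1 x) = x" "!!x. x : car M ==> p2 (j1 x) = 0[M']"
  "!!x. x : car M' ==> p2 (j2 x) = x" "!!x. x : car M' ==> p1 (j2 x) = 0[M]"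
  "!!x. x : car B ==> j1 (p1 x) +[B] j2 (p2 x) = x" and dB: "dm B = dm M + dm M'"
  by (rule fd_biproduct[OF M M'], rule that)
 note Bl = fd_lm[OF B]
 interpret B: left_module R B by (rule Bl)
 note ac = socvD(1)[OF a] and bc = socvD(1)[OF b(1)]
 let ?w = "j1 a -[B] j2 b"
 have jc: "j1 a : car B" "j2 b : car B" using hom_closed[OF j1 ac] hom_closed[OF j2 bc] .
 have w: "?w : socv i B"
  by (rule B.sub_diff[OF sub_socv[OF Bl i] hom_socv[OF Ml Bl i j1 a] hom_socv[OF Ml' Bl i j2 b(1)]])
 note wc = socvD(1)[OF w]
 have p1w: "p1 ?w = a" using hom_diff[OF Bl Ml p1 jc] pj(1)[OF ac] pj(4)[OF bc] ac by simp
 have p2w: "p2 ?w = -[M'] b" using hom_diff[OF Bl Ml' p2 jc] pj(2)[OF ac] pj(3)[OF bc] bc by (simp add: a_minus_def)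
 have w0: "?w ~= 0[B]" using p1w hom_zero[OF Bl Ml p1] b(3) by metis
 obtain N :: "('k, 'a) fd_module" and p where N: "fd N" and p: "p : mhom R B N" and ps: "p ` car B = car N"
  and pk: "!!x. x : car B ==> p x = 0[N] \<longleftrightarrow> x : line B ?w" and dN: "dm B = dm (B on (line B ?w)) + dm N"
  by (rule fd_quotient[OF B line_sub[OF Bl w i]], rule that)
 note Nl = fd_lm[OF N]
 interpret N: left_module R N by (rule Nl)
 have i1: "(%x. p (j1 x)) : mhom R M N" and i2: "(%x. p (j2 x)) : mhom R M' N"
  by (rule hom_comp[OF j1 p], rule hom_comp[OF j2 p])
 have inj1: "x = 0[M]" if x: "x : car M" "p (j1 x) = 0[N]" for x
 proof -
  have "j1 x : line B ?w" using pk[OF hom_closed[OF j1 x(1)]] x(2) by simp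
  then obtain c where c: "c : car K" "j1 x = scl B c ?w" unfolding line_def by blast
  have "0[M'] = scl M' c (-[M'] b)" using pj(2)[OF x(1)] hom_scl[OF p2 c(1) wc] p2w c(2) by simp
  moreover have "-[M'] b ~= 0[M']" using b(2) bc by (metis M'.M.minus_minus M'.M.r_neg1 M'.M.r_zero M'.M.zero_closed)
  ultimately have "c = 0[K]" using scl_cancel[OF Ml' M'.sub_zero_self c(1), of "-[M'] b"] bc by auto
  then show ?thesis using pj(1)[OF x(1)] c(2) zero_scl[OF Bl wc] hom_zero[OF Bl Ml p1] by simp
 qed
 have inj2: "x = 0[M']" if x: "x : car M'" "p (j2 x) = 0[N]" for x
 proof -
  have "j2 x : line B ?w" using pk[OF hom_closed[OF j2 x(1)]] x(2) by simp
  then obtain c where c: "c : car K" "j2 x = scl B c ?w" unfolding line_def by blast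
  have "0[M] = scl M c a" using pj(4)[OF x(1)] hom_scl[OF p1 c(1) wc] p1w c(2) by simp
  then have "c = 0[K]" using scl_cancel[OF Ml M.sub_zero_self c(1), of a] ac b(3) by auto
  then show ?thesis using pj(3)[OF x(1)] c(2) zero_scl[OF Bl wc] hom_zero[OF Bl Ml' p2] by simp
 qed
 have cover: "set_add N ((%x. p (j1 x)) ` car M) ((%x. p (j2 x)) ` car M') = car N"
 proof (intro equalityI subsetI)
  fix y assume "y : set_add N ((%x. p (j1 x)) ` car M) ((%x. p (j2 x)) ` car M')"
  then show "y : car N"
   using N.sub_carrier[OF N.sub_set_add[OF sub_image[OF Ml Nl i1 M.sub_carrier_self] sub_image[OF Ml' Nl i2 M'.sub_carrier_self]]] by blast
 next
  fix y assume "y : car N"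
  then have "y : p ` car B" using ps by simp
  then obtain x where x: "y = p x" "x : car B" by (rule imageE)
  have "p x = p (j1 (p1 x)) +[N] p (j2 (p2 x))"
   using hom_add[OF p hom_closed[OF j1 hom_closed[OF p1 x(2)]] hom_closed[OF j2 hom_closed[OF p2 x(2)]]] pj(5)[OF x(2)] by simp
  then show "y : set_add N ((%x. p (j1 x)) ` car M) ((%x. p (j2 x)) ` car M')"
   using set_addI[OF imageI[OF hom_closed[OF p1 x(2)]] imageI[OF hom_closed[OF p2 x(2)]], of N "%x. p (j1 x)" "%x. p (j2 x)"] x(1) by simp
 qed
 have "p ?w = 0[N]" using pk[OF wc] line_self[OF Bl wc] by simp
 then have "p (j1 a) -[N] p (j2 b) = 0[N]" using hom_diff[OF Bl Nl p jc] by simp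
 then have eq: "p (j1 a) = p (j2 b)"
  using N.diff_add_cancel[OF hom_closed[OF p jc(1)] hom_closed[OF p jc(2)]] hom_closed[OF p jc(2)] by simp
 have "dm N + 1 = dm M + dm M'" using dN dB dm_line[OF Bl B w i w0] by simp
 moreover have "inj_on (%x. p (j1 x)) (car M)" "inj_on (%x. p (j2 x)) (car M')"
  using inj_iff_kernel[OF Ml Nl i1] inj_iff_kernel[OF Ml' Nl i2] inj1 inj2 by blast+
 ultimately show thesis using that[OF N i1 i2 _ _ cover eq] by blast
qed

lemma transfer:
 assumes M: "lm M" and X: "lm X" and j1: "j1 : mhom R M X" and b: "bij_betw j1 (car M) (car X)"
  and j2: "j2 : mhom R M' X" and e: "j1 a = j2 b" and a: "a : car M"
 shows "\<exists>\<phi>\<in>mhom R M' M. \<phi> b = a"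
proof (rule bexI)
 show "(%x. inv_into (car M) j1 (j2 x)) : mhom R M' M"
  by (rule hom_comp[OF j2 hom_inv[OF M X j1 b]])
 show "inv_into (car M) j1 (j2 b) = a"
  using inv_into_f_f[OF bij_betw_imp_inj_on[OF b] a] e by simp
qed

text \<open>\<open>M\<close> maps onto \<open>N1\<close> and \<open>M'\<close> onto
  \<open>N2\<close>, while the dimensions of \<open>N1\<close> and \<open>N2\<close> add up to only
  one less than those of \<open>M\<close> and \<open>M'\<close>. So one of the two surjections is
  bijective. Its inverse, applied after the projection of the other module to the same summand,
  carries one glued element to the other.\<close>

lemma summand_case:
 fixes M M' N :: "('k, 'a) fd_module"
 assumes M: "fd M" and M': "fd M'" and N: "fd N" and i1: "i1 : mhom R M N" and i2: "i2 : mhom R M' N"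
  and a: "a : car M" and b: "b : car M'" and ab: "i1 a = i2 b" and d: "dm N + 1 = dm M + dm M'"
  and N1: "sub N N1" and N2: "sub N N2" and int: "N1 \<inter> N2 = {0[N]}" and sum: "set_add N N1 N2 = car N"
  and c1: "set_add N (i1 ` car M) N2 = car N" and c2: "set_add N (i2 ` car M') N1 = car N"
 shows "(\<exists>\<phi>\<in>mhom R M M'. \<phi> a = b) \<or> (\<exists>\<phi>\<in>mhom R M' M. \<phi> b = a)"
proof -
 note Ml = fd_lm[OF M] and Ml' = fd_lm[OF M'] and Nl = fd_lm[OF N]
 interpret N: left_module R N by (rule Nl)
 obtain p q where pq: "p : mhom R N N" "q : mhom R N N"
  "!!x. x : car N ==> p x : N1" "!!x. x : car N ==> q x : N2"
  "!!x. x : car N ==> p x +[N] q x = x"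
  "!!a. a : N1 ==> p a = a" "!!b. b : N2 ==> q b = b"
  "!!b. b : N2 ==> p b = 0[N]" "!!a. a : N1 ==> q a = 0[N]"
  by (rule decomposition[OF Nl N1 N2 int sum], rule that)
 have surj: "(%x. r (i x)) : mhom R X (N on A) \<and> (%x. r (i x)) ` car X = car (N on A)"
  if X: "lm X" and i: "i : mhom R X N" and A: "sub N A" and B: "sub N B" and r: "r : mhom R N N"
   and rA: "!!x. x : car N ==> r x : A" and rid: "!!x. x : A ==> r x = x" and r0: "!!x. x : B ==> r x = 0[N]"
   and cov: "set_add N (i ` car X) B = car N" for X :: "('k, 'a) fd_module" and i r A B
 proof (intro conjI equalityI subsetI)
  show h: "(%x. r (i x)) : mhom R X (N on A)"
   by (rule hom_into_sub[OF X Nl hom_comp[OF i r]]) (rule rA[OF hom_closed[OF i]])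
  fix y assume "y : (%x. r (i x)) ` car X" then show "y : car (N on A)" using hom_closed[OF h] by blast
 next
  fix y assume "y : car (N on A)"
  then have y: "y : A" "y : car N" using N.sub_carrier[OF A] by auto
  then have "y : set_add N (i ` car X) B" using cov by simp
  then obtain u v where uv: "u : i ` car X" "v : B" "y = u +[N] v" by (rule set_addE)
  obtain x where x: "u = i x" "x : car X" using uv(1) by (rule imageE)
  have uc: "u : car N" "v : car N" using hom_closed[OF i x(2)] x(1) N.sub_carrier[OF B uv(2)] by auto
  have "r y = r u" using hom_add[OF r uc] uv(3) r0[OF uv(2)] hom_closed[OF r uc(1)] by simp
  then have "y = r (i x)" using rid[OF y(1)] x(1) by simp
  then show "y : (%x. r (i x)) ` car X" using x(2) by (rule image_eqI)
 qed
 note s1 = surj[OF Ml i1 N1 N2 pq(1,3,6,8) c1] and s2 = surj[OF Ml' i2 N2 N1 pq(2,4,7,9) c2]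
 note f1 = fd_sub[OF N N1] and f2 = fd_sub[OF N N2]
 have l: "dm (N on N1) \<le> dm M" "dm (N on N2) \<le> dm M'"
  using dm_surj_le(1)[OF M f1] s1 dm_surj_le(1)[OF M' f2] s2 by blast+
 have "dm (N on N1) + dm (N on N2) = dm N"
  using dm_set_add[OF N N1 N2] int sum dm_zero_sub[OF N] by simp
 then consider "dm M = dm (N on N1)" | "dm M' = dm (N on N2)" using l d by linarith
 then show ?thesis
 proof cases
  case 1
  have "\<exists>\<phi>\<in>mhom R M' M. \<phi> b = a"
  proof (rule transfer[OF Ml fd_lm[OF f1]])
   show "(%x. p (i1 x)) : mhom R M (N on N1)" using s1 by blast
   show "bij_betw (%x. p (i1 x)) (car M) (car (N on N1))"
    using surj_imp_bij[OF M f1] s1 1 by blast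
   show "(%x. p (i2 x)) : mhom R M' (N on N1)"
    by (rule hom_into_sub[OF Ml' Nl hom_comp[OF i2 pq(1)]]) (rule pq(3)[OF hom_closed[OF i2]])
   show "p (i1 a) = p (i2 b)" using ab by simp
  qed (rule a)
  then show ?thesis ..
 next
  case 2
  have "\<exists>\<phi>\<in>mhom R M M'. \<phi> a = b"
  proof (rule transfer[OF Ml' fd_lm[OF f2]])
   show "(%x. q (i2 x)) : mhom R M' (N on N2)" using s2 by blast
   show "bij_betw (%x. q (i2 x)) (car M') (car (N on N2))"
    using surj_imp_bij[OF M' f2] s2 2 by blast
   show "(%x. q (i1 x)) : mhom R M (N on N2)"
    by (rule hom_into_sub[OF Ml Nl hom_comp[OF i1 pq(2)]]) (rule pq(4)[OF hom_closed[OF i1]])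
   show "q (i2 b) = q (i1 a)" using ab by simp
  qed (rule b)
  then show ?thesis ..
 qed
qed

lemma not_uniform_embed:
 fixes M N :: "('k, 'a) fd_module"
 assumes M: "lm M" and N: "lm N" and f: "f : mhom R M N" and inj: "inj_on f (car M)"
  and nu: "\<not> uniform M" and nz: "car M ~= {0[M]}"
 shows "\<not> uniform N"
proof -
 interpret M: left_module R M by (rule M)
 obtain i a k b where a: "i : I" "a : socv i M" "a ~= 0[M]" and b: "k : I" "b : socv k M" "b ~: line M a"
  by (rule not_uniformE[OF M nu nz], rule that)
 have "f a ~= 0[N]"
  using inj_iff_kernel[OF M N f] inj socvD(1)[OF a(2)] a(3) by blast
 moreover have "f b ~: line N (f a)"
 proof
  assume "f b : line N (f a)"
  then obtain c where c: "c : car K" "f b = scl N c (f a)" unfolding line_def by blast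
  then have "f b = f (scl M c a)" using hom_scl[OF f c(1) socvD(1)[OF a(2)]] by simp
  then have "b = scl M c a" using inj_onD[OF inj] socvD(1)[OF b(2)] scl_closed[OF M c(1) socvD(1)[OF a(2)]] by blast
  then show False using b(3) c(1) unfolding line_def by blast
 qed
 ultimately show ?thesis
  using not_uniformI[OF N hom_socv[OF M N a(1) f a(2)] a(1) _ hom_socv[OF M N b(1) f b(2)] b(1)] by blast
qed

text \<open>Gluing the two modules along the given simple submodules yields a module that is neither hollow nor
 uniform, hence decomposes; a summand of maximal dimension provides the homomorphism.\<close>

lemma socle_extension:
 fixes M M' :: "('k, 'a) fd_module"
 assumes M: "fd M" "hollow M" and M': "fd M'" "hollow M'" and nu: "\<not> uniform M \<or> \<not> uniform M'"
  and i: "i : I" and a: "a : socv i M" "a ~= 0[M]" and b: "b : socv i M'" "b ~= 0[M']"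
 shows "(\<exists>\<phi>\<in>mhom R M M'. \<phi> a = b) \<or> (\<exists>\<phi>\<in>mhom R M' M. \<phi> b = a)"
proof -
 note Ml = fd_lm[OF M(1)] and Ml' = fd_lm[OF M'(1)]
 interpret M: left_module R M by (rule Ml)
 interpret M': left_module R M' by (rule Ml')
 obtain N :: "('k, 'a) fd_module" and i1 i2 where N: "fd N" and i1: "i1 : mhom R M N" and i2: "i2 : mhom R M' N"
  and inj: "inj_on i1 (car M)" "inj_on i2 (car M')" and cov: "set_add N (i1 ` car M) (i2 ` car M') = car N"
  and ab: "i1 a = i2 b" and d: "dm N + 1 = dm M + dm M'"
  by (rule glue[OF M(1) M'(1) i a(1) b(1,2) a(2)], rule that)
 note Nl = fd_lm[OF N]
 interpret N: left_module R N by (rule Nl)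
 note ac = socvD(1)[OF a(1)] and bc = socvD(1)[OF b(1)]
 let ?A = "i1 ` car M" and ?B = "i2 ` car M'"
 have A: "sub N ?A" and B: "sub N ?B"
  by (rule sub_image[OF Ml Nl i1 M.sub_carrier_self], rule sub_image[OF Ml' Nl i2 M'.sub_carrier_self])
 show ?thesis
 proof (cases "?A = car N \<or> ?B = car N")
  case True
  then show ?thesis
  proof
   assume "?A = car N"
   then have bij: "bij_betw i1 (car M) (car N)" using inj(1) by (simp add: bij_betw_def)
   have "\<exists>\<phi>\<in>mhom R M' M. \<phi> b = a"
    by (rule transfer[where a=a and b=b, OF Ml Nl i1 bij i2]) (fact ab, fact ac)
   then show ?thesis ..
  next
   assume "?B = car N"
   then have bij: "bij_betw i2 (car M') (car N)" using inj(2) by (simp add: bij_betw_def)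
   have "\<exists>\<phi>\<in>mhom R M M'. \<phi> a = b"
    by (rule transfer[where a=b and b=a, OF Ml' Nl i2 bij i1]) (fact ab[symmetric], fact bc)
   then show ?thesis ..
  qed
 next
  case False
  have ia: "i1 a ~= 0[N]" using inj_iff_kernel[OF Ml Nl i1] inj(1) ac a(2) by blast
  have nzA: "?A ~= {0[N]}" using ia ac by blast
  have nzB: "?B ~= {0[N]}" using ia ab bc by force
  have hA: "hollow_sub N ?A" by (rule hollow_image[OF Ml Nl i1 M.sub_carrier_self M(2) nzA])
  have hB: "hollow_sub N ?B" by (rule hollow_image[OF Ml' Nl i2 M'.sub_carrier_self M'(2) nzB])
  have "\<not> hollow N" using hollow_subD[OF _ A B cov] False by blast
  moreover have "\<not> uniform N"
   using nu not_uniform_embed[OF Ml Nl i1 inj(1) _ hollow_sub_nonzero[OF M(2)]]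
    not_uniform_embed[OF Ml' Nl i2 inj(2) _ hollow_sub_nonzero[OF M'(2)]] by blast
  ultimately have "\<not> indec N" using local_colocal[of N] by blast
  moreover have "car N ~= {0[N]}" using ia hom_closed[OF i1 ac] by blast
  ultimately obtain N1 N2 where n: "sub N N1" "sub N N2" "N1 \<inter> N2 = {0[N]}" "set_add N N1 N2 = car N"
   "N1 ~= {0[N]}" "N2 ~= {0[N]}"
   using N unfolding indec_iff by blast
  have n': "N2 \<inter> N1 = {0[N]}" "set_add N N2 N1 = car N"
   using n N.set_add_comm[OF N.sub_subset[OF n(1)] N.sub_subset[OF n(2)]] by auto
  from hollow_pair_summands[OF Nl A B hA hB cov n]
  show ?thesis
  proof
   assume "set_add N ?A N2 = car N \<and> set_add N ?B N1 = car N"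
   then show ?thesis using summand_case[OF M(1) M'(1) N i1 i2 ac bc ab d n(1-4)] by blast
  next
   assume "set_add N ?A N1 = car N \<and> set_add N ?B N2 = car N"
   then show ?thesis using summand_case[OF M(1) M'(1) N i1 i2 ac bc ab d n(2,1) n'] by blast
  qed
 qed
qed

lemma nonsurj_add:
 assumes M: "lm M" and N: "lm N" and h: "hollow N" and f: "f : mhom R M N" and g: "g : mhom R M N"
  and fs: "f ` car M ~= car N" and gs: "g ` car M ~= car N"
 shows "(%x. f x +[N] g x) ` car M ~= car N"
proof
 interpret N: left_module R N by (rule N)
 assume "(%x. f x +[N] g x) ` car M = car N"
 from hollow_diff_surj[OF M N h hom_plus[OF M N f g] g this gs]
 have "(%x. f x +[N] g x -[N] g x) ` car M = car N" .
 moreover have "(%x. f x +[N] g x -[N] g x) ` car M = f ` car M"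
  by (rule image_cong) (use hom_closed[OF f] hom_closed[OF g] in \<open>simp_all add: a_minus_def N.M.a_assoc N.M.r_neg\<close>)
 ultimately show False using fs by simp
qed

lemma nonsurj_scl:
 assumes M: "lm M" and N: "lm N" and f: "f : mhom R M N" and c: "c : car K"
  and fs: "f ` car M ~= car N"
 shows "(%x. scl N c (f x)) : mhom R M N" "(%x. scl N c (f x)) ` car M ~= car N"
proof -
 interpret M: left_module R M by (rule M)
 interpret N: left_module R N by (rule N)
 show "(%x. scl N c (f x)) : mhom R M N" unfolding scl_def by (rule hom_sc[OF M N f c])
 have s: "sub N (f ` car M)" by (rule sub_image[OF M N f M.sub_carrier_self])
 have "(%x. scl N c (f x)) ` car M <= f ` car M" using scl_sub[OF N s c] by blast
 then show "(%x. scl N c (f x)) ` car M ~= car N" using fs N.sub_subset[OF s] by blast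
qed

text \<open>Brings the endomorphism into Jordan form on the plane of \<open>a\<close> and
  \<open>b\<close>. Subtracting its residue scalar \<open>c\<close> replaces \<open>a\<close> by
  \<open>a' = a - c b\<close>, which spans the same plane together with \<open>b\<close>. On this
  plane the new map sends \<open>b\<close> to \<open>a'\<close>, and since it is not onto it is
  nilpotent; this forces \<open>a'\<close> to go to zero.\<close>

lemma nilpotent_step:
 fixes M :: "('k, 'a) fd_module"
 assumes M: "fd M" "hollow M" and nu: "\<not> uniform M" and v: "v : I"
  and a: "a : socv v M" "a ~= 0[M]" and b: "b : socv v M" "b ~: line M a" and \<phi>: "\<phi> : mhom R M M" "\<phi> b = a"
  and span: "socv v M <= set_add M (line M a) (line M b)"
 obtains a' \<rho> where "a' : socv v M" "a' ~: line M b" "\<rho> : mhom R M M" "\<rho> ` car M ~= car M"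
  "\<rho> b = a'" "\<rho> a' = 0[M]" "a : set_add M (line M a') (line M b)" "a' : set_add M (line M a) (line M b)"
proof -
 note Ml = fd_lm[OF M(1)]
 interpret M: left_module R M by (rule Ml)
 note ac = socvD(1)[OF a(1)] and bc = socvD(1)[OF b(1)]
 obtain c where c: "c : car K" and \<rho>: "(%x. \<phi> x -[M] scl M c x) : mhom R M M"
  and ns: "(%x. \<phi> x -[M] scl M c x) ` car M ~= car M"
  by (rule End_residue[OF Ml M \<phi>(1)], rule that)
 let ?\<rho> = "%x. \<phi> x -[M] scl M c x"
 let ?a = "a -[M] scl M c b"
 have la: "sub M (line M a)" and lb: "sub M (line M b)" using line_sub[OF Ml] a(1) b(1) v by blast+
 have cb: "scl M c b : line M b" unfolding line_def using c by blast
 have cbc: "scl M c b : car M" by (rule M.sub_carrier[OF lb cb])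
 have a': "?a : socv v M"
  by (rule M.sub_diff[OF sub_socv[OF Ml v] a(1)]) (rule scl_sub[OF Ml sub_socv[OF Ml v] c b(1)])
 note a'c = socvD(1)[OF a']
 have anb: "a ~: line M b"
 proof
  assume "a : line M b"
  then have "b : line M a" by (rule line_sym[OF Ml bc _ a(2) la line_self[OF Ml ac]])
  then show False using b(2) by blast
 qed
 have a'nb: "?a ~: line M b"
  using M.sub_diff_mem[OF lb ac cb] anb by blast
 have \<rho>b: "?\<rho> b = ?a" using \<phi>(2) by simp
 have la': "sub M (line M ?a)" by (rule line_sub[OF Ml a' v])
 have aeq: "a = ?a +[M] scl M c b" using M.diff_add_cancel[OF ac cbc] by simp
 have in1: "a : set_add M (line M ?a) (line M b)"
  using set_addI[OF line_self[OF Ml a'c] cb, of M] aeq by simp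
 have in2: "?a : set_add M (line M a) (line M b)"
  using set_addI[OF line_self[OF Ml ac] M.sub_neg[OF lb cb], of M] by (simp add: a_minus_def)
 have "set_add M (line M a) (line M b) <= set_add M (line M ?a) (line M b)"
  by (rule M.set_add_least[OF M.sub_set_add[OF la' lb] line_least[OF Ml M.sub_set_add[OF la' lb] in1] M.set_add_upper2[OF la' lb]])
 then have span': "socv v M <= set_add M (line M ?a) (line M b)" using span by blast
 have \<rho>a: "?\<rho> ?a : socv v M" by (rule hom_socv[OF Ml Ml v \<rho> a'])
 then have "?\<rho> ?a : set_add M (line M ?a) (line M b)" using span' by blast
 then obtain u t where ut: "u : line M ?a" "t : line M b" "?\<rho> ?a = u +[M] t" by (rule set_addE)
 obtain \<alpha> where \<alpha>: "\<alpha> : car K" "u = scl M \<alpha> ?a" using ut(1) unfolding line_def by blast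
 obtain \<beta> where \<beta>: "\<beta> : car K" "t = scl M \<beta> b" using ut(2) unfolding line_def by blast
 have utc: "u : car M" "t : car M" using M.sub_carrier[OF la' ut(1)] M.sub_carrier[OF lb ut(2)] .
 have b0: "b ~= 0[M]" using b(2) M.sub_zero[OF la] by blast
 text \<open>On \<open>b\<close> the endomorphism \<open>\<rho>\<^sup>2 - \<alpha>\<rho>\<close>, which is not onto, acts as the scalar \<open>\<beta>\<close>.\<close>
 let ?\<psi> = "%x. ?\<rho> (?\<rho> x -[M] scl M \<alpha> x)"
 have al: "(%x. scl M \<alpha> x) : mhom R M M" unfolding scl_def by (rule hom_sc[OF Ml Ml hom_id \<alpha>(1)])
 have \<chi>: "(%x. ?\<rho> x -[M] scl M \<alpha> x) : mhom R M M" by (rule hom_minus[OF Ml Ml \<rho> al])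
 have \<psi>: "?\<psi> : mhom R M M" by (rule hom_comp[OF \<chi> \<rho>])
 have "?\<psi> ` car M <= ?\<rho> ` car M"
 proof
  fix y assume "y : ?\<psi> ` car M"
  then obtain x where x: "y = ?\<psi> x" "x : car M" by (rule imageE)
  show "y : ?\<rho> ` car M" unfolding x(1) by (rule imageI[OF hom_closed[OF \<chi> x(2)]])
 qed
 then have \<psi>ns: "?\<psi> ` car M ~= car M" using ns M.sub_subset[OF sub_image[OF Ml Ml \<rho> M.sub_carrier_self]] by blast
 have sab: "scl M \<alpha> b : car M" by (rule scl_closed[OF Ml \<alpha>(1) bc])
 have "?\<psi> b = ?\<rho> (?a -[M] scl M \<alpha> b)" by (simp only: \<rho>b)
 also have "\<dots> = ?\<rho> ?a -[M] ?\<rho> (scl M \<alpha> b)" by (rule hom_diff[OF Ml Ml \<rho> a'c sab])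
 also have "?\<rho> (scl M \<alpha> b) = scl M \<alpha> ?a" using hom_scl[OF \<rho> \<alpha>(1) bc] \<rho>b by simp
 also have "?\<rho> ?a -[M] scl M \<alpha> ?a = t"
  unfolding ut(3) \<alpha>(2)[symmetric] using utc by (simp add: a_minus_def M.M.a_comm[of u t] M.M.a_assoc M.M.r_neg)
 finally have \<psi>b: "?\<psi> b = scl M \<beta> b" using \<beta>(2) by simp
 have "?\<psi> b = 0[M]" by (rule End_nonsurj_nilpotent[OF Ml M \<psi> \<psi>ns bc b0 \<beta>(1) \<psi>b])
 then have "t = 0[M]" using \<psi>b \<beta>(2) by simp
 then have \<rho>a': "?\<rho> ?a = scl M \<alpha> ?a" using ut(3) utc \<alpha>(2) by simp
 have a'0: "?a ~= 0[M]" using a'nb M.sub_zero[OF lb] by metis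
 have "?\<rho> ?a = 0[M]" by (rule End_nonsurj_nilpotent[OF Ml M \<rho> ns a'c a'0 \<alpha>(1) \<rho>a'])
 then show thesis using that[OF a' a'nb \<rho> ns \<rho>b _ in1 in2] by blast
qed

end

context fd_algebra
begin

lemma dm_mono:
 assumes M: "fd M" and A: "sub M A" and B: "sub M B" and AB: "A <= B"
 shows "dm (M on A) \<le> dm (M on B)"
  "dm (M on A) = dm (M on B) ==> A = B"
proof -
 interpret M: left_module R M by (rule fd_lm[OF M])
 have s: "sub (M on B) A" using M.sub_of_sub[OF B] A AB by blast
 show "dm (M on A) \<le> dm (M on B)" using dm_sub_le[OF fd_sub[OF M B] s] by simp
 show "A = B" if "dm (M on A) = dm (M on B)"
  using dm_sub_eq[OF fd_sub[OF M B] s] that by simp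
qed

end

section \<open>Planes in the socle and quotients by a line\<close>

context split_algebra
begin

lemma dm_set_add_line:
 assumes M: "fd M" and A: "sub M A" and x: "x : socv i M" "i : I" "x ~: A"
 shows "dm (M on (set_add M A (line M x))) = dm (M on A) + 1"
proof -
 note Ml = fd_lm[OF M]
 interpret M: left_module R M by (rule Ml)
 have x0: "x ~= 0[M]" using x(3) M.sub_zero[OF A] by blast
 have "A \<inter> line M x = {0[M]}" using line_inter[OF Ml x(1,2) A x(3)] by blast
 then show ?thesis
  using dm_set_add[OF M A line_sub[OF Ml x(1,2)]] dm_zero_sub[OF M] dm_line[OF Ml M x(1,2) x0] by simp
qed

lemma socv_le: "socv i M <= soc M" "socv i M <= car M"
 by (auto dest: socvD)

abbreviation lines :: "('a, 'm) module => 'm => 'm => 'm set" where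
 "lines M a b \<equiv> set_add M (line M a) (line M b)"

lemma dm_lines:
 assumes M: "fd M" and a: "a : socv i M" "i : I" "a ~= 0[M]" and b: "b : socv k M" "k : I" "b ~: line M a"
 shows "dm (M on (lines M a b)) = 2"
 using dm_set_add_line[OF M line_sub[OF fd_lm[OF M] a(1,2)] b] dm_line[OF fd_lm[OF M] M a] by simp

lemma sub_lines:
 assumes M: "lm M" and a: "a : socv i M" "i : I" and b: "b : socv k M" "k : I"
 shows "sub M (lines M a b)" "line M a <= lines M a b" "line M b <= lines M a b" "lines M a b <= soc M"
proof -
 interpret M: left_module R M by (rule M)
 note la = line_sub[OF M a] and lb = line_sub[OF M b]
 show "sub M (lines M a b)" "line M a <= lines M a b" "line M b <= lines M a b"
  by (rule M.sub_set_add[OF la lb], rule M.set_add_upper1[OF la lb], rule M.set_add_upper2[OF la lb])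
 show "lines M a b <= soc M"
  by (rule M.set_add_least[OF sub_soc[OF M] line_least[OF M sub_soc[OF M] socvD(2)[OF a(1)]] line_least[OF M sub_soc[OF M] socvD(2)[OF b(1)]]])
qed

lemma lineE:
 assumes "y : line M x" obtains c where "c : car K" "y = scl M c x"
 using assms unfolding line_def by blast

lemma lineI: "c : car K ==> scl M c x : line M x"
 unfolding line_def by blast

lemma hom_line:
 fixes M :: "('a, 'm) module" and N :: "('a, 'n) module"
 assumes "lm M" "lm N" "f : mhom R M N" "x : car M" "f x = 0[N]" "y : line M x"
 shows "f y = 0[N]"
 using assms(6) by (rule lineE) (simp add: hom_scl[OF assms(3) _ assms(4)] assms(5) scl_zero[OF assms(2)])

text \<open>A predicate instead of a construction: the quotient by \<open>line M a\<close> is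
  available only as a copy in the fixed carrier type, together with its projection.\<close>

definition quot :: "('a, 'm) module => 'm => ('k, 'a) fd_module => ('m => nat => 'k) => bool" where
 "quot M a Y p \<longleftrightarrow> fd Y \<and> p : mhom R M Y \<and> p ` car M = car Y \<and>
  (\<forall>x\<in>car M. p x = 0[Y] \<longleftrightarrow> x : line M a)"

lemma quotD:
 assumes "quot M a Y p"
 shows "fd Y" "p : mhom R M Y" "p ` car M = car Y"
  "x : car M ==> p x = 0[Y] \<longleftrightarrow> x : line M a"
 using assms unfolding quot_def by blast+

lemma quot_exists:
 fixes M :: "('a, 'm) module"
 assumes M: "fd M" and a: "a : socv i M" "i : I"
 obtains Y :: "('k, 'a) fd_module" and p where "quot M a Y p"
proof -
 obtain Y :: "('k, 'a) fd_module" and p where Y: "fd Y" "p : mhom R M Y" "p ` car M = car Y"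
  and k: "!!x. x : car M ==> p x = 0[Y] \<longleftrightarrow> x : line M a"
  by (rule fd_quotient[OF M line_sub[OF fd_lm[OF M] a]], rule that)
 show thesis by (rule that[of Y p]) (simp add: quot_def Y k)
qed

lemma quot_dm:
 fixes M :: "('a, 'm) module"
 assumes q: "quot M a Y p" and M: "fd M" and a: "a : socv i M" "i : I" "a ~= 0[M]"
 shows "dm M = Suc (dm Y)"
proof -
 note Ml = fd_lm[OF M]
 interpret M: left_module R M by (rule Ml)
 have "{x : car M. p x = 0[Y]} = line M a"
  using quotD(4)[OF q] M.sub_subset[OF line_sub[OF Ml a(1,2)]] by blast
 then show ?thesis
  using fd_surj(2)[OF M fd_lm[OF quotD(1)[OF q]] quotD(2,3)[OF q]] dm_line[OF Ml M a] by simp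
qed

text \<open>\<open>Y\<close> has dimension one less than \<open>M\<close>, so the kernel of a
  surjection onto it is one-dimensional, and it already contains the line of \<open>a\<close>. The
  line of \<open>a\<close> may differ from that of \<open>b\<close>; most contradictions below come
  from a second element in such a kernel.\<close>

lemma kernel_of_surj:
 fixes M :: "('a, 'm) module"
 assumes M: "fd M" and q: "quot M b Y p" and b: "b : socv k M" "k : I" "b ~= 0[M]" and a: "a : socv i M" "i : I" "a ~= 0[M]"
  and f: "f : mhom R M Y" and fs: "f ` car M = car Y" and fa: "f a = 0[Y]"
  and x: "x : car M" "f x = 0[Y]"
 shows "x : line M a"
proof -
 note Ml = fd_lm[OF M]
 interpret M: left_module R M by (rule Ml)
 note Yl = fd_lm[OF quotD(1)[OF q]]
 let ?k = "{x : car M. f x = 0[Y]}"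
 have k: "sub M ?k" by (rule sub_kernel[OF Ml Yl f])
 have l: "sub M (line M a)" by (rule line_sub[OF Ml a(1,2)])
 have le: "line M a <= ?k" by (rule line_least[OF Ml k]) (simp add: fa socvD(1)[OF a(1)])
 have "dm (M on (line M a)) = dm (M on ?k)"
  using fd_surj(2)[OF M Yl f fs] quot_dm[OF q M b] dm_line[OF Ml M a] by simp
 then have "line M a = ?k" by (rule dm_mono(2)[OF M l k le])
 then show ?thesis using x by blast
qed

lemma quot_socle_preimage:
 fixes M :: "('a, 'm) module"
 assumes M: "lm M" and q: "quot M a Y p" and s: "soc Y = p ` soc M" and k: "k : I" and y: "y : socv k Y"
 obtains x where "x : socv k M" "y = p x"
proof -
 have "y : p ` soc M" using socvD(2)[OF y] s by simp
 then obtain x where x: "y = p x" "x : soc M" by (rule imageE)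
 have xc: "x : car M" using x(2) unfolding soc_def by blast
 have "p (e k .[M] x) = y" using hom_smult[OF quotD(2)[OF q] e_closed[OF k] xc] x(1) socvD(3)[OF y] by simp
 then show thesis using that[OF e_in_socv[OF M k x(2)]] by simp
qed

end

text \<open>What is known about a counterexample of least dimension to \<open>socle_dim\<close>: its
  socle has dimension exactly three, and passing to the quotient by a line creates no new socle.
  These assumptions turn out to be contradictory.\<close>

locale minimal_socle = lc_algebra K R I e J
 for K :: "('k, 'c) ring_scheme" and R :: "('k, 'a, 'z) module_scheme" and I :: "'i set" and e and J +
 fixes M :: "('k, 'a) fd_module"
 assumes M: "fd M" and h: "hollow M" and d3: "dm (M on (soc M)) = 3"
  and small: "!!i a (Y :: ('k, 'a) fd_module) p. i : I ==> a : socv i M ==> a ~= 0[M] ==> quot M a Y p ==> soc Y = p ` soc M"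

section \<open>Exclusion of a three-dimensional socle\<close>

context minimal_socle
begin

lemma Ml: "lm M" by (rule fd_lm[OF M])

lemma quot_nonzero:
 assumes q: "quot M a Y p" and a: "a : socv i M" "i : I" "a ~= 0[M]"
 shows "car Y ~= {0[Y]}"
proof
 assume "car Y = {0[Y]}"
 then have "dm Y = 0" using dm_zero_iff[OF quotD(1)[OF q]] by simp
 then show False using quot_dm[OF q M a] dm_sub_le[OF M sub_soc[OF Ml]] d3 by simp
qed

lemma quot_hollow:
 assumes q: "quot M a Y p" and a: "a : socv i M" "i : I" "a ~= 0[M]"
 shows "hollow Y"
 by (rule hollow_surj[OF M quotD(1)[OF q] quotD(2)[OF q] h quotD(3)[OF q] quot_nonzero[OF q a]])

text \<open>The map factors through \<open>M/a\<close>. By \<open>small\<close> the socle of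
  \<open>M/a\<close> consists of images of socle elements of \<open>M\<close>, on which the factor
  is injective by \<open>ker\<close>; hence it is injective, and \<open>M/a\<close> has the same
  dimension as \<open>Y\<close>.\<close>

lemma surj_of_kernel:
 assumes q: "quot M b Y p" and b: "b : socv k M" "k : I" "b ~= 0[M]" and a: "a : socv i M" "i : I" "a ~= 0[M]"
  and f: "f : mhom R M Y" and fa: "f a = 0[Y]" and ker: "!!s. s : soc M ==> f s = 0[Y] ==> s : line M a"
 shows "f ` car M = car Y"
proof -
 note ac = socvD(1)[OF a(1)]
 obtain X :: "('k, 'a) fd_module" and r where r: "quot M a X r" by (rule quot_exists[OF M a(1,2)])
 note X = quotD(1)[OF r] and Y = quotD(1)[OF q]
 have "r x = 0[X] ==> f x = 0[Y]" if "x : car M" for x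
  using quotD(4)[OF r that] hom_line[where f=f and x=a, OF Ml fd_lm[OF Y] f ac fa] by blast
 then obtain g where g: "g : mhom R X Y" and gr: "!!x. x : car M ==> g (r x) = f x"
  using factor_through[OF Ml fd_lm[OF X] fd_lm[OF Y] quotD(2,3)[OF r] f] by blast
 have "inj_on g (car X)"
 proof (rule inj_on_socle[OF fd_lm[OF X] fd_lm[OF Y] g])
  fix l y assume l: "l : I" and y: "y : socv l X" and gy: "g y = 0[Y]"
  obtain s where s: "s : socv l M" "y = r s" by (rule quot_socle_preimage[OF Ml r small[OF a(2,1,3) r] l y])
  have "f s = 0[Y]" using gr[OF socvD(1)[OF s(1)]] s(2) gy by simp
  then have "s : line M a" by (rule ker[OF socvD(2)[OF s(1)]])
  then show "y = 0[X]" using quotD(4)[OF r socvD(1)[OF s(1)]] s(2) by simp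
 qed
 then have "bij_betw g (car X) (car Y)"
  using inj_imp_bij[OF X Y g] quot_dm[OF r M a] quot_dm[OF q M b] by simp
 then have gs: "g ` car X = car Y" by (simp add: bij_betw_def)
 have "f ` car M = g ` (r ` car M)" unfolding image_image by (rule image_cong[OF refl]) (simp add: gr)
 then show ?thesis using gs quotD(3)[OF r] by simp
qed

text \<open>The aim is an endomorphism that is not onto but has rank two on the socle, so that its
  kernel there is a single line \<open>u\<close>. Composed with the projection modulo a line
  \<open>a\<close> outside its image on the socle, it still kills just \<open>u\<close> there and so
  is onto \<open>M/a\<close> by \<open>surj_of_kernel\<close>. This is impossible because
  \<open>M\<close> is hollow.\<close>

lemma same_vertex_false:
 assumes v: "v : I" and all: "soc M <= socv v M"
 shows False
proof -
 interpret M: left_module R M by (rule Ml)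
 note sv = sub_socv[OF Ml v] and ss = sub_soc[OF Ml]
 have eq: "soc M = socv v M" by (rule subset_antisym[OF all socv_le(1)])
 \<comment> \<open>The orbit of \<open>x\<close> under the endomorphism ring. For \<open>x\<close>
   in the socle it is a submodule, as \<open>R\<close> acts there by scalars and scalars may be
   moved into the endomorphism.\<close>
 let ?r = "%x. {\<phi> x | \<phi>. \<phi> : mhom R M M}"
 have sc: "(%x. scl M c (f x)) : mhom R M M" if "c : car K" "f : mhom R M M" for c f
  unfolding scl_def by (rule hom_sc[OF Ml Ml that(2,1)])
 have rs: "sub M (?r x)" and rle: "?r x <= socv v M" if x: "x : socv v M" for x
 proof -
  show le: "?r x <= socv v M" using hom_socv[OF Ml Ml v _ x] by blast
  show "sub M (?r x)"
  proof (rule M.subI)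
   show "?r x <= car M" by (rule subset_trans[OF le socv_le(2)])
   show "0[M] : ?r x" using hom_const_zero[OF Ml Ml] by fast
   fix y z assume "y : ?r x" "z : ?r x"
   then obtain f g where fg: "f : mhom R M M" "g : mhom R M M" "y = f x" "z = g x" by blast
   show "y +[M] z : ?r x" unfolding fg(3,4) using hom_plus[OF Ml Ml fg(1,2)] by fast
  next
   fix r y assume r: "r : car R" and y: "y : ?r x"
   then obtain f where f: "f : mhom R M M" "y = f x" by blast
   obtain c where c: "c : car K" "r .[M] y = scl M c y"
    using socv_scalar[OF Ml subsetD[OF le y] v r] by blast
   show "r .[M] y : ?r x" unfolding f(2) c(2)[unfolded f(2)] using sc[OF c(1) f(1)] by fast
  qed
 qed
 have trans: "?r y <= ?r x" if yx: "y : ?r x" for x y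
 proof
  fix z assume "z : ?r y"
  then obtain g where g: "g : mhom R M M" "z = g y" by blast
  obtain f where f: "f : mhom R M M" "y = f x" using yx by blast
  show "z : ?r x" unfolding g(2) f(2) using hom_comp[OF f(1) g(1)] by fast
 qed
 have self: "x : ?r x" for x using hom_id[of R M] by fast
 \<comment> \<open>By \<open>socle_extension\<close> any two orbits of nonzero socle elements are
   comparable, so an orbit of greatest dimension is the whole socle.\<close>
 let ?P = "%x. x : socv v M"
 let ?d = "%x. dm (M on (?r x))"
 have bound: "\<forall>x. ?P x --> ?d x < Suc (dm M)" using dm_sub_le[OF M rs] by (simp add: less_Suc_eq_le)
 have "?P 0[M]" by (rule M.sub_zero[OF sv])
 from ex_has_greatest_nat[of ?P, OF this bound]
 obtain x where x: "x : socv v M" and mx: "!!y. y : socv v M ==> ?d y \<le> ?d x" by blast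
 obtain i0 a0 where a0: "a0 : soc M" "a0 ~= 0[M]"
 proof -
  have "soc M ~= {0[M]}" using d3 dm_zero_sub[OF M] by auto
  then show thesis using that M.sub_zero[OF ss] by blast
 qed
 have nuni: "\<not> uniform M"
 proof -
  have "line M a0 ~= soc M" using dm_line[OF Ml M _ v a0(2)] a0(1) eq d3 by auto
  moreover have "line M a0 <= soc M" by (rule line_least[OF Ml ss a0(1)])
  ultimately obtain b where "b : soc M" "b ~: line M a0" by blast
  then show ?thesis using not_uniformI[OF Ml _ v a0(2) _ v] a0(1) eq by blast
 qed
 have lemA: "b : ?r a \<or> a : ?r b" if "a : socv v M" "a ~= 0[M]" "b : socv v M" "b ~= 0[M]" for a b
  using socle_extension[OF M h M h _ v that] nuni by blast
 have reach: "y : ?r x" if y: "y : socv v M" for y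
 proof (cases "y = 0[M] \<or> x = 0[M]")
  case True
  show ?thesis
  proof (cases "y = 0[M]")
   case True then show ?thesis using M.sub_zero[OF rs[OF x]] by simp
  next
   case False
   then have x0: "x = 0[M]" using True by blast
   have "?r x <= {0[M]}" unfolding x0 using hom_zero[OF Ml Ml] by blast
   then have "?r x = {0[M]}" using M.sub_zero[OF rs[OF x]] by blast
   then have "?d y = 0" using mx[OF y] dm_zero_sub[OF M] by simp
   then have "?r y = {0[M]}" using dm_zero_iff[OF fd_sub[OF M rs[OF y]]] by simp
   then show ?thesis using self[of y] False by blast
  qed
 next
  case False
  show ?thesis
  proof (cases "y : ?r x")
   case False': False
   then have "x : ?r y" using lemA[OF x _ y] False by blast
   then have sub: "?r x <= ?r y" by (rule trans)
   have "?d x = ?d y" using dm_mono(1)[OF M rs[OF x] rs[OF y] sub] mx[OF y] by simp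
   then have "?r x = ?r y" by (rule dm_mono(2)[OF M rs[OF x] rs[OF y] sub])
   then show ?thesis using self[of y] by blast
  qed blast
 qed
 have x0: "x ~= 0[M]"
 proof
  assume "x = 0[M]"
  then have "!!y. y : ?r x ==> y = 0[M]" using hom_zero[OF Ml Ml] by blast
  then show False using reach[of a0] a0 eq by blast
 qed
 let ?ns = "%\<rho>. \<rho> : mhom R M M \<and> \<rho> ` car M ~= car M"
 have residue: "\<exists>c \<rho>. c : car K \<and> ?ns \<rho> \<and> \<rho> a = b -[M] scl M c a" if "b : ?r a" for a b
 proof -
  obtain \<phi> where \<phi>: "\<phi> : mhom R M M" "b = \<phi> a" using \<open>b : ?r a\<close> by fast
  obtain c where c: "c : car K" "(%x. \<phi> x -[M] scl M c x) : mhom R M M"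
   "(%x. \<phi> x -[M] scl M c x) ` car M ~= car M" by (rule End_residue[OF Ml M h \<phi>(1)], rule that)
  show ?thesis
   by (rule exI[of _ c], rule exI[of _ "%x. \<phi> x -[M] scl M c x"], intro conjI) (rule c, rule c, rule c, simp add: \<phi>(2))
 qed
 have nil: "\<rho> a = 0[M]" if that': "?ns \<rho>" "a : socv v M" "\<rho> a : line M a" for \<rho> a
 proof (cases "a = 0[M]")
  case True then show ?thesis using that(1) hom_zero[OF Ml Ml] by blast
 next
  case False
  obtain c where "c : car K" "\<rho> a = scl M c a" using that'(3) by (rule lineE)
  then show ?thesis
   by (rule End_nonsurj_nilpotent[OF Ml M h conjunct1[OF that'(1)] conjunct2[OF that'(1)] socvD(1)[OF that'(2)] False])
 qed
 have indep_sym: "a ~: line M b" if "a : socv v M" "a ~= 0[M]" "b : socv v M" "b ~: line M a" for a b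
  using line_sym[OF Ml socvD(1)[OF that(3)] _ that(2) line_sub[OF Ml that(1) v] line_self[OF Ml socvD(1)[OF that(1)]]] that(4) by blast
 have residue': "\<exists>\<rho>. ?ns \<rho> \<and> \<rho> a ~: line M a \<and> (\<exists>c\<in>car K. \<rho> a = b -[M] scl M c a)"
  if "a : socv v M" "b : car M" "b : ?r a" "b ~: line M a" for a b
 proof -
  obtain c \<rho> where c: "c : car K" "?ns \<rho>" "\<rho> a = b -[M] scl M c a" using residue[OF \<open>b : ?r a\<close>] by blast
  have "\<rho> a ~: line M a"
   using M.sub_diff_mem[OF line_sub[OF Ml that(1) v] that(2) lineI[OF c(1)]] c(3) that(4) by auto
  then show ?thesis by (intro exI[of _ \<rho>] conjI bexI[of _ c] c conjunct1[OF c(2)] conjunct2[OF c(2)])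
 qed
 have lx: "sub M (line M x)" by (rule line_sub[OF Ml x v])
 obtain y where y: "y : socv v M" "y ~: line M x"
 proof -
  have "line M x ~= soc M" using dm_line[OF Ml M x v x0] d3 by auto
  then show thesis using that line_least[OF Ml sv x] eq by blast
 qed
 obtain z where z: "z : socv v M" "z ~: lines M x y"
 proof -
  have "lines M x y ~= soc M" using dm_lines[OF M x v x0 y(1) v y(2)] d3 by auto
  then show thesis using that sub_lines(4)[OF Ml x v y(1) v] eq by blast
 qed
 obtain \<rho>y where \<rho>y: "?ns \<rho>y" "\<rho>y x ~: line M x" "\<exists>c\<in>car K. \<rho>y x = y -[M] scl M c x"
  using residue'[OF x socvD(1)[OF y(1)] reach[OF y(1)] y(2)] by blast
 have znx: "z ~: line M x" using z(2) sub_lines(2)[OF Ml x v y(1) v] by blast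
 obtain \<rho>z where \<rho>z: "?ns \<rho>z" "\<rho>z x ~: line M x" "\<exists>c\<in>car K. \<rho>z x = z -[M] scl M c x"
  using residue'[OF x socvD(1)[OF z(1)] reach[OF z(1)] znx] by blast
 let ?b = "\<rho>y x" and ?c = "\<rho>z x"
 have bs: "?b : socv v M" using hom_socv[OF Ml Ml v conjunct1[OF \<rho>y(1)] x] .
 have cs: "?c : socv v M" using hom_socv[OF Ml Ml v conjunct1[OF \<rho>z(1)] x] .
 have b0: "?b ~= 0[M]" using \<rho>y(2) M.sub_zero[OF lx] by metis
 note L = sub_lines[OF Ml x v y(1) v]
 have bL: "?b : lines M x y"
 proof -
  obtain c where c: "c : car K" "?b = y -[M] scl M c x" using \<rho>y(3) by blast
  show ?thesis unfolding c(2)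
   by (rule M.sub_diff[OF L(1) subsetD[OF L(3) line_self[OF Ml socvD(1)[OF y(1)]]] subsetD[OF L(2) lineI[OF c(1)]]])
 qed
 have cnb: "?c ~: line M ?b"
 proof
  assume "?c : line M ?b"
  then have cL: "?c : lines M x y" using line_least[OF Ml L(1) bL] by blast
  obtain c where c: "c : car K" "?c = z -[M] scl M c x" using \<rho>z(3) by blast
  have "z : lines M x y"
   by (rule M.sub_diff_mem[OF L(1) socvD(1)[OF z(1)] subsetD[OF L(2) lineI[OF c(1)]]]) (use c(2) cL in simp)
  then show False using z(2) by blast
 qed
 have c0: "?c ~= 0[M]" using \<rho>z(2) M.sub_zero[OF lx] by metis
 have wit: "\<exists>\<rho>. ?ns \<rho> \<and> (\<exists>s\<in>socv v M. \<exists>t\<in>socv v M. \<rho> s ~= 0[M] \<and> \<rho> t ~: line M (\<rho> s))"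
  if that': "?ns \<rho>" "s : socv v M" "\<rho> s ~= 0[M]" "t : socv v M" "\<rho> t ~: line M (\<rho> s)" for \<rho> s t
  by (rule exI[of _ \<rho>], rule conjI, rule that'(1), rule bexI[of _ s], rule bexI[of _ t], rule conjI, rule that'(3), rule that'(5), rule that'(4), rule that'(2))
 text \<open>Two independent elements of \<open>N x\<close>, with \<open>N\<close> the endomorphisms that are not onto, are
  related by an endomorphism; this yields an element of \<open>N\<close> of rank two on the socle.\<close>
 have rank2: "\<exists>\<rho>. ?ns \<rho> \<and> (\<exists>s\<in>socv v M. \<exists>t\<in>socv v M. \<rho> s ~= 0[M] \<and> \<rho> t ~: line M (\<rho> s))"
  if ns: "?ns \<rho>1" and as: "\<rho>1 x : socv v M" "\<rho>1 x ~= 0[M]" and b: "b : socv v M" "b ~: line M (\<rho>1 x)" "b : ?r (\<rho>1 x)" for \<rho>1 b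
 proof -
  let ?a = "\<rho>1 x"
  obtain \<rho>0 where \<rho>0: "?ns \<rho>0" "\<rho>0 ?a ~: line M ?a" using residue'[OF as(1) socvD(1)[OF b(1)] b(3,2)] by blast
  let ?a' = "\<rho>0 ?a"
  have a': "?a' : socv v M" using hom_socv[OF Ml Ml v conjunct1[OF \<rho>0(1)] as(1)] .
  have la: "sub M (line M ?a)" by (rule line_sub[OF Ml as(1) v])
  have a'0: "?a' ~= 0[M]" using \<rho>0(2) M.sub_zero[OF la] by metis
  \<comment> \<open>If neither \<open>\<rho>1\<close> nor \<open>\<rho>0\<close> already has rank
    two on \<open>x\<close> and \<open>a\<close>, then their sum does: \<open>\<rho>1\<close> kills
    \<open>a\<close>, so the sum sends \<open>a\<close> to \<open>a'\<close>, and it sends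
    \<open>x\<close> to \<open>a\<close> plus a multiple of \<open>a'\<close>, where
    \<open>a\<close> is not on the line of \<open>a'\<close>.\<close>
  consider "\<rho>1 ?a ~: line M ?a" | "\<rho>0 x ~: line M ?a'" | "\<rho>1 ?a : line M ?a" "\<rho>0 x : line M ?a'" by blast
  then show ?thesis
  proof cases
   case 1 show ?thesis by (rule wit[of \<rho>1 x ?a, OF ns x as(2,1) 1])
  next
   case 2 show ?thesis by (rule wit[of \<rho>0 ?a x, OF \<rho>0(1) as(1) a'0 x 2])
  next
   case 3
   have z: "\<rho>1 ?a = 0[M]" by (rule nil[of \<rho>1 ?a, OF ns as(1) 3(1)])
   let ?\<sigma> = "%w. \<rho>0 w +[M] \<rho>1 w"
   have \<sigma>: "?ns ?\<sigma>"
    by (rule conjI[OF hom_plus[OF Ml Ml conjunct1[OF \<rho>0(1)] conjunct1[OF ns]] nonsurj_add[OF Ml Ml h conjunct1[OF \<rho>0(1)] conjunct1[OF ns] conjunct2[OF \<rho>0(1)] conjunct2[OF ns]]])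
   have \<sigma>a: "?\<sigma> ?a = ?a'" using z socvD(1)[OF a'] by simp
   have la': "sub M (line M ?a')" by (rule line_sub[OF Ml a' v])
   have "?\<sigma> x ~: line M ?a'"
   proof
    assume "?\<sigma> x : line M ?a'"
    then have "?a +[M] \<rho>0 x : line M ?a'"
     using M.M.a_comm[OF socvD(1)[OF as(1)] M.sub_carrier[OF la' 3(2)]] by simp
    then have "?a : line M ?a'" by (rule M.sub_add_mem[OF la' socvD(1)[OF as(1)] 3(2)])
    then show False using indep_sym[OF as a' \<rho>0(2)] by blast
   qed
   then have n: "?\<sigma> x ~: line M (?\<sigma> ?a)" unfolding \<sigma>a .
   have "?\<sigma> ?a ~= 0[M]" unfolding \<sigma>a by (rule a'0)
   from wit[of ?\<sigma> ?a x, OF \<sigma> as(1) this x n] show ?thesis .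
  qed
 qed
 have "\<exists>\<rho>. ?ns \<rho> \<and> (\<exists>s\<in>socv v M. \<exists>t\<in>socv v M. \<rho> s ~= 0[M] \<and> \<rho> t ~: line M (\<rho> s))"
  using lemA[OF bs b0 cs c0]
 proof
  assume "?c : ?r ?b" then show ?thesis by (rule rank2[of \<rho>y ?c, OF \<rho>y(1) bs b0 cs cnb])
 next
  assume "?b : ?r ?c" then show ?thesis by (rule rank2[of \<rho>z ?b, OF \<rho>z(1) cs c0 bs indep_sym[OF bs b0 cs cnb]])
 qed
 then obtain \<rho> s t where \<rho>: "\<rho> : mhom R M M" "\<rho> ` car M ~= car M" and s: "s : socv v M" "\<rho> s ~= 0[M]"
  and t: "t : socv v M" "\<rho> t ~: line M (\<rho> s)" by (elim exE bexE conjE)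
 have "\<not> inj_on \<rho> (car M)" using inj_iff_surj[OF M M \<rho>(1)] \<rho>(2) by simp
 then obtain u where u: "u : socv v M" "\<rho> u = 0[M]" "u ~= 0[M]"
  using inj_on_socle[OF Ml Ml \<rho>(1)] socv_le(1)[of _ M] eq by blast
 let ?S = "M on (soc M)"
 have Sf: "fd ?S" by (rule fd_sub[OF M ss])
 have rS: "\<rho> : mhom R ?S M" by (rule hom_restrict_sub[OF Ml Ml \<rho>(1) ss])
 have imle: "\<rho> ` soc M <= soc M" using hom_soc[OF Ml Ml \<rho>(1)] by blast
 have imS: "sub M (\<rho> ` soc M)" by (rule sub_image[OF Ml Ml \<rho>(1) ss])
 have rsv: "\<rho> s : socv v M" "\<rho> t : socv v M" using hom_socv[OF Ml Ml v \<rho>(1)] s(1) t(1) by blast+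
 have two: "2 \<le> dm (M on (\<rho> ` soc M))"
 proof -
  have "line M (\<rho> s) <= \<rho> ` soc M" "line M (\<rho> t) <= \<rho> ` soc M"
   by (rule line_least[OF Ml imS imageI[OF socvD(2)[OF s(1)]]], rule line_least[OF Ml imS imageI[OF socvD(2)[OF t(1)]]])
  then have "lines M (\<rho> s) (\<rho> t) <= \<rho> ` soc M" by (rule M.set_add_least[OF imS])
  then have "dm (M on (lines M (\<rho> s) (\<rho> t))) \<le> dm (M on (\<rho> ` soc M))"
   by (rule dm_mono(1)[OF M sub_lines(1)[OF Ml rsv(1) v rsv(2) v] imS])
  then show ?thesis using dm_lines[OF M rsv(1) v s(2) rsv(2) v t(2)] by simp
 qed
 let ?k = "{y : soc M. \<rho> y = 0[M]}"
 \<comment> \<open>Rank at least two and a nonzero kernel use up dimension three: the kernel on the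
   socle is the line of \<open>u\<close>, and the image is a proper submodule of the socle.\<close>
 have rn: "3 = dm (M on ?k) + dm (M on (\<rho> ` soc M))"
  using dm_image[OF Sf Ml rS] d3 by simp
 have ksub: "sub M ?k"
 proof -
  have "?k = soc M \<inter> {y : car M. \<rho> y = 0[M]}" using M.sub_subset[OF ss] by fast
  then show ?thesis using M.sub_Int[OF ss sub_kernel[OF Ml Ml \<rho>(1)]] by (simp only:)
 qed
 have uk: "line M u <= ?k" by (rule line_least[OF Ml ksub]) (use u socvD(2)[OF u(1)] in blast)
 have l1: "dm (M on (line M u)) = 1" by (rule dm_line[OF Ml M u(1) v u(3)])
 have "dm (M on (line M u)) = dm (M on ?k)"
  using dm_mono(1)[OF M line_sub[OF Ml u(1) v] ksub uk] l1 rn two by simp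
 then have ku: "line M u = ?k" by (rule dm_mono(2)[OF M line_sub[OF Ml u(1) v] ksub uk])
 have "dm (M on (\<rho> ` soc M)) ~= 3" using rn ku l1 by simp
 then have "\<rho> ` soc M ~= soc M" using d3 by auto
 then obtain a where a: "a : socv v M" "a ~: \<rho> ` soc M" using imle eq by blast
 have a0': "a ~= 0[M]" using a(2) M.sub_zero[OF imS] by blast
 obtain Y :: "('k, 'a) fd_module" and p where q: "quot M a Y p" by (rule quot_exists[OF M a(1) v])
 have pr: "(%x. p (\<rho> x)) : mhom R M Y" by (rule hom_comp[OF \<rho>(1) quotD(2)[OF q]])
 have "(%x. p (\<rho> x)) ` car M = car Y"
 proof (rule surj_of_kernel[OF q a(1) v a0' u(1) v u(3) pr])
  show "p (\<rho> u) = 0[Y]" using u(2) hom_zero[OF Ml fd_lm[OF quotD(1)[OF q]] quotD(2)[OF q]] by simp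
  fix w assume w: "w : soc M" "p (\<rho> w) = 0[Y]"
  have "\<rho> w : line M a" using quotD(4)[OF q hom_closed[OF \<rho>(1)]] w M.sub_carrier[OF ss] by blast
  moreover have "\<rho> w : \<rho> ` soc M" using w(1) by blast
  ultimately have "\<rho> w = 0[M]" using line_inter[OF Ml a(1) v imS a(2)] by blast
  then show "w : line M u" using ku w(1) by blast
 qed
 moreover have "(%x. p (\<rho> x)) ` car M ~= car Y"
  by (rule hollow_comp_not_surj[OF Ml fd_lm[OF quotD(1)[OF q]] Ml h \<rho>(1) quotD(2)[OF q] \<rho>(2) quot_nonzero[OF q a(1) v a0']])
 ultimately show False by blast
qed

end

context minimal_socle
begin

lemma socle_decomposition:
 assumes a: "a : socv i M" "i : I" "a ~= 0[M]" and b: "b : socv k M" "k : I" "b ~: line M a"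
  and c: "c : socv l M" "l : I" "c ~: lines M a b" and s: "s : soc M"
 obtains \<alpha> \<beta> \<gamma> where "\<alpha> : car K" "\<beta> : car K" "\<gamma> : car K"
  "s = (scl M \<alpha> a +[M] scl M \<beta> b) +[M] scl M \<gamma> c"
proof -
 interpret M: left_module R M by (rule Ml)
 note L = sub_lines[OF Ml a(1,2) b(1,2)] and lc = line_sub[OF Ml c(1,2)]
 let ?T = "set_add M (lines M a b) (line M c)"
 have T: "sub M ?T" by (rule M.sub_set_add[OF L(1) lc])
 have le: "?T <= soc M"
  by (rule M.set_add_least[OF sub_soc[OF Ml] L(4) line_least[OF Ml sub_soc[OF Ml] socvD(2)[OF c(1)]]])
 have "dm (M on ?T) = dm (M on (soc M))"
  using dm_set_add_line[OF M L(1) c] dm_lines[OF M a b] d3 by simp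
 then have "s : ?T" using dm_mono(2)[OF M T sub_soc[OF Ml] le] s by blast
 then obtain u t where u: "u : lines M a b" and t: "t : line M c" and e: "s = u +[M] t" by (rule set_addE)
 obtain x y where x: "x : line M a" and y: "y : line M b" and e': "u = x +[M] y" using u by (rule set_addE)
 obtain \<alpha> where \<alpha>: "\<alpha> : car K" "x = scl M \<alpha> a" using x by (rule lineE)
 obtain \<beta> where \<beta>: "\<beta> : car K" "y = scl M \<beta> b" using y by (rule lineE)
 obtain \<gamma> where \<gamma>: "\<gamma> : car K" "t = scl M \<gamma> c" using t by (rule lineE)
 show thesis by (rule that[OF \<alpha>(1) \<beta>(1) \<gamma>(1)]) (simp only: e e' \<alpha>(2) \<beta>(2) \<gamma>(2))
qed

text \<open>On the socle, with basis \<open>a\<close>, \<open>b\<close>, \<open>c\<close>, the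
  composite \<open>g p\<close> sends \<open>a\<close> to zero, \<open>b\<close> to a nonzero
  multiple of \<open>p' a\<close> and \<open>c\<close> to \<open>p' c\<close>. The last two are
  independent modulo the line of \<open>b\<close>, so the kernel on the socle is the line of
  \<open>a\<close> and \<open>surj_of_kernel\<close> applies.\<close>

lemma glue_surj:
 assumes q: "quot M a Y p" and q': "quot M b Y' p'"
  and a: "a : socv i M" "i : I" "a ~= 0[M]" and b: "b : socv k M" "k : I" "b ~: line M a"
  and c: "c : socv l M" "l : I" "c ~: lines M a b"
  and g: "g : mhom R Y Y'" and gc: "g (p c) = p' c" and gb: "g (p b) = scl Y' x (p' a)"
  and x: "x : car K" "x ~= 0[K]"
 shows "(%y. g (p y)) ` car M = car Y'"
proof -
 interpret M: left_module R M by (rule Ml)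
 interpret K: field K by (rule field_K)
 note Yl = fd_lm[OF quotD(1)[OF q]] and Yl' = fd_lm[OF quotD(1)[OF q']]
 note p = quotD(2)[OF q] and p' = quotD(2)[OF q']
 note ac = socvD(1)[OF a(1)] and bc = socvD(1)[OF b(1)] and cc = socvD(1)[OF c(1)]
 have la: "sub M (line M a)" and lb: "sub M (line M b)" by (rule line_sub[OF Ml a(1,2)], rule line_sub[OF Ml b(1,2)])
 have b0: "b ~= 0[M]" using b(3) M.sub_zero[OF la] by blast
 note L = sub_lines[OF Ml a(1,2) b(1,2)]
 have h: "(%y. g (p y)) : mhom R M Y'" by (rule hom_comp[OF p g])
 have pa: "p a = 0[Y]" using quotD(4)[OF q ac] line_self[OF Ml ac] by blast
 have ga: "g (p a) = 0[Y']" unfolding pa by (rule hom_zero[OF Yl Yl' g])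
 show ?thesis
 proof (rule surj_of_kernel[OF q' b(1,2) b0 a h])
  show "g (p a) = 0[Y']" by (rule ga)
  fix s assume s: "s : soc M" "g (p s) = 0[Y']"
  obtain \<alpha> \<beta> \<gamma> where co: "\<alpha> : car K" "\<beta> : car K" "\<gamma> : car K"
   and se: "s = (scl M \<alpha> a +[M] scl M \<beta> b) +[M] scl M \<gamma> c" by (rule socle_decomposition[OF a b c s(1)], rule that)
  have sc: "scl M \<alpha> a : car M" "scl M \<beta> b : car M" "scl M \<gamma> c : car M"
   using co ac bc cc by (simp_all add: scl_closed[OF Ml])
  let ?r = "scl M (\<beta> *[K] x) a +[M] scl M \<gamma> c"
  have bx: "\<beta> *[K] x : car K" using co x by simp
  have rac: "scl M (\<beta> *[K] x) a : car M" by (rule scl_closed[OF Ml bx ac])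
  interpret Y': left_module R Y' by (rule Yl')
  have pac: "p' a : car Y'" by (rule hom_closed[OF p' ac])
  have "g (p s) = (scl Y' \<alpha> (g (p a)) +[Y'] scl Y' \<beta> (g (p b))) +[Y'] scl Y' \<gamma> (g (p c))"
   unfolding se using sc co ac bc cc
   by (simp add: hom_add[OF h] M.M.a_closed hom_scl[where f="%y. g (p y)", OF h])
  also have "\<dots> = p' ?r"
   unfolding ga gb gc using co x ac cc bx rac sc pac
   by (simp add: scl_zero[OF Yl'] scl_scl[OF Yl'] hom_add[OF p'] hom_scl[OF p'] scl_closed[OF Yl'])
  finally have "?r : line M b" using s(2) quotD(4)[OF q', of ?r] rac sc by simp
  then have rL: "?r : lines M a b" using L(3) by blast
  have g0: "\<gamma> = 0[K]"
  proof (rule ccontr)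
   assume n: "\<gamma> ~= 0[K]"
   have "scl M \<gamma> c : lines M a b"
    by (rule M.sub_add_mem[OF L(1) sc(3) subsetD[OF L(2) lineI[OF bx]]]) (use rL M.M.a_comm[OF sc(3) rac] in simp)
   then show False using scl_cancel[OF Ml L(1) co(3) n cc] c(3) by blast
  qed
  have "\<beta> *[K] x = 0[K]"
  proof (rule ccontr)
   assume n: "\<beta> *[K] x ~= 0[K]"
   have "scl M (\<beta> *[K] x) a : line M b" using \<open>?r : line M b\<close> rac unfolding g0 zero_scl[OF Ml cc] by simp
   then have "a : line M b" by (rule scl_cancel[OF Ml lb bx n ac])
   then show False using line_sym[OF Ml bc _ a(3) la line_self[OF Ml ac]] b(3) by blast
  qed
  then have "\<beta> = 0[K]" using K.integral_iff[OF co(2) x(1)] x(2) by simp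
  then show "s : line M a" unfolding se g0 using zero_scl[OF Ml bc] zero_scl[OF Ml cc] sc(1) lineI[OF co(1)] by simp
 qed
qed

text \<open>If \<open>g (p b)\<close> were zero, then either \<open>g p\<close> is onto with
  \<open>a\<close> and \<open>b\<close> in its kernel, or \<open>p' - g p\<close> is onto with
  \<open>b\<close> and \<open>c\<close> in its kernel; both kernels would have to be lines. As an
  element at vertex \<open>k\<close>, the nonzero \<open>g (p b)\<close> comes from
  \<open>socv k M\<close> outside the line of \<open>b\<close>, and \<open>alt\<close> then leaves
  nonzero multiples of \<open>p' a\<close> only.\<close>

lemma glue_direction:
 assumes q: "quot M a Y p" and q': "quot M b Y' p'"
  and a: "a : socv i M" "i : I" "a ~= 0[M]" and b: "b : socv k M" "k : I" "b ~: line M a"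
  and c: "c : socv l M" "l : I" "c ~: lines M a b"
  and g: "g : mhom R Y Y'" and gc: "g (p c) = p' c"
  and alt: "socv k M <= line M b \<or> socv k M <= lines M a b"
 shows "\<not> socv k M <= line M b \<and> (\<exists>x\<in>car K. x ~= 0[K] \<and> g (p b) = scl Y' x (p' a) \<and> (%y. g (p y)) ` car M = car Y')"
proof -
 interpret M: left_module R M by (rule Ml)
 note Yl = fd_lm[OF quotD(1)[OF q]] and Yl' = fd_lm[OF quotD(1)[OF q']]
 interpret Y': left_module R Y' by (rule Yl')
 note p = quotD(2)[OF q] and p' = quotD(2)[OF q']
 note ac = socvD(1)[OF a(1)] and bc = socvD(1)[OF b(1)] and cc = socvD(1)[OF c(1)]
 have la: "sub M (line M a)" and lb: "sub M (line M b)" by (rule line_sub[OF Ml a(1,2)], rule line_sub[OF Ml b(1,2)])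
 have b0: "b ~= 0[M]" using b(3) M.sub_zero[OF la] by blast
 note L = sub_lines[OF Ml a(1,2) b(1,2)]
 have c0: "c ~= 0[M]" using c(3) M.sub_zero[OF L(1)] by blast
 have hg: "(%y. g (p y)) : mhom R M Y'" by (rule hom_comp[OF p g])
 have pa: "p a = 0[Y]" using quotD(4)[OF q ac] line_self[OF Ml ac] by blast
 have ga: "g (p a) = 0[Y']" unfolding pa by (rule hom_zero[OF Yl Yl' g])
 have pb: "p' b = 0[Y']" using quotD(4)[OF q' bc] line_self[OF Ml bc] by blast
 have nz: "g (p b) ~= 0[Y']"
 proof
  assume gb: "g (p b) = 0[Y']"
  show False
  proof (cases "(%y. g (p y)) ` car M = car Y'")
   case True
   from kernel_of_surj[where f="%y. g (p y)" and a=a and x=b, OF M q' b(1,2) b0 a hg True ga bc gb]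
   have "b : line M a" .
   then show False using b(3) by blast
  next
   case False
   let ?d = "%y. p' y -[Y'] g (p y)"
   have d: "?d : mhom R M Y'" by (rule hom_minus[OF Ml Yl' p' hg])
   have ds: "?d ` car M = car Y'"
    by (rule hollow_diff_surj[OF Ml Yl' quot_hollow[OF q' b(1,2) b0] p' hg quotD(3)[OF q'] False])
   have dc: "?d c = 0[Y']" using gc Y'.diff_self[OF hom_closed[OF p' cc]] by simp
   have db: "?d b = 0[Y']" using gb pb by simp
   have "b : line M c" by (rule kernel_of_surj[where f="?d" and a=c and x=b, OF M q' b(1,2) b0 c(1,2) c0 d ds dc bc db])
   then have "c : line M b" by (rule line_sym[OF Ml cc _ b0 lb line_self[OF Ml bc]])
   then show False using c(3) L(3) by blast
  qed
 qed
 have gk: "g (p b) : socv k Y'" by (rule hom_socv[OF Yl Yl' b(2) g hom_socv[OF Ml Yl b(2) p b(1)]])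
 obtain s where s: "s : socv k M" "g (p b) = p' s"
  by (rule quot_socle_preimage[OF Ml q' small[OF b(2,1) b0 q'] b(2) gk], rule that)
 note sc = socvD(1)[OF s(1)]
 have nb: "s ~: line M b" using quotD(4)[OF q' sc] nz s(2) by auto
 then have "s : lines M a b" using alt s(1) by blast
 then obtain u w where u: "u : line M a" and w: "w : line M b" and e: "s = u +[M] w" by (rule set_addE)
 obtain x where x: "x : car K" "u = scl M x a" using u by (rule lineE)
 note uc = M.sub_carrier[OF la u] and wc = M.sub_carrier[OF lb w]
 have pw: "p' w = 0[Y']" using quotD(4)[OF q' wc] w by blast
 have gb: "g (p b) = scl Y' x (p' a)"
  unfolding s(2) e using hom_add[OF p' uc wc] pw hom_closed[OF p' uc] hom_scl[OF p' x(1) ac] x(2) by simp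
 have x0: "x ~= 0[K]"
 proof
  assume "x = 0[K]"
  then show False using gb nz zero_scl[OF Yl' hom_closed[OF p' ac]] by simp
 qed
 show ?thesis using nb s(1) x x0 gb glue_surj[OF q q' a b c g gc gb x(1) x0] by blast
qed

text \<open>\<open>socle_extension\<close> matches the images of \<open>c\<close> in
  \<open>M/a\<close> and \<open>M/b\<close> by a map \<open>g\<close> in one direction. By
  \<open>glue_direction\<close> the image of \<open>b\<close> (in the other direction, of
  \<open>a\<close>) goes to a multiple \<open>x\<close> of the image of the other element, which
  rules out the first alternative and leaves \<open>\<rho>\<close> available. The surjection
  \<open>g p - x p' \<rho>\<close>, in the other direction \<open>p\<close> minus the inverse of
  \<open>x\<close> times \<open>g p' \<rho>\<close>, kills both \<open>a\<close> and
  \<open>b\<close>, whereas its kernel has to be a line.\<close>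

lemma three_lines_false:
 assumes a: "a : socv i M" "i : I" "a ~= 0[M]" and b: "b : socv k M" "k : I" "b ~: line M a"
  and c: "c : socv l M" "l : I" "c ~: lines M a b"
  and alt: "socv i M <= line M a \<and> socv k M <= line M b \<or>
   i = k \<and> socv i M <= lines M a b \<and> (\<exists>\<rho>\<in>mhom R M M. \<rho> ` car M ~= car M \<and> \<rho> b = a \<and> \<rho> a = 0[M])"
 shows False
proof -
 interpret M: left_module R M by (rule Ml)
 interpret K: field K by (rule field_K)
 note ac = socvD(1)[OF a(1)] and bc = socvD(1)[OF b(1)] and cc = socvD(1)[OF c(1)]
 have la: "sub M (line M a)" and lb: "sub M (line M b)" by (rule line_sub[OF Ml a(1,2)], rule line_sub[OF Ml b(1,2)])
 have b0: "b ~= 0[M]" using b(3) M.sub_zero[OF la] by blast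
 note L = sub_lines[OF Ml a(1,2) b(1,2)]
 have anb: "a ~: line M b"
  using line_sym[OF Ml bc _ a(3) la line_self[OF Ml ac]] b(3) by blast
 have comm: "lines M b a = lines M a b" by (rule M.set_add_comm[OF M.sub_subset[OF lb] M.sub_subset[OF la]])
 have c': "c ~: lines M b a" using c(3) comm by simp
 obtain Y :: "('k, 'a) fd_module" and p where q: "quot M a Y p" by (rule quot_exists[OF M a(1,2)])
 obtain Y' :: "('k, 'a) fd_module" and p' where q': "quot M b Y' p'" by (rule quot_exists[OF M b(1,2)])
 note Yl = fd_lm[OF quotD(1)[OF q]] and Yl' = fd_lm[OF quotD(1)[OF q']]
 note p = quotD(2)[OF q] and p' = quotD(2)[OF q']
 interpret Y: left_module R Y by (rule Yl)
 interpret Y': left_module R Y' by (rule Yl')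
 note hY = quot_hollow[OF q a] and hY' = quot_hollow[OF q' b(1,2) b0]
 have pa: "p a = 0[Y]" using quotD(4)[OF q ac] line_self[OF Ml ac] by blast
 have pb0: "p b ~= 0[Y]" using quotD(4)[OF q bc] b(3) by blast
 have "c ~: line M a" "c ~: line M b" using c(3) L(2,3) by blast+
 then have pc0: "p c ~= 0[Y]" "p' c ~= 0[Y']" using quotD(4)[OF q cc] quotD(4)[OF q' cc] by blast+
 have pcb: "p c ~: line Y (p b)"
 proof
  assume "p c : line Y (p b)"
  then obtain x where x: "x : car K" "p c = scl Y x (p b)" by (rule lineE)
  have xb: "scl M x b : car M" by (rule scl_closed[OF Ml x(1) bc])
  have "p (c -[M] scl M x b) = p c -[Y] p (scl M x b)" by (rule hom_diff[OF Ml Yl p cc xb])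
  also have "\<dots> = 0[Y]" unfolding hom_scl[OF p x(1) bc] x(2)[symmetric] by (rule Y.diff_self[OF hom_closed[OF p cc]])
  finally have "c -[M] scl M x b : line M a" using quotD(4)[OF q M.M.minus_closed[OF cc xb]] by blast
  then have "c -[M] scl M x b : lines M a b" using L(2) by blast
  then have "c : lines M a b" by (rule M.sub_diff_mem[OF L(1) cc subsetD[OF L(3) lineI[OF x(1)]]])
  then show False using c(3) by blast
 qed
 have nu: "\<not> uniform Y"
  by (rule not_uniformI[OF Yl hom_socv[OF Ml Yl b(2) p b(1)] b(2) pb0 hom_socv[OF Ml Yl c(2) p c(1)] c(2) pcb])
 have alt1: "socv k M <= line M b \<or> socv k M <= lines M a b" and alt2: "socv i M <= line M a \<or> socv i M <= lines M b a"
  using alt comm by auto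
 have disj: "(\<exists>g\<in>mhom R Y Y'. g (p c) = p' c) \<or> (\<exists>g\<in>mhom R Y' Y. g (p' c) = p c)"
  by (rule socle_extension[OF quotD(1)[OF q] hY quotD(1)[OF q'] hY' disjI1[OF nu] c(2)
    hom_socv[OF Ml Yl c(2) p c(1)] pc0(1) hom_socv[OF Ml Yl' c(2) p' c(1)] pc0(2)])
 then show False
 proof
  assume "\<exists>g\<in>mhom R Y Y'. g (p c) = p' c"
  then obtain g where g: "g : mhom R Y Y'" "g (p c) = p' c" by blast
  from glue_direction[OF q q' a b c g alt1]
  obtain x where nn: "\<not> socv k M <= line M b" and x: "x : car K" "x ~= 0[K]" "g (p b) = scl Y' x (p' a)"
   "(%y. g (p y)) ` car M = car Y'" by blast
  obtain \<rho> where r: "\<rho> : mhom R M M" "\<rho> ` car M ~= car M" "\<rho> b = a" "\<rho> a = 0[M]" using alt nn by blast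
  have h1: "(%y. p' (\<rho> y)) : mhom R M Y'" by (rule hom_comp[OF r(1) p'])
  have s1: "(%y. p' (\<rho> y)) ` car M ~= car Y'"
   by (rule hollow_comp_not_surj[OF Ml Yl' Ml h r(1) p' r(2) quot_nonzero[OF q' b(1,2) b0]])
  note h2 = nonsurj_scl[OF Ml Yl' h1 x(1) s1]
  have hg: "(%y. g (p y)) : mhom R M Y'" by (rule hom_comp[OF p g(1)])
  let ?d = "%y. g (p y) -[Y'] scl Y' x (p' (\<rho> y))"
  have d: "?d : mhom R M Y'" by (rule hom_minus[OF Ml Yl' hg h2(1)])
  have ds: "?d ` car M = car Y'" by (rule hollow_diff_surj[OF Ml Yl' hY' hg h2(1) x(4) h2(2)])
  have da: "?d a = 0[Y']" using pa hom_zero[OF Yl Yl' g(1)] r(4) hom_zero[OF Ml Yl' p'] scl_zero[OF Yl' x(1)] by simp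
  have db: "?d b = 0[Y']" unfolding x(3) r(3) by (rule Y'.diff_self[OF scl_closed[OF Yl' x(1) hom_closed[OF p' ac]]])
  have "b : line M a" by (rule kernel_of_surj[where f="?d" and a=a and x=b, OF M q' b(1,2) b0 a d ds da bc db])
  then show False using b(3) by blast
 next
  assume "\<exists>g\<in>mhom R Y' Y. g (p' c) = p c"
  then obtain g where g: "g : mhom R Y' Y" "g (p' c) = p c" by blast
  from glue_direction[OF q' q b(1,2) b0 a(1,2) anb c(1,2) c' g alt2]
  obtain x where nn: "\<not> socv i M <= line M a" and x: "x : car K" "x ~= 0[K]" "g (p' a) = scl Y x (p b)" by blast
  obtain \<rho> where r: "\<rho> : mhom R M M" "\<rho> ` car M ~= car M" "\<rho> b = a" "\<rho> a = 0[M]" using alt nn by blast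
  let ?y = "inv\<^bsub>K\<^esub> x"
  have y: "?y : car K" "?y *[K] x = 1[K]" using x K.field_Units by auto
  have gp: "(%z. g (p' z)) : mhom R M Y" by (rule hom_comp[OF p' g(1)])
  have h1: "(%z. g (p' (\<rho> z))) : mhom R M Y" by (rule hom_comp[OF r(1) gp])
  have s1: "(%z. g (p' (\<rho> z))) ` car M ~= car Y"
   by (rule hollow_comp_not_surj[OF Ml Yl Ml h r(1) gp r(2) quot_nonzero[OF q a]])
  note h2 = nonsurj_scl[OF Ml Yl h1 y(1) s1]
  let ?d = "%z. p z -[Y] scl Y ?y (g (p' (\<rho> z)))"
  have d: "?d : mhom R M Y" by (rule hom_minus[OF Ml Yl p h2(1)])
  have ds: "?d ` car M = car Y" by (rule hollow_diff_surj[OF Ml Yl hY p h2(1) quotD(3)[OF q] h2(2)])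
  have da: "?d a = 0[Y]" using pa r(4) hom_zero[OF Ml Yl' p'] hom_zero[OF Yl' Yl g(1)] scl_zero[OF Yl y(1)] by simp
  have pbc: "p b : car Y" by (rule hom_closed[OF p bc])
  have db: "?d b = 0[Y]"
   unfolding r(3) x(3) scl_scl[OF Yl y(1) x(1) pbc] y(2) scl_one[OF Yl pbc] by (rule Y.diff_self[OF pbc])
  have "b : line M a" by (rule kernel_of_surj[where f="?d" and a=a and x=b, OF M q a a d ds da bc db])
  then show False using b(3) by blast
 qed
qed

text \<open>If some vertex carries just one line \<open>c\<close> of the socle, the other two lines
  lie at other vertices: two different ones give the first alternative of
  \<open>three_lines_false\<close>, a common one gives the second after normalising an endomorphism.
  If every vertex that occurs carries at least two lines, dimension three leaves room for a single
  vertex.\<close>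

lemma socle_not_three: False
proof -
 interpret M: left_module R M by (rule Ml)
 note ss = sub_soc[OF Ml]
 have scM: "s : car M" if "s : soc M" for s by (rule M.sub_carrier[OF ss that])
 show False
 proof (cases "\<exists>w\<in>I. \<exists>c\<in>socv w M. c ~= 0[M] \<and> socv w M <= line M c")
  case True
  then obtain w c where w: "w : I" and c: "c : socv w M" "c ~= 0[M]" and cw: "socv w M <= line M c" by blast
  note lc = line_sub[OF Ml c(1) w]
  \<comment> \<open>A submodule that contains the line of \<open>c\<close> but not the whole socle
    misses an element at some vertex; that vertex cannot be \<open>w\<close>, whose part of the
    socle is this line.\<close>
  have pick: "\<exists>k\<in>I. k ~= w \<and> (\<exists>b\<in>socv k M. b ~: A)" if A: "sub M A" and lA: "line M c <= A" and d: "dm (M on A) < 3" for A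
  proof -
   have "\<not> soc M <= A" using dm_mono(1)[OF M ss A] d d3 by auto
   then obtain s where s: "s : soc M" "s ~: A" by blast
   obtain k where k: "k : I" "e k .[M] s ~: A" using ex_component[OF Ml A scM[OF s(1)] s(2)] by blast
   have "e k .[M] s : socv k M" by (rule e_in_socv[OF Ml k(1) s(1)])
   moreover have "k ~= w"
   proof
    assume "k = w"
    then have "e k .[M] s : socv w M" using \<open>e k .[M] s : socv k M\<close> by simp
    then show False using cw lA k(2) by blast
   qed
   ultimately show ?thesis using k by blast
  qed
  obtain i a where i: "i : I" "i ~= w" and a: "a : socv i M" "a ~: line M c"
   using pick[OF lc order_refl] dm_line[OF Ml M c(1) w c(2)] by auto
  note L1 = sub_lines[OF Ml c(1) w a(1) i(1)]
  obtain k b where k: "k : I" "k ~= w" and b: "b : socv k M" "b ~: lines M c a"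
   using pick[OF L1(1,2)] dm_lines[OF M c(1) w c(2) a(1) i(1) a(2)] by auto
  note la = line_sub[OF Ml a(1) i(1)] and lb = line_sub[OF Ml b(1) k(1)]
  have a0: "a ~= 0[M]" using a(2) M.sub_zero[OF lc] by blast
  have bna: "b ~: line M a" using b(2) L1(3) by blast
  note ac = socvD(1)[OF a(1)] and bc = socvD(1)[OF b(1)] and cc = socvD(1)[OF c(1)]
  note L = sub_lines[OF Ml a(1) i(1) b(1) k(1)]
  have cn: "c ~: lines M a b"
  proof
   assume cL: "c : lines M a b"
   have le1: "lines M c a <= lines M a b" by (rule M.set_add_least[OF L(1) line_least[OF Ml L(1) cL] L(2)])
   have "lines M c a = lines M a b"
    by (rule dm_mono(2)[OF M L1(1) L(1) le1])
     (simp add: dm_lines[OF M c(1) w c(2) a(1) i(1) a(2)] dm_lines[OF M a(1) i(1) a0 b(1) k(1) bna])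
   then show False using b(2) L(3) line_self[OF Ml bc] by blast
  qed
  have comp: "\<exists>\<alpha>\<in>car K. \<exists>\<beta>\<in>car K. s = e j .[M] scl M \<alpha> a +[M] e j .[M] scl M \<beta> b"
   if j: "j : I" "j ~= w" and s: "s : socv j M" for j s
  proof -
   obtain \<alpha> \<beta> \<gamma> where co: "\<alpha> : car K" "\<beta> : car K" "\<gamma> : car K"
    and se: "s = (scl M \<alpha> a +[M] scl M \<beta> b) +[M] scl M \<gamma> c"
    by (rule socle_decomposition[OF a(1) i(1) a0 b(1) k(1) bna c(1) w cn socvD(2)[OF s]], rule that)
   have sc: "scl M \<alpha> a : car M" "scl M \<beta> b : car M" "scl M \<gamma> c : car M"
    using co ac bc cc by (simp_all add: scl_closed[OF Ml])
   note ej = e_closed[OF j(1)]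
   have "e j .[M] scl M \<gamma> c = 0[M]"
    by (rule e_other[OF Ml line_socv[OF Ml c(1) w lineI[OF co(3)]] w j])
   then have "e j .[M] s = e j .[M] scl M \<alpha> a +[M] e j .[M] scl M \<beta> b"
    unfolding se using sc ej by (simp add: M.smult_r_distr M.smult_closed)
   then show ?thesis using socvD(3)[OF s] co by auto
  qed
  show False
  proof (cases "i = k")
   case False
   have other: "socv j M <= line M x"
    if j: "j : I" "j ~= w" and "(j = i \<and> x = a) \<or> (j = k \<and> x = b)" for j x
   proof
    fix s assume "s : socv j M"
    then obtain \<alpha> \<beta> where co: "\<alpha> : car K" "\<beta> : car K"
     and se: "s = e j .[M] scl M \<alpha> a +[M] e j .[M] scl M \<beta> b" using comp[OF j] by blast
    have sa: "scl M \<alpha> a : socv i M" and sb: "scl M \<beta> b : socv k M"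
     using line_socv[OF Ml a(1) i(1) lineI[OF co(1)]] line_socv[OF Ml b(1) k(1) lineI[OF co(2)]] .
    from that(3) show "s : line M x"
    proof
     assume x: "j = i \<and> x = a"
     then have "s = scl M \<alpha> a" unfolding se
      using socvD(3)[OF sa] e_other[OF Ml sb k(1) i(1) False] socvD(1)[OF sa] by simp
     then show ?thesis using x lineI[OF co(1)] by simp
    next
     assume x: "j = k \<and> x = b"
     then have "s = scl M \<beta> b" unfolding se
      using socvD(3)[OF sb] e_other[OF Ml sa i(1) k(1)] False socvD(1)[OF sb] by simp
     then show ?thesis using x lineI[OF co(2)] by simp
    qed
   qed
   show False
    by (rule three_lines_false[OF a(1) i(1) a0 b(1) k(1) bna c(1) w cn])
     (rule disjI1, rule conjI, rule other[OF i], simp, rule other[OF k], simp)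
  next
   case True
   have bi: "b : socv i M" using b(1) True by simp
   have span: "socv i M <= lines M a b"
   proof
    fix s assume "s : socv i M"
    then obtain \<alpha> \<beta> where co: "\<alpha> : car K" "\<beta> : car K"
     and se: "s = e i .[M] scl M \<alpha> a +[M] e i .[M] scl M \<beta> b" using comp[OF i] by blast
    have sa: "scl M \<alpha> a : socv i M" and sb: "scl M \<beta> b : socv i M"
     using line_socv[OF Ml a(1) i(1) lineI[OF co(1)]] line_socv[OF Ml bi i(1) lineI[OF co(2)]] .
    show "s : lines M a b" unfolding se socvD(3)[OF sa] socvD(3)[OF sb]
     by (rule set_addI[OF lineI[OF co(1)] lineI[OF co(2)]])
   qed
   have nu: "\<not> uniform M" by (rule not_uniformI[OF Ml a(1) i(1) a0 b(1) k(1) bna])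
   have b0: "b ~= 0[M]" using bna M.sub_zero[OF la] by blast
   have anb: "a ~: line M b" using line_sym[OF Ml bc _ a0 la line_self[OF Ml ac]] bna by blast
   have comm: "lines M b a = lines M a b" by (rule M.set_add_comm[OF M.sub_subset[OF lb] M.sub_subset[OF la]])
   \<comment> \<open>Normalising the endomorphism replaces \<open>x\<close> by \<open>x'\<close> but
     keeps the plane spanned with \<open>y\<close>, so \<open>c\<close> stays independent of
     it.\<close>
   have step: False
    if x: "x : socv i M" "x ~= 0[M]" and y: "y : socv i M" "y ~: line M x" and f: "f : mhom R M M" "f y = x"
     and xy: "lines M x y = lines M a b" for x y f
   proof -
    have sp: "socv i M <= lines M x y" using span xy by simp
    obtain x' \<rho> where x': "x' : socv i M" "x' ~: line M y" and r: "\<rho> : mhom R M M" "\<rho> ` car M ~= car M"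
     "\<rho> y = x'" "\<rho> x' = 0[M]" and m: "x : lines M x' y" "x' : lines M x y"
     by (rule nilpotent_step[OF M h nu i(1) x y f sp], rule that)
    note ly = line_sub[OF Ml y(1) i(1)] and lx' = line_sub[OF Ml x'(1) i(1)]
    note L2 = sub_lines[OF Ml x'(1) i(1) y(1) i(1)] and L3 = sub_lines[OF Ml x(1) i(1) y(1) i(1)]
    have x'0: "x' ~= 0[M]" using x'(2) M.sub_zero[OF ly] by blast
    have y0: "y ~= 0[M]" using y(2) M.sub_zero[OF line_sub[OF Ml x(1) i(1)]] by blast
    have ynx': "y ~: line M x'"
     using line_sym[OF Ml socvD(1)[OF x'(1)] _ y0 ly line_self[OF Ml socvD(1)[OF y(1)]]] x'(2) by blast
    have eq: "lines M x' y = lines M a b"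
    proof
     show "lines M x' y <= lines M a b"
      unfolding xy[symmetric] by (rule M.set_add_least[OF L3(1) line_least[OF Ml L3(1) m(2)] L3(3)])
     show "lines M a b <= lines M x' y"
      unfolding xy[symmetric] by (rule M.set_add_least[OF L2(1) line_least[OF Ml L2(1) m(1)] L2(3)])
    qed
    have cn': "c ~: lines M x' y" using cn eq by simp
    have sp': "socv i M <= lines M x' y" using span eq by simp
    show False
     by (rule three_lines_false[OF x'(1) i(1) x'0 y(1) i(1) ynx' c(1) w cn']) (intro disjI2 conjI refl sp' bexI[of _ \<rho>] r)
   qed
   from socle_extension[OF M h M h disjI1[OF nu] i(1) a(1) a0 bi b0] show False
   proof
    assume "\<exists>f\<in>mhom R M M. f a = b"
    then obtain f where "f : mhom R M M" "f a = b" by blast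
    then show False by (rule step[OF bi b0 a(1) anb _ _ comm])
   next
    assume "\<exists>f\<in>mhom R M M. f b = a"
    then obtain f where "f : mhom R M M" "f b = a" by blast
    then show False by (rule step[OF a(1) a0 bi bna _ _ refl])
   qed
  qed
 next
  case False
  have nz: "soc M ~= {0[M]}" using d3 dm_zero_sub[OF M] by auto
  obtain v a where v: "v : I" and a: "a : socv v M" "a ~= 0[M]" by (rule ex_socv[OF Ml ss nz], rule that)
  have two: "\<exists>y\<in>socv k M. y ~: line M x" if "k : I" "x : socv k M" "x ~= 0[M]" for k x using False that by blast
  obtain b where b: "b : socv v M" "b ~: line M a" using two[OF v a] by blast
  have "soc M <= socv v M"
  proof (rule ccontr)
   assume "\<not> soc M <= socv v M"
   then obtain s where s: "s : soc M" "s ~: socv v M" by blast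
   note sv = sub_socv[OF Ml v]
   obtain k where k: "k : I" "e k .[M] s ~: socv v M" using ex_component[OF Ml sv scM[OF s(1)] s(2)] by blast
   let ?c = "e k .[M] s"
   have c: "?c : socv k M" by (rule e_in_socv[OF Ml k(1) s(1)])
   have kv: "k ~= v" using c k(2) by blast
   have c0: "?c ~= 0[M]" using k(2) M.sub_zero[OF sv] by metis
   obtain d where d: "d : socv k M" "d ~: line M ?c" using two[OF k(1) c c0] by blast
   note sk = sub_socv[OF Ml k(1)]
   have int: "socv v M \<inter> socv k M = {0[M]}" using socv_inter[OF Ml v k(1) kv] M.sub_zero[OF sv] M.sub_zero[OF sk] by blast
   have le: "set_add M (socv v M) (socv k M) <= soc M" by (rule M.set_add_least[OF ss]) (rule socv_le)+
   have "dm (M on (set_add M (socv v M) (socv k M))) = dm (M on (socv v M)) + dm (M on (socv k M))"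
    using dm_set_add[OF M sv sk] int dm_zero_sub[OF M] by simp
   moreover have "dm (M on (lines M a b)) \<le> dm (M on (socv v M))"
    by (rule dm_mono(1)[OF M sub_lines(1)[OF Ml a(1) v b(1) v] sv M.set_add_least[OF sv line_least[OF Ml sv a(1)] line_least[OF Ml sv b(1)]]])
   moreover have "dm (M on (lines M ?c d)) \<le> dm (M on (socv k M))"
    by (rule dm_mono(1)[OF M sub_lines(1)[OF Ml c k(1) d(1) k(1)] sk M.set_add_least[OF sk line_least[OF Ml sk c] line_least[OF Ml sk d(1)]]])
   moreover have "dm (M on (set_add M (socv v M) (socv k M))) \<le> 3"
    using dm_mono(1)[OF M M.sub_set_add[OF sv sk] ss le] d3 by simp
   ultimately show False
    using dm_lines[OF M a(1) v a(2) b(1) v b(2)] dm_lines[OF M c k(1) c0 d(1) k(1) d(2)] by simp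
  qed
  then show False by (rule same_vertex_false[OF v])
 qed
qed

end

section \<open>Hollow modules that are not uniform\<close>

context lc_algebra
begin

text \<open>In a counterexample of least dimension, every quotient by a line is hollow with socle of
  dimension at most two. It contains the image of the old socle, whose dimension drops by just one;
  hence the old socle has dimension three and its image is the whole new socle.\<close>

lemma socle_dim:
 fixes M :: "('k, 'a) fd_module"
 assumes "fd M" "hollow M"
 shows "dm (M on (soc M)) \<le> 2"
 using assms
proof (induction "dm M" arbitrary: M rule: less_induct)
 case less
 note M = less.prems(1) and h = less.prems(2)
 note Ml = fd_lm[OF M]
 interpret M: left_module R M by (rule Ml)
 note ss = sub_soc[OF Ml]
 show ?case
 proof (rule ccontr)
  assume "\<not> ?thesis"
  then have g3: "3 \<le> dm (M on (soc M))" by simp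
  have key: "dm (M on (soc M)) = 3 \<and> soc Y = p ` soc M"
   if i: "i : I" and a: "a : socv i M" "a ~= 0[M]" and q: "quot M a Y p" for i a and Y :: "('k, 'a) fd_module" and p
  proof -
   note Y = quotD(1)[OF q] and p = quotD(2)[OF q]
   note Yl = fd_lm[OF Y]
   note d = quot_dm[OF q M a(1) i a(2)]
   have "dm Y ~= 0" using d g3 dm_sub_le[OF M ss] by simp
   then have "car Y ~= {0[Y]}" using dm_zero_iff[OF Y] by simp
   then have "hollow Y" by (rule hollow_surj[OF M Y p h quotD(3)[OF q]])
   then have IH: "dm (Y on (soc Y)) \<le> 2" using less.hyps[OF _ Y] d by simp
   have le: "p ` soc M <= soc Y" using hom_soc[OF Ml Yl p] by blast
   have im: "sub Y (p ` soc M)" by (rule sub_image[OF Ml Yl p ss])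
   have ker: "{x : soc M. p x = 0[Y]} = line M a"
    using quotD(4)[OF q M.sub_carrier[OF ss]] line_least[OF Ml ss socvD(2)[OF a(1)]] by blast
   have rn: "dm (M on (soc M)) = 1 + dm (Y on (p ` soc M))"
    using dm_image[OF fd_sub[OF M ss] Yl hom_restrict_sub[OF Ml Yl p ss]] ker dm_line[OF Ml M a(1) i a(2)] by simp
   have l: "dm (Y on (p ` soc M)) \<le> dm (Y on (soc Y))" by (rule dm_mono(1)[OF Y im sub_soc[OF Yl] le])
   have "p ` soc M = soc Y" by (rule dm_mono(2)[OF Y im sub_soc[OF Yl] le]) (use l rn g3 IH in simp)
   then show ?thesis using rn g3 IH l by simp
  qed
  have nz: "soc M ~= {0[M]}" using g3 dm_zero_sub[OF M] by auto
  obtain v a where v: "v : I" and a: "a : socv v M" "a ~= 0[M]" by (rule ex_socv[OF Ml ss nz], rule that)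
  obtain Y :: "('k, 'a) fd_module" and p where q: "quot M a Y p" by (rule quot_exists[OF M a(1) v])
  interpret minimal_socle K R I e J M
   by unfold_locales (use M h key[OF v a q] key in blast)+
  show False by (rule socle_not_three)
 qed
qed

text \<open>By \<open>socle_dim\<close> any two independent lines fill the socle. If both lie at the
  same vertex, \<open>socle_extension\<close> links them by an endomorphism in one direction, and
  \<open>nilpotent_step\<close> normalises it; the lines are exchanged or replaced
  accordingly.\<close>

lemma nonuniform_socle:
 fixes M :: "('k, 'a) fd_module"
 assumes M: "fd M" and h: "hollow M" and nu: "\<not> uniform M"
 obtains i a k b where "i : I" "a : socv i M" "a ~= 0[M]" "k : I" "b : socv k M" "b ~: line M a" "soc M = lines M a b"
  "i ~= k \<or> (\<exists>\<rho>\<in>mhom R M M. \<rho> ` car M ~= car M \<and> \<rho> b = a \<and> \<rho> a = 0[M])"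
proof -
 note Ml = fd_lm[OF M]
 interpret M: left_module R M by (rule Ml)
 obtain i a k b where i: "i : I" and a: "a : socv i M" "a ~= 0[M]" and k: "k : I" and b: "b : socv k M" "b ~: line M a"
  by (rule not_uniformE[OF Ml nu hollow_sub_nonzero[OF h]], rule that)
 have all: "soc M = lines M x y" if x: "x : socv j M" "j : I" "x ~= 0[M]" and y: "y : socv l M" "l : I" "y ~: line M x" for j l x y
 proof -
  note L = sub_lines[OF Ml x(1,2) y(1,2)]
  have "lines M x y = soc M"
   by (rule dm_mono(2)[OF M L(1) sub_soc[OF Ml] L(4)])
    (use dm_lines[OF M x y] socle_dim[OF M h] dm_mono(1)[OF M L(1) sub_soc[OF Ml] L(4)] in simp)
  then show ?thesis ..
 qed
 show thesis
 proof (cases "i = k")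
  case False
  then show thesis using that[OF i a k b all[OF a(1) i a(2) b(1) k b(2)]] by blast
 next
  case True
  have bi: "b : socv i M" using b(1) True by simp
  note la = line_sub[OF Ml a(1) i]
  have b0: "b ~= 0[M]" using b(2) M.sub_zero[OF la] by blast
  have anb: "a ~: line M b"
   using line_sym[OF Ml socvD(1)[OF b(1)] _ a(2) la line_self[OF Ml socvD(1)[OF a(1)]]] b(2) by blast
  have step: thesis if x: "x : socv i M" "x ~= 0[M]" and y: "y : socv i M" "y ~: line M x" and f: "f : mhom R M M" "f y = x" for x y f
  proof -
   have sp: "socv i M <= lines M x y" using socv_le(1)[of i M] all[OF x(1) i x(2) y(1) i y(2)] by simp
   obtain x' \<rho> where x': "x' : socv i M" "x' ~: line M y" and r: "\<rho> : mhom R M M" "\<rho> ` car M ~= car M"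
    "\<rho> y = x'" "\<rho> x' = 0[M]"
    by (rule nilpotent_step[OF M h nu i x y f sp], rule that)
   note ly = line_sub[OF Ml y(1) i]
   have x'0: "x' ~= 0[M]" using x'(2) M.sub_zero[OF ly] by blast
   have y0: "y ~= 0[M]" using y(2) M.sub_zero[OF line_sub[OF Ml x(1) i]] by blast
   have ynx': "y ~: line M x'"
    using line_sym[OF Ml socvD(1)[OF x'(1)] _ y0 ly line_self[OF Ml socvD(1)[OF y(1)]]] x'(2) by blast
   show thesis
    by (rule \<open>!!j c l d. j : I ==> c : socv j M ==> c ~= 0[M] ==> l : I ==> d : socv l M ==> d ~: line M c ==>
      soc M = lines M c d ==> j ~= l \<or> (\<exists>\<rho>\<in>mhom R M M. \<rho> ` car M ~= car M \<and> \<rho> d = c \<and> \<rho> c = 0[M]) ==> thesis\<close>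
      [OF i x'(1) x'0 i y(1) ynx' all[OF x'(1) i x'0 y(1) i ynx']]) (intro disjI2 conjI bexI[of _ \<rho>] r)
  qed
  from socle_extension[OF M h M h disjI1[OF nu] i a(1) a(2) bi b0] show thesis
  proof
   assume "\<exists>f\<in>mhom R M M. f a = b"
   then obtain f where "f : mhom R M M" "f a = b" by blast
   then show thesis by (rule step[OF bi b0 a(1) anb])
  next
   assume "\<exists>f\<in>mhom R M M. f b = a"
   then obtain f where "f : mhom R M M" "f b = a" by blast
   then show thesis by (rule step[OF a bi b(2)])
  qed
 qed
qed

lemma inj_of_lines:
 fixes M X :: "('k, 'a) fd_module"
 assumes M: "lm M" and X: "lm X" and f: "f : mhom R M X"
  and i: "i : I" and a: "a : socv i M" and k: "k : I" and b: "b : socv k M"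
  and S: "soc M = lines M a b" and fa: "f a ~= 0[X]" and fb: "f b ~: line X (f a)"
 shows "inj_on f (car M)"
proof (rule inj_on_socle[OF M X f])
 interpret M: left_module R M by (rule M)
 interpret X: left_module R X by (rule X)
 note ac = socvD(1)[OF a] and bc = socvD(1)[OF b]
 note fac = hom_closed[OF f ac] and fbc = hom_closed[OF f bc]
 fix j s assume "j : I" and s: "s : socv j M" and fs: "f s = 0[X]"
 have "s : lines M a b" using socvD(2)[OF s] S by simp
 then obtain u w where u: "u : line M a" and w: "w : line M b" and se: "s = u +[M] w" by (rule set_addE)
 obtain \<alpha> where \<alpha>: "\<alpha> : car K" "u = scl M \<alpha> a" using u by (rule lineE)
 obtain \<beta> where \<beta>: "\<beta> : car K" "w = scl M \<beta> b" using w by (rule lineE)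
 have uw: "u : car M" "w : car M" using scl_closed[OF M \<alpha>(1) ac] scl_closed[OF M \<beta>(1) bc] \<alpha>(2) \<beta>(2) by simp_all
 have sum: "scl X \<alpha> (f a) +[X] scl X \<beta> (f b) = 0[X]"
  using fs hom_add[OF f uw] hom_scl[OF f \<alpha>(1) ac] hom_scl[OF f \<beta>(1) bc] unfolding se \<alpha>(2) \<beta>(2) by simp
 have l: "sub X (line X (f a))" by (rule line_sub[OF X hom_socv[OF M X i f a] i])
 note sc = scl_closed[OF X \<alpha>(1) fac] scl_closed[OF X \<beta>(1) fbc]
 have b0: "\<beta> = 0[K]"
 proof (rule ccontr)
  assume n: "\<beta> ~= 0[K]"
  have "scl X \<beta> (f b) : line X (f a)"
   by (rule X.sub_add_mem[OF l sc(2) lineI[OF \<alpha>(1)]]) (use sum X.M.a_comm[OF sc] X.sub_zero[OF l] in simp)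
  then show False using scl_cancel[OF X l \<beta>(1) n fbc] fb by blast
 qed
 have "\<alpha> = 0[K]"
 proof (rule ccontr)
  assume n: "\<alpha> ~= 0[K]"
  have "scl X \<alpha> (f a) : {0[X]}" using sum sc zero_scl[OF X fbc] b0 by simp
  then show False using scl_cancel[OF X X.sub_zero_self \<alpha>(1) n fac] fa by blast
 qed
 then show "s = 0[M]" unfolding se \<alpha>(2) \<beta>(2) b0 using zero_scl[OF M ac] zero_scl[OF M bc] by simp
qed

text \<open>The map \<open>f\<close> then splits into \<open>g\<close>, which kills
  \<open>a\<close>, and \<open>f - g\<close>, which kills \<open>b\<close>. If \<open>f\<close> is
  not injective on the socle, \<open>g\<close> is zero, \<open>f\<close> itself or a multiple of
  \<open>f \<rho>\<close>. If it is injective, then \<open>X\<close> is not uniform, hence hollow,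
  and \<open>socle_extension\<close> applied to \<open>M/a\<close> and \<open>X\<close> either
  yields \<open>g\<close> or a map from \<open>X\<close> to \<open>M/a\<close> taking
  \<open>f b\<close> to the image of \<open>b\<close>. The latter is excluded by a surjection onto
  \<open>M/a\<close> killing both \<open>a\<close> and \<open>b\<close>.\<close>

lemma nonuniform_factor:
 fixes M X :: "('k, 'a) fd_module"
 assumes M: "fd M" and h: "hollow M" and i: "i : I" and a: "a : socv i M" "a ~= 0[M]"
  and k: "k : I" and b: "b : socv k M" "b ~: line M a" and S: "soc M = lines M a b"
  and alt: "i ~= k \<or> (\<exists>\<rho>\<in>mhom R M M. \<rho> ` car M ~= car M \<and> \<rho> b = a \<and> \<rho> a = 0[M])"
  and X: "indec X" and f: "f : mhom R M X" and nb: "\<not> bij_betw f (car M) (car X)"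
 shows "\<exists>g\<in>mhom R M X. g a = 0[X] \<and> g b = f b"
proof -
 note Ml = fd_lm[OF M] and Xf = indec_fd[OF X]
 note Xl = fd_lm[OF Xf]
 interpret M: left_module R M by (rule Ml)
 interpret X: left_module R X by (rule Xl)
 note ac = socvD(1)[OF a(1)] and bc = socvD(1)[OF b(1)]
 \<comment> \<open>Values at \<open>a\<close> and \<open>b\<close> that are proportional, with the
   one at \<open>b\<close> nonzero, cannot belong to different vertices, so \<open>alt\<close>
   provides \<open>\<rho>\<close>.\<close>
 have sep: "\<exists>\<rho>\<in>mhom R M M. \<rho> ` car M ~= car M \<and> \<rho> b = a \<and> \<rho> a = 0[M]"
  if Z: "lm Z" and g: "g : mhom R M Z" and c: "c : car K" "g b = scl Z c (g a)" and n: "g b ~= 0[Z]"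
  for Z :: "('k, 'a) fd_module" and g c
 proof (cases "i = k")
  case False
  have "scl Z c (g a) : socv i Z" by (rule line_socv[OF Z hom_socv[OF Ml Z i g a(1)] i lineI[OF c(1)]])
  then have "g b = 0[Z]"
   using e_other[OF Z _ i k] False socvD(3)[OF hom_socv[OF Ml Z k g b(1)]] c(2) by auto
  then show ?thesis using n by blast
 qed (use alt in blast)
 show ?thesis
 proof (cases "f a ~= 0[X] \<and> f b ~: line X (f a)")
  case False
  consider "f b = 0[X]" | "f a = 0[X]" | "f b ~= 0[X]" "f b : line X (f a)" using False by blast
  then show ?thesis
  proof cases
   case 1
   then show ?thesis using hom_const_zero[OF Ml Xl] by auto
  next
   case 2
   then show ?thesis using f by blast
  next
   case 3
   obtain c where c: "c : car K" "f b = scl X c (f a)" using 3(2) by (rule lineE)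
   obtain \<rho> where r: "\<rho> : mhom R M M" "\<rho> b = a" "\<rho> a = 0[M]" using sep[OF Xl f c 3(1)] by blast
   \<comment> \<open>This multiple of \<open>f \<rho>\<close> kills \<open>a\<close> and sends
     \<open>b\<close> to \<open>c\<close> times \<open>f a\<close>, which is
     \<open>f b\<close>.\<close>
   have g: "(%x. scl X c (f (\<rho> x))) : mhom R M X" unfolding scl_def by (rule hom_sc[OF Ml Xl hom_comp[OF r(1) f] c(1)])
   have "scl X c (f (\<rho> a)) = 0[X]" using r(3) hom_zero[OF Ml Xl f] scl_zero[OF Xl c(1)] by simp
   moreover have "scl X c (f (\<rho> b)) = f b" using r(2) c(2) by simp
   ultimately show ?thesis by (intro bexI[OF _ g] conjI)
  qed
 next
  case True
  then have inj: "inj_on f (car M)" using inj_of_lines[OF Ml Xl f i a(1) k b(1) S] by blast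
  have nuM: "\<not> uniform M" by (rule not_uniformI[OF Ml a(1) i a(2) b(1) k b(2)])
  have nuX: "\<not> uniform X" by (rule not_uniform_embed[OF Ml Xl f inj nuM hollow_sub_nonzero[OF h]])
  then have hX: "hollow X" using local_colocal[OF X] by blast
  have fs: "f ` car M ~= car X" using nb inj unfolding bij_betw_def by blast
  obtain Y :: "('k, 'a) fd_module" and p where q: "quot M a Y p" by (rule quot_exists[OF M a(1) i])
  note Y = quotD(1)[OF q] and p = quotD(2)[OF q]
  note Yl = fd_lm[OF Y]
  interpret Y: left_module R Y by (rule Yl)
  note pbc = hom_closed[OF p bc]
  have pb: "p b ~= 0[Y]" using quotD(4)[OF q bc] b(2) by blast
  have pa: "p a = 0[Y]" using quotD(4)[OF q ac] line_self[OF Ml ac] by blast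
  have Y0: "car Y ~= {0[Y]}" using pb pbc by blast
  have hY: "hollow Y" by (rule hollow_surj[OF M Y p h quotD(3)[OF q] Y0])
  have fb0: "f b ~= 0[X]" using True X.sub_zero[OF line_sub[OF Xl hom_socv[OF Ml Xl i f a(1)] i]] by metis
  from socle_extension[OF Y hY Xf hX disjI2[OF nuX] k hom_socv[OF Ml Yl k p b(1)] pb hom_socv[OF Ml Xl k f b(1)] fb0]
  show ?thesis
  proof
   assume "\<exists>g\<in>mhom R Y X. g (p b) = f b"
   then obtain g where g: "g : mhom R Y X" "g (p b) = f b" by blast
   have "g (p a) = 0[X]" unfolding pa by (rule hom_zero[OF Yl Xl g(1)])
   then show ?thesis using g(2) by (intro bexI[OF _ hom_comp[OF p g(1)]] conjI)
  next
   assume "\<exists>g\<in>mhom R X Y. g (f b) = p b"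
   then obtain g where g: "g : mhom R X Y" "g (f b) = p b" by blast
   have gf: "(%x. g (f x)) : mhom R M Y" by (rule hom_comp[OF f g(1)])
   have ns: "(%x. g (f x)) ` car M ~= car Y" by (rule hollow_comp_not_surj[OF Xl Yl Ml hX f g(1) fs Y0])
   have ga0: "g (f a) ~= 0[Y]"
   proof
    assume z: "g (f a) = 0[Y]"
    let ?d = "%x. p x -[Y] g (f x)"
    have d: "?d : mhom R M Y" by (rule hom_minus[OF Ml Yl p gf])
    have ds: "?d ` car M = car Y" by (rule hollow_diff_surj[OF Ml Yl hY p gf quotD(3)[OF q] ns])
    have da: "?d a = 0[Y]" using z pa by simp
    have db: "?d b = 0[Y]" unfolding g(2) by (rule Y.diff_self[OF pbc])
    have "b : line M a" by (rule kernel_of_surj[where f="?d" and a=a and x=b, OF M q a(1) i a(2) a(1) i a(2) d ds da bc db])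
    then show False using b(2) by blast
   qed
   \<comment> \<open>\<open>M/a\<close> is smaller than \<open>M\<close>. As \<open>g f\<close> does
     not kill \<open>a\<close>, the failure of injectivity means that its values at \<open>a\<close>
     and \<open>b\<close> are proportional.\<close>
   have "\<not> inj_on (%x. g (f x)) (car M)"
    using dm_inj_le(1)[OF M Y gf] quot_dm[OF q M a(1) i a(2)] by auto
   then have "g (f b) : line Y (g (f a))" using inj_of_lines[OF Ml Yl gf i a(1) k b(1) S ga0] by blast
   then obtain c where c: "c : car K" "g (f b) = scl Y c (g (f a))" by (rule lineE)
   have gb0: "g (f b) ~= 0[Y]" using pb g(2) by simp
   obtain \<rho> where r: "\<rho> : mhom R M M" "\<rho> ` car M ~= car M" "\<rho> b = a" "\<rho> a = 0[M]"
    using sep[OF Yl gf c gb0] by blast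
   \<comment> \<open>The projection kills \<open>a\<close>, so this difference agrees with
     \<open>g f\<close> at \<open>a\<close>; after \<open>\<rho>\<close> and multiplication by
     \<open>c\<close> its value at \<open>b\<close> is therefore \<open>p b\<close>. Composing with
     \<open>\<rho>\<close> also makes it fail to be onto, so subtracting it from \<open>p\<close>
     preserves surjectivity.\<close>
   let ?t = "%x. g (f x) -[Y] p x"
   have t: "?t : mhom R M Y" by (rule hom_minus[OF Ml Yl gf p])
   have tr: "(%x. ?t (\<rho> x)) : mhom R M Y" by (rule hom_comp[OF r(1) t])
   have trs: "(%x. ?t (\<rho> x)) ` car M ~= car Y" by (rule hollow_comp_not_surj[OF Ml Yl Ml h r(1) t r(2) Y0])
   note h2 = nonsurj_scl[OF Ml Yl tr c(1) trs]
   let ?d = "%x. p x -[Y] scl Y c (?t (\<rho> x))"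
   have d: "?d : mhom R M Y" by (rule hom_minus[OF Ml Yl p h2(1)])
   have ds: "?d ` car M = car Y" by (rule hollow_diff_surj[OF Ml Yl hY p h2(1) quotD(3)[OF q] h2(2)])
   have "?t (\<rho> a) = 0[Y]" using r(4) hom_zero[OF Ml Yl t] by simp
   then have da: "?d a = 0[Y]" using pa scl_zero[OF Yl c(1)] by simp
   have "?t (\<rho> b) = g (f a)" using r(3) pa hom_closed[OF gf ac] by simp
   then have db: "?d b = 0[Y]" using c(2) g(2) Y.diff_self[OF pbc] by simp
   have "b : line M a" by (rule kernel_of_surj[where f="?d" and a=a and x=b, OF M q a(1) i a(2) a(1) i a(2) d ds da bc db])
   then show ?thesis using b(2) by blast
  qed
 qed
qed

end

section \<open>Simple modules at the vertices\<close>

context split_algebra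
begin

lemma line_simple:
 fixes Z :: "('k, 'a) fd_module"
 assumes Z: "fd Z" and z: "z : socv v Z" "v : I" "z ~= 0[Z]"
 shows "hollow (Z on (line Z z))"
proof -
 note Zl = fd_lm[OF Z]
 interpret Z: left_module R Z by (rule Zl)
 let ?S = "Z on (line Z z)"
 have l: "sub Z (line Z z)" by (rule line_sub[OF Zl z(1,2)])
 have Sf: "fd ?S" by (rule fd_sub[OF Z l])
 interpret S: left_module R ?S by (rule fd_lm[OF Sf])
 have d: "dm ?S = 1" by (rule dm_line[OF Zl Z z])
 have "line Z z ~= {0[Z]}" using line_self[OF Zl socvD(1)[OF z(1)]] z(3) by blast
 moreover have "B = line Z z \<or> C = line Z z" if B: "sub ?S B" and C: "sub ?S C" and s: "set_add ?S B C = line Z z" for B C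
 proof (cases "dm (?S on B) = 1")
  case True
  then show ?thesis using dm_sub_eq[OF Sf B] d by simp
 next
  case False
  then have "dm (?S on B) = 0" using dm_sub_le[OF Sf B] d by simp
  then have B0: "B = {0[Z]}" using dm_zero_iff[OF fd_sub[OF Sf B]] by simp
  have "set_add ?S B C <= C"
   by (rule S.set_add_least[OF C _ order_refl]) (use S.sub_zero[OF C] B0 in simp)
  then show ?thesis using s S.sub_subset[OF C] by simp
 qed
 ultimately show ?thesis unfolding hollow_sub_def by simp
qed

text \<open>The class of \<open>e v\<close> in \<open>R/J\<close> is killed by \<open>J\<close>,
  fixed by \<open>e v\<close>, and nonzero because \<open>e v\<close> is not in
  \<open>J\<close>.\<close>

lemma ex_vertex_simple:
 assumes v: "v : I"
 obtains Z :: "('k, 'a) fd_module" and z where "fd Z" "z : socv v Z" "z ~= 0[Z]"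
proof -
 interpret R: ring R by (rule ring_R)
 interpret J: ideal J R by (rule J_ideal)
 have rl: "lm (regular R)" by (rule regular_left_module[OF ring_R])
 interpret G: left_module R "regular R" by (rule rl)
 have rf: "fd (regular R)" unfolding fd_def using rl fdim_regular by simp
 have sJ: "sub (regular R) J"
  by (rule G.subI) (use J.I_l_closed J.a_subset J.zero_closed J.a_closed in auto)
 obtain Z :: "('k, 'a) fd_module" and p where Z: "fd Z" and p: "p : mhom R (regular R) Z" "p ` car (regular R) = car Z"
  and k: "!!x. x : car (regular R) ==> p x = 0[Z] \<longleftrightarrow> x : J"
  by (rule fd_quotient[OF rf sJ], rule that)
 have ev: "e v : car (regular R)" using e_closed[OF v] by simp
 have act: "r .[Z] p (e v) = p (r *[R] e v)" if "r : car R" for r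
  using hom_smult[OF p(1) that ev] by simp
 have "p (e v) : socv v Z"
  unfolding socv_def soc_def
 proof (intro CollectI conjI ballI)
  show "p (e v) : car Z" by (rule hom_closed[OF p(1) ev])
  show "e v .[Z] p (e v) = p (e v)" using act[OF e_closed[OF v]] e_idem[OF v] by simp
  fix j assume j: "j : J"
  have "j *[R] e v : J" by (rule J.I_r_closed[OF j e_closed[OF v]])
  then show "j .[Z] p (e v) = 0[Z]" using act[OF J_carrier[OF j]] k[of "j *[R] e v"] J.a_subset by auto
 qed
 moreover have "p (e v) ~= 0[Z]" using k[OF ev] e_notin[OF v] by blast
 ultimately show thesis using that Z by blast
qed

text \<open>A map out of the simple module at \<open>v\<close> is determined by the image of
  \<open>z\<close>, and every \<open>y\<close> in \<open>socv v X\<close> occurs: each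
  \<open>r\<close> acts on \<open>z\<close> and on \<open>y\<close> by the same scalar, read off
  from \<open>r e_v\<close> modulo \<open>J\<close>.\<close>

lemma hd_line:
 fixes Z X :: "('k, 'a) fd_module"
 assumes Z: "fd Z" and z: "z : socv v Z" "v : I" "z ~= 0[Z]" and X: "fd X"
 shows "hd (Z on (line Z z)) X = dm (X on (socv v X))"
proof -
 note Zl = fd_lm[OF Z] and Xl = fd_lm[OF X]
 interpret R: ring R by (rule ring_R)
 interpret Z: left_module R Z by (rule Zl)
 interpret X: left_module R X by (rule Xl)
 interpret K: field K by (rule field_K)
 let ?S = "Z on (line Z z)"
 note zc = socvD(1)[OF z(1)]
 have l: "sub Z (line Z z)" by (rule line_sub[OF Zl z(1,2)])
 have Sf: "fd ?S" by (rule fd_sub[OF Z l])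
 note Sl = fd_lm[OF Sf]
 have zl: "z : line Z z" by (rule line_self[OF Zl zc])
 then have zS: "z : car ?S" by simp
 have zs: "z : socv v ?S" using socvD[OF z(1)] zl unfolding socv_def soc_def by auto
 have rl: "lm (regular R)" by (rule regular_left_module[OF ring_R])
 have ext: "\<exists>g\<in>mhom R ?S X. g z = y" if y: "y : socv v X" for y
 proof -
  note yc = socvD(1)[OF y]
  have hz: "(%r. r .[Z] z) : mhom R (regular R) ?S"
  proof (rule homI)
   show "r .[Z] z : car ?S" if "r : car (regular R)" for r using Z.sub_smult[OF l _ zl] that by simp
  qed (use zc in \<open>simp_all add: Z.smult_l_distr Z.smult_assoc\<close>)
  have hy: "(%r. r .[X] y) : mhom R (regular R) X"
   by (rule homI) (use yc in \<open>simp_all add: X.smult_l_distr X.smult_assoc X.smult_closed\<close>)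
  have sur: "(%r. r .[Z] z) ` car (regular R) = car ?S"
  proof
   show "(%r. r .[Z] z) ` car (regular R) <= car ?S" using hom_closed[OF hz] by blast
   show "car ?S <= (%r. r .[Z] z) ` car (regular R)"
    using sc_closed unfolding line_def scl_def by auto
  qed
  have ker: "r .[X] y = 0[X]" if r: "r : car (regular R)" and rz: "r .[Z] z = 0[?S]" for r
  proof -
   have rc: "r : car R" using r by simp
   obtain c j where c: "c : car K" and j: "j : J" and e: "r *[R] e v = (c .[R] 1[R]) *[R] e v +[R] j" using split[OF rc z(2)] by blast
   note ec = e_closed[OF z(2)]
   have act: "r .[W] w = scl W c w" if W: "lm W" and w: "w : socv v W" for W :: "('k, 'a) fd_module" and w
   proof -
    interpret W: left_module R W by (rule W)
    note wc = socvD(1)[OF w]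
    have "r .[W] w = (r *[R] e v) .[W] w" using W.smult_assoc[OF rc ec wc] socvD(3)[OF w] by simp
    also have "\<dots> = ((c .[R] 1[R]) *[R] e v) .[W] w +[W] j .[W] w"
     unfolding e using sc_closed[OF c] ec J_carrier[OF j] wc by (intro W.smult_l_distr R.m_closed)
    also have "\<dots> = scl W c w" using W.smult_assoc[OF sc_closed[OF c] ec wc] socvD(3)[OF w] socvD(4)[OF w j] scl_closed[OF W c wc]
     unfolding scl_def by simp
    finally show ?thesis .
   qed
   have "scl Z c z : {0[Z]}" using act[OF Zl z(1)] rz by simp
   then have "c = 0[K]" using scl_cancel[OF Zl Z.sub_zero_self c _ zc] z(3) by blast
   then show ?thesis using act[OF Xl y] zero_scl[OF Xl yc] by simp
  qed
  obtain g where g: "g : mhom R ?S X" "!!r. r : car (regular R) ==> g (r .[Z] z) = r .[X] y"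
   using factor_through[OF rl Sl Xl hz sur hy ker] by blast
  have "g z = y" using g(2)[of "1[R]"] Z.smult_one[OF zc] X.smult_one[OF yc] by simp
  then show ?thesis using g(1) by blast
 qed
 have det: "f u = g u" if f: "f : mhom R ?S X" and g: "g : mhom R ?S X" and fg: "f z = g z" and u: "u : car ?S" for f g u
 proof -
  have "u : line Z z" using u by simp
  then obtain c where c: "c : car K" "u = scl Z c z" by (rule lineE)
  then have e: "u = scl ?S c z" by (simp add: scl_def)
  show ?thesis unfolding e hom_scl[OF f c(1) zS] hom_scl[OF g c(1) zS] fg by (rule refl)
 qed
 let ?T = "restr R (X on (socv v X))"
 have sX: "sub X (socv v X)" by (rule sub_socv[OF Xl z(2)])
 have Tl: "left_module K ?T" by (rule restr_lm[OF fd_lm[OF fd_sub[OF X sX]]])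
 have T: "(%f. f z) : mhom K (hom_space R ?S X) ?T"
  by (rule homI) (use zS hom_socv[OF Sl Xl z(2) Hom_hom zs] in \<open>simp_all\<close>)
 have bij: "bij_betw (%f. f z) (car (hom_space R ?S X)) (car ?T)"
  unfolding bij_betw_def
 proof
  show "inj_on (%f. f z) (car (hom_space R ?S X))"
  proof (rule inj_onI)
   fix f g assume "f : car (hom_space R ?S X)" "g : car (hom_space R ?S X)" and fg: "f z = g z"
   then have f: "f : Hom ?S X" and g: "g : Hom ?S X" by simp_all
   show "f = g" by (rule Hom_eqI[OF f g]) (rule det[OF Hom_hom[OF f] Hom_hom[OF g] fg])
  qed
  show "(%f. f z) ` car (hom_space R ?S X) = car ?T"
  proof
   show "(%f. f z) ` car (hom_space R ?S X) <= car ?T" using hom_closed[OF T] by blast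
   show "car ?T <= (%f. f z) ` car (hom_space R ?S X)"
   proof
    fix y assume "y : car ?T"
    then have "y : socv v X" by simp
    then obtain g where g: "g : mhom R ?S X" "g z = y" using ext by blast
    show "y : (%f. f z) ` car (hom_space R ?S X)"
     by (rule image_eqI[of _ _ "\<lambda>x\<in>car ?S. g x"]) (use g(2) zS restrict_Hom[OF Sl g(1)] in simp_all)
   qed
  qed
 qed
 show ?thesis using dim_iso(2)[OF fdim_hom[OF Sf X] Tl T bij] unfolding hd_def dm_def by simp
qed

lemma uniform_socle_sum:
 fixes X :: "('k, 'a) fd_module"
 assumes X: "fd X" and u: "uniform X"
 shows "(\<Sum>v\<in>I. dm (X on (socv v X))) = 1"
proof -
 note Xl = fd_lm[OF X]
 interpret X: left_module R X by (rule Xl)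
 have nz: "car X ~= {0[X]}" using u unfolding uniform_def by blast
 obtain i a where i: "i : I" and a: "a : socv i X" "a ~= 0[X]" by (rule ex_socv[OF Xl X.sub_carrier_self nz], rule that)
 have b: "b : line X a" if "k : I" "b : socv k X" for k b
  using not_uniformI[OF Xl a(1) i a(2) that(2,1)] u by blast
 have one: "dm (X on (socv v X)) = (if v = i then 1 else 0)" if v: "v : I" for v
 proof (cases "v = i")
  case True
  have "socv i X = line X a" using b[OF i] line_least[OF Xl sub_socv[OF Xl i] a(1)] by blast
  then show ?thesis using True dm_line[OF Xl X a(1) i a(2)] by simp
 next
  case False
  have "socv v X <= {0[X]}"
   using socv_inter[OF Xl v i _ _ line_socv[OF Xl a(1) i b[OF v]]] False by blast
  then have "socv v X = {0[X]}" using X.sub_zero[OF sub_socv[OF Xl v]] by blast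
  then show ?thesis using False dm_zero_sub[OF X] by simp
 qed
 have "(\<Sum>v\<in>I. dm (X on (socv v X))) = (\<Sum>v\<in>I. if v = i then 1 else 0)" by (rule sum.cong[OF refl one])
 then show ?thesis using i finite_I by (simp add: sum.delta)
qed

end

section \<open>The weights and their sum\<close>

context lc_algebra
begin

text \<open>The modules are the quotients of \<open>M\<close> by the two socle lines and by their
  sum, indecomposable as nonzero images of a hollow module. For \<open>X\<close> not isomorphic to
  \<open>M\<close>, \<open>nonuniform_factor\<close> gives equality in \<open>hd_mesh\<close>. For
  \<open>X\<close> isomorphic to \<open>M\<close>, splitting an isomorphism into a map killing
  \<open>a\<close> and one killing \<open>b\<close> would make one of them bijective by
  \<open>local_End\<close>.\<close>

lemma nonuniform_mesh:
 fixes M :: "('k, 'a) fd_module"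
 assumes M: "fd M" and h: "hollow M" and nu: "\<not> uniform M"
 obtains F1 F2 F3 :: "('k, 'a) fd_module" where "indec F1" "indec F2" "indec F3"
  "!!X :: ('k, 'a) fd_module. indec X ==> \<not> isomorphic_modules R M X ==> hd F1 X + hd F2 X = hd M X + hd F3 X"
  "!!X :: ('k, 'a) fd_module. indec X ==> isomorphic_modules R M X ==> hd F1 X + hd F2 X < hd M X + hd F3 X"
proof -
 note Ml = fd_lm[OF M]
 interpret M: left_module R M by (rule Ml)
 obtain i a k b where i: "i : I" and a: "a : socv i M" "a ~= 0[M]" and k: "k : I" and b: "b : socv k M" "b ~: line M a"
  and S: "soc M = lines M a b"
  and alt: "i ~= k \<or> (\<exists>\<rho>\<in>mhom R M M. \<rho> ` car M ~= car M \<and> \<rho> b = a \<and> \<rho> a = 0[M])"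
  by (rule nonuniform_socle[OF M h nu], rule that)
 note ac = socvD(1)[OF a(1)] and bc = socvD(1)[OF b(1)]
 note la = line_sub[OF Ml a(1) i] and lb = line_sub[OF Ml b(1) k]
 note L = sub_lines[OF Ml a(1) i b(1) k]
 have b0: "b ~= 0[M]" using b(2) M.sub_zero[OF la] by blast
 have anb: "a ~: line M b" using line_sym[OF Ml bc _ a(2) la line_self[OF Ml ac]] b(2) by blast
 \<comment> \<open>This makes the third quotient nonzero: a hollow module is not the sum of two
   different lines.\<close>
 have nl: "lines M a b ~= car M"
 proof
  assume "lines M a b = car M"
  from hollow_subD[OF h la lb this] show False using b(2) anb ac bc by blast
 qed
 obtain F1 :: "('k, 'a) fd_module" and p1 where F1: "fd F1" and p1: "p1 : mhom R M F1" "p1 ` car M = car F1"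
  and k1: "!!x. x : car M ==> p1 x = 0[F1] \<longleftrightarrow> x : line M a" by (rule fd_quotient[OF M la], rule that)
 obtain F2 :: "('k, 'a) fd_module" and p2 where F2: "fd F2" and p2: "p2 : mhom R M F2" "p2 ` car M = car F2"
  and k2: "!!x. x : car M ==> p2 x = 0[F2] \<longleftrightarrow> x : line M b" by (rule fd_quotient[OF M lb], rule that)
 obtain F3 :: "('k, 'a) fd_module" and p3 where F3: "fd F3" and p3: "p3 : mhom R M F3" "p3 ` car M = car F3"
  and k3: "!!x. x : car M ==> p3 x = 0[F3] \<longleftrightarrow> x : lines M a b" by (rule fd_quotient[OF M L(1)], rule that)
 have ind: "indec F" if F: "fd F" and p: "p : mhom R M F" "p ` car M = car F"
  and kp: "!!x. x : car M ==> p x = 0[F] \<longleftrightarrow> x : A" and x: "x : car M" "x ~: A" for F :: "('k, 'a) fd_module" and p A x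
 proof -
  have "p x ~= 0[F]" using kp[OF x(1)] x(2) by blast
  then have "car F ~= {0[F]}" using hom_closed[OF p(1) x(1)] by blast
  from hollow_indec[OF F hollow_surj[OF M F p(1) h p(2) this]] show ?thesis .
 qed
 obtain x where x: "x : car M" "x ~: lines M a b" using nl M.sub_subset[OF L(1)] by blast
 have mesh: "hd F1 X + hd F2 X \<le> hd M X + hd F3 X"
  "hd F1 X + hd F2 X = hd M X + hd F3 X \<longleftrightarrow>
   (\<forall>f\<in>mhom R M X. \<exists>f1\<in>mhom R M X. \<exists>f2\<in>mhom R M X.
    (\<forall>a\<in>line M a. f1 a = 0[X]) \<and> (\<forall>b\<in>line M b. f2 b = 0[X]) \<and> (\<forall>x\<in>car M. f x = f1 x +[X] f2 x))"
  if X: "fd X" for X :: "('k, 'a) fd_module"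
  by (rule hd_mesh[OF M X la lb F1 p1 k1 F2 p2 k2 F3 p3 k3]; assumption)+
 show thesis
 proof (rule that[of F1 F2 F3])
  show "indec F1" by (rule ind[OF F1 p1 k1 bc b(2)])
  show "indec F2" by (rule ind[OF F2 p2 k2 ac anb])
  show "indec F3" by (rule ind[OF F3 p3 k3 x])
  fix X :: "('k, 'a) fd_module" assume X: "indec X"
  note Xf = indec_fd[OF X]
  note Xl = fd_lm[OF Xf]
  interpret X: left_module R X by (rule Xl)
  show "hd F1 X + hd F2 X = hd M X + hd F3 X" if ni: "\<not> isomorphic_modules R M X"
   unfolding mesh(2)[OF Xf]
  proof
   fix f assume f: "f : mhom R M X"
   have nb: "\<not> bij_betw f (car M) (car X)" using isoI[OF f] ni by blast
   obtain g where g: "g : mhom R M X" "g a = 0[X]" "g b = f b"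
    using nonuniform_factor[OF M h i a k b S alt X f nb] by blast
   let ?g = "%x. f x -[X] g x"
   have g2: "?g : mhom R M X" by (rule hom_minus[OF Ml Xl f g(1)])
   have gb: "?g b = 0[X]" unfolding g(3) by (rule X.diff_self[OF hom_closed[OF f bc]])
   show "\<exists>f1\<in>mhom R M X. \<exists>f2\<in>mhom R M X.
    (\<forall>a\<in>line M a. f1 a = 0[X]) \<and> (\<forall>b\<in>line M b. f2 b = 0[X]) \<and> (\<forall>x\<in>car M. f x = f1 x +[X] f2 x)"
   proof (rule bexI[OF _ g(1)], rule bexI[OF _ g2], intro conjI ballI)
    show "g y = 0[X]" if "y : line M a" for y by (rule hom_line[where f=g and x=a, OF Ml Xl g(1) ac g(2) that])
    show "?g y = 0[X]" if "y : line M b" for y by (rule hom_line[where f="?g" and x=b, OF Ml Xl g2 bc gb that])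
    show "f y = g y +[X] ?g y" if "y : car M" for y
     by (rule X.add_diff_cancel[OF hom_closed[OF g(1) that] hom_closed[OF f that], symmetric])
   qed
  qed
  show "hd F1 X + hd F2 X < hd M X + hd F3 X" if iso: "isomorphic_modules R M X"
  proof (rule ccontr)
   assume "\<not> ?thesis"
   then have eq: "hd F1 X + hd F2 X = hd M X + hd F3 X" using mesh(1)[OF Xf] by simp
   obtain f where f: "f : mhom R M X" and fb: "bij_betw f (car M) (car X)" using iso by (rule isoE)
   obtain f1 f2 where f12: "f1 : mhom R M X" "f2 : mhom R M X"
    and v1: "\<forall>a\<in>line M a. f1 a = 0[X]" and v2: "\<forall>b\<in>line M b. f2 b = 0[X]"
    and s: "\<forall>x\<in>car M. f x = f1 x +[X] f2 x"
    using bspec[OF eq[unfolded mesh(2)[OF Xf]] f] by (elim bexE conjE)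
   let ?g = "inv_into (car M) f"
   have g: "?g : mhom R X M" by (rule hom_inv[OF Ml Xl f fb])
   have g1: "(%x. ?g (f1 x)) : mhom R M M" and g2: "(%x. ?g (f2 x)) : mhom R M M"
    by (rule hom_comp[OF f12(1) g], rule hom_comp[OF f12(2) g])
   have id: "?g (f1 y) +[M] ?g (f2 y) = y" if y: "y : car M" for y
   proof -
    have "?g (f1 y) +[M] ?g (f2 y) = ?g (f y)"
     using hom_add[OF g hom_closed[OF f12(1) y] hom_closed[OF f12(2) y]] s y by simp
    also have "\<dots> = y" using inv_into_f_f[OF bij_betw_imp_inj_on[OF fb] y] .
    finally show ?thesis .
   qed
   have "bij_betw (%y. ?g (f1 y) +[M] ?g (f2 y)) (car M) (car M)"
    by (subst bij_betw_cong[where g="%y. y"]) (simp_all add: id bij_betw_def)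
   from local_End[OF hollow_indec[OF M h] g1 g2 this]
   show False
   proof
    assume "bij_betw (%x. ?g (f1 x)) (car M) (car M)"
    then have "inj_on (%x. ?g (f1 x)) (car M)" by (rule bij_betw_imp_inj_on)
    moreover have "?g (f1 a) = 0[M]" using v1 line_self[OF Ml ac] hom_zero[OF Xl Ml g] by simp
    ultimately show False using inj_iff_kernel[OF Ml Ml g1] ac a(2) by blast
   next
    assume "bij_betw (%x. ?g (f2 x)) (car M) (car M)"
    then have "inj_on (%x. ?g (f2 x)) (car M)" by (rule bij_betw_imp_inj_on)
    moreover have "?g (f2 b) = 0[M]" using v2 line_self[OF Ml bc] hom_zero[OF Xl Ml g] by simp
    ultimately show False using inj_iff_kernel[OF Ml Ml g2] bc b0 by blast
   qed
  qed
 qed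
qed

lemma weight_sum:
 fixes Ms :: "('k, 'a) fd_module list" and w :: "nat => rat"
 assumes rep: "representatives R indec Ms"
  and w: "!!i. i < length Ms ==> (\<Sum>j<length Ms. of_nat (hd (Ms ! i) (Ms ! j)) * w j) = 1"
 shows "(\<Sum>j<length Ms. w j) = of_nat (card I)"
proof -
 let ?n = "length Ms"
 note ri = representatives_indec[OF rep]
 have fdM: "fd (Ms ! j)" if "j < ?n" for j by (rule indec_fd[OF ri(1)[OF that]])
 \<comment> \<open>The defining relation of the weights depends on the isomorphism class only, so it
   is available for the quotients of a listed module and for the simple modules.\<close>
 have one: "(\<Sum>j<?n. of_nat (hd F (Ms ! j)) * w j) = 1" if F: "indec F" for F :: "('k, 'a) fd_module"
 proof -
  obtain i where i: "i < ?n" "isomorphic_modules R F (Ms ! i)" using ri(3)[OF F] by blast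
  have "hd F (Ms ! j) = hd (Ms ! i) (Ms ! j)" if "j < ?n" for j
   by (rule hd_cong[OF i(2) indec_fd[OF F] fdM[OF i(1)] iso_refl fdM[OF that] fdM[OF that]])
  then have "(\<Sum>j<?n. of_nat (hd F (Ms ! j)) * w j) = (\<Sum>j<?n. of_nat (hd (Ms ! i) (Ms ! j)) * w j)" by (intro sum.cong) auto
  then show ?thesis using w[OF i(1)] by simp
 qed
 have zero: "w j = 0" if j: "j < ?n" and nu: "\<not> uniform (Ms ! j)" for j
 proof -
  note M = fdM[OF j]
  have h: "hollow (Ms ! j)" using local_colocal[OF ri(1)[OF j]] nu by blast
  obtain F1 F2 F3 :: "('k, 'a) fd_module" where F: "indec F1" "indec F2" "indec F3"
   and ne: "!!X :: ('k, 'a) fd_module. indec X ==> \<not> isomorphic_modules R (Ms ! j) X ==> hd F1 X + hd F2 X = hd (Ms ! j) X + hd F3 X"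
   and eq: "!!X :: ('k, 'a) fd_module. indec X ==> isomorphic_modules R (Ms ! j) X ==> hd F1 X + hd F2 X < hd (Ms ! j) X + hd F3 X"
   by (rule nonuniform_mesh[OF M h nu], rule that)
  \<comment> \<open>The defect of the mesh relation at the listed modules. Its weighted sum is
    \<open>1 + 1 - 1 - 1\<close>, and it is nonzero at \<open>j\<close> only, so the weight at
    \<open>j\<close> vanishes.\<close>
  let ?c = "%i. (of_nat (hd (Ms ! j) (Ms ! i)) + of_nat (hd F3 (Ms ! i)) - of_nat (hd F1 (Ms ! i)) - of_nat (hd F2 (Ms ! i)) :: rat)"
  have "(\<Sum>i<?n. ?c i * w i) = 0"
   using one[OF ri(1)[OF j]] one[OF F(1)] one[OF F(2)] one[OF F(3)] by (simp add: algebra_simps sum.distrib sum_subtractf)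
  moreover have "?c i * w i = 0" if i: "i < ?n" "i ~= j" for i
  proof -
   have "\<not> isomorphic_modules R (Ms ! j) (Ms ! i)" using ri(2)[OF j i(1)] i(2) by blast
   from arg_cong[OF ne[OF ri(1)[OF i(1)] this], of "of_nat :: nat => rat"] show ?thesis by simp
  qed
  then have "(\<Sum>i<?n. ?c i * w i) = (\<Sum>i<?n. if i = j then ?c j * w j else 0)" by (intro sum.cong) auto
  then have "(\<Sum>i<?n. ?c i * w i) = ?c j * w j" using j by simp
  ultimately have "?c j * w j = 0" by simp
  moreover have "?c j ~= 0"
  proof -
   have "(of_nat (hd F1 (Ms ! j) + hd F2 (Ms ! j)) :: rat) < of_nat (hd (Ms ! j) (Ms ! j) + hd F3 (Ms ! j))"
    using eq[OF ri(1)[OF j] iso_refl] by (simp only: of_nat_less_iff)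
   then show ?thesis by simp
  qed
  ultimately show ?thesis by simp
 qed
 have "\<exists>S :: 'i => ('k, 'a) fd_module. \<forall>v\<in>I. indec (S v) \<and> (\<forall>X :: ('k, 'a) fd_module. fd X --> hd (S v) X = dm (X on (socv v X)))"
 proof (rule bchoice, rule ballI)
  fix v assume v: "v : I"
  obtain Z :: "('k, 'a) fd_module" and z where Z: "fd Z" and z: "z : socv v Z" "z ~= 0[Z]" by (rule ex_vertex_simple[OF v], rule that)
  have "indec (Z on (line Z z))"
   by (rule hollow_indec[OF fd_sub[OF Z line_sub[OF fd_lm[OF Z] z(1) v]] line_simple[OF Z z(1) v z(2)]])
  then show "\<exists>S :: ('k, 'a) fd_module. indec S \<and> (\<forall>X :: ('k, 'a) fd_module. fd X --> hd S X = dm (X on (socv v X)))"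
   using hd_line[OF Z z(1) v z(2)] by blast
 qed
 then obtain S :: "'i => ('k, 'a) fd_module" where S: "!!v. v : I ==> indec (S v)"
  and hS: "!!v X :: ('k, 'a) fd_module. v : I ==> fd X ==> hd (S v) X = dm (X on (socv v X))" by blast
 \<comment> \<open>A uniform module receives maps from the simple module of exactly one vertex, in
   dimension one; for the others both sides vanish with the weight.\<close>
 have col: "(\<Sum>v\<in>I. of_nat (hd (S v) (Ms ! j)) * w j) = w j" if j: "j < ?n" for j
 proof (cases "uniform (Ms ! j)")
  case True
  have "(\<Sum>v\<in>I. hd (S v) (Ms ! j)) = 1"
   using uniform_socle_sum[OF fdM[OF j] True] hS[OF _ fdM[OF j]] by simp
  then have "(\<Sum>v\<in>I. of_nat (hd (S v) (Ms ! j)) :: rat) = 1" by (metis of_nat_1 of_nat_sum)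
  then show ?thesis by (simp add: sum_distrib_right[symmetric])
 next
  case False
  then show ?thesis using zero[OF j] by simp
 qed
 have "(\<Sum>j<?n. w j) = (\<Sum>j<?n. \<Sum>v\<in>I. of_nat (hd (S v) (Ms ! j)) * w j)" by (rule sum.cong) (simp_all add: col)
 also have "\<dots> = (\<Sum>v\<in>I. \<Sum>j<?n. of_nat (hd (S v) (Ms ! j)) * w j)" by (rule sum.swap)
 also have "\<dots> = (\<Sum>v\<in>I. 1)" by (rule sum.cong[OF refl]) (rule one[OF S])
 finally show ?thesis by simp
qed

end

section \<open>Isomorphism classes and indecomposable projective modules\<close>

context fd_algebra
begin

lemma iso_equiv:
 fixes P :: "('k, 'a) fd_module => bool"
 assumes P: "!!M. P M ==> lm M"
 shows "equiv {M. P M} {(M, N). P M \<and> P N \<and> isomorphic_modules R M N}"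
proof (rule equivI)
 show "{(M, N). P M \<and> P N \<and> isomorphic_modules R M N} <= {M. P M} \<times> {M. P M}" by auto
 show "refl_on {M. P M} {(M, N). P M \<and> P N \<and> isomorphic_modules R M N}" by (auto simp: refl_on_def iso_refl)
 show "sym {(M, N). P M \<and> P N \<and> isomorphic_modules R M N}" by (auto simp: sym_def dest: iso_sym[OF P P])
 show "trans {(M, N). P M \<and> P N \<and> isomorphic_modules R M N}" by (auto simp: trans_def intro: iso_trans)
qed

lemma representatives_exist:
 fixes P :: "('k, 'a) fd_module => bool"
 assumes P: "!!M. P M ==> lm M" and fin: "finite (iso_classes R P)"
 shows "\<exists>Ms. representatives R P Ms"
proof -
 define r where "r = {(M, N). P M \<and> P N \<and> isomorphic_modules R M N}"
 define A where "A = {M. P M}"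
 have r: "equiv A r" unfolding A_def r_def by (rule iso_equiv[OF P])
 have r_iff: "(M, N) : r \<longleftrightarrow> P M \<and> P N \<and> isomorphic_modules R M N" for M N by (simp add: r_def)
 have A_iff: "M : A \<longleftrightarrow> P M" for M by (simp add: A_def)
 have q: "iso_classes R P = A // r" by (simp add: iso_classes_def A_def r_def)
 obtain Cs where Cs: "set Cs = A // r" "distinct Cs" using finite_distinct_list[OF fin] q by auto
 define s where "s C = (SOME M. M : C)" for C :: "('k, 'a) fd_module set"
 have s1: "s C : C" if C: "C : A // r" for C
 proof -
  obtain M where "M : C" using in_quotient_imp_non_empty[OF r C] by blast
  then show ?thesis unfolding s_def by (rule someI)
 qed
 have s2: "P (s C)" if C: "C : A // r" for C
  using subsetD[OF in_quotient_imp_subset[OF r C] s1[OF C]] A_iff by blast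
 have "representatives R P (map s Cs)"
  unfolding representatives_def
 proof (intro conjI ballI allI impI)
  fix M assume "M : set (map s Cs)"
  then obtain C where "M = s C" "C : set Cs" unfolding set_map by (rule imageE)
  then show "P M" using s2 Cs(1) by simp
 next
  fix M assume M: "P M"
  have cM: "r `` {M} : A // r" by (rule quotientI) (simp add: A_iff M)
  then obtain i where i: "i < length Cs" "Cs ! i = r `` {M}" unfolding Cs(1)[symmetric] in_set_conv_nth by blast
  show "\<exists>!i. i < length (map s Cs) \<and> isomorphic_modules R M (map s Cs ! i)"
  proof (rule ex1I[of _ i])
   have "(M, s (r `` {M})) : r" using s1[OF cM] by blast
   then show "i < length (map s Cs) \<and> isomorphic_modules R M (map s Cs ! i)" using i r_iff by simp
   fix j assume j: "j < length (map s Cs) \<and> isomorphic_modules R M (map s Cs ! j)"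
   then have jl: "j < length Cs" by simp
   have jC: "Cs ! j : A // r" using Cs(1) nth_mem[OF jl] by simp
   have "(M, s (Cs ! j)) : r" using j jl s2[OF jC] M r_iff by simp
   then have "s (Cs ! j) : r `` {M}" by blast
   then have "r `` {M} = Cs ! j"
    using quotient_disj[OF r cM jC] s1[OF jC] by blast
   then show "j = i" using nth_eq_iff_index_eq[OF Cs(2) jl i(1)] i(2) by simp
  qed
 qed
 then show ?thesis ..
qed

end

text \<open>Serves twice: for the bound path algebra, where it identifies the rank with the number
  of vertices, and for the Auslander algebra, where it gives the matrix whose inverse defines the
  magnitude.\<close>

locale basic_algebra = fd_algebra K R
 for K :: "('k, 'c) ring_scheme" and R :: "('k, 'a, 'z) module_scheme" +
 fixes I :: "'i set" and e :: "'i => 'a"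
 assumes finite_I: "finite I"
  and e_closed: "i : I ==> e i : car R"
  and e_idem: "i : I ==> e i *[R] e i = e i"
  and e_sum: "finsum R e I = 1[R]"
  and hollow_pj: "i : I ==> hollow ((regular R) on ((%r. r *[R] e i) ` car R))"
  and pj_inj: "i : I ==> j : I ==>
   isomorphic_modules R ((regular R) on ((%r. r *[R] e i) ` car R))
    ((regular R) on ((%r. r *[R] e j) ` car R)) ==> i = j"

context basic_algebra
begin

definition pj :: "'i => ('a, 'a) module" where
 "pj i = (regular R) on ((%r. r *[R] e i) ` car R)"

lemma pj_sel [simp]: "car (pj i) = (%r. r *[R] e i) ` car R" "0[pj i] = 0[R]"
  "x +[pj i] y = x +[R] y" "r .[pj i] x = r *[R] x"
 by (simp_all add: pj_def)

lemma regular_fd: "fd (regular R)"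
 unfolding fd_def using regular_left_module[OF ring_R] fdim_regular by simp

lemma pj_fd:
 assumes i: "i : I" shows "fd (pj i)"
proof -
 interpret G: left_module R "regular R" by (rule regular_left_module[OF ring_R])
 have "sub (regular R) ((%r. r *[R] e i) ` car R)" using G.sub_cyclic[of "e i"] e_closed[OF i] by simp
 then show ?thesis unfolding pj_def by (rule fd_sub[OF regular_fd])
qed

lemma pj_elem:
 assumes i: "i : I" and "x : car (pj i)" shows "x : car R" "x *[R] e i = x"
proof -
 interpret R: ring R by (rule ring_R)
 obtain r where "r : car R" "x = r *[R] e i" using assms(2) by auto
 then show "x : car R" "x *[R] e i = x" using e_closed[OF i] e_idem[OF i] by (simp_all add: R.m_assoc)
qed

lemma e_in_pj:
 assumes i: "i : I" shows "e i : car (pj i)"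
 using e_closed[OF i] e_idem[OF i] by (auto intro!: image_eqI[of _ _ "e i"])

lemma pj_map:
 assumes i: "i : I" and X: "lm X" and x: "x : car X"
 shows "(%r. r .[X] x) : mhom R (pj i) X"
proof -
 interpret X: left_module R X by (rule X)
 show ?thesis
  by (rule homI) (use x pj_elem(1)[OF i] in \<open>simp_all only: pj_sel(3,4) X.smult_closed X.smult_l_distr X.smult_assoc\<close>)
qed

lemma pj_hom:
 assumes i: "i : I" and X: "lm X" and f: "f : mhom R (pj i) X"
 shows "r : car (pj i) ==> f r = r .[X] f (e i)" "e i .[X] f (e i) = f (e i)"
proof -
 show "f r = r .[X] f (e i)" if "r : car (pj i)" for r
  using hom_smult[OF f pj_elem(1)[OF i that] e_in_pj[OF i]] pj_elem(2)[OF i that] by simp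
 from this[OF e_in_pj[OF i]] show "e i .[X] f (e i) = f (e i)" by simp
qed

lemma pj_lift:
 fixes X :: "('a, 'm) module" and Y :: "('a, 'n) module"
 assumes i: "i : I" and X: "lm X" and Y: "lm Y" and g: "g : mhom R X Y" "g ` car X = car Y" and f: "f : mhom R (pj i) Y"
 shows "\<exists>h\<in>mhom R (pj i) X. \<forall>p\<in>car (pj i). g (h p) = f p"
proof -
 interpret X: left_module R X by (rule X)
 interpret R: ring R by (rule ring_R)
 have "f (e i) : g ` car X" using hom_closed[OF f e_in_pj[OF i]] g(2) by simp
 then obtain x where x: "f (e i) = g x" "x : car X" by (rule imageE)
 have "g (r .[X] x) = f r" if "r : car (pj i)" for r
  using hom_smult[OF g(1) pj_elem(1)[OF i that] x(2)] pj_hom(1)[OF i Y f that] x(1) by simp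
 then show ?thesis using pj_map[OF i X x(2)] by (intro bexI[of _ "%r. r .[X] x"]) auto
qed

text \<open>Evaluation at \<open>e i\<close> identifies \<open>Hom(R e_i, X)\<close> with
  \<open>e_i X\<close>, written as the set of elements fixed by \<open>e i\<close>.\<close>

lemma hd_pj:
 fixes X :: "('a, 'm) module"
 assumes i: "i : I" and X: "fd X"
 shows "hd (pj i) X = vectorspace.dim K ((restr R X) on {x : car X. e i .[X] x = x})"
proof -
 note Xl = fd_lm[OF X] and Pl = fd_lm[OF pj_fd[OF i]]
 interpret X: left_module R X by (rule Xl)
 note ei = e_closed[OF i]
 let ?E = "{x : car X. e i .[X] x = x}"
 let ?T = "(restr R X) on ?E"
 interpret KX: left_module K "restr R X" by (rule restr_lm[OF Xl])
 have E: "is_sub K (restr R X) ?E"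
 proof (rule KX.subI)
  fix c x assume c: "c : car K" and x: "x : ?E"
  have "e i .[X] ((c .[R] 1[R]) .[X] x) = (c .[R] 1[R]) .[X] x"
   using X.smult_assoc[OF ei sc_closed[OF c], of x] X.smult_assoc[OF sc_closed[OF c] ei, of x] sc_central[OF c ei] x by simp
  then show "c .[restr R X] x : ?E" using x X.smult_closed[OF sc_closed[OF c]] by simp
 qed (use ei in \<open>auto simp: X.smult_r_distr\<close>)
 have Tl: "left_module K ?T" by (rule KX.sub_left_module[OF E])
 have T: "(%f. f (e i)) : mhom K (hom_space R (pj i) X) ?T"
  by (rule homI) (use e_in_pj[OF i] hom_closed[OF Hom_hom e_in_pj[OF i]] pj_hom(2)[OF i Xl Hom_hom] in \<open>simp_all del: pj_sel(1)\<close>)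
 have bij: "bij_betw (%f. f (e i)) (car (hom_space R (pj i) X)) (car ?T)"
  unfolding bij_betw_def
 proof
  show "inj_on (%f. f (e i)) (car (hom_space R (pj i) X))"
  proof (rule inj_onI)
   fix f g assume "f : car (hom_space R (pj i) X)" "g : car (hom_space R (pj i) X)" and fg: "f (e i) = g (e i)"
   then have f: "f : Hom (pj i) X" and g: "g : Hom (pj i) X" by simp_all
   show "f = g"
   proof (rule Hom_eqI[OF f g])
    fix x assume x: "x : car (pj i)"
    have "f x = x .[X] f (e i)" by (rule pj_hom(1)[OF i Xl Hom_hom[OF f] x])
    also have "\<dots> = g x" unfolding fg by (rule pj_hom(1)[OF i Xl Hom_hom[OF g] x, symmetric])
    finally show "f x = g x" .
   qed
  qed
  show "(%f. f (e i)) ` car (hom_space R (pj i) X) = car ?T"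
  proof
   show "(%f. f (e i)) ` car (hom_space R (pj i) X) <= car ?T" using hom_closed[OF T] by blast
   show "car ?T <= (%f. f (e i)) ` car (hom_space R (pj i) X)"
   proof
    fix y assume "y : car ?T"
    then have y: "y : car X" "e i .[X] y = y" by simp_all
    show "y : (%f. f (e i)) ` car (hom_space R (pj i) X)"
     by (rule image_eqI[of _ _ "\<lambda>r\<in>car (pj i). r .[X] y"])
      (use y e_in_pj[OF i] restrict_Hom[OF Pl pj_map[OF i Xl y(1)]] in \<open>simp_all del: pj_sel(1)\<close>)
   qed
  qed
 qed
 show ?thesis using dim_iso(2)[OF fdim_hom[OF pj_fd[OF i] X] Tl T bij] unfolding hd_def by simp
qed

text \<open>A copy of \<open>pj i\<close> in the carrier type to which \<open>projective\<close> and
  \<open>iso_classes\<close> refer.\<close>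

definition PJ :: "'i => ('k, 'a) fd_module" where
 "PJ i = (SOME P. fd P \<and> isomorphic_modules R (pj i) P)"

lemma PJ:
 assumes i: "i : I" shows "fd (PJ i)" "isomorphic_modules R (pj i) (PJ i)"
proof -
 obtain P :: "('k, 'a) fd_module" and f where "fd P" "f : mhom R (pj i) P" "bij_betw f (car (pj i)) (car P)"
  by (rule fd_copy[OF pj_fd[OF i]], rule that)
 then have "\<exists>P :: ('k, 'a) fd_module. fd P \<and> isomorphic_modules R (pj i) P" using isoI by blast
 from someI_ex[OF this] show "fd (PJ i)" "isomorphic_modules R (pj i) (PJ i)" unfolding PJ_def by blast+
qed

lemma projectiveD:
 fixes X Y P :: "('k, 'a) fd_module"
 assumes "projective R P" "fd X" "fd Y" "g : mhom R X Y" "g ` car X = car Y" "f : mhom R P Y"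
 shows "\<exists>h\<in>mhom R P X. \<forall>p\<in>car P. g (h p) = f p"
proof -
 from conjunct2[OF assms(1)[unfolded projective_def], THEN spec[of _ X], THEN spec[of _ Y], THEN spec[of _ g], THEN spec[of _ f]]
 show ?thesis by (rule mp) (intro conjI assms(4-6); simp add: fg_iff_fd assms(2,3))
qed

lemma hollow_PJ: assumes i: "i : I" shows "hollow (PJ i)"
proof -
 obtain f where f: "f : mhom R (pj i) (PJ i)" and b: "bij_betw f (car (pj i)) (car (PJ i))"
  using PJ(2)[OF i] by (rule isoE)
 have h: "hollow (pj i)" using hollow_pj[OF i] unfolding pj_def .
 have dm: "dm (PJ i) = dm (pj i)" by (rule fd_iso(2)[OF pj_fd[OF i] fd_lm[OF PJ(1)[OF i]] f b])
 have "dm (pj i) ~= 0" using dm_zero_iff[OF pj_fd[OF i]] hollow_sub_nonzero[OF h] by simp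
 then have nz: "car (PJ i) ~= {0[PJ i]}" using dm_zero_iff[OF PJ(1)[OF i]] dm by simp
 show ?thesis by (rule hollow_surj[OF pj_fd[OF i] PJ(1)[OF i] f h bij_betw_imp_surj_on[OF b] nz])
qed

lemma projective_PJ: assumes i: "i : I" shows "projective R (PJ i)"
 unfolding projective_def
proof (intro conjI allI impI)
 show "fin_gen_module R (PJ i)" using PJ(1)[OF i] by (simp add: fg_iff_fd)
 note Pl = fd_lm[OF PJ(1)[OF i]] and pl = fd_lm[OF pj_fd[OF i]]
 fix X Y :: "('k, 'a) fd_module" and g f
 assume a: "fin_gen_module R X \<and> fin_gen_module R Y \<and> g : mhom R X Y \<and> g ` car X = car Y \<and> f : mhom R (PJ i) Y"
 then have X: "lm X" and Y: "lm Y" and g: "g : mhom R X Y" "g ` car X = car Y" and f: "f : mhom R (PJ i) Y"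
  using fd_lm fg_iff_fd by blast+
 obtain \<phi> where \<phi>: "\<phi> : mhom R (pj i) (PJ i)" and b: "bij_betw \<phi> (car (pj i)) (car (PJ i))"
  using PJ(2)[OF i] by (rule isoE)
 obtain h where h: "h : mhom R (pj i) X" "\<forall>p\<in>car (pj i). g (h p) = f (\<phi> p)"
  using pj_lift[OF i X Y g hom_comp[OF \<phi> f]] by blast
 let ?\<psi> = "inv_into (car (pj i)) \<phi>"
 have \<psi>: "?\<psi> : mhom R (PJ i) (pj i)" by (rule hom_inv[OF pl Pl \<phi> b])
 have "g (h (?\<psi> p)) = f p" if p: "p : car (PJ i)" for p
  using h(2)[rule_format, OF hom_closed[OF \<psi> p]] bij_betw_inv_into_right[OF b p] by simp
 then show "\<exists>h\<in>mhom R (PJ i) X. \<forall>p\<in>car (PJ i). g (h p) = f p"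
  using hom_comp[OF \<psi> h(1)] by (intro bexI[of _ "%x. h (?\<psi> x)"]) auto
qed

lemma indec_PJ: "i : I ==> indec (PJ i)"
 by (rule hollow_indec[OF PJ(1) hollow_PJ])

lemma PJ_inj:
 assumes i: "i : I" and j: "j : I" and iso: "isomorphic_modules R (PJ i) (PJ j)"
 shows "i = j"
proof -
 have "isomorphic_modules R (pj i) (pj j)"
  by (rule iso_trans[OF iso_trans[OF PJ(2)[OF i] iso] iso_sym[OF fd_lm[OF pj_fd[OF j]] fd_lm[OF PJ(1)[OF j]] PJ(2)[OF j]]])
 then show ?thesis unfolding pj_def by (rule pj_inj[OF i j])
qed

lemma ex_maximal_sub:
 fixes P :: "('k, 'a) fd_module"
 assumes P: "fd P" and nz: "car P ~= {0[P]}"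
 obtains N where "sub P N" "N ~= car P" "!!A. sub P A ==> N <= A ==> A = N \<or> A = car P"
proof -
 interpret P: left_module R P by (rule fd_lm[OF P])
 let ?Q = "%N. sub P N \<and> N ~= car P"
 have 0: "?Q {0[P]}" using P.sub_zero_self nz by simp
 have bound: "\<forall>N. ?Q N --> dm (P on N) < Suc (dm P)" using dm_sub_le[OF P] by (simp add: less_Suc_eq_le)
 from ex_has_greatest_nat[of ?Q, OF 0 bound]
 obtain N where N: "?Q N" and mx: "!!A. ?Q A ==> dm (P on A) \<le> dm (P on N)" by blast
 show thesis
 proof (rule that)
  show "sub P N" "N ~= car P" using N by blast+
  fix A assume A: "sub P A" and le: "N <= A"
  show "A = N \<or> A = car P"
  proof (rule ccontr)
   assume n: "\<not> ?thesis"
   interpret A: left_module R "P on A" by (rule P.sub_left_module[OF A])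
   have s: "sub (P on A) N" using P.sub_of_sub[OF A] N le by blast
   have "dm (P on A) \<le> dm (P on N)" using mx[of A] A n by blast
   then have "dm ((P on A) on N) = dm (P on A)" using dm_sub_le(1)[OF fd_sub[OF P A] s] by simp
   from dm_sub_eq[OF fd_sub[OF P A] s this] show False using n by simp
  qed
 qed
qed

lemma finsum_smult:
 assumes X: "lm X" and x: "x : car X" and F: "finite F" "F <= I" and N: "sub X N" and eN: "!!i. i : I ==> e i .[X] x : N"
 shows "finsum R e F : car R \<and> finsum R e F .[X] x : N"
 using F
proof (induction F)
 interpret X: left_module R X by (rule X)
 case empty
 then show ?case using X.sub_zero[OF N] x by simp
next
 interpret X: left_module R X by (rule X)
 case (insert i F)
 have i: "i : I" using insert by blast
 have IH: "finsum R e F : car R" "finsum R e F .[X] x : N" using insert by auto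
 have "finsum R e (insert i F) = e i +[R] finsum R e F"
  by (rule X.R.finsum_insert[OF insert(1,2)]) (use insert(4) e_closed in auto)
 then show ?case using IH e_closed[OF i] X.smult_l_distr[OF e_closed[OF i] IH(1) x] X.sub_add[OF N eN[OF i] IH(2)] by simp
qed

text \<open>\<open>P\<close> has a simple quotient \<open>S\<close> on which some \<open>e i\<close>
  acts nontrivially, so \<open>PJ i\<close> also maps onto \<open>S\<close>. The map from
  \<open>P\<close> lifts to \<open>PJ i\<close>, and the lift is onto because its image and the
  kernel of \<open>PJ i \<rightarrow> S\<close> span the hollow \<open>PJ i\<close>. It splits by
  projectivity of \<open>PJ i\<close>, and \<open>P\<close> is indecomposable.\<close>

lemma indecomposable_projective_iso:
 fixes P :: "('k, 'a) fd_module"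
 assumes P: "indecomposable_projective R P"
 shows "\<exists>i\<in>I. isomorphic_modules R P (PJ i)"
proof -
 have ind: "indec P" and pr: "projective R P" using P unfolding indecomposable_projective_def by blast+
 note Pf = indec_fd[OF ind]
 note Pl = fd_lm[OF Pf]
 interpret P: left_module R P by (rule Pl)
 obtain N where N: "sub P N" "N ~= car P" and mx: "!!A. sub P A ==> N <= A ==> A = N \<or> A = car P"
  by (rule ex_maximal_sub[OF Pf indec_nonzero[OF ind]], rule that)
 obtain S :: "('k, 'a) fd_module" and \<pi> where S: "fd S" and \<pi>: "\<pi> : mhom R P S" "\<pi> ` car P = car S"
  and k: "!!x. x : car P ==> \<pi> x = 0[S] \<longleftrightarrow> x : N" by (rule fd_quotient[OF Pf N(1)], rule that)
 note Sl = fd_lm[OF S]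
 interpret S: left_module R S by (rule Sl)
 have simp: "A = car S" if A: "sub S A" "A ~= {0[S]}" for A
 proof -
  let ?A = "{x : car P. \<pi> x : A}"
  have sA: "sub P ?A" by (rule sub_vimage[OF Pl Sl \<pi>(1) A(1)])
  have N_le: "N <= ?A"
  proof
   fix x assume x: "x : N"
   have xc: "x : car P" by (rule P.sub_carrier[OF N(1) x])
   then show "x : ?A" using k[OF xc] x S.sub_zero[OF A(1)] by simp
  qed
  obtain y where y: "y : A" "y ~= 0[S]" using A S.sub_zero[OF A(1)] by blast
  have "y : \<pi> ` car P" using S.sub_carrier[OF A(1) y(1)] \<pi>(2) by simp
  then obtain x where x: "y = \<pi> x" "x : car P" by (rule imageE)
  have "x : ?A" "x ~: N" using x y k[OF x(2)] by auto
  then have c: "?A = car P" using mx[OF sA N_le] by blast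
  have "car S <= A" unfolding \<pi>(2)[symmetric] using c by blast
  then show ?thesis using S.sub_subset[OF A(1)] by blast
 qed
 obtain x where x: "x : car P" "x ~: N" using N P.sub_subset by blast
 have sx: "\<pi> x : car S" "\<pi> x ~= 0[S]" using hom_closed[OF \<pi>(1) x(1)] k[OF x(1)] x(2) by auto
 have "\<exists>i\<in>I. e i .[S] \<pi> x ~: {0[S]}"
 proof (rule ccontr)
  assume "\<not> ?thesis"
  then have "!!i. i : I ==> e i .[S] \<pi> x : {0[S]}" by blast
  from finsum_smult[OF Sl sx(1) finite_I order_refl S.sub_zero_self this] show False
   using e_sum S.smult_one[OF sx(1)] sx(2) by simp
 qed
 then obtain i where i: "i : I" and ei: "e i .[S] \<pi> x ~= 0[S]" by blast
 let ?s = "e i .[S] \<pi> x"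
 have sc: "?s : car S" by (rule S.smult_closed[OF e_closed[OF i] sx(1)])
 note PJf = PJ(1)[OF i] and PJl = fd_lm[OF PJ(1)[OF i]] and pl = fd_lm[OF pj_fd[OF i]]
 interpret PJ: left_module R "PJ i" by (rule PJl)
 obtain \<phi> where \<phi>: "\<phi> : mhom R (pj i) (PJ i)" and b: "bij_betw \<phi> (car (pj i)) (car (PJ i))"
  using PJ(2)[OF i] by (rule isoE)
 let ?\<psi> = "inv_into (car (pj i)) \<phi>"
 have \<psi>: "?\<psi> : mhom R (PJ i) (pj i)" by (rule hom_inv[OF pl PJl \<phi> b])
 let ?q = "%y. ?\<psi> y .[S] ?s"
 have q: "?q : mhom R (PJ i) S" by (rule hom_comp[OF \<psi> pj_map[OF i Sl sc]])
 have q1: "?q (\<phi> (e i)) = ?s"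
 proof -
  have "?\<psi> (\<phi> (e i)) = e i" by (rule bij_betw_inv_into_left[OF b e_in_pj[OF i]])
  then show ?thesis using S.smult_assoc[OF e_closed[OF i] e_closed[OF i] sx(1)] e_idem[OF i] by simp
 qed
 have \<phi>e: "\<phi> (e i) : car (PJ i)" by (rule hom_closed[OF \<phi> e_in_pj[OF i]])
 have qs: "?q ` car (PJ i) = car S"
 proof (rule simp[OF sub_image[OF PJl Sl q PJ.sub_carrier_self]])
  have "?s : ?q ` car (PJ i)" using imageI[OF \<phi>e, of ?q] q1 by simp
  then show "?q ` car (PJ i) ~= {0[S]}" using ei by blast
 qed
 have "\<exists>h\<in>mhom R P (PJ i). \<forall>p\<in>car P. ?q (h p) = \<pi> p"
  by (rule projectiveD[OF pr PJf S q qs \<pi>(1)])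
 then obtain h where h: "h : mhom R P (PJ i)" and hq: "!!p. p : car P ==> ?q (h p) = \<pi> p" by blast
 let ?k = "{y : car (PJ i). ?q y = 0[S]}"
 have ks: "sub (PJ i) ?k" by (rule sub_kernel[OF PJl Sl q])
 have hi: "sub (PJ i) (h ` car P)" by (rule sub_image[OF Pl PJl h P.sub_carrier_self])
 have "set_add (PJ i) (h ` car P) ?k = car (PJ i)"
 proof
  show "set_add (PJ i) (h ` car P) ?k <= car (PJ i)" by (rule PJ.sub_subset[OF PJ.sub_set_add[OF hi ks]])
  show "car (PJ i) <= set_add (PJ i) (h ` car P) ?k"
  proof
   fix y assume y: "y : car (PJ i)"
   have "?q y : \<pi> ` car P" using hom_closed[OF q y] \<pi>(2) by simp
   then obtain p where p: "?q y = \<pi> p" "p : car P" by (rule imageE)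
   note hp = hom_closed[OF h p(2)]
   have "?q (y -[PJ i] h p) = ?q y -[S] ?q (h p)" by (rule hom_diff[OF PJl Sl q y hp])
   also have "\<dots> = 0[S]" unfolding hq[OF p(2)] p(1) by (rule S.diff_self[OF hom_closed[OF \<pi>(1) p(2)]])
   finally have "y -[PJ i] h p : ?k" using PJ.M.minus_closed[OF y hp] by simp
   from set_addI[OF imageI[OF p(2), of h] this, of "PJ i"]
   show "y : set_add (PJ i) (h ` car P) ?k" using PJ.add_diff_cancel[OF hp y] by simp
  qed
 qed
 from hollow_subD[OF hollow_PJ[OF i] hi ks this]
 have hs: "h ` car P = car (PJ i)"
 proof
  assume "?k = car (PJ i)"
  then have "\<phi> (e i) : ?k" using \<phi>e by blast
  then show ?thesis using q1 ei by simp
 qed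
 have "\<exists>m\<in>mhom R (PJ i) P. \<forall>p\<in>car (PJ i). h (m p) = p"
  by (rule projectiveD[OF projective_PJ[OF i] Pf PJf h hs hom_id])
 then obtain m where m: "m : mhom R (PJ i) P" and mh: "!!p. p : car (PJ i) ==> h (m p) = p" by blast
 have "bij_betw (%p. h (m p)) (car (PJ i)) (car (PJ i))"
  by (subst bij_betw_cong[where g="%y. y"]) (simp_all add: mh bij_betw_def)
 from split_mono_bij[where f=m and g=h, OF PJf indec_nonzero[OF indec_PJ[OF i]] ind m h this]
 have "isomorphic_modules R (PJ i) P" by (rule isoI[OF m])
 from iso_sym[OF PJl Pl this] show ?thesis using i by blast
qed

lemma indecomposable_projective_PJ: "i : I ==> indecomposable_projective R (PJ i)"
 unfolding indecomposable_projective_def using indec_PJ projective_PJ by blast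

lemma indecomposable_projective_fd: "indecomposable_projective R P ==> fd P"
 unfolding indecomposable_projective_def using indec_fd by blast

lemma iso_classes_PJ:
 "\<exists>f. bij_betw f I (iso_classes R (indecomposable_projective R))"
proof -
 define r where "r = {(M :: ('k, 'a) fd_module, N). indecomposable_projective R M \<and> indecomposable_projective R N \<and> isomorphic_modules R M N}"
 define A where "A = {M :: ('k, 'a) fd_module. indecomposable_projective R M}"
 have r: "equiv A r" unfolding A_def r_def by (rule iso_equiv[OF fd_lm[OF indecomposable_projective_fd]])
 have r_iff: "(M, N) : r \<longleftrightarrow> indecomposable_projective R M \<and> indecomposable_projective R N \<and> isomorphic_modules R M N" for M N
  by (simp add: r_def)
 have A_iff: "M : A \<longleftrightarrow> indecomposable_projective R M" for M by (simp add: A_def)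
 have q: "iso_classes R (indecomposable_projective R) = A // r" by (simp add: iso_classes_def A_def r_def)
 have "bij_betw (%i. r `` {PJ i}) I (A // r)"
  unfolding bij_betw_def
 proof
  show "inj_on (%i. r `` {PJ i}) I"
  proof (rule inj_onI)
   fix i j assume i: "i : I" and j: "j : I" and e: "r `` {PJ i} = r `` {PJ j}"
   have "(PJ i, PJ j) : r" by (rule eq_equiv_class[OF e r]) (simp add: A_iff indecomposable_projective_PJ[OF j])
   then show "i = j" using PJ_inj[OF i j] r_iff by blast
  qed
  show "(%i. r `` {PJ i}) ` I = A // r"
  proof
   show "(%i. r `` {PJ i}) ` I <= A // r" by (rule image_subsetI, rule quotientI) (simp add: indecomposable_projective_PJ A_iff)
   show "A // r <= (%i. r `` {PJ i}) ` I"
   proof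
    fix C assume "C : A // r"
    then obtain P where P: "P : A" and C: "C = r `` {P}" by (rule quotientE)
    have P': "indecomposable_projective R P" using P A_iff by blast
    obtain i where i: "i : I" "isomorphic_modules R P (PJ i)" using indecomposable_projective_iso[OF P'] by blast
    have "(P, PJ i) : r" using P' i indecomposable_projective_PJ[OF i(1)] r_iff by blast
    then have "r `` {P} = r `` {PJ i}" by (rule equiv_class_eq[OF r])
    then show "C : (%i. r `` {PJ i}) ` I" unfolding C by (rule image_eqI) (rule i(1))
   qed
  qed
 qed
 then show ?thesis unfolding q by blast
qed

lemma algebra_rank_eq: "algebra_rank R = card I"
proof -
 obtain f where "bij_betw f I (iso_classes R (indecomposable_projective R))" using iso_classes_PJ by (rule exE)
 from bij_betw_same_card[OF this] show ?thesis unfolding algebra_rank_def by simp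
qed

lemma projective_representatives_exist: "\<exists>Ps. representatives R (indecomposable_projective R) Ps"
proof -
 obtain f where "bij_betw f I (iso_classes R (indecomposable_projective R))" using iso_classes_PJ by (rule exE)
 then have fin: "finite (iso_classes R (indecomposable_projective R))" using finite_I bij_betw_finite by blast
 show ?thesis by (rule representatives_exist[OF _ fin]) (rule fd_lm[OF indecomposable_projective_fd])
qed

text \<open>\<open>has_magnitude\<close> ranges over all lists of representatives, so the dimensions
  are needed for an arbitrary one. Such a list is a relabelling \<open>\<sigma>\<close> of the
  \<open>PJ i\<close>, and the space on the right is \<open>e_k R e_l\<close> for the relabelled
  indices.\<close>

lemma projective_representatives:
 assumes rep: "representatives R (indecomposable_projective R) Ps"
 obtains \<sigma> where "bij_betw \<sigma> {..<length Ps} I" "!!k l. k < length Ps ==> l < length Ps ==>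
  hd (Ps ! k) (Ps ! l) = vectorspace.dim K ((restr R (pj (\<sigma> l))) on {x : car (pj (\<sigma> l)). e (\<sigma> k) *[R] x = x})"
proof -
 have P: "indecomposable_projective R (Ps ! k)" if "k < length Ps" for k using rep that unfolding representatives_def by simp
 have ex1: "\<exists>!k. k < length Ps \<and> isomorphic_modules R M (Ps ! k)" if "indecomposable_projective R M" for M
  using rep that unfolding representatives_def by blast
 have "\<forall>k. \<exists>i. k < length Ps --> i : I \<and> isomorphic_modules R (Ps ! k) (PJ i)"
  using indecomposable_projective_iso[OF P] by blast
 from choice[OF this] obtain \<sigma> where "\<forall>k. k < length Ps --> \<sigma> k : I \<and> isomorphic_modules R (Ps ! k) (PJ (\<sigma> k))" by (elim exE)
 then have \<sigma>: "!!k. k < length Ps ==> \<sigma> k : I" "!!k. k < length Ps ==> isomorphic_modules R (Ps ! k) (PJ (\<sigma> k))" by simp_all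
 have sym: "isomorphic_modules R (PJ (\<sigma> k)) (Ps ! k)" if k: "k < length Ps" for k
  by (rule iso_sym[OF fd_lm[OF indecomposable_projective_fd[OF P[OF k]]] fd_lm[OF PJ(1)[OF \<sigma>(1)[OF k]]] \<sigma>(2)[OF k]])
 have "bij_betw \<sigma> {..<length Ps} I"
  unfolding bij_betw_def
 proof
  show "inj_on \<sigma> {..<length Ps}"
  proof (rule inj_onI)
   fix k l assume "k : {..<length Ps}" "l : {..<length Ps}" and e: "\<sigma> k = \<sigma> l"
   then have k: "k < length Ps" and l: "l < length Ps" by simp_all
   have "isomorphic_modules R (PJ (\<sigma> k)) (Ps ! l)" using sym[OF l] e by simp
   then show "k = l" using ex1[OF indecomposable_projective_PJ[OF \<sigma>(1)[OF k]]] sym[OF k] k l by blast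
  qed
  show "\<sigma> ` {..<length Ps} = I"
  proof
   show "\<sigma> ` {..<length Ps} <= I" using \<sigma>(1) by auto
   show "I <= \<sigma> ` {..<length Ps}"
   proof
    fix i assume i: "i : I"
    obtain k where k: "k < length Ps" "isomorphic_modules R (PJ i) (Ps ! k)" using ex1[OF indecomposable_projective_PJ[OF i]] by blast
    have "i = \<sigma> k" by (rule PJ_inj[OF i \<sigma>(1)[OF k(1)] iso_trans[OF k(2) \<sigma>(2)[OF k(1)]]])
    then show "i : \<sigma> ` {..<length Ps}" using k(1) by blast
   qed
  qed
 qed
 moreover have "hd (Ps ! k) (Ps ! l) = vectorspace.dim K ((restr R (pj (\<sigma> l))) on {x : car (pj (\<sigma> l)). e (\<sigma> k) *[R] x = x})"
  if k: "k < length Ps" and l: "l < length Ps" for k l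
 proof -
  note pk = pj_fd[OF \<sigma>(1)[OF k]] and pl = pj_fd[OF \<sigma>(1)[OF l]]
  have f: "fd (Ps ! k)" "fd (Ps ! l)" using indecomposable_projective_fd P k l by blast+
  have ik: "isomorphic_modules R (Ps ! k) (pj (\<sigma> k))"
   by (rule iso_trans[OF \<sigma>(2)[OF k] iso_sym[OF fd_lm[OF pk] fd_lm[OF PJ(1)[OF \<sigma>(1)[OF k]]] PJ(2)[OF \<sigma>(1)[OF k]]]])
  have il: "isomorphic_modules R (Ps ! l) (pj (\<sigma> l))"
   by (rule iso_trans[OF \<sigma>(2)[OF l] iso_sym[OF fd_lm[OF pl] fd_lm[OF PJ(1)[OF \<sigma>(1)[OF l]]] PJ(2)[OF \<sigma>(1)[OF l]]]])
  have "hd (Ps ! k) (Ps ! l) = hd (pj (\<sigma> k)) (pj (\<sigma> l))" by (rule hd_cong[OF ik f(1) pk il f(2) pl])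
  then show ?thesis using hd_pj[OF \<sigma>(1)[OF k] pl] by (simp only: pj_sel(4))
 qed
 ultimately show thesis by (rule that)
qed

end

section \<open>The Auslander algebra of a list of indecomposable modules\<close>

locale indec_list = fd_algebra K R
 for K :: "('k, 'c) ring_scheme" and R :: "('k, 'a, 'z) module_scheme" +
 fixes Ms :: "('k, 'a) fd_module list"
 assumes Ms: "i < length Ms ==> indec (Ms ! i)"
  and Ms_inj: "i < length Ms ==> j < length Ms ==> isomorphic_modules R (Ms ! i) (Ms ! j) ==> i = j"

context indec_list
begin

abbreviation D :: "('a, nat => nat => 'k) module" where "D \<equiv> direct_sum_list Ms"

definition inj :: "nat => (nat => 'k) => nat => nat => 'k" where
 "inj i y = (\<lambda>j\<in>{..<length Ms}. if j = i then y else 0[Ms ! j])"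

lemma D_sel:
 "car D = (\<Pi>\<^sub>E i\<in>{..<length Ms}. car (Ms ! i))"
 "0[D] = (\<lambda>i\<in>{..<length Ms}. 0[Ms ! i])"
 "x +[D] y = (\<lambda>i\<in>{..<length Ms}. x i +[Ms ! i] y i)"
 "r .[D] x = (\<lambda>i\<in>{..<length Ms}. r .[Ms ! i] x i)"
 by (simp_all add: direct_sum_list_def)

lemma D_ext:
 assumes "x : car D" "y : car D" "!!i. i < length Ms ==> x i = y i" shows "x = y"
 using assms unfolding D_sel by (intro PiE_ext[of x _ _ y]) auto

lemma D_comp: "x : car D ==> i < length Ms ==> x i : car (Ms ! i)"
 unfolding D_sel by (auto dest: PiE_mem)

lemma D_memI: "x : extensional {..<length Ms} ==> (!!i. i < length Ms ==> x i : car (Ms ! i)) ==> x : car D"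
 unfolding D_sel by (auto simp: PiE_def)

lemma Ml: "i < length Ms ==> lm (Ms ! i)"
 by (rule fd_lm[OF indec_fd[OF Ms]])

lemma D_lm: "lm D"
proof -
 have g: "abelian_group (Ms ! i)" if "i < length Ms" for i using Ml[OF that] unfolding left_module_def by blast
 show ?thesis
 proof (rule left_moduleI[OF ring_R])
  fix x y z assume x: "x : car D" and y: "y : car D"
  show xy: "x +[D] y : car D"
  proof (rule D_memI)
   fix i assume i: "i < length Ms"
   interpret M: left_module R "Ms ! i" by (rule Ml[OF i])
   show "(x +[D] y) i : car (Ms ! i)" using D_comp[OF x i] D_comp[OF y i] i by (simp add: D_sel)
  qed (simp add: D_sel)
  show "x +[D] y = y +[D] x"
   unfolding D_sel
  proof (rule restrict_ext)
   fix i assume "i : {..<length Ms}"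
   then have i: "i < length Ms" by simp
   interpret M: left_module R "Ms ! i" by (rule Ml[OF i])
   show "x i +[Ms ! i] y i = y i +[Ms ! i] x i" by (rule M.M.a_comm[OF D_comp[OF x i] D_comp[OF y i]])
  qed
  assume z: "z : car D"
  show "x +[D] y +[D] z = x +[D] (y +[D] z)"
   unfolding D_sel
  proof (rule restrict_ext)
   fix i assume "i : {..<length Ms}"
   then have i: "i < length Ms" by simp
   interpret M: left_module R "Ms ! i" by (rule Ml[OF i])
   show "(\<lambda>i\<in>{..<length Ms}. x i +[Ms ! i] y i) i +[Ms ! i] z i = x i +[Ms ! i] (\<lambda>i\<in>{..<length Ms}. y i +[Ms ! i] z i) i"
    using M.M.a_assoc[OF D_comp[OF x i] D_comp[OF y i] D_comp[OF z i]] i by simp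
  qed
 next
  show "0[D] : car D"
  proof (rule D_memI)
   fix i assume i: "i < length Ms"
   interpret M: left_module R "Ms ! i" by (rule Ml[OF i])
   show "0[D] i : car (Ms ! i)" using i by (simp add: D_sel)
  qed (simp add: D_sel)
 next
  fix x assume x: "x : car D"
  have xe: "x = (\<lambda>i\<in>{..<length Ms}. x i)" using x unfolding D_sel by (simp add: PiE_def extensional_restrict)
  show "0[D] +[D] x = x"
   by (subst (2) xe) (unfold D_sel, rule restrict_ext, use D_comp[OF x] g in \<open>simp add: abelian_group_def abelian_monoid.l_zero\<close>)
  show "\<exists>y\<in>car D. y +[D] x = 0[D]"
  proof
   let ?y = "\<lambda>i\<in>{..<length Ms}. -[Ms ! i] x i"
   show "?y +[D] x = 0[D]"
    unfolding D_sel by (rule restrict_ext) (use D_comp[OF x] g in \<open>simp add: abelian_group.l_neg\<close>)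
   show "?y : car D"
    by (rule D_memI) (use D_comp[OF x] g in \<open>simp_all add: abelian_group.a_inv_closed\<close>)
  qed
  show "1[R] .[D] x = x"
   by (subst (2) xe) (unfold D_sel, rule restrict_ext, use D_comp[OF x] in \<open>simp add: left_module.smult_one[OF Ml]\<close>)
  fix a assume a: "a : car R"
  show "a .[D] x : car D"
   by (rule D_memI) (use D_comp[OF x] a in \<open>simp_all add: D_sel left_module.smult_closed[OF Ml]\<close>)
  show "(a +[R] b) .[D] x = a .[D] x +[D] b .[D] x" if b: "b : car R" for b
   unfolding D_sel by (rule restrict_ext) (use D_comp[OF x] a b in \<open>simp add: left_module.smult_l_distr[OF Ml]\<close>)
  show "(a *[R] b) .[D] x = a .[D] (b .[D] x)" if b: "b : car R" for b
   unfolding D_sel by (rule restrict_ext) (use D_comp[OF x] a b in \<open>simp add: left_module.smult_assoc[OF Ml]\<close>)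
  show "a .[D] (x +[D] y) = a .[D] x +[D] a .[D] y" if y: "y : car D" for y
   unfolding D_sel by (rule restrict_ext) (use D_comp[OF x] D_comp[OF y] a in \<open>simp add: left_module.smult_r_distr[OF Ml]\<close>)
 qed
qed

lemma proj_hom: "i < length Ms ==> (%x. x i) : mhom R D (Ms ! i)"
 by (rule homI) (simp_all add: D_comp, simp_all add: D_sel)

lemma inj_hom:
 assumes i: "i < length Ms" shows "inj i : mhom R (Ms ! i) D"
proof (rule homI)
 have z: "0[Ms ! j] : car (Ms ! j)" "0[Ms ! j] +[Ms ! j] 0[Ms ! j] = 0[Ms ! j]"
  "!!a. a : car R ==> a .[Ms ! j] 0[Ms ! j] = 0[Ms ! j]" if "j < length Ms" for j
 proof -
  interpret M: left_module R "Ms ! j" by (rule Ml[OF that])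
  show "0[Ms ! j] : car (Ms ! j)" "0[Ms ! j] +[Ms ! j] 0[Ms ! j] = 0[Ms ! j]"
   "!!a. a : car R ==> a .[Ms ! j] 0[Ms ! j] = 0[Ms ! j]" by simp_all
 qed
 fix x assume x: "x : car (Ms ! i)"
 show "inj i x : car D" by (rule D_memI) (use x z in \<open>simp_all add: inj_def\<close>)
 show "inj i (x +[Ms ! i] y) = inj i x +[D] inj i y" for y
  unfolding D_sel inj_def by (rule restrict_ext) (use z in simp)
 show "inj i (a .[Ms ! i] x) = a .[D] inj i x" if "a : car R" for a
  unfolding D_sel inj_def by (rule restrict_ext) (use z that in simp)
qed

lemma inj_self [simp]: "i < length Ms ==> inj i y i = y"
 by (simp add: inj_def)

text \<open>Exhausts the direct sum by the submodules supported on a finite set of indices; each new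
  index adds the image of one summand.\<close>

lemma D_fd: "fd D"
proof -
 interpret D: left_module R D by (rule D_lm)
 let ?D = "%F. {x : car D. \<forall>j<length Ms. j ~: F --> x j = 0[Ms ! j]}"
 have "sub D (?D F) \<and> fd (D on (?D F))" if "finite F" "F <= {..<length Ms}" for F
  using that
 proof (induction F)
  case empty
  have "?D {} = {0[D]}"
  proof
   show "?D {} <= {0[D]}"
   proof
    fix x assume x: "x : ?D {}"
    have "x = 0[D]" by (rule D_ext) (use x D.M.zero_closed in \<open>simp_all add: D_sel(2)\<close>)
    then show "x : {0[D]}" by simp
   qed
   show "{0[D]} <= ?D {}" by (simp add: D_sel(2)[symmetric]) (simp add: D_sel(2))
  qed
  moreover have "fd (D on {0[D]})"
  proof -
   have l: "lm (D on {0[D]})" by (rule D.sub_left_module[OF D.sub_zero_self])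
   show ?thesis unfolding fd_def using l fdim_zero[OF field_K restr_lm[OF l]] by simp
  qed
  ultimately show ?case using D.sub_zero_self by simp
 next
  case (insert i F)
  then have i: "i < length Ms" and IH: "sub D (?D F)" "fd (D on (?D F))" by auto
  interpret M: left_module R "Ms ! i" by (rule Ml[OF i])
  let ?I = "inj i ` car (Ms ! i)"
  have sI: "sub D ?I" by (rule sub_image[OF Ml[OF i] D_lm inj_hom[OF i] M.sub_carrier_self])
  have fI: "fd (D on ?I)"
  proof (rule fd_surj(1)[OF indec_fd[OF Ms[OF i]]])
   show "lm (D on ?I)" by (rule D.sub_left_module[OF sI])
   show "inj i : mhom R (Ms ! i) (D on ?I)" by (rule hom_into_sub[OF Ml[OF i] D_lm inj_hom[OF i]]) (rule imageI)
  qed simp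
  have "set_add D (?D F) ?I = ?D (insert i F)"
  proof
   show "set_add D (?D F) ?I <= ?D (insert i F)"
   proof
    fix x assume "x : set_add D (?D F) ?I"
    then obtain u w where u: "u : ?D F" and w: "w : ?I" and x: "x = u +[D] w" by (rule set_addE)
    obtain y where y: "w = inj i y" "y : car (Ms ! i)" using w by (rule imageE)
    have xc: "x : car D" unfolding x by (rule D.M.a_closed) (use u hom_closed[OF inj_hom[OF i] y(2)] y(1) in auto)
    have "x j = 0[Ms ! j]" if j: "j < length Ms" "j ~: insert i F" for j
    proof -
     interpret Mj: left_module R "Ms ! j" by (rule Ml[OF j(1)])
     show ?thesis using u j unfolding x y(1) by (simp add: D_sel(3) inj_def)
    qed
    then show "x : ?D (insert i F)" using xc by simp
   qed
   show "?D (insert i F) <= set_add D (?D F) ?I"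
   proof
    fix x assume x: "x : ?D (insert i F)"
    then have xc: "x : car D" by simp
    let ?w = "inj i (x i)"
    have w: "?w : ?I" by (rule imageI[OF D_comp[OF xc i]])
    have wc: "?w : car D" by (rule hom_closed[OF inj_hom[OF i] D_comp[OF xc i]])
    let ?u = "x -[D] ?w"
    have uc: "?u : car D" by (rule D.M.minus_closed[OF xc wc])
    have "?u j = 0[Ms ! j]" if j: "j < length Ms" "j ~: F" for j
    proof -
     interpret Mj: left_module R "Ms ! j" by (rule Ml[OF j(1)])
     have "?u j = x j -[Ms ! j] ?w j" by (rule hom_diff[OF D_lm Ml[OF j(1)] proj_hom[OF j(1)] xc wc])
     then show ?thesis using x j i Mj.diff_self[OF D_comp[OF xc j(1)]] by (cases "j = i") (simp_all add: inj_def)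
    qed
    then have "?u : ?D F" using uc by simp
    from set_addI[OF this w, of D] show "x : set_add D (?D F) ?I" using D.diff_add_cancel[OF xc wc] by simp
   qed
  qed
  then show ?case using D.sub_set_add[OF IH(1) sI] fd_set_add[OF D_lm IH(1) sI IH(2) fI] by simp
 qed
 from this[of "{..<length Ms}"] have "fd (D on (?D {..<length Ms}))" by simp
 moreover have "?D {..<length Ms} = car D" by auto
 ultimately show ?thesis by simp
qed

abbreviation \<Gamma> :: "('k, (nat => nat => 'k) => nat => nat => 'k) module" where "\<Gamma> \<equiv> auslander_algebra R Ms"

lemma \<Gamma>_sel:
 "car \<Gamma> = Hom D D" "0[\<Gamma>] = 0[hom_space R D D]" "1[\<Gamma>] = (\<lambda>x\<in>car D. x)"
 "f +[\<Gamma>] g = f +[hom_space R D D] g" "f *[\<Gamma>] g = (\<lambda>x\<in>car D. f (g x))" "c .[\<Gamma>] f = c .[hom_space R D D] f"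
 by (simp_all add: auslander_algebra_def end_algebra_def compose_def hom_space_def Hom_def)

lemma Hom_closed:
 assumes f: "f : Hom D D" and x: "x : car D" shows "f x : car D"
 by (rule hom_closed[OF Hom_hom[OF f] x])

lemma \<Gamma>_app:
 assumes "x : car D"
 shows "1[\<Gamma>] x = x" "0[\<Gamma>] x = 0[D]" "(f +[\<Gamma>] g) x = f x +[D] g x" "(f *[\<Gamma>] g) x = f (g x)"
  "(c .[\<Gamma>] f) x = (c .[R] 1[R]) .[D] f x"
 using assms by (simp_all add: \<Gamma>_sel)

lemma \<Gamma>_comp:
 assumes f: "f : Hom D D" and g: "g : Hom D D" shows "f *[\<Gamma>] g : Hom D D"
 unfolding \<Gamma>_sel by (rule restrict_Hom[OF D_lm hom_comp[OF Hom_hom[OF g] Hom_hom[OF f]]])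

lemma \<Gamma>_ring: "ring \<Gamma>"
proof -
 interpret H: left_module K "hom_space R D D" by (rule hom_space_lm[OF D_lm D_lm])
 interpret D: left_module R D by (rule D_lm)
 have cl: "!!f g. f : Hom D D ==> g : Hom D D ==> f +[\<Gamma>] g : Hom D D"
  using H.M.a_closed unfolding \<Gamma>_sel(4) hom_space_sel(1) by blast
 have one: "1[\<Gamma>] : Hom D D" unfolding \<Gamma>_sel by (rule restrict_Hom[OF D_lm hom_id])
 show ?thesis
 proof (rule ringI)
  show "abelian_group \<Gamma>"
  proof (rule abelian_groupI)
   fix x assume "x : car \<Gamma>"
   then have x: "x : car (hom_space R D D)" by (simp add: \<Gamma>_sel)
   show "\<exists>y\<in>car \<Gamma>. y +[\<Gamma>] x = 0[\<Gamma>]"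
    unfolding \<Gamma>_sel(1,2,4) hom_space_sel(1)[symmetric]
    by (rule bexI[of _ "-[hom_space R D D] x"]) (rule H.M.l_neg[OF x], rule H.M.a_inv_closed[OF x])
  qed (unfold \<Gamma>_sel(1,2,4) hom_space_sel(1)[symmetric], (rule H.M.a_closed H.M.zero_closed H.M.a_assoc H.M.a_comm H.M.l_zero; assumption)+)
  show "monoid \<Gamma>"
  proof (rule monoidI)
   fix f g h assume f: "f : car \<Gamma>" and g: "g : car \<Gamma>" and h: "h : car \<Gamma>"
   then have fgh: "f : Hom D D" "g : Hom D D" "h : Hom D D" by (simp_all add: \<Gamma>_sel)
   show "f *[\<Gamma>] g *[\<Gamma>] h = f *[\<Gamma>] (g *[\<Gamma>] h)"
    unfolding \<Gamma>_sel(5) by (rule restrict_ext) (simp add: Hom_closed[OF fgh(3)])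
  next
   fix f assume "f : car \<Gamma>"
   then have f: "f : Hom D D" by (simp add: \<Gamma>_sel)
   show "1[\<Gamma>] *[\<Gamma>] f = f"
    by (rule Hom_eqI[OF \<Gamma>_comp[OF one f] f]) (simp add: \<Gamma>_app Hom_closed[OF f])
   show "f *[\<Gamma>] 1[\<Gamma>] = f"
    by (rule Hom_eqI[OF \<Gamma>_comp[OF f one] f]) (simp add: \<Gamma>_app)
  qed (use one \<Gamma>_comp in \<open>simp_all add: \<Gamma>_sel(1)\<close>)
  fix f g h assume "f : car \<Gamma>" "g : car \<Gamma>" "h : car \<Gamma>"
  then have f: "f : Hom D D" and g: "g : Hom D D" and h: "h : Hom D D" by (simp_all add: \<Gamma>_sel)
  show "(f +[\<Gamma>] g) *[\<Gamma>] h = f *[\<Gamma>] h +[\<Gamma>] g *[\<Gamma>] h"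
   by (rule Hom_eqI[OF \<Gamma>_comp[OF cl[OF f g] h] cl[OF \<Gamma>_comp[OF f h] \<Gamma>_comp[OF g h]]]) (simp add: \<Gamma>_app Hom_closed[OF h])
  show "h *[\<Gamma>] (f +[\<Gamma>] g) = h *[\<Gamma>] f +[\<Gamma>] h *[\<Gamma>] g"
   by (rule Hom_eqI[OF \<Gamma>_comp[OF h cl[OF f g]] cl[OF \<Gamma>_comp[OF h f] \<Gamma>_comp[OF h g]]])
    (simp add: \<Gamma>_app Hom_closed[OF f] Hom_closed[OF g] hom_add[OF Hom_hom[OF h]])
 qed
qed

lemma \<Gamma>_smult: "c : car K ==> f : Hom D D ==> c .[\<Gamma>] f : Hom D D"
 using left_module.smult_closed[OF hom_space_lm[OF D_lm D_lm]] unfolding \<Gamma>_sel(6) hom_space_sel(1) by blast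

lemma \<Gamma>_one: "1[\<Gamma>] : Hom D D"
 unfolding \<Gamma>_sel by (rule restrict_Hom[OF D_lm hom_id])

lemma \<Gamma>_scalar:
 assumes c: "c : car K" and f: "f : Hom D D"
 shows "(c .[\<Gamma>] 1[\<Gamma>]) *[\<Gamma>] f = c .[\<Gamma>] f" "f *[\<Gamma>] (c .[\<Gamma>] 1[\<Gamma>]) = c .[\<Gamma>] f"
proof -
 note c1 = \<Gamma>_smult[OF c \<Gamma>_one] and cf = \<Gamma>_smult[OF c f]
 show "(c .[\<Gamma>] 1[\<Gamma>]) *[\<Gamma>] f = c .[\<Gamma>] f"
  by (rule Hom_eqI[OF \<Gamma>_comp[OF c1 f] cf]) (simp add: \<Gamma>_app Hom_closed[OF f])
 show "f *[\<Gamma>] (c .[\<Gamma>] 1[\<Gamma>]) = c .[\<Gamma>] f"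
  by (rule Hom_eqI[OF \<Gamma>_comp[OF f c1] cf]) (simp add: \<Gamma>_app hom_smult[OF Hom_hom[OF f] sc_closed[OF c]])
qed

lemma \<Gamma>_fd_algebra: "fd_algebra K \<Gamma>"
proof -
 interpret H: left_module K "hom_space R D D" by (rule hom_space_lm[OF D_lm D_lm])
 have one: "1[\<Gamma>] : car (hom_space R D D)" using \<Gamma>_one by simp
 show ?thesis
 proof (rule fd_algebra.intro)
  show "field K" by (rule field_K)
  show "ring \<Gamma>" by (rule \<Gamma>_ring)
  show "1[K] .[\<Gamma>] 1[\<Gamma>] = 1[\<Gamma>]" unfolding \<Gamma>_sel(6) by (rule H.smult_one[OF one])
  fix c assume c: "c : car K"
  show "c .[\<Gamma>] 1[\<Gamma>] : car \<Gamma>" using \<Gamma>_smult[OF c \<Gamma>_one] by (simp add: \<Gamma>_sel(1))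
  show "(c +[K] d) .[\<Gamma>] 1[\<Gamma>] = c .[\<Gamma>] 1[\<Gamma>] +[\<Gamma>] d .[\<Gamma>] 1[\<Gamma>]" if d: "d : car K" for d
   unfolding \<Gamma>_sel(4,6) by (rule H.smult_l_distr[OF c d one])
  show "(c *[K] d) .[\<Gamma>] 1[\<Gamma>] = (c .[\<Gamma>] 1[\<Gamma>]) *[\<Gamma>] (d .[\<Gamma>] 1[\<Gamma>])" if d: "d : car K" for d
   unfolding \<Gamma>_scalar(1)[OF c \<Gamma>_smult[OF d \<Gamma>_one]] unfolding \<Gamma>_sel(6) by (rule H.smult_assoc[OF c d one])
  show "(c .[\<Gamma>] 1[\<Gamma>]) *[\<Gamma>] f = f *[\<Gamma>] (c .[\<Gamma>] 1[\<Gamma>])" if f: "f : car \<Gamma>" for f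
   using \<Gamma>_scalar[OF c] f by (simp add: \<Gamma>_sel(1))
 next
  let ?G = "restr \<Gamma> (regular \<Gamma>)"
  have surj: "(%f. f) ` car (hom_space R D D) = car ?G" by (simp add: \<Gamma>_sel(1))
  have z: "0[hom_space R D D] = 0[?G]" by (simp only: restr_sel regular_sel \<Gamma>_sel(2))
  have a: "f +[?G] g = f +[hom_space R D D] g" for f g by (simp only: restr_sel regular_sel \<Gamma>_sel(4))
  have s: "c .[?G] f = c .[hom_space R D D] f" if c: "c : car K" and f: "f : car (hom_space R D D)" for c f
  proof -
   have "c .[?G] f = (c .[\<Gamma>] 1[\<Gamma>]) *[\<Gamma>] f" by (simp only: restr_sel regular_sel)
   also have "\<dots> = c .[\<Gamma>] f" by (rule \<Gamma>_scalar(1)[OF c]) (use f in simp)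
   finally show ?thesis unfolding \<Gamma>_sel(6) .
  qed
  have im1: "left_module K ?G"
   by (rule left_module_image(1)[where p="%f. f", OF hom_space_lm[OF D_lm D_lm] surj z]) (rule a, rule s)
  have im2: "(%f. f) : mhom K (hom_space R D D) ?G"
   by (rule left_module_image(2)[where p="%f. f", OF hom_space_lm[OF D_lm D_lm] surj z]) (rule a, rule s)
  show "fdim K ?G"
   by (rule dim_iso(1)[OF fdim_hom[OF D_fd D_fd] im1 im2]) (unfold bij_betw_def, intro conjI inj_onI surj)
 qed
qed

definition \<epsilon> :: "nat => (nat => nat => 'k) => nat => nat => 'k" where
 "\<epsilon> i = (\<lambda>x\<in>car D. inj i (x i))"

lemma \<epsilon>_app: "x : car D ==> \<epsilon> i x = inj i (x i)"
 by (simp add: \<epsilon>_def)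

lemma lift_Hom:
 assumes "i < length Ms" "j < length Ms" "g : mhom R (Ms ! j) (Ms ! i)"
 shows "(\<lambda>x\<in>car D. inj i (g (x j))) : Hom D D"
 by (rule restrict_Hom[OF D_lm hom_comp[OF hom_comp[OF proj_hom[OF assms(2)] assms(3)] inj_hom[OF assms(1)]]])

lemma \<epsilon>_Hom: "i < length Ms ==> \<epsilon> i : Hom D D"
 unfolding \<epsilon>_def by (rule lift_Hom[OF _ _ hom_id])

lemma corner_hom:
 assumes "i < length Ms" "j < length Ms" "a : Hom D D"
 shows "(%y. a (inj j y) i) : mhom R (Ms ! j) (Ms ! i)"
 by (rule hom_comp[OF hom_comp[OF inj_hom[OF assms(2)] Hom_hom[OF assms(3)]] proj_hom[OF assms(1)]])

lemma \<epsilon>_idem: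
 assumes i: "i < length Ms" shows "\<epsilon> i *[\<Gamma>] \<epsilon> i = \<epsilon> i"
 by (rule Hom_eqI[OF \<Gamma>_comp[OF \<epsilon>_Hom[OF i] \<epsilon>_Hom[OF i]] \<epsilon>_Hom[OF i]])
  (simp add: \<Gamma>_app \<epsilon>_app hom_closed[OF inj_hom[OF i] D_comp] i)

lemma \<epsilon>_sum: "finsum \<Gamma> \<epsilon> {..<length Ms} = 1[\<Gamma>]"
proof -
 interpret G: ring \<Gamma> by (rule \<Gamma>_ring)
 interpret D: left_module R D by (rule D_lm)
 have "finsum \<Gamma> \<epsilon> F : Hom D D \<and> (\<forall>x\<in>car D. \<forall>j<length Ms. finsum \<Gamma> \<epsilon> F x j = (if j : F then x j else 0[Ms ! j]))"
  if "finite F" "F <= {..<length Ms}" for F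
  using that
 proof (induction F)
  case empty
  have "0[\<Gamma>] : Hom D D" using G.zero_closed unfolding \<Gamma>_sel(1) .
  then show ?case by (simp add: \<Gamma>_app(2)) (simp add: D_sel(2))
 next
  case (insert i F)
  then have i: "i < length Ms" and IH: "finsum \<Gamma> \<epsilon> F : Hom D D"
   "!!x j. x : car D ==> j < length Ms ==> finsum \<Gamma> \<epsilon> F x j = (if j : F then x j else 0[Ms ! j])" by auto
  have s: "finsum \<Gamma> \<epsilon> (insert i F) = \<epsilon> i +[\<Gamma>] finsum \<Gamma> \<epsilon> F"
   by (rule G.finsum_insert[OF insert(1,2)]) (use insert(4) \<epsilon>_Hom in \<open>auto simp: \<Gamma>_sel(1)\<close>)
  have c: "\<epsilon> i +[\<Gamma>] finsum \<Gamma> \<epsilon> F : Hom D D" using G.a_closed \<epsilon>_Hom[OF i] IH(1) by (simp add: \<Gamma>_sel(1))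
  have "finsum \<Gamma> \<epsilon> (insert i F) x j = (if j : insert i F then x j else 0[Ms ! j])" if x: "x : car D" and j: "j < length Ms" for x j
  proof -
   interpret Mj: left_module R "Ms ! j" by (rule Ml[OF j])
   have "finsum \<Gamma> \<epsilon> (insert i F) x j = inj i (x i) j +[Ms ! j] finsum \<Gamma> \<epsilon> F x j"
    unfolding s \<Gamma>_app(3)[OF x] \<epsilon>_app[OF x] using j by (simp add: D_sel(3))
   note sum = this
   show ?thesis
   proof (cases "j = i")
    case True
    have "x i +[Ms ! i] 0[Ms ! i] = x i" using Mj.M.r_zero[OF D_comp[OF x j]] unfolding True .
    then show ?thesis using sum True insert(2) IH(2)[OF x j] i by simp
   next
    case False
    then show ?thesis using sum D_comp[OF x j] j IH(2)[OF x j] by (simp add: inj_def)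
   qed
  qed
  then show ?case using c s by simp
 qed
 from this[of "{..<length Ms}"] have f: "finsum \<Gamma> \<epsilon> {..<length Ms} : Hom D D"
  "!!x j. x : car D ==> j < length Ms ==> finsum \<Gamma> \<epsilon> {..<length Ms} x j = x j" by auto
 show ?thesis
 proof (rule Hom_eqI[OF f(1) \<Gamma>_one])
  fix x assume x: "x : car D"
  show "finsum \<Gamma> \<epsilon> {..<length Ms} x = 1[\<Gamma>] x"
   unfolding \<Gamma>_app(1)[OF x] by (rule D_ext[OF Hom_closed[OF f(1) x] x f(2)[OF x]])
 qed
qed

text \<open>In a product of endomorphisms the right factor acts first, so the left ideal generated
  by \<open>\<epsilon> i\<close> consists of the endomorphisms that depend on the
  \<open>i\<close>-th coordinate only; it is \<open>Hom(M_i, D)\<close>.\<close>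

abbreviation pr :: "nat => ((nat => nat => 'k) => nat => nat => 'k, (nat => nat => 'k) => nat => nat => 'k) module" where
 "pr i \<equiv> (regular \<Gamma>) on ((%r. r *[\<Gamma>] \<epsilon> i) ` car \<Gamma>)"

lemma pr_sub: "i < length Ms ==> Module.submodule ((%r. r *[\<Gamma>] \<epsilon> i) ` car \<Gamma>) \<Gamma> (regular \<Gamma>)"
 using left_module.sub_cyclic[OF regular_left_module[OF \<Gamma>_ring], of "\<epsilon> i"] \<epsilon>_Hom by (simp add: \<Gamma>_sel(1))

lemma pr_iff:
 assumes i: "i < length Ms"
 shows "a : car (pr i) \<longleftrightarrow> a : Hom D D \<and> (\<forall>x\<in>car D. a (inj i (x i)) = a x)"
proof
 assume "a : car (pr i)"
 then obtain r where r: "r : Hom D D" "a = r *[\<Gamma>] \<epsilon> i" by (auto simp: \<Gamma>_sel(1))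
 have "a (inj i (x i)) = a x" if x: "x : car D" for x
 proof -
  note y = hom_closed[OF inj_hom[OF i] D_comp[OF x i]]
  show ?thesis unfolding r(2) \<Gamma>_app(4)[OF y] \<Gamma>_app(4)[OF x] \<epsilon>_app[OF y] \<epsilon>_app[OF x] inj_self[OF i] by (rule refl)
 qed
 then show "a : Hom D D \<and> (\<forall>x\<in>car D. a (inj i (x i)) = a x)" using \<Gamma>_comp[OF r(1) \<epsilon>_Hom[OF i]] r(2) by simp
next
 assume a: "a : Hom D D \<and> (\<forall>x\<in>car D. a (inj i (x i)) = a x)"
 then have "a = a *[\<Gamma>] \<epsilon> i"
  by (intro Hom_eqI[OF _ \<Gamma>_comp[OF _ \<epsilon>_Hom[OF i]]]) (simp_all add: \<Gamma>_app \<epsilon>_app)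
 then show "a : car (pr i)" using a by (auto simp: \<Gamma>_sel(1) intro: image_eqI[of _ _ a])
qed

lemma \<epsilon>_pr: assumes i: "i < length Ms" shows "\<epsilon> i : car (pr i)"
 unfolding pr_iff[OF i] using \<epsilon>_Hom[OF i] hom_closed[OF inj_hom[OF i] D_comp[OF _ i]] i by (simp add: \<epsilon>_app)

text \<open>The inverse of the corner of \<open>a\<close> at \<open>i\<close>, extended by zero to
  the direct sum, multiplies \<open>a\<close> to the generator \<open>\<epsilon> i\<close>.\<close>

lemma corner_unit:
 assumes i: "i < length Ms" and A: "Module.submodule A \<Gamma> (pr i)" and a: "a : A"
  and bij: "bij_betw (%y. a (inj i y) i) (car (Ms ! i)) (car (Ms ! i))"
 shows "A = car (pr i)"
proof -
 have pl: "left_module \<Gamma> (pr i)"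
  by (rule left_module.sub_left_module[OF regular_left_module[OF \<Gamma>_ring] pr_sub[OF i]])
 interpret P: left_module \<Gamma> "pr i" by (rule pl)
 have ap: "a : car (pr i)" by (rule P.sub_carrier[OF A a])
 then have aH: "a : Hom D D" and ax: "!!x. x : car D ==> a (inj i (x i)) = a x" using pr_iff[OF i] by blast+
 let ?g = "%y. a (inj i y) i"
 let ?h = "inv_into (car (Ms ! i)) ?g"
 have h: "?h : mhom R (Ms ! i) (Ms ! i)" by (rule hom_inv[OF Ml[OF i] Ml[OF i] corner_hom[OF i i aH] bij])
 let ?c = "\<lambda>x\<in>car D. inj i (?h (x i))"
 have c: "?c : Hom D D" by (rule lift_Hom[OF i i h])
 have "?c *[\<Gamma>] a = \<epsilon> i"
 proof (rule Hom_eqI[OF \<Gamma>_comp[OF c aH] \<epsilon>_Hom[OF i]])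
  fix x assume x: "x : car D"
  have "(?c *[\<Gamma>] a) x = inj i (?h (?g (x i)))"
   unfolding \<Gamma>_app(4)[OF x] using Hom_closed[OF aH x] ax[OF x] by simp
  also have "?h (?g (x i)) = x i" by (rule bij_betw_inv_into_left[OF bij D_comp[OF x i]])
  finally show "(?c *[\<Gamma>] a) x = \<epsilon> i x" unfolding \<epsilon>_app[OF x] .
 qed
 moreover have "?c .[pr i] a : A" by (rule P.sub_smult[OF A _ a]) (simp add: \<Gamma>_sel(1) c)
 ultimately have eA: "\<epsilon> i : A" by simp
 have "car (pr i) <= A"
 proof
  fix b assume "b : car (pr i)"
  then obtain r where r: "r : car \<Gamma>" "b = r *[\<Gamma>] \<epsilon> i" by auto
  have "r .[pr i] \<epsilon> i : A" by (rule P.sub_smult[OF A r(1) eA])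
  then show "b : A" using r(2) by simp
 qed
 then show ?thesis using P.sub_subset[OF A] by blast
qed

text \<open>If \<open>\<epsilon> i = a + b\<close>, the corners of \<open>a\<close> and
  \<open>b\<close> at \<open>i\<close> add up to the identity of an indecomposable module, so by
  \<open>local_End\<close> one of them is bijective and \<open>corner_unit\<close> applies.\<close>

lemma hollow_pr:
 assumes i: "i < length Ms" shows "fd_algebra.hollow_sub \<Gamma> (pr i) (car (pr i))"
 unfolding fd_algebra.hollow_sub_def[OF \<Gamma>_fd_algebra]
proof (intro conjI allI impI)
 have pl: "left_module \<Gamma> (pr i)"
  by (rule left_module.sub_left_module[OF regular_left_module[OF \<Gamma>_ring] pr_sub[OF i]])
 interpret P: left_module \<Gamma> "pr i" by (rule pl)
 interpret M: left_module R "Ms ! i" by (rule Ml[OF i])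
 obtain y where y: "y : car (Ms ! i)" "y ~= 0[Ms ! i]" using indec_nonzero[OF Ms[OF i]] M.M.zero_closed by blast
 note jy = hom_closed[OF inj_hom[OF i] y(1)]
 have "\<epsilon> i (inj i y) i = y" using \<epsilon>_app[OF jy] i by simp
 moreover have "0[\<Gamma>] (inj i y) i = 0[Ms ! i]" using \<Gamma>_app(2)[OF jy] i by (simp add: D_sel(2))
 ultimately have "\<epsilon> i ~= 0[\<Gamma>]" using y(2) by metis
 then show "car (pr i) ~= {0[pr i]}" using \<epsilon>_pr[OF i] by auto
 fix A B assume "Module.submodule A \<Gamma> (pr i) \<and> Module.submodule B \<Gamma> (pr i) \<and> set_add (pr i) A B = car (pr i)"
 then have A: "Module.submodule A \<Gamma> (pr i)" and B: "Module.submodule B \<Gamma> (pr i)" and s: "set_add (pr i) A B = car (pr i)" by blast+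
 have "\<epsilon> i : set_add (pr i) A B" using \<epsilon>_pr[OF i] s by simp
 then obtain a b where a: "a : A" and b: "b : B" and e: "\<epsilon> i = a +[pr i] b" by (rule set_addE)
 have "a +[pr i] b = a +[\<Gamma>] b" by simp
 with e have e': "\<epsilon> i = a +[\<Gamma>] b" by (rule trans)
 have aH: "a : Hom D D" and bH: "b : Hom D D" using P.sub_carrier[OF A a] P.sub_carrier[OF B b] pr_iff[OF i] by blast+
 have id: "a (inj i y) i +[Ms ! i] b (inj i y) i = y" if y: "y : car (Ms ! i)" for y
 proof -
  note jy = hom_closed[OF inj_hom[OF i] y]
  have "\<epsilon> i (inj i y) i = y" using \<epsilon>_app[OF jy] i by simp
  moreover have "\<epsilon> i (inj i y) i = a (inj i y) i +[Ms ! i] b (inj i y) i"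
   unfolding e' \<Gamma>_app(3)[OF jy] using i by (simp add: D_sel(3))
  ultimately show ?thesis by simp
 qed
 have "bij_betw (%y. a (inj i y) i +[Ms ! i] b (inj i y) i) (car (Ms ! i)) (car (Ms ! i))"
  by (subst bij_betw_cong[where g="%y. y"]) (simp_all add: id bij_betw_def)
 from local_End[OF Ms[OF i] corner_hom[OF i i aH] corner_hom[OF i i bH] this]
 show "A = car (pr i) \<or> B = car (pr i)"
  using corner_unit[OF i A a] corner_unit[OF i B b] by blast
qed

text \<open>The isomorphism and its inverse are right multiplications by \<open>a\<close> and
  \<open>b\<close>, with products \<open>b a = \<epsilon> j\<close> and
  \<open>a b = \<epsilon> i\<close>. Their corners are mutually inverse maps between the two listed
  modules.\<close>

lemma pr_inj:
 assumes i: "i < length Ms" and j: "j < length Ms" and iso: "isomorphic_modules \<Gamma> (pr i) (pr j)"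
 shows "i = j"
proof -
 have pl: "left_module \<Gamma> (pr i)" if "i < length Ms" for i
  by (rule left_module.sub_left_module[OF regular_left_module[OF \<Gamma>_ring] pr_sub[OF that]])
 obtain f where f: "f : mhom \<Gamma> (pr i) (pr j)" and bij: "bij_betw f (car (pr i)) (car (pr j))"
  using iso by (rule fd_algebra.isoE[OF \<Gamma>_fd_algebra])
 let ?g = "inv_into (car (pr i)) f"
 have g: "?g : mhom \<Gamma> (pr j) (pr i)" by (rule hom_inv[OF pl[OF i] pl[OF j] f bij])
 let ?a = "f (\<epsilon> i)" and ?b = "?g (\<epsilon> j)"
 have ap: "?a : car (pr j)" by (rule hom_closed[OF f \<epsilon>_pr[OF i]])
 have bp: "?b : car (pr i)" by (rule hom_closed[OF g \<epsilon>_pr[OF j]])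
 have aH: "?a : Hom D D" and bH: "?b : Hom D D" using ap bp pr_iff[OF j] pr_iff[OF i] by blast+
 have aj: "?a *[\<Gamma>] \<epsilon> j = ?a" if True
  by (rule Hom_eqI[OF \<Gamma>_comp[OF aH \<epsilon>_Hom[OF j]] aH]) (use ap pr_iff[OF j] in \<open>simp add: \<Gamma>_app \<epsilon>_app\<close>)
 have bi: "?b *[\<Gamma>] \<epsilon> i = ?b" if True
  by (rule Hom_eqI[OF \<Gamma>_comp[OF bH \<epsilon>_Hom[OF i]] bH]) (use bp pr_iff[OF i] in \<open>simp add: \<Gamma>_app \<epsilon>_app\<close>)
 have ba: "?b *[\<Gamma>] ?a = \<epsilon> j"
 proof -
  have bc: "?b : car \<Gamma>" using bH by (simp add: \<Gamma>_sel(1))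
  have "f (?b .[pr i] \<epsilon> i) = ?b .[pr j] ?a" by (rule hom_smult[OF f bc \<epsilon>_pr[OF i]])
  moreover have "?b .[pr i] \<epsilon> i = ?b" using bi by simp
  ultimately show ?thesis using bij_betw_inv_into_right[OF bij \<epsilon>_pr[OF j]] by simp
 qed
 have ab: "?a *[\<Gamma>] ?b = \<epsilon> i"
 proof -
  have ac: "?a : car \<Gamma>" using aH by (simp add: \<Gamma>_sel(1))
  have "?g (?a .[pr j] \<epsilon> j) = ?a .[pr i] ?b" by (rule hom_smult[OF g ac \<epsilon>_pr[OF j]])
  moreover have "?a .[pr j] \<epsilon> j = ?a" using aj by simp
  ultimately show ?thesis using bij_betw_inv_into_left[OF bij \<epsilon>_pr[OF i]] by simp
 qed
 have inv: "u (inj l (w (inj k y) l)) k = y"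
  if k: "k < length Ms" and l: "l < length Ms" and u: "u : car (pr l)" and w: "w : Hom D D" and uw: "u *[\<Gamma>] w = \<epsilon> k" and y: "y : car (Ms ! k)"
  for k l u w y
 proof -
  note jy = hom_closed[OF inj_hom[OF k] y]
  have "u (inj l (w (inj k y) l)) = u (w (inj k y))" using u pr_iff[OF l] Hom_closed[OF w jy] by blast
  also have "\<dots> = \<epsilon> k (inj k y)" unfolding uw[symmetric] \<Gamma>_app(4)[OF jy] by (rule refl)
  finally show ?thesis using \<epsilon>_app[OF jy] k by simp
 qed
 let ?u = "%y. ?b (inj i y) j"
 have u: "?u : mhom R (Ms ! i) (Ms ! j)" by (rule corner_hom[OF j i bH])
 have w: "(%y. ?a (inj j y) i) : mhom R (Ms ! j) (Ms ! i)" by (rule corner_hom[OF i j aH])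
 have "bij_betw ?u (car (Ms ! i)) (car (Ms ! j))"
 proof (rule bij_betw_byWitness[where f'="%y. ?a (inj j y) i"])
  show "\<forall>y\<in>car (Ms ! i). ?a (inj j (?b (inj i y) j)) i = y" by (rule ballI) (rule inv[OF i j ap bH ab])
  show "\<forall>y\<in>car (Ms ! j). ?b (inj i (?a (inj j y) i)) j = y" by (rule ballI) (rule inv[OF j i bp aH ba])
  show "?u ` car (Ms ! i) <= car (Ms ! j)" by (rule image_subsetI) (rule hom_closed[OF u])
  show "(%y. ?a (inj j y) i) ` car (Ms ! j) <= car (Ms ! i)" by (rule image_subsetI) (rule hom_closed[OF w])
 qed
 from isoI[OF u this] show ?thesis by (rule Ms_inj[OF i j])
qed

lemma \<Gamma>_basic: "basic_algebra K \<Gamma> {..<length Ms} \<epsilon>"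
proof (rule basic_algebra.intro[OF \<Gamma>_fd_algebra], rule basic_algebra_axioms.intro)
 show "finsum \<Gamma> \<epsilon> {..<length Ms} = 1[\<Gamma>]" by (rule \<epsilon>_sum)
 fix i assume "i : {..<length Ms}"
 then have i: "i < length Ms" by simp
 show "\<epsilon> i : car \<Gamma>" using \<epsilon>_Hom[OF i] by (simp add: \<Gamma>_sel(1))
 show "\<epsilon> i *[\<Gamma>] \<epsilon> i = \<epsilon> i" by (rule \<epsilon>_idem[OF i])
 show "fd_algebra.hollow_sub \<Gamma> (pr i) (car (pr i))" by (rule hollow_pr[OF i])
 fix j assume "j : {..<length Ms}" and "isomorphic_modules \<Gamma> (pr i) (pr j)"
 then show "i = j" using pr_inj[OF i] by simp
qed simp

text \<open>The corner between the idempotents at \<open>i\<close> and \<open>j\<close> is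
  \<open>Hom(M_j, M_i)\<close>, with the order of the indices reversed; this is why a transpose
  appears in the magnitude.\<close>

lemma corner_dim:
 assumes i: "i < length Ms" and j: "j < length Ms"
 shows "vectorspace.dim K ((restr \<Gamma> (pr j)) on {x : car (pr j). \<epsilon> i *[\<Gamma>] x = x}) = hd (Ms ! j) (Ms ! i)"
proof -
 let ?W = "(restr \<Gamma> (pr j)) on {x : car (pr j). \<epsilon> i *[\<Gamma>] x = x}"
 let ?H = "hom_space R (Ms ! j) (Ms ! i)"
 let ?T = "%g. \<lambda>x\<in>car D. inj i (g (x j))"
 interpret Mi: left_module R "Ms ! i" by (rule Ml[OF i])
 interpret Mj: left_module R "Ms ! j" by (rule Ml[OF j])
 have Hl: "left_module K ?H" by (rule hom_space_lm[OF Ml[OF j] Ml[OF i]])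
 have TW: "?T g : car ?W" if g: "g : Hom (Ms ! j) (Ms ! i)" for g
 proof -
  have gH: "?T g : Hom D D" by (rule lift_Hom[OF i j Hom_hom[OF g]])
  have 1: "?T g : car (pr j)" unfolding pr_iff[OF j] using gH hom_closed[OF inj_hom[OF j] D_comp[OF _ j]] j by simp
  have "\<epsilon> i *[\<Gamma>] ?T g = ?T g"
   by (rule Hom_eqI[OF \<Gamma>_comp[OF \<epsilon>_Hom[OF i] gH] gH])
    (use hom_closed[OF inj_hom[OF i] hom_closed[OF Hom_hom[OF g] D_comp[OF _ j]]] i in \<open>simp add: \<Gamma>_app \<epsilon>_app\<close>)
  then show ?thesis using 1 by simp
 qed
 have sur: "\<exists>g\<in>Hom (Ms ! j) (Ms ! i). x = ?T g" if x: "x : car ?W" for x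
 proof -
  have xp: "x : car (pr j)" and ex: "\<epsilon> i *[\<Gamma>] x = x" using x by simp_all
  then have xH: "x : Hom D D" and xj: "!!y. y : car D ==> x (inj j (y j)) = x y" using pr_iff[OF j] by blast+
  let ?g = "\<lambda>y\<in>car (Ms ! j). x (inj j y) i"
  have g: "?g : Hom (Ms ! j) (Ms ! i)" by (rule restrict_Hom[OF Ml[OF j] corner_hom[OF i j xH]])
  have "x = ?T ?g"
  proof (rule Hom_eqI[OF xH lift_Hom[OF i j Hom_hom[OF g]]])
   fix y assume y: "y : car D"
   have "x y = (\<epsilon> i *[\<Gamma>] x) y" using ex by simp
   also have "\<dots> = inj i (x y i)" unfolding \<Gamma>_app(4)[OF y] by (rule \<epsilon>_app[OF Hom_closed[OF xH y]])
   finally show "x y = ?T ?g y" using y xj[OF y] D_comp[OF y j] by simp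
  qed
  then show ?thesis using g by blast
 qed
 have surj: "?T ` car ?H = car ?W"
 proof
  show "?T ` car ?H <= car ?W" by (rule image_subsetI) (rule TW, simp)
  show "car ?W <= ?T ` car ?H"
  proof
   fix x assume "x : car ?W"
   then obtain g where "g : Hom (Ms ! j) (Ms ! i)" "x = ?T g" using sur by blast
   then show "x : ?T ` car ?H" by simp
  qed
 qed
 have "?T 0[?H] = (\<lambda>x\<in>car D. 0[D])"
  by (rule restrict_ext) (simp add: D_comp[OF _ j] hom_zero[OF Ml[OF i] D_lm inj_hom[OF i]])
 then have z: "?T 0[?H] = 0[?W]" by (simp add: \<Gamma>_sel(2))
 have a: "?T f +[?W] ?T g = ?T (f +[?H] g)" if "f : car ?H" "g : car ?H" for f g
 proof -
  have f: "f : Hom (Ms ! j) (Ms ! i)" and g: "g : Hom (Ms ! j) (Ms ! i)" using that by simp_all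
  have "?T f +[?W] ?T g = (\<lambda>x\<in>car D. ?T f x +[D] ?T g x)" by (simp add: \<Gamma>_sel(4))
  also have "\<dots> = ?T (f +[?H] g)"
  proof (rule restrict_ext)
   fix x assume x: "x : car D"
   show "?T f x +[D] ?T g x = inj i ((f +[?H] g) (x j))"
    using x D_comp[OF x j] hom_add[OF inj_hom[OF i] hom_closed[OF Hom_hom[OF f] D_comp[OF x j]] hom_closed[OF Hom_hom[OF g] D_comp[OF x j]]] by simp
  qed
  finally show ?thesis .
 qed
 have s: "c .[?W] ?T g = ?T (c .[?H] g)" if c: "c : car K" and "g : car ?H" for c g
 proof -
  have g: "g : Hom (Ms ! j) (Ms ! i)" using that(2) by simp
  have "c .[?W] ?T g = c .[\<Gamma>] ?T g" using \<Gamma>_scalar(1)[OF c lift_Hom[OF i j Hom_hom[OF g]]] by simp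
  also have "\<dots> = (\<lambda>x\<in>car D. (c .[R] 1[R]) .[D] ?T g x)" by (simp only: \<Gamma>_sel(6) hom_space_sel(4))
  also have "\<dots> = ?T (c .[?H] g)"
  proof (rule restrict_ext)
   fix x assume x: "x : car D"
   show "(c .[R] 1[R]) .[D] ?T g x = inj i ((c .[?H] g) (x j))"
    using x D_comp[OF x j] hom_smult[OF inj_hom[OF i] sc_closed[OF c] hom_closed[OF Hom_hom[OF g] D_comp[OF x j]]] by simp
  qed
  finally show ?thesis .
 qed
 have 1: "left_module K ?W"
  by (rule left_module_image(1)[where p="?T", OF Hl surj z]) (rule a, assumption, assumption, rule s)
 have 2: "?T : mhom K ?H ?W"
  by (rule left_module_image(2)[where p="?T", OF Hl surj z]) (rule a, assumption, assumption, rule s)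
 have "inj_on ?T (car ?H)"
 proof (rule inj_onI)
  fix f g assume "f : car ?H" "g : car ?H" and e: "?T f = ?T g"
  then have f: "f : Hom (Ms ! j) (Ms ! i)" and g: "g : Hom (Ms ! j) (Ms ! i)" by simp_all
  show "f = g"
  proof (rule Hom_eqI[OF f g])
   fix y assume y: "y : car (Ms ! j)"
   note jy = hom_closed[OF inj_hom[OF j] y]
   have "?T f (inj j y) i = ?T g (inj j y) i" using e by simp
   then show "f y = g y" using jy i j by simp
  qed
 qed
 then have bij: "bij_betw ?T (car ?H) (car ?W)" using surj unfolding bij_betw_def by blast
 show ?thesis
  using dim_iso(2)[OF fdim_hom[OF indec_fd[OF Ms[OF j]] indec_fd[OF Ms[OF i]]] 1 2 bij] unfolding hd_def .
qed

end

section \<open>Bound path algebras as split algebras\<close>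

locale bound_quiver = K: field K + Q: fin_digraph Q
 for K :: "('k, 'c) ring_scheme" and Q :: "('v, 'e) pre_digraph" +
 fixes N :: "('v \<times> 'e list \<times> 'v => 'k) set"
 assumes admissible: "admissible_ideal K Q N"

context bound_quiver
begin

abbreviation A :: "('k, 'v \<times> 'e list \<times> 'v => 'k) module" where "A \<equiv> path_algebra K Q"
abbreviation B :: "('v \<times> 'e list \<times> 'v => 'k) set" where "B \<equiv> arrow_ideal K Q"

lemma N_ideal: "ideal N A"
 using admissible unfolding admissible_ideal_def by blast

text \<open>Since \<^term>\<open>N\<close> is an ideal of it, the path algebra is a ring; no computation is needed.\<close>

lemma A_ring: "ring A"
 using N_ideal by (rule ideal.axioms(2))

end

sublocale bound_quiver \<subseteq> A: ring "path_algebra K Q"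
 by (rule A_ring)

context bound_quiver
begin

lemma A_carrier: "x : car A \<longleftrightarrow> (\<forall>p. x p : car K) \<and> finite {p. x p ~= 0[K]} \<and> (\<forall>p. x p ~= 0[K] --> p : paths Q)"
 by (auto simp: path_algebra_def)

lemma A_val: "x : car A ==> x p : car K"
 and A_fin: "x : car A ==> finite {p. x p ~= 0[K]}"
 and A_path: "x : car A ==> x p ~= 0[K] ==> p : paths Q"
 by (unfold A_carrier) blast+

lemma A_app:
 "(x +[A] y) w = x w +[K] y w" "0[A] w = 0[K]" "(c .[A] x) w = c *[K] x w"
 "(x *[A] y) w = finsum K (%f. x (fst f) *[K] y (snd f)) (factorizations Q w)"
 "1[A] w = (if \<exists>v\<in>verts Q. w = (v, [], v) then 1[K] else 0[K])"
 by (simp_all add: path_algebra_def case_prod_beta')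

lemma paths_iff: "(u, p, v) : paths Q \<longleftrightarrow> Q.awalk u p v"
 by (simp add: paths_def)

lemma factorizations_iff:
 "(p, q) : factorizations Q w \<longleftrightarrow> p : paths Q \<and> q : paths Q \<and> (\<exists>u a v b x. p = (u, a, v) \<and> q = (v, b, x) \<and> w = (u, a @ b, x))"
 by (simp add: factorizations_def)

lemma finite_factorizations: "finite (factorizations Q w)"
proof -
 obtain u p x where w: "w = (u, p, x)" by (cases w)
 have "factorizations Q w <= (%(k, m). ((u, take k p, m), (m, drop k p, x))) ` ({..length p} \<times> verts Q)"
 proof
  fix f assume "f : factorizations Q w"
  then obtain a m b where f: "f = ((u, a, m), (m, b, x))" and p: "p = a @ b" and m: "Q.awalk m b x"
   unfolding w by (cases f) (auto simp: factorizations_iff paths_iff)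
  have "m : verts Q" using m unfolding Q.awalk_def by blast
  then show "f : (%(k, m). ((u, take k p, m), (m, drop k p, x))) ` ({..length p} \<times> verts Q)"
   by (intro image_eqI[of _ _ "(length a, m)"]) (simp_all add: f p)
 qed
 then show ?thesis by (rule finite_subset) (simp add: Q.finite_verts)
qed

lemma smult_closed: "c : car K ==> x : car A ==> c .[A] x : car A"
proof -
 assume c: "c : car K" and x: "x : car A"
 have "{p. c *[K] x p ~= 0[K]} <= {p. x p ~= 0[K]}" using c by auto
 then have "finite {p. c *[K] x p ~= 0[K]}" by (rule finite_subset[OF _ A_fin[OF x]])
 moreover have "p : paths Q" if "c *[K] x p ~= 0[K]" for p
  by (rule A_path[OF x]) (use that c in auto)
 ultimately show "c .[A] x : car A" unfolding A_carrier A_app using c A_val[OF x] by simp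
qed

text \<open>Evaluated path by path, both products are \<open>c\<close> times a product with
  \<open>1\<close>, so the unit laws of the ring suffice.\<close>

lemma scalar:
 assumes c: "c : car K" and x: "x : car A"
 shows "(c .[A] 1[A]) *[A] x = c .[A] x" "x *[A] (c .[A] 1[A]) = c .[A] x"
proof -
 note v = A_val[OF x] A_val[OF A.one_closed]
 show "(c .[A] 1[A]) *[A] x = c .[A] x"
 proof
  fix w
  have "((c .[A] 1[A]) *[A] x) w = finsum K (%f. c *[K] (1[A] (fst f) *[K] x (snd f))) (factorizations Q w)"
   unfolding A_app(3,4) using c v by (intro K.finsum_cong' refl) (simp_all add: K.m_assoc)
  also have "\<dots> = c *[K] (1[A] *[A] x) w"
   unfolding A_app(4) by (rule K.finsum_rdistr[OF finite_factorizations c, symmetric]) (use v in simp)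
  finally show "((c .[A] 1[A]) *[A] x) w = (c .[A] x) w" unfolding A.l_one[OF x] A_app(3) .
 qed
 show "x *[A] (c .[A] 1[A]) = c .[A] x"
 proof
  fix w
  have "(x *[A] (c .[A] 1[A])) w = finsum K (%f. c *[K] (x (fst f) *[K] 1[A] (snd f))) (factorizations Q w)"
   unfolding A_app(3,4) using c v by (intro K.finsum_cong' refl) (simp_all add: K.m_lcomm)
  also have "\<dots> = c *[K] (x *[A] 1[A]) w"
   unfolding A_app(4) by (rule K.finsum_rdistr[OF finite_factorizations c, symmetric]) (use v in simp)
  finally show "(x *[A] (c .[A] 1[A])) w = (c .[A] x) w" unfolding A.r_one[OF x] A_app(3) .
 qed
qed

lemma A_module: "left_module K A"
proof (rule left_moduleI[OF K.ring_axioms])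
 fix x assume x: "x : car A"
 show "\<exists>y\<in>car A. y +[A] x = 0[A]" using A.l_neg[OF x] A.a_inv_closed[OF x] by blast
 show "1[K] .[A] x = x" by (rule ext) (simp add: A_app A_val[OF x])
 fix c assume c: "c : car K"
 show "c .[A] x : car A" by (rule smult_closed[OF c x])
 show "(c +[K] d) .[A] x = c .[A] x +[A] d .[A] x" if "d : car K" for d
  by (rule ext) (simp add: A_app A_val[OF x] c that K.l_distr)
 show "(c *[K] d) .[A] x = c .[A] (d .[A] x)" if "d : car K" for d
  by (rule ext) (simp add: A_app A_val[OF x] c that K.m_assoc)
 show "c .[A] (x +[A] y) = c .[A] x +[A] c .[A] y" if "y : car A" for y
  by (rule ext) (simp add: A_app A_val[OF x] A_val[OF that] c K.r_distr)
qed (simp_all add: A.a_assoc, (rule A.a_comm; assumption))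

lemma A_diff_zero:
 assumes x: "x : car A" and y: "y : car A" and w: "x w = y w"
 shows "(x -[A] y) w = 0[K]"
proof -
 interpret M: left_module K A by (rule A_module)
 let ?d = "x -[A] y"
 have d: "?d : car A" using x y by simp
 have "(?d +[A] y) w = y w" using M.diff_add_cancel[OF x y] w by simp
 then have "?d w +[K] y w = y w" by (simp add: A_app)
 then have "(?d w +[K] y w) +[K] -[K] y w = y w +[K] -[K] y w" by simp
 then show ?thesis using A_val[OF d, of w] A_val[OF y, of w] by (simp add: K.a_assoc K.r_neg)
qed

definition \<delta> :: "'v \<times> 'e list \<times> 'v => 'v \<times> 'e list \<times> 'v => 'k" where
 "\<delta> p w = (if w = p then 1[K] else 0[K])"

lemma \<delta>_closed: "p : paths Q ==> \<delta> p : car A"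
proof -
 assume p: "p : paths Q"
 have "finite {w. \<delta> p w ~= 0[K]}" by (rule finite_subset[of _ "{p}"]) (auto simp: \<delta>_def)
 then show ?thesis using p by (auto simp: A_carrier \<delta>_def)
qed

lemma \<delta>_mult_app: "(\<delta> p *[A] \<delta> q) w = (if (p, q) : factorizations Q w then 1[K] else 0[K])"
proof -
 have "(\<delta> p *[A] \<delta> q) w = finsum K (%f. if (p, q) = f then 1[K] else 0[K]) (factorizations Q w)"
  unfolding A_app(4) by (rule K.finsum_cong') (auto simp: \<delta>_def)
 also have "\<dots> = (if (p, q) : factorizations Q w then 1[K] else 0[K])"
 proof (cases "(p, q) : factorizations Q w")
  case True
  then show ?thesis using K.add.finprod_singleton[OF True finite_factorizations, of "%_. 1[K]"] by (simp add: finsum_def)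
 next
  case False
  have "finsum K (%f. if (p, q) = f then 1[K] else 0[K]) (factorizations Q w) = finsum K (%f. 0[K]) (factorizations Q w)"
   by (rule K.finsum_cong') (use False in auto)
  then show ?thesis using False by simp
 qed
 finally show ?thesis .
qed

lemma \<delta>_mult:
 assumes "(u, a, v) : paths Q" "(v, b, x) : paths Q"
 shows "\<delta> (u, a, v) *[A] \<delta> (v, b, x) = \<delta> (u, a @ b, x)"
 by (rule ext) (use assms in \<open>auto simp: \<delta>_mult_app factorizations_iff \<delta>_def\<close>)

lemma \<delta>_mult_zero: "v ~= v' ==> \<delta> (u, a, v) *[A] \<delta> (v', b, x) = 0[A]"
 by (rule ext) (auto simp: \<delta>_mult_app factorizations_iff A_app(2))

lemma trivial_path: "v : verts Q ==> (v, [], v) : paths Q"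
 by (simp add: paths_iff Q.awalk_Nil_iff)

lemma mult_trivial:
 assumes x: "x : car A" and y: "y : car A"
 shows "(x *[A] y) (v, [], v) = x (v, [], v) *[K] y (v, [], v)"
proof (cases "v : verts Q")
 case True
 have "factorizations Q (v, [], v) = {((v, [], v), (v, [], v))}"
  using True by (auto simp: factorizations_def paths_iff Q.awalk_Nil_iff)
 then show ?thesis using A_val[OF x] A_val[OF y] by (simp add: A_app(4))
next
 case False
 then have n: "(v, [], v) ~: paths Q" by (simp add: paths_iff Q.awalk_Nil_iff)
 have z: "z (v, [], v) = 0[K]" if "z : car A" for z using A_path[OF that] n by blast
 show ?thesis using z[OF x] z[OF y] z[OF A.m_closed[OF x y]] by simp
qed

text \<open>Induction on the support. The added path is known to lie in the support of the original
  \<open>x\<close>, so information on the coefficients of \<open>x\<close> stays usable in the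
  step.\<close>

lemma path_induct [consumes 1, case_names zero add]:
 assumes x: "x : car A" and zero: "P 0[A]"
  and add: "!!c p y. c : car K ==> p : paths Q ==> x p ~= 0[K] ==> y : car A ==> P y ==> P (c .[A] \<delta> p +[A] y)"
 shows "P x"
proof -
 have "P y" if "finite S" "S <= {p. x p ~= 0[K]}" "y : car A" "{p. y p ~= 0[K]} = S" for S y
  using that
 proof (induction S arbitrary: y rule: finite_induct)
  case empty
  have "y = 0[A]" by (rule ext) (use empty in \<open>auto simp: A_app\<close>)
  then show ?case using zero by simp
 next
  case (insert p S)
  let ?z = "y(p := 0[K])"
  have y: "y : car A" by (rule insert.prems(2))
  have Sz: "{q. ?z q ~= 0[K]} = S" using insert by auto
  have z: "?z : car A" unfolding A_carrier Sz using insert.hyps(1) A_val[OF y] A_path[OF y] by auto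
  have Pz: "P ?z" by (rule insert.IH[OF _ z Sz]) (use insert.prems(1) in blast)
  have p: "p : paths Q" using insert.prems(3) A_path[OF y] by blast
  have "y = y p .[A] \<delta> p +[A] ?z" by (rule ext) (use A_val[OF y] in \<open>auto simp: A_app \<delta>_def\<close>)
  moreover have "P (y p .[A] \<delta> p +[A] ?z)"
   by (rule add[OF A_val[OF y] p _ z Pz]) (use insert.prems(1) in blast)
  ultimately show ?case by simp
 qed
 from this[OF A_fin[OF x] order_refl x refl] show ?thesis .
qed

lemma arrow_gen: "{%w. if w = (tail Q e, [e], head Q e) then 1[K] else 0[K] | e. e : arcs Q} = {\<delta> (tail Q e, [e], head Q e) | e. e : arcs Q}"
 by (simp add: \<delta>_def[abs_def])

lemma arc_path: "e : arcs Q ==> (tail Q e, [e], head Q e) : paths Q"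
 by (simp add: paths_iff Q.arc_implies_awalk)

lemma B_ideal: "ideal B A" and arc_in_B: "e : arcs Q ==> \<delta> (tail Q e, [e], head Q e) : B"
proof -
 have s: "{\<delta> (tail Q e, [e], head Q e) | e. e : arcs Q} <= car A" using \<delta>_closed[OF arc_path] by blast
 show "ideal B A" unfolding arrow_ideal_def arrow_gen by (rule A.genideal_ideal[OF s])
 show "\<delta> (tail Q e, [e], head Q e) : B" if "e : arcs Q"
  unfolding arrow_ideal_def arrow_gen using A.genideal_self[OF s] that by blast
qed

text \<open>The coefficient at a trivial path is multiplicative, so the elements with no trivial
  path in their support form an ideal, and it contains the arrows.\<close>

lemma B_trivial:
 assumes "x : B" shows "x (v, [], v) = 0[K]"
proof -
 let ?Z = "{x : car A. \<forall>v. x (v, [], v) = 0[K]}"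
 have neg: "(-[A] x) w = 0[K]" if x: "x : car A" "x w = 0[K]" for x w
  using A_diff_zero[OF A.zero_closed x(1), of w] x by (simp add: A_app a_minus_def)
 have "ideal ?Z A"
 proof (rule idealI[OF A_ring])
  show "subgroup ?Z (add_monoid A)"
   by (rule A.add.subgroupI) (auto simp: A_app neg a_inv_def[symmetric] intro: exI[of _ "0[A]"])
 qed (auto simp: mult_trivial A_val)
 moreover have "{\<delta> (tail Q e, [e], head Q e) | e. e : arcs Q} <= ?Z" using \<delta>_closed[OF arc_path] by (auto simp: \<delta>_def)
 ultimately have "B <= ?Z" unfolding arrow_ideal_def arrow_gen by (rule A.genideal_minimal)
 then show ?thesis using assms by blast
qed

abbreviation pw :: "nat => ('v \<times> 'e list \<times> 'v => 'k) set" where "pw n \<equiv> B [^]\<^bsub>ideals_set A\<^esub> n"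

lemma pw_simps: "pw 0 = car A" "pw (Suc n) = ideal_prod A (pw n) B"
 by (simp_all add: nat_pow_def ideals_set_def)

lemma pw_ideal: "ideal (pw n) A"
 by (induction n) (simp_all only: pw_simps A.oneideal A.ideal_prod_is_ideal[OF _ B_ideal])

lemma N_le_B: "N <= B"
proof -
 have "N <= pw 2" using admissible unfolding admissible_ideal_def by blast
 also have "\<dots> <= B" unfolding numeral_2_eq_2 pw_simps(2)[of "Suc 0"] using A.ideal_prod_inter[OF pw_ideal B_ideal, of "Suc 0"] by blast
 finally show ?thesis .
qed

lemma ex_pw_le: "\<exists>m. pw m <= N"
 using admissible unfolding admissible_ideal_def by blast

lemma foldr_mult:
 assumes "set xs <= car A" "z : car A"
 shows "foldr (mult A) xs 1[A] : car A \<and> foldr (mult A) xs z = foldr (mult A) xs 1[A] *[A] z"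
 using assms(1) by (induction xs) (use assms(2) in \<open>auto simp: A.m_assoc\<close>)

lemma foldr_pw: "set xs <= B ==> foldr (mult A) xs 1[A] : pw (length xs)"
proof (induction xs rule: rev_induct)
 case Nil
 show ?case unfolding list.size(3) pw_simps(1) by simp
next
 case (snoc x xs)
 interpret B: ideal B A by (rule B_ideal)
 have c: "set xs <= car A" "x : car A" using snoc(2) B.a_subset by auto
 have "foldr (mult A) (xs @ [x]) 1[A] = foldr (mult A) xs 1[A] *[A] x"
  using foldr_mult[OF c] c(2) by simp
 also have "\<dots> : pw (length (xs @ [x]))"
  unfolding length_append_singleton pw_simps(2) by (rule ideal_prod.prod) (use snoc in auto)
 finally show ?case .
qed

lemma \<delta>_pw: "(u, a, v) : paths Q ==> \<delta> (u, a, v) : pw (length a)"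
proof (induction a arbitrary: v rule: rev_induct)
 case Nil
 show ?case unfolding list.size(3) pw_simps(1) by (rule \<delta>_closed[OF Nil])
next
 case (snoc e a)
 let ?m = "Q.awlast u a"
 have w: "Q.awalk u a ?m" "Q.awalk ?m [e] v" using snoc.prems unfolding paths_iff Q.awalk_append_iff by blast+
 then have e: "e : arcs Q" "?m = tail Q e" "v = head Q e" by (auto simp: Q.awalk_Cons_iff Q.awalk_Nil_iff)
 have "\<delta> (u, a @ [e], v) = \<delta> (u, a, tail Q e) *[A] \<delta> (tail Q e, [e], head Q e)"
  using \<delta>_mult[OF _ arc_path[OF e(1)], of u a] w(1) e by (simp add: paths_iff)
 also have "\<dots> : pw (length (a @ [e]))"
  unfolding length_append_singleton pw_simps(2)
  by (rule ideal_prod.prod[OF snoc.IH arc_in_B[OF e(1)]]) (use w(1) e in \<open>simp add: paths_iff\<close>)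
 finally show ?case .
qed

text \<open>The first \<open>m\<close> arrows of the path already give an element of the
  \<open>m\<close>-th power of the arrow ideal.\<close>

lemma \<delta>_long:
 assumes m: "pw m <= N" and p: "(u, a, v) : paths Q" and l: "m \<le> length a"
 shows "\<delta> (u, a, v) : N"
proof -
 interpret N: ideal N A by (rule N_ideal)
 let ?x = "Q.awlast u (take m a)"
 have "Q.awalk u (take m a @ drop m a) v" using p by (simp add: paths_iff)
 then have w: "(u, take m a, ?x) : paths Q" "(?x, drop m a, v) : paths Q" unfolding Q.awalk_append_iff by (simp_all add: paths_iff)
 have "length (take m a) = m" using l by simp
 then have "\<delta> (u, take m a, ?x) : N" using subsetD[OF m] \<delta>_pw[OF w(1)] by metis
 from N.I_r_closed[OF this \<delta>_closed[OF w(2)]] show ?thesis using \<delta>_mult[OF w] by simp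
qed

text \<open>A nontrivial path is its first arrow times the rest. Together with
  \<open>B_trivial\<close> this describes the arrow ideal by coefficients.\<close>

lemma in_B:
 assumes x: "x : car A" and z: "!!v. x (v, [], v) = 0[K]" shows "x : B"
 using x
proof (induction rule: path_induct)
 case zero
 interpret B: ideal B A by (rule B_ideal)
 show ?case by (rule B.zero_closed)
next
 case (add c p y)
 interpret B: ideal B A by (rule B_ideal)
 obtain u a v where p: "p = (u, a, v)" by (cases p)
 have "a ~= []"
 proof
  assume a: "a = []"
  then have "u = v" using add(2) p by (simp add: paths_iff Q.awalk_Nil_iff)
  then show False using add(3) z p a by simp
 qed
 then obtain e b where a: "a = e # b" by (cases a) auto
 have w: "e : arcs Q" "u = tail Q e" "Q.awalk (head Q e) b v" using add(2) unfolding p a paths_iff Q.awalk_Cons_iff by blast+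
 have "\<delta> p = \<delta> (tail Q e, [e], head Q e) *[A] \<delta> (head Q e, b, v)"
  using \<delta>_mult[OF arc_path[OF w(1)], of b v] w by (simp add: p a paths_iff)
 then have "\<delta> p : B" using B.I_r_closed[OF arc_in_B[OF w(1)] \<delta>_closed] w(3) by (simp add: paths_iff)
 then have "c .[A] \<delta> p : B"
  using B.I_l_closed[OF _ smult_closed[OF add(1) A.one_closed]] scalar(1)[OF add(1) \<delta>_closed[OF add(2)]] by metis
 then show ?case using B.a_closed add(5) by blast
qed

abbreviation \<Lambda> :: "('k, ('v \<times> 'e list \<times> 'v => 'k) set) module" where "\<Lambda> \<equiv> bound_path_algebra K Q N"
abbreviation \<phi> :: "('v \<times> 'e list \<times> 'v => 'k) => ('v \<times> 'e list \<times> 'v => 'k) set" where "\<phi> x \<equiv> N +>\<^bsub>A\<^esub> x"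

lemma N_sub: "is_sub K A N"
proof -
 interpret M: left_module K A by (rule A_module)
 interpret N: ideal N A by (rule N_ideal)
 show ?thesis
 proof (rule M.subI)
  fix c x assume c: "c : car K" and x: "x : N"
  show "c .[A] x : N"
   using N.I_l_closed[OF x smult_closed[OF c A.one_closed]] scalar(1)[OF c] N.a_subset x by auto
 qed (use N.a_subset N.zero_closed N.a_closed in auto)
qed

lemma \<Lambda>_module: "left_module K \<Lambda>" "\<phi> : mhom K A \<Lambda>" "\<phi> ` car A = car \<Lambda>"
  "!!x. x : car A ==> \<phi> x = 0[\<Lambda>] \<longleftrightarrow> x : N"
 unfolding bound_path_algebra_def using quotient_module[OF A_module N_sub] by blast+

lemma \<phi>_closed: "x : car A ==> \<phi> x : car \<Lambda>"
 by (rule hom_closed[OF \<Lambda>_module(2)])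

lemma \<phi>_ex: assumes "X : car \<Lambda>" obtains x where "x : car A" "X = \<phi> x"
proof -
 have "X : \<phi> ` car A" using assms \<Lambda>_module(3) by simp
 then obtain x where "X = \<phi> x" "x : car A" by (rule imageE)
 then show thesis using that by blast
qed

lemma \<phi>_add: "x : car A ==> y : car A ==> \<phi> (x +[A] y) = \<phi> x +[\<Lambda>] \<phi> y"
 by (rule hom_add[OF \<Lambda>_module(2)])

lemma \<phi>_smult: "c : car K ==> x : car A ==> \<phi> (c .[A] x) = c .[\<Lambda>] \<phi> x"
 by (rule hom_smult[OF \<Lambda>_module(2)])

lemma \<Lambda>_mult: "mult \<Lambda> = rcoset_mult A N" and \<Lambda>_one: "1[\<Lambda>] = \<phi> 1[A]"
 by (simp_all add: bound_path_algebra_def quotient_module_def FactRing_def ring.defs module.defs)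

lemma \<phi>_mult:
 assumes "x : car A" "y : car A" shows "\<phi> (x *[A] y) = \<phi> x *[\<Lambda>] \<phi> y"
 unfolding \<Lambda>_mult using ideal.rcoset_mult_add[OF N_ideal assms] by simp

lemma \<Lambda>_ring: "ring \<Lambda>"
proof (rule ringI)
 interpret M: left_module K \<Lambda> by (rule \<Lambda>_module(1))
 show "abelian_group \<Lambda>" by (rule M.M.abelian_group_axioms)
 show "monoid \<Lambda>"
 proof (rule monoidI)
  fix X Y assume "X : car \<Lambda>" "Y : car \<Lambda>"
  then obtain x y where x: "x : car A" "X = \<phi> x" and y: "y : car A" "Y = \<phi> y" by (metis \<phi>_ex)
  show "X *[\<Lambda>] Y : car \<Lambda>" using \<phi>_closed[OF A.m_closed[OF x(1) y(1)]] \<phi>_mult[OF x(1) y(1)] x y by simp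
  fix Z assume "Z : car \<Lambda>"
  then obtain z where z: "z : car A" "Z = \<phi> z" by (rule \<phi>_ex)
  show "X *[\<Lambda>] Y *[\<Lambda>] Z = X *[\<Lambda>] (Y *[\<Lambda>] Z)"
   unfolding x(2) y(2) z(2) using x y z by (simp add: \<phi>_mult[symmetric] A.m_assoc)
 next
  show "1[\<Lambda>] : car \<Lambda>" unfolding \<Lambda>_one by (rule \<phi>_closed) simp
  fix X assume "X : car \<Lambda>"
  then obtain x where x: "x : car A" "X = \<phi> x" by (rule \<phi>_ex)
  show "1[\<Lambda>] *[\<Lambda>] X = X" "X *[\<Lambda>] 1[\<Lambda>] = X" unfolding \<Lambda>_one x(2) using x by (simp_all add: \<phi>_mult[symmetric])
 qed
 fix X Y Z assume "X : car \<Lambda>" "Y : car \<Lambda>" "Z : car \<Lambda>"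
 then obtain x y z where x: "x : car A" "X = \<phi> x" and y: "y : car A" "Y = \<phi> y" and z: "z : car A" "Z = \<phi> z" by (metis \<phi>_ex)
 show "(X +[\<Lambda>] Y) *[\<Lambda>] Z = X *[\<Lambda>] Z +[\<Lambda>] Y *[\<Lambda>] Z" "Z *[\<Lambda>] (X +[\<Lambda>] Y) = Z *[\<Lambda>] X +[\<Lambda>] Z *[\<Lambda>] Y"
  unfolding x(2) y(2) z(2) using x y z by (simp_all add: \<phi>_mult[symmetric] \<phi>_add[symmetric] A.l_distr A.r_distr)
qed

lemma \<Lambda>_scalar:
 assumes c: "c : car K" and "X : car \<Lambda>"
 shows "(c .[\<Lambda>] 1[\<Lambda>]) *[\<Lambda>] X = c .[\<Lambda>] X" "X *[\<Lambda>] (c .[\<Lambda>] 1[\<Lambda>]) = c .[\<Lambda>] X"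
proof -
 obtain x where x: "x : car A" "X = \<phi> x" using assms(2) by (rule \<phi>_ex)
 note c1 = smult_closed[OF c A.one_closed]
 have e: "c .[\<Lambda>] 1[\<Lambda>] = \<phi> (c .[A] 1[A])" unfolding \<Lambda>_one by (rule \<phi>_smult[OF c A.one_closed, symmetric])
 show "(c .[\<Lambda>] 1[\<Lambda>]) *[\<Lambda>] X = c .[\<Lambda>] X" "X *[\<Lambda>] (c .[\<Lambda>] 1[\<Lambda>]) = c .[\<Lambda>] X"
  unfolding e x(2) \<phi>_mult[OF c1 x(1), symmetric] \<phi>_mult[OF x(1) c1, symmetric] scalar[OF c x(1)] by (rule \<phi>_smult[OF c x(1)])+
qed

lemma short_paths_finite: "finite {(u, a, v). (u, a, v) : paths Q \<and> length a < m}"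
proof -
 have f: "finite {a. set a <= arcs Q \<and> length a \<le> m}" by (rule finite_lists_length_le[OF Q.finite_arcs])
 have "{(u, a, v). (u, a, v) : paths Q \<and> length a < m} <= verts Q \<times> {a. set a <= arcs Q \<and> length a \<le> m} \<times> verts Q"
  by (auto simp: paths_iff dest: Q.awalk_hd_in_verts Q.awalk_last_in_verts)
 then show ?thesis by (rule finite_subset) (simp add: f Q.finite_verts)
qed

text \<open>Paths of length at least \<open>m\<close> lie in \<open>N\<close>, so the classes of the
  finitely many shorter paths span.\<close>

lemma \<Lambda>_fdim: "fdim K (restr \<Lambda> (regular \<Lambda>))"
proof -
 let ?W = "restr \<Lambda> (regular \<Lambda>)"
 have W: "left_module K ?W"
  by (rule left_module_image(1)[OF \<Lambda>_module(1), where p="%x. x"]) (simp_all add: \<Lambda>_scalar)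
 have V: "vectorspace K ?W" using W K.field_axioms by (simp add: vectorspace_iff)
 obtain m where m: "pw m <= N" using ex_pw_le by blast
 let ?S = "(%p. \<phi> (\<delta> p)) ` {(u, a, v). (u, a, v) : paths Q \<and> length a < m}"
 have S: "?S <= car ?W" using \<phi>_closed[OF \<delta>_closed] by auto
 let ?N = "module.span K ?W ?S"
 have sN: "is_sub K ?W ?N" and SN: "?S <= ?N" using sub_span[OF V S] by blast+
 interpret W: left_module K ?W by (rule W)
 have dN: "\<phi> (\<delta> p) : ?N" if p: "p : paths Q" for p
 proof -
  obtain u a v where pe: "p = (u, a, v)" by (cases p)
  show ?thesis
  proof (cases "length a < m")
   case True
   then have "\<phi> (\<delta> p) : ?S" using p pe by (intro imageI) simp
   then show ?thesis using SN by blast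
  next
   case False
   have "\<delta> p : N" unfolding pe by (rule \<delta>_long[OF m]) (use p pe False in auto)
   then have "\<phi> (\<delta> p) = 0[?W]" using \<Lambda>_module(4)[OF \<delta>_closed[OF p]] by simp
   then show ?thesis using W.sub_zero[OF sN] by simp
  qed
 qed
 have "\<phi> x : ?N" if "x : car A" for x
  using that
 proof (induction rule: path_induct)
  case zero
  show ?case using W.sub_zero[OF sN] \<Lambda>_module(4)[OF A.zero_closed] additive_subgroup.zero_closed[OF ideal.axioms(1)[OF N_ideal]] by simp
 next
  case (add c p y)
  note d = \<delta>_closed[OF add(2)]
  have "c .[?W] \<phi> (\<delta> p) +[?W] \<phi> y : ?N" by (rule W.sub_add[OF sN W.sub_smult[OF sN add(1) dN[OF add(2)]] add(5)])
  moreover have "\<phi> (c .[A] \<delta> p +[A] y) = c .[?W] \<phi> (\<delta> p) +[?W] \<phi> y"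
   using \<phi>_add[OF smult_closed[OF add(1) d] add(4)] \<phi>_smult[OF add(1) d] \<Lambda>_scalar(1)[OF add(1) \<phi>_closed[OF d]] by simp
  ultimately show ?case by simp
 qed
 then have "car ?W <= ?N" using \<phi>_ex by auto
 then have "?N = car ?W" using W.sub_subset[OF sN] by blast
 moreover interpret vectorspace K ?W by (rule V)
 have "finite ?S" by (rule finite_imageI[OF short_paths_finite])
 ultimately have "fin_dim" unfolding fin_dim_def using S by blast
 then show ?thesis unfolding fdim_def using W K.field_axioms by blast
qed

lemma \<Lambda>_fd_algebra: "fd_algebra K \<Lambda>"
proof (rule fd_algebra.intro)
 interpret M: left_module K \<Lambda> by (rule \<Lambda>_module(1))
 have one: "1[\<Lambda>] : car \<Lambda>" unfolding \<Lambda>_one by (rule \<phi>_closed) simp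
 show "field K" by (rule K.field_axioms)
 show "ring \<Lambda>" by (rule \<Lambda>_ring)
 show "fdim K (restr \<Lambda> (regular \<Lambda>))" by (rule \<Lambda>_fdim)
 show "1[K] .[\<Lambda>] 1[\<Lambda>] = 1[\<Lambda>]" by (rule M.smult_one[OF one])
 fix c assume c: "c : car K"
 show "c .[\<Lambda>] 1[\<Lambda>] : car \<Lambda>" by (rule M.smult_closed[OF c one])
 show "(c +[K] d) .[\<Lambda>] 1[\<Lambda>] = c .[\<Lambda>] 1[\<Lambda>] +[\<Lambda>] d .[\<Lambda>] 1[\<Lambda>]" if "d : car K" for d
  by (rule M.smult_l_distr[OF c that one])
 show "(c *[K] d) .[\<Lambda>] 1[\<Lambda>] = (c .[\<Lambda>] 1[\<Lambda>]) *[\<Lambda>] (d .[\<Lambda>] 1[\<Lambda>])" if d: "d : car K" for d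
  unfolding \<Lambda>_scalar(1)[OF c M.smult_closed[OF d one]] by (rule M.smult_assoc[OF c d one])
 show "(c .[\<Lambda>] 1[\<Lambda>]) *[\<Lambda>] X = X *[\<Lambda>] (c .[\<Lambda>] 1[\<Lambda>])" if "X : car \<Lambda>" for X
  unfolding \<Lambda>_scalar[OF c that] by (rule refl)
qed

definition vertex :: "'v => ('v \<times> 'e list \<times> 'v => 'k) set" where "vertex v = \<phi> (\<delta> (v, [], v))"

lemma vertex_closed: "v : verts Q ==> vertex v : car \<Lambda>"
 unfolding vertex_def by (rule \<phi>_closed[OF \<delta>_closed[OF trivial_path]])

lemma \<phi>_zero: "\<phi> 0[A] = 0[\<Lambda>]"
 using \<Lambda>_module(4)[OF A.zero_closed] additive_subgroup.zero_closed[OF ideal.axioms(1)[OF N_ideal]] by blast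

lemma vertex_sum: "finsum \<Lambda> vertex (verts Q) = 1[\<Lambda>]"
proof -
 interpret L: ring \<Lambda> by (rule \<Lambda>_ring)
 let ?s = "%F w. if \<exists>v\<in>F. w = (v, [], v) then 1[K] else 0[K]"
 have "?s F : car A \<and> finsum \<Lambda> vertex F = \<phi> (?s F)" if "finite F" "F <= verts Q" for F
  using that
 proof (induction F)
  case empty
  have "?s {} = 0[A]" by (rule ext) (simp add: A_app)
  then show ?case using \<phi>_zero by simp
 next
  case (insert v F)
  then have v: "v : verts Q" and IH: "?s F : car A" "finsum \<Lambda> vertex F = \<phi> (?s F)" by auto
  note d = \<delta>_closed[OF trivial_path[OF v]]
  have e: "?s (insert v F) = \<delta> (v, [], v) +[A] ?s F" by (rule ext) (use insert(2) in \<open>auto simp: A_app \<delta>_def\<close>)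
  have fi: "finsum \<Lambda> vertex (insert v F) = vertex v +[\<Lambda>] finsum \<Lambda> vertex F"
   by (rule L.finsum_insert[OF insert(1,2)]) (use insert(4) vertex_closed in auto)
  have "?s (insert v F) : car A" unfolding e by (rule A.a_closed[OF d IH(1)])
  moreover have "finsum \<Lambda> vertex (insert v F) = \<phi> (?s (insert v F))" unfolding e \<phi>_add[OF d IH(1)] fi IH(2) vertex_def by (rule refl)
  ultimately show ?case by blast
 qed
 from this[OF Q.finite_verts order_refl] have "finsum \<Lambda> vertex (verts Q) = \<phi> (?s (verts Q))" by blast
 moreover have "?s (verts Q) = 1[A]" by (rule ext) (simp add: A_app)
 ultimately show ?thesis unfolding \<Lambda>_one by simp
qed

lemma J_ideal: "ideal (\<phi> ` B) \<Lambda>"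
proof (rule idealI[OF \<Lambda>_ring])
 interpret B: ideal B A by (rule B_ideal)
 interpret L: ring \<Lambda> by (rule \<Lambda>_ring)
 note Bc = subsetD[OF B.a_subset]
 interpret M: left_module K A by (rule A_module)
 show "subgroup (\<phi> ` B) (add_monoid \<Lambda>)"
 proof (rule L.add.subgroupI)
  show "\<phi> ` B <= car \<Lambda>" using \<phi>_closed Bc by blast
  show "\<phi> ` B ~= {}" using B.zero_closed by blast
  fix X assume "X : \<phi> ` B"
  then obtain x where x: "X = \<phi> x" "x : B" by (rule imageE)
  have "\<phi> (-[A] x) = -[\<Lambda>] \<phi> x" by (rule hom_neg[OF A_module \<Lambda>_module(1,2) Bc[OF x(2)]])
  then show "-[\<Lambda>] X : \<phi> ` B" unfolding x(1) using imageI[OF B.a_inv_closed[OF x(2)], of \<phi>] by simp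
  fix Y assume "Y : \<phi> ` B"
  then obtain y where y: "Y = \<phi> y" "y : B" by (rule imageE)
  show "X +[\<Lambda>] Y : \<phi> ` B"
   using imageI[OF B.a_closed[OF x(2) y(2)], of \<phi>] \<phi>_add[OF Bc[OF x(2)] Bc[OF y(2)]] x(1) y(1) by simp
 qed
 fix X Y assume "X : \<phi> ` B" and "Y : car \<Lambda>"
 obtain x where x: "X = \<phi> x" "x : B" using \<open>X : \<phi> ` B\<close> by (rule imageE)
 obtain y where y: "y : car A" "Y = \<phi> y" using \<open>Y : car \<Lambda>\<close> by (rule \<phi>_ex)
 show "Y *[\<Lambda>] X : \<phi> ` B" using imageI[OF B.I_l_closed[OF x(2) y(1)], of \<phi>] \<phi>_mult[OF y(1) Bc[OF x(2)]] x y by simp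
 show "X *[\<Lambda>] Y : \<phi> ` B" using imageI[OF B.I_r_closed[OF x(2) y(1)], of \<phi>] \<phi>_mult[OF Bc[OF x(2)] y(1)] x y by simp
qed

lemma foldr_\<phi>: "set xs <= car A ==> foldr (mult \<Lambda>) (map \<phi> xs) 1[\<Lambda>] = \<phi> (foldr (mult A) xs 1[A])"
proof (induction xs)
 case (Cons x xs)
 have "foldr (mult A) xs 1[A] : car A" using foldr_mult[of xs "1[A]"] Cons(2) by simp
 then show ?case using Cons by (simp add: \<phi>_mult)
qed (simp add: \<Lambda>_one)

lemma \<Lambda>_split: "split_algebra K \<Lambda> (verts Q) vertex (\<phi> ` B)"
proof (rule split_algebra.intro[OF \<Lambda>_fd_algebra], rule split_algebra_axioms.intro)
 interpret B: ideal B A by (rule B_ideal)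
 interpret N: ideal N A by (rule N_ideal)
 interpret L: ring \<Lambda> by (rule \<Lambda>_ring)
 interpret MA: left_module K A by (rule A_module)
 note Bc = subsetD[OF B.a_subset]
 show "finite (verts Q)" by (rule Q.finite_verts)
 show "finsum \<Lambda> vertex (verts Q) = 1[\<Lambda>]" by (rule vertex_sum)
 show "ideal (\<phi> ` B) \<Lambda>" by (rule J_ideal)
 fix v assume v: "v : verts Q"
 note d = \<delta>_closed[OF trivial_path[OF v]]
 show "vertex v : car \<Lambda>" by (rule vertex_closed[OF v])
 show "vertex v *[\<Lambda>] vertex v = vertex v"
  unfolding vertex_def \<phi>_mult[OF d d, symmetric] \<delta>_mult[OF trivial_path[OF v] trivial_path[OF v]] by simp
 show "vertex v ~: \<phi> ` B"
 proof
  assume "vertex v : \<phi> ` B"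
  then obtain x where x: "vertex v = \<phi> x" "x : B" by (rule imageE)
  \<comment> \<open>Equal classes differ by an element of \<open>N\<close>, and \<open>N\<close>
    lies inside the arrow ideal, so the trivial path itself would lie there.\<close>
  have "\<delta> (v, [], v) -[A] x : N" using MA.coset_eq_iff[OF N_sub d Bc[OF x(2)]] x(1) unfolding vertex_def by blast
  then have "\<delta> (v, [], v) -[A] x : B" using N_le_B by blast
  from B.a_closed[OF this x(2)] have "\<delta> (v, [], v) : B" using MA.diff_add_cancel[OF d Bc[OF x(2)]] by simp
  from B_trivial[OF this, of v] show False by (simp add: \<delta>_def)
 qed
 show "vertex v *[\<Lambda>] vertex u = 0[\<Lambda>]" if u: "u : verts Q" and ne: "v ~= u" for u
  unfolding vertex_def \<phi>_mult[OF d \<delta>_closed[OF trivial_path[OF u]], symmetric] \<delta>_mult_zero[OF ne] by (rule \<phi>_zero)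
 fix X assume "X : car \<Lambda>"
 then obtain x where x: "x : car A" "X = \<phi> x" by (rule \<phi>_ex)
 \<comment> \<open>The scalar is the coefficient of \<open>x\<close> at the trivial path of
   \<open>v\<close>. After subtracting it, no trivial path is left in the product of
   \<open>x\<close> with that path, so the remainder lies in the arrow ideal.\<close>
 let ?c = "x (v, [], v)"
 have c: "?c : car K" by (rule A_val[OF x(1)])
 let ?y = "x *[A] \<delta> (v, [], v)" and ?z = "?c .[A] \<delta> (v, [], v)"
 have y: "?y : car A" using x d by simp
 have z: "?z : car A" by (rule smult_closed[OF c d])
 have "?y -[A] ?z : B"
 proof (rule in_B)
  show "?y -[A] ?z : car A" using y z by simp
  fix u
  show "(?y -[A] ?z) (u, [], u) = 0[K]"
   by (rule A_diff_zero[OF y z]) (simp add: mult_trivial[OF x(1) d] A_app(3), simp add: \<delta>_def c A_val[OF x(1)])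
 qed
 moreover have "\<phi> ?z +[\<Lambda>] \<phi> (?y -[A] ?z) = \<phi> ?y"
  using \<phi>_add[OF z A.minus_closed[OF y z]] MA.add_diff_cancel[OF z y] by simp
 then have "X *[\<Lambda>] vertex v = (?c .[\<Lambda>] 1[\<Lambda>]) *[\<Lambda>] vertex v +[\<Lambda>] \<phi> (?y -[A] ?z)"
  unfolding \<Lambda>_scalar(1)[OF c vertex_closed[OF v]] unfolding vertex_def x(2) \<phi>_smult[OF c d, symmetric] \<phi>_mult[OF x(1) d, symmetric] by simp
 ultimately show "\<exists>c\<in>car K. \<exists>j\<in>\<phi> ` B. X *[\<Lambda>] vertex v = (c .[\<Lambda>] 1[\<Lambda>]) *[\<Lambda>] vertex v +[\<Lambda>] j" using c by blast
next
 interpret B: ideal B A by (rule B_ideal)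
 interpret L: ring \<Lambda> by (rule \<Lambda>_ring)
 \<comment> \<open>A list of \<open>m\<close> classes lifts to a list in the arrow ideal, and the
   product of the lifts lies in its \<open>m\<close>-th power, hence in \<open>N\<close>.\<close>
 obtain m where m: "pw m <= N" using ex_pw_le by blast
 have lift: "\<exists>xs. set xs <= B \<and> rs = map \<phi> xs" if "set rs <= \<phi> ` B" for rs
  using that
 proof (induction rs)
  case (Cons r rs)
  then obtain xs where xs: "set xs <= B" "rs = map \<phi> xs" by auto
  obtain x where x: "r = \<phi> x" "x : B" using Cons(2) by auto
  show ?case by (rule exI[of _ "x # xs"]) (use xs x in simp)
 qed simp
 have "foldr (mult \<Lambda>) rs 1[\<Lambda>] = 0[\<Lambda>]" if rs: "set rs <= \<phi> ` B" "length rs = m" for rs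
 proof -
  obtain xs where xs: "set xs <= B" "rs = map \<phi> xs" using lift[OF rs(1)] by blast
  have c: "set xs <= car A" using xs(1) B.a_subset by blast
  have "foldr (mult A) xs 1[A] : N" using foldr_pw[OF xs(1)] m rs(2) xs(2) by auto
  then show ?thesis
   using foldr_\<phi>[OF c] \<Lambda>_module(4)[of "foldr (mult A) xs 1[A]"] foldr_mult[OF c A.one_closed] xs(2) by simp
 qed
 then show "\<exists>n. \<forall>rs. set rs <= \<phi> ` B \<and> length rs = n --> foldr (mult \<Lambda>) rs 1[\<Lambda>] = 0[\<Lambda>]" by blast
qed

end

section \<open>Indecomposable projective modules of a split algebra\<close>

context split_algebra
begin

abbreviation pp :: "'i => ('a, 'a) module" where
 "pp i \<equiv> (regular R) on ((%r. r *[R] e i) ` car R)"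

lemma pp_lm: "i : I ==> lm (pp i)"
 using left_module.sub_left_module[OF regular_left_module[OF ring_R] left_module.sub_cyclic[OF regular_left_module[OF ring_R], of "e i"]] e_closed
 by simp

lemma pp_elem:
 assumes i: "i : I" and x: "x : car (pp i)"
 shows "x : car R" "x *[R] e i = x" "\<exists>c\<in>car K. \<exists>j\<in>J. x = (c .[R] 1[R]) *[R] e i +[R] j"
proof -
 interpret R: ring R by (rule ring_R)
 obtain r where r: "r : car R" "x = r *[R] e i" using x by auto
 then show "x : car R" "x *[R] e i = x" using e_closed[OF i] e_idem[OF i] by (simp_all add: R.m_assoc)
 show "\<exists>c\<in>car K. \<exists>j\<in>J. x = (c .[R] 1[R]) *[R] e i +[R] j" unfolding r(2) by (rule split[OF r(1) i])
qed

lemma e_in_pp: "i : I ==> e i : car (pp i)"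
 using e_closed e_idem by (auto intro!: image_eqI[of _ _ "e i"])

text \<open>After dividing by \<open>c\<close>, the submodule contains \<open>e i\<close> up to an
  element \<open>t\<close> of \<open>J\<close>. Substituting \<open>e_i = a' + t e_i\<close> into
  itself repeatedly gives \<open>e i\<close> as an element of \<open>A\<close> plus
  \<open>t^n e_i\<close>, and \<open>t\<close> is nilpotent.\<close>

lemma sub_full:
 assumes i: "i : I" and A: "sub (pp i) A" and a: "a : A" and c: "c : car K" "c ~= 0[K]" and j: "j : J"
  and e: "a = (c .[R] 1[R]) *[R] e i +[R] j"
 shows "A = car (pp i)"
proof -
 interpret R: ring R by (rule ring_R)
 interpret K: field K by (rule field_K)
 interpret J: ideal J R by (rule J_ideal)
 interpret P: left_module R "pp i" by (rule pp_lm[OF i])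
 note ei = e_closed[OF i]
 let ?d = "inv\<^bsub>K\<^esub> c"
 have d: "?d : car K" "?d *[K] c = 1[K]" using c K.field_Units by auto
 let ?D = "?d .[R] 1[R]" and ?C = "c .[R] 1[R]"
 have D: "?D : car R" and C: "?C : car R" using sc_closed d(1) c(1) by blast+
 have jc: "j : car R" by (rule J_carrier[OF j])
 have ac: "a : car R" "a *[R] e i = a" using pp_elem[OF i P.sub_carrier[OF A a]] by blast+
 let ?a = "?D *[R] a"
 have a': "?a : A" using P.sub_smult[OF A D a] by simp
 have DC: "?D *[R] ?C = 1[R]" using sc_mult[OF d(1) c(1)] d(2) sc_one by simp
 have ae: "?a = e i +[R] ?D *[R] j"
  unfolding e using D C ei jc by (simp add: R.r_distr R.m_assoc[symmetric] DC)
 let ?j = "-[R] (?D *[R] j)"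
 let ?t = "?j *[R] e i"
 have jJ: "?j : J" by (rule J.a_inv_closed[OF J.I_l_closed[OF j D]])
 have jcc: "?D *[R] j : car R" using D jc by simp
 have t: "?t : J" by (rule J.I_r_closed[OF jJ ei])
 have tc: "?t : car R" by (rule J_carrier[OF t])
 have aa: "?a *[R] e i = ?a" using D ac ei by (simp add: R.m_assoc)
 have "e i = ?a +[R] ?j" unfolding ae using ei jcc by (simp add: R.a_assoc R.r_neg)
 then have "e i *[R] e i = (?a +[R] ?j) *[R] e i" by simp
 then have rec: "e i = ?a +[R] ?t" using e_idem[OF i] aa D ac(1) ei jcc by (simp add: R.l_distr)
 have it: "\<exists>b\<in>A. e i = b +[R] foldr (mult R) (replicate n ?t) 1[R] *[R] e i \<and> foldr (mult R) (replicate n ?t) 1[R] : car R" for n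
 proof (induction n)
  case 0
  show ?case by (rule bexI[OF _ P.sub_zero[OF A]]) (use ei in simp)
 next
  case (Suc n)
  let ?f = "foldr (mult R) (replicate n ?t) 1[R]"
  obtain b where b: "b : A" "e i = b +[R] ?f *[R] e i" and f: "?f : car R" using Suc by blast
  have bc: "b : car R" using pp_elem(1)[OF i P.sub_carrier[OF A b(1)]] .
  have tb: "?t *[R] b : A" using P.sub_smult[OF A tc b(1)] by simp
  have tt: "?t = ?t *[R] e i" using jcc ei e_idem[OF i] by (simp add: R.m_assoc)
  have "?t *[R] e i = ?t *[R] (b +[R] ?f *[R] e i)" using b(2) by simp
  also have "\<dots> = ?t *[R] b +[R] (?t *[R] ?f) *[R] e i" using tc bc f ei by (simp add: R.r_distr R.m_assoc)
  finally have "?t = ?t *[R] b +[R] (?t *[R] ?f) *[R] e i" using tt by simp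
  then have "e i = ?a +[R] (?t *[R] b +[R] (?t *[R] ?f) *[R] e i)" using rec by simp
  then have "e i = (?a +[R] ?t *[R] b) +[R] (?t *[R] ?f) *[R] e i"
   using D ac(1) tc bc f ei by (simp add: R.a_assoc)
  moreover have "?a +[R] ?t *[R] b : A" using P.sub_add[OF A a' tb] by simp
  ultimately show ?case using tc f by (intro bexI[of _ "?a +[R] ?t *[R] b"]) simp_all
 qed
 obtain n where n: "\<forall>rs. set rs <= J \<and> length rs = n --> foldr (mult R) rs 1[R] = 0[R]" using J_nilp by blast
 have z: "foldr (mult R) (replicate n ?t) 1[R] = 0[R]" by (rule n[rule_format]) (use t in auto)
 obtain b where b: "b : A" "e i = b +[R] foldr (mult R) (replicate n ?t) 1[R] *[R] e i" using it[of n] by blast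
 have "b : car R" using pp_elem(1)[OF i P.sub_carrier[OF A b(1)]] .
 then have eA: "e i : A" using b ei unfolding z by simp
 have "car (pp i) <= A"
 proof
  fix x assume "x : car (pp i)"
  then obtain r where r: "r : car R" "x = r *[R] e i" by auto
  show "x : A" using P.sub_smult[OF A r(1) eA] r(2) by simp
 qed
 then show ?thesis using P.sub_subset[OF A] by blast
qed

text \<open>If \<open>e i\<close> is a sum of two elements, their scalar parts cannot both vanish,
  since \<open>e i\<close> is not in \<open>J\<close>; \<open>sub_full\<close> applies to a summand
  with nonzero scalar part.\<close>

lemma hollow_pp:
 assumes i: "i : I" shows "hollow (pp i)"
 unfolding hollow_sub_def
proof (intro conjI allI impI)
 interpret R: ring R by (rule ring_R)
 interpret J: ideal J R by (rule J_ideal)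
 interpret K: field K by (rule field_K)
 interpret P: left_module R "pp i" by (rule pp_lm[OF i])
 note ei = e_closed[OF i]
 have "e i ~= 0[R]" using e_notin[OF i] J.zero_closed by metis
 then show "car (pp i) ~= {0[pp i]}" using e_in_pp[OF i] by auto
 fix A B assume "sub (pp i) A \<and> sub (pp i) B \<and> set_add (pp i) A B = car (pp i)"
 then have A: "sub (pp i) A" and B: "sub (pp i) B" and s: "set_add (pp i) A B = car (pp i)" by blast+
 have "e i : set_add (pp i) A B" using e_in_pp[OF i] s by simp
 then obtain a b where a: "a : A" and b: "b : B" and e: "e i = a +[pp i] b" by (rule set_addE)
 obtain c j where c: "c : car K" "j : J" "a = (c .[R] 1[R]) *[R] e i +[R] j" using pp_elem(3)[OF i P.sub_carrier[OF A a]] by blast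
 obtain d l where d: "d : car K" "l : J" "b = (d .[R] 1[R]) *[R] e i +[R] l" using pp_elem(3)[OF i P.sub_carrier[OF B b]] by blast
 have z: "0[K] .[R] 1[R] = 0[R]"
 proof -
  have zc: "0[K] .[R] 1[R] : car R" by (rule sc_closed) simp
  have "0[K] .[R] 1[R] +[R] 0[K] .[R] 1[R] = 0[K] .[R] 1[R]" using sc_add[of "0[K]" "0[K]"] by simp
  then show ?thesis using zc R.add.l_cancel_one by blast
 qed
 show "A = car (pp i) \<or> B = car (pp i)"
 proof (cases "c = 0[K] \<and> d = 0[K]")
  case True
  have "a = j" "b = l" using c(3) d(3) True z J_carrier[OF c(2)] J_carrier[OF d(2)] ei by simp_all
  then have "e i : J" using e J.a_closed[OF c(2) d(2)] by simp
  then show ?thesis using e_notin[OF i] by blast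
 next
  case False
  then show ?thesis using sub_full[OF i A a c(1) _ c(2,3)] sub_full[OF i B b d(1) _ d(2,3)] by blast
 qed
qed

text \<open>An isomorphism yields \<open>x\<close> in \<open>e_i R e_k\<close> and \<open>y\<close>
  with \<open>y x = e_k\<close>. For different indices orthogonality kills the scalar part of
  \<open>x\<close>, so \<open>x\<close>, and with it \<open>e k\<close>, would lie in
  \<open>J\<close>.\<close>

lemma pp_inj:
 assumes i: "i : I" and k: "k : I" and iso: "isomorphic_modules R (pp i) (pp k)"
 shows "i = k"
proof (rule ccontr)
 assume ne: "i ~= k"
 interpret R: ring R by (rule ring_R)
 interpret J: ideal J R by (rule J_ideal)
 note ei = e_closed[OF i] and ek = e_closed[OF k]
 obtain f where f: "f : mhom R (pp i) (pp k)" and bij: "bij_betw f (car (pp i)) (car (pp k))"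
  using iso by (rule isoE)
 let ?g = "inv_into (car (pp i)) f"
 have g: "?g : mhom R (pp k) (pp i)" by (rule hom_inv[OF pp_lm[OF i] pp_lm[OF k] f bij])
 let ?x = "f (e i)" and ?y = "?g (e k)"
 have xp: "?x : car (pp k)" by (rule hom_closed[OF f e_in_pp[OF i]])
 have yp: "?y : car (pp i)" by (rule hom_closed[OF g e_in_pp[OF k]])
 note xc = pp_elem(1)[OF k xp] and yc = pp_elem(1)[OF i yp]
 have "f (?y .[pp i] e i) = ?y .[pp k] ?x" by (rule hom_smult[OF f yc e_in_pp[OF i]])
 moreover have "?y .[pp i] e i = ?y" using pp_elem(2)[OF i yp] by simp
 ultimately have yx: "?y *[R] ?x = e k" using bij_betw_inv_into_right[OF bij e_in_pp[OF k]] by simp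
 have "f (e i .[pp i] e i) = e i .[pp k] ?x" by (rule hom_smult[OF f ei e_in_pp[OF i]])
 then have ex: "e i *[R] ?x = ?x" using e_idem[OF i] by simp
 obtain c j where c: "c : car K" "j : J" "?x = (c .[R] 1[R]) *[R] e k +[R] j" using pp_elem(3)[OF k xp] by blast
 let ?C = "c .[R] 1[R]"
 have C: "?C : car R" by (rule sc_closed[OF c(1)])
 have jc: "j : car R" by (rule J_carrier[OF c(2)])
 have "e i *[R] (?C *[R] e k) = ?C *[R] (e i *[R] e k)"
  using sc_central[OF c(1) ei] C ei ek by (simp add: R.m_assoc[symmetric])
 then have "e i *[R] (?C *[R] e k) = 0[R]" using e_orth[OF i k ne] C by simp
 then have "e i *[R] (?C *[R] e k +[R] j) = e i *[R] j" using C ei ek jc by (simp add: R.r_distr)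
 then have "?x = e i *[R] j" using ex c(3) by simp
 then have "?x : J" using J.I_l_closed[OF c(2) ei] by simp
 then have "e k : J" using J.I_l_closed[OF _ yc] yx by metis
 then show False using e_notin[OF k] by blast
qed

lemma split_basic: "basic_algebra K R I e"
 by (rule basic_algebra.intro[OF fd_algebra_axioms], rule basic_algebra_axioms.intro)
  (rule finite_I, rule e_closed, assumption, rule e_idem, assumption, rule e_sum, rule hollow_pp, assumption, rule pp_inj, assumption+)

end

section \<open>Simple tops, simple socles and uniserial modules\<close>

context fd_algebra
begin

lemma simple_quotientI:
 fixes M :: "('a, 'm) module"
 assumes M: "lm M" and N: "sub M N" "N ~= car M" and mx: "!!A. sub M A ==> N <= A ==> A = N \<or> A = car M"
 shows "simple_module R (quotient_module M N)"
proof -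
 let ?Q = "quotient_module M N" and ?p = "%x. N +>\<^bsub>M\<^esub> x"
 note Q = quotient_module[OF M N(1)]
 interpret M: left_module R M by (rule M)
 interpret Q: left_module R ?Q by (rule Q(1))
 show ?thesis
  unfolding simple_module_def
 proof (intro conjI allI impI)
  show "left_module R ?Q" by (rule Q(1))
  obtain x where x: "x : car M" "x ~: N" using N M.sub_subset by blast
  then have "?p x ~= 0[?Q]" using Q(4) by blast
  then show "car ?Q ~= {0[?Q]}" using hom_closed[OF Q(2) x(1)] by blast
  fix X assume X: "sub ?Q X"
  let ?A = "{x : car M. ?p x : X}"
  have A: "sub M ?A" by (rule sub_vimage[OF M Q(1,2) X])
  have "N <= ?A"
  proof
   fix x assume x: "x : N"
   have xc: "x : car M" by (rule M.sub_carrier[OF N(1) x])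
   have "?p x = 0[?Q]" using Q(4)[OF xc] x by blast
   then show "x : ?A" using xc Q.sub_zero[OF X] by simp
  qed
  from mx[OF A this] show "X = {0[?Q]} \<or> X = car ?Q"
  proof
   assume e: "?A = N"
   have "X <= {0[?Q]}"
   proof
    fix y assume y: "y : X"
    have "y : ?p ` car M" using Q.sub_carrier[OF X y] Q(3) by simp
    then obtain x where x: "y = ?p x" "x : car M" by (rule imageE)
    have "x : ?A" using x y by simp
    then have "x : N" using e by blast
    then show "y : {0[?Q]}" using Q(4)[OF x(2)] x(1) by blast
   qed
   then show ?thesis using Q.sub_zero[OF X] by blast
  next
   assume e: "?A = car M"
   have "car ?Q <= X"
   proof
    fix y assume "y : car ?Q"
    then have "y : ?p ` car M" using Q(3) by simp
    then obtain x where x: "y = ?p x" "x : car M" by (rule imageE)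
    then have "x : ?A" using e by blast
    then show "y : X" using x(1) by simp
   qed
   then show ?thesis using Q.sub_subset[OF X] by blast
  qed
 qed
qed

lemma simple_quotientD:
 fixes M :: "('a, 'm) module"
 assumes M: "lm M" and N: "sub M N" and s: "simple_module R (quotient_module M N)" and A: "sub M A" "N <= A"
 shows "A = N \<or> A = car M"
proof -
 let ?Q = "quotient_module M N" and ?p = "%x. N +>\<^bsub>M\<^esub> x"
 note Q = quotient_module[OF M N]
 interpret M: left_module R M by (rule M)
 have "sub ?Q (?p ` A)" by (rule sub_image[OF M Q(1,2) A(1)])
 then have "?p ` A = {0[?Q]} \<or> ?p ` A = car ?Q" using s unfolding simple_module_def by blast
 then show ?thesis
 proof
  assume e: "?p ` A = {0[?Q]}"
  have "A <= N"
  proof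
   fix x assume x: "x : A"
   have "?p x : ?p ` A" by (rule imageI[OF x])
   then have "?p x = 0[?Q]" using e by simp
   then show "x : N" using Q(4)[OF M.sub_carrier[OF A(1) x]] by blast
  qed
  then show ?thesis using A(2) by blast
 next
  assume e: "?p ` A = car ?Q"
  have "car M <= A"
  proof
   fix x assume x: "x : car M"
   have "?p x : ?p ` A" using hom_closed[OF Q(2) x] e by simp
   then obtain a where a: "?p x = ?p a" "a : A" by (rule imageE)
   note ac = M.sub_carrier[OF A(1) a(2)]
   have "x -[M] a : N" using M.coset_eq_iff[OF N x ac] a(1) by blast
   then show "x : A" using M.sub_diff_mem[OF A(1) x a(2)] A(2) by blast
  qed
  then show ?thesis using M.sub_subset[OF A(1)] by blast
 qed
qed

lemma ex_maximal_above:
 fixes M :: "('a, 'm) module"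
 assumes M: "fd M" and A: "sub M A" "A ~= car M"
 shows "\<exists>N. maximal_submodule R M N \<and> A <= N"
proof -
 interpret M: left_module R M by (rule fd_lm[OF M])
 let ?Q = "%N. sub M N \<and> N ~= car M \<and> A <= N"
 have 0: "?Q A" using A by simp
 have bound: "\<forall>N. ?Q N --> dm (M on N) < Suc (dm M)" using dm_sub_le[OF M] by (simp add: less_Suc_eq_le)
 from ex_has_greatest_nat[of ?Q, OF 0 bound]
 obtain N where N: "?Q N" and mx: "!!B. ?Q B ==> dm (M on B) \<le> dm (M on N)" by blast
 have "maximal_submodule R M N"
  unfolding maximal_submodule_def
 proof (intro conjI allI impI)
  show "sub M N" "N ~= car M" using N by blast+
  fix B assume B: "sub M B \<and> N <= B"
  show "B = N \<or> B = car M"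
  proof (cases "B = car M")
   case False
   then have q: "?Q B" using B N by blast
   have "dm (M on N) = dm (M on B)" using mx[OF q] dm_mono(1)[OF M, of N B] N B by simp
   then have "N = B" using dm_mono(2)[OF M, of N B] N B by blast
   then show ?thesis by simp
  qed simp
 qed
 then show ?thesis using N by blast
qed

text \<open>When the top is simple, the radical is the only maximal submodule, and it contains any
  two proper submodules together with their sum.\<close>

lemma simple_top_hollow:
 fixes M :: "('a, 'm) module"
 assumes M: "fd M" "car M ~= {0[M]}" and s: "simple_module R (module_top R M)"
 shows "hollow M"
 unfolding hollow_sub_def
proof (intro conjI allI impI)
 show "car M ~= {0[M]}" by (rule M(2))
 interpret M: left_module R M by (rule fd_lm[OF M(1)])
 let ?J = "radical R M"
 have J: "sub M ?J"
  by (rule M.subI) (auto simp: radical_def maximal_submodule_def intro: M.sub_zero M.sub_add M.sub_smult M.smult_closed)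
 have max_rad: "N = ?J" if N: "maximal_submodule R M N" for N
 proof -
  have "?J <= N" using N unfolding radical_def by blast
  then have "N = ?J \<or> N = car M"
   using simple_quotientD[OF M.is_left_module J s[unfolded module_top_def]] N unfolding maximal_submodule_def by blast
  then show ?thesis using N unfolding maximal_submodule_def by blast
 qed
 fix A B assume ab: "sub M A \<and> sub M B \<and> set_add M A B = car M"
 show "A = car M \<or> B = car M"
 proof (rule ccontr)
  assume n: "\<not> ?thesis"
  obtain N where N: "maximal_submodule R M N" "A <= N" using ex_maximal_above[OF M(1)] ab n by blast
  obtain N' where N': "maximal_submodule R M N'" "B <= N'" using ex_maximal_above[OF M(1)] ab n by blast
  have "set_add M A B <= ?J" by (rule M.set_add_least[OF J]) (use N N' max_rad in blast)+
  then have "?J = car M" using ab M.sub_subset[OF J] by simp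
  then show False using max_rad[OF N(1)] N(1) unfolding maximal_submodule_def by simp
 qed
qed

lemma ex_simple_sub:
 fixes M :: "('a, 'm) module"
 assumes M: "fd M" and A: "sub M A" "A ~= {0[M]}"
 shows "\<exists>S. sub M S \<and> S <= A \<and> S ~= {0[M]} \<and> simple_module R (M on S)"
proof -
 interpret M: left_module R M by (rule fd_lm[OF M])
 let ?Q = "%S. sub M S \<and> S <= A \<and> S ~= {0[M]}"
 have "?Q A" using A by simp
 from ex_has_least_nat[of ?Q, OF this, of "%S. dm (M on S)"]
 obtain S where S: "?Q S" and mn: "!!B. ?Q B ==> dm (M on S) \<le> dm (M on B)" by blast
 have "simple_module R (M on S)"
  unfolding simple_module_def
 proof (intro conjI allI impI)
  show "left_module R (M on S)" using S by (intro M.sub_left_module) blast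
  show "car (M on S) ~= {0[M on S]}" using S by simp
  fix N assume "sub (M on S) N"
  then have N: "sub M N" "N <= S" using M.sub_of_sub S by blast+
  show "N = {0[M on S]} \<or> N = car (M on S)"
  proof (cases "N = {0[M]}")
   case False
   then have "?Q N" using N S by blast
   then have "dm (M on N) = dm (M on S)" using mn dm_mono(1)[OF M N(1) _ N(2)] S by (simp add: order_antisym)
   then have "N = S" using dm_mono(2)[OF M N(1) _ N(2)] S by blast
   then show ?thesis by simp
  qed simp
 qed
 then show ?thesis using S by blast
qed

text \<open>Every simple submodule equals the simple socle, and every nonzero submodule contains a
  simple one.\<close>

lemma simple_socle_uniform:
 fixes M :: "('a, 'm) module"
 assumes M: "fd M" "car M ~= {0[M]}" and s: "simple_module R (module_socle R M)"
 shows "uniform M"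
 unfolding uniform_def
proof (intro conjI allI impI)
 show "car M ~= {0[M]}" by (rule M(2))
 interpret M: left_module R M by (rule fd_lm[OF M(1)])
 let ?U = "\<Union>{S. sub M S \<and> simple_module R (M on S)}"
 let ?S = "generated_submodule R M ?U"
 have U: "?U <= car M" using M.sub_subset by blast
 have S: "sub M ?S"
 proof (rule M.subI)
  show "?S <= car M" unfolding generated_submodule_def using U M.sub_carrier_self by blast
  show "0[M] : ?S" unfolding generated_submodule_def using M.sub_zero by blast
  show "x +[M] y : ?S" if "x : ?S" "y : ?S" for x y using that M.sub_add unfolding generated_submodule_def by blast
  show "a .[M] x : ?S" if "a : car R" "x : ?S" for a x using that M.sub_smult unfolding generated_submodule_def by blast
 qed
 have US: "?U <= ?S" unfolding generated_submodule_def by blast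
 have full: "T = ?S" if T: "sub M T" "T ~= {0[M]}" "simple_module R (M on T)" for T
 proof -
  have "T <= ?S" using US T by blast
  then have "sub (M on ?S) T" using M.sub_of_sub[OF S] T(1) by blast
  then have "T = {0[M on ?S]} \<or> T = car (M on ?S)" using s unfolding module_socle_def simple_module_def by blast
  then show ?thesis using T(2) by simp
 qed
 fix A B assume ab: "sub M A \<and> sub M B \<and> A \<inter> B = {0[M]}"
 show "A = {0[M]} \<or> B = {0[M]}"
 proof (rule ccontr)
  assume n: "\<not> ?thesis"
  obtain T where T: "sub M T" "T <= A" "T ~= {0[M]}" "simple_module R (M on T)" using ex_simple_sub[OF M(1), of A] ab n by blast
  obtain T' where T': "sub M T'" "T' <= B" "T' ~= {0[M]}" "simple_module R (M on T')" using ex_simple_sub[OF M(1), of B] ab n by blast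
  have "T = T'" using full[OF T(1,3,4)] full[OF T'(1,3,4)] by simp
  then have "T <= {0[M]}" using T(2) T'(2) ab by blast
  then show False using T(3) M.sub_zero[OF T(1)] by blast
 qed
qed

text \<open>A segment of a composition series with free end points, so that a series can be built
  from pieces above and below a given submodule.\<close>

definition simple_chain :: "('a, 'm) module => 'm set list => bool" where
 "simple_chain M Ns \<longleftrightarrow> Ns ~= [] \<and> (\<forall>N\<in>set Ns. sub M N) \<and>
  (\<forall>i. Suc i < length Ns --> Ns ! i <= Ns ! Suc i \<and>
    simple_module R (quotient_module (M on (Ns ! Suc i)) (Ns ! i)))"

lemma simple_chain_Cons:
 assumes c: "simple_chain M Ns" and A: "sub M A" and s: "simple_module R (quotient_module (M on (List.hd Ns)) A)"
  and le: "A <= List.hd Ns"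
 shows "simple_chain M (A # Ns)"
 using c A(1) s le unfolding simple_chain_def
 by (auto simp: nth_Cons hd_conv_nth split: nat.split)

text \<open>Prolongs a chain starting at \<open>C\<close> downwards until it starts at
  \<open>A\<close>. The next member after \<open>A\<close> is a submodule of least dimension
  strictly between \<open>A\<close> and \<open>C\<close>, with \<open>C\<close> itself
  allowed.\<close>

lemma ex_simple_chain:
 fixes M :: "('a, 'm) module"
 assumes M: "fd M" and C: "sub M C" and T: "simple_chain M T" "List.hd T = C"
 shows "sub M A ==> A <= C ==> \<exists>L. simple_chain M L \<and> List.hd L = A \<and> set T <= set L \<and> last L = last T"
proof (induction "dm (M on C) - dm (M on A)" arbitrary: A rule: less_induct)
 case less
 note A = less.prems
 interpret M: left_module R M by (rule fd_lm[OF M])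
 show ?case
 proof (cases "A = C")
  case True
  then show ?thesis using T by blast
 next
  case False
  let ?Q = "%B. sub M B \<and> A <= B \<and> B ~= A \<and> B <= C"
  have "?Q C" using C A False by blast
  from ex_has_least_nat[of ?Q, OF this, of "%B. dm (M on B)"]
  obtain B where B: "?Q B" and mn: "!!D. ?Q D ==> dm (M on B) \<le> dm (M on D)" by blast
  have Bs: "sub M B" "A <= B" "B ~= A" "B <= C" using B by blast+
  have lt: "dm (M on A) < dm (M on B)"
   using dm_mono[OF M A(1) Bs(1,2)] Bs(3) by (metis le_neq_implies_less)
  have "dm (M on B) \<le> dm (M on C)" by (rule dm_mono(1)[OF M Bs(1) C Bs(4)])
  then have "dm (M on C) - dm (M on B) < dm (M on C) - dm (M on A)" using lt by simp
  from less.hyps[OF this Bs(1,4)]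
  obtain L where L: "simple_chain M L" "List.hd L = B" "set T <= set L" "last L = last T" by blast
  have sA: "sub (M on B) A" using M.sub_of_sub[OF Bs(1)] A(1) Bs(2) by blast
  have "simple_module R (quotient_module (M on B) A)"
  proof (rule simple_quotientI[OF M.sub_left_module[OF Bs(1)] sA])
   show "A ~= car (M on B)" using Bs(3) by simp
   fix D assume "sub (M on B) D" and AD: "A <= D"
   then have D: "sub M D" "D <= B" using M.sub_of_sub[OF Bs(1)] by blast+
   show "D = A \<or> D = car (M on B)"
   proof (cases "D = A")
    case False
    then have "?Q D" using D AD Bs(4) by blast
    then have "dm (M on D) = dm (M on B)" using mn dm_mono(1)[OF M D(1) Bs(1) D(2)] by (simp add: order_antisym)
    then have "D = B" by (rule dm_mono(2)[OF M D(1) Bs(1) D(2)])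
    then show ?thesis by simp
   qed simp
  qed
  then have "simple_chain M (A # L)" using simple_chain_Cons[OF L(1) A(1)] L(2) Bs(2) by simp
  moreover have "L ~= []" using L(1) unfolding simple_chain_def by blast
  ultimately show ?thesis using L by (intro exI[of _ "A # L"]) auto
 qed
qed

text \<open>The series is refined from the whole module down to \<open>A\<close>, and from there
  down to zero.\<close>

lemma composition_series_through:
 fixes M :: "('a, 'm) module"
 assumes M: "fd M" and A: "sub M A"
 shows "\<exists>Ns. composition_series R M Ns \<and> A : set Ns"
proof -
 interpret M: left_module R M by (rule fd_lm[OF M])
 have t: "simple_chain M [car M]" unfolding simple_chain_def using M.sub_carrier_self by simp
 obtain L where L: "simple_chain M L" "List.hd L = A" "last L = car M"
  using ex_simple_chain[OF M M.sub_carrier_self t _ A M.sub_subset[OF A]] by auto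
 have "{0[M]} <= A" using M.sub_zero[OF A] by blast
 from ex_simple_chain[OF M A L(1,2) M.sub_zero_self this]
 obtain L' where L': "simple_chain M L'" "List.hd L' = {0[M]}" "set L <= set L'" "last L' = last L" by blast
 have "L ~= []" using L(1) unfolding simple_chain_def by blast
 then have "A : set L'" using L(2) L'(3) hd_in_set by blast
 moreover have "composition_series R M L'"
  using L' L(3) unfolding composition_series_def simple_chain_def by simp
 ultimately show ?thesis by blast
qed

text \<open>Every submodule occurs in some composition series, hence in the only one, and the
  members of that one form a finite chain.\<close>

lemma uniserial_subs:
 fixes M :: "('a, 'm) module"
 assumes M: "fd M" and u: "uniserial R M"
 shows "finite {A. sub M A}" "sub M A ==> sub M B ==> A <= B \<or> B <= A"
proof -
 obtain Ns where Ns: "composition_series R M Ns" and uq: "!!L. composition_series R M L ==> L = Ns"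
  using u unfolding uniserial_def by blast
 have all: "A : set Ns" if "sub M A" for A
  using composition_series_through[OF M that] uq by blast
 then have "{A. sub M A} <= set Ns" by blast
 then show "finite {A. sub M A}" by (rule finite_subset) simp
 have step: "Ns ! i <= Ns ! Suc i" if "Suc i < length Ns" for i using Ns that unfolding composition_series_def by blast
 have mono: "Ns ! i <= Ns ! j" if "i \<le> j" "j < length Ns" for i j
  using that
 proof (induction rule: dec_induct)
  case (step n)
  then show ?case using \<open>!!i. Suc i < length Ns ==> Ns ! i <= Ns ! Suc i\<close>[of n] by auto
 qed simp
 show "A <= B \<or> B <= A" if A: "sub M A" and B: "sub M B"
 proof -
  obtain i where i: "i < length Ns" "Ns ! i = A" using all[OF A] by (metis in_set_conv_nth)
  obtain j where j: "j < length Ns" "Ns ! j = B" using all[OF B] by (metis in_set_conv_nth)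
  show ?thesis using mono[of i j] mono[of j i] i j by (cases "i \<le> j") auto
 qed
qed

lemma uniserial_hollow:
 fixes M :: "('a, 'm) module"
 assumes M: "fd M" "car M ~= {0[M]}" and u: "uniserial R M"
 shows "hollow M"
 unfolding hollow_sub_def
proof (intro conjI allI impI)
 show "car M ~= {0[M]}" by (rule M(2))
 interpret M: left_module R M by (rule fd_lm[OF M(1)])
 fix A B assume ab: "sub M A \<and> sub M B \<and> set_add M A B = car M"
 from uniserial_subs(2)[OF M(1) u, of A B] ab show "A = car M \<or> B = car M"
  using M.set_add_least[of A A B] M.set_add_least[of B A B] M.sub_subset[of A] M.sub_subset[of B] by blast
qed

lemma iso_of_kernel:
 fixes P X Y :: "('k, 'a) fd_module"
 assumes P: "lm P" and X: "lm X" and Y: "lm Y" and f: "f : mhom R P X" "f ` car P = car X"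
  and g: "g : mhom R P Y" "g ` car P = car Y"
  and ker: "!!x. x : car P ==> f x = 0[X] \<longleftrightarrow> g x = 0[Y]"
 shows "isomorphic_modules R X Y"
proof -
 obtain h where h: "h : mhom R X Y" and hf: "!!x. x : car P ==> h (f x) = g x"
  using factor_through[OF P X Y f g(1)] ker by blast
 have "inj_on h (car X)"
  unfolding inj_iff_kernel[OF X Y h]
 proof (intro ballI impI)
  fix y assume y: "y : car X" "h y = 0[Y]"
  have "y : f ` car P" using y(1) f(2) by simp
  then obtain x where x: "y = f x" "x : car P" by (rule imageE)
  then show "y = 0[X]" using hf[OF x(2)] y(2) ker[OF x(2)] by simp
 qed
 moreover have "h ` car X = car Y"
 proof -
  have "h ` car X = h ` (f ` car P)" using f(2) by simp
  also have "\<dots> = g ` car P" unfolding image_image by (rule image_cong[OF refl hf])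
  finally show ?thesis using g(2) by simp
 qed
 ultimately show ?thesis using isoI[OF h] unfolding bij_betw_def by blast
qed

end

section \<open>Representation-finiteness of Nakayama algebras and the two instances of the type
  hypothesis\<close>

context split_algebra
begin

interpretation Bas: basic_algebra K R I e
 by (rule split_basic)

text \<open>The generator \<open>m\<close> from \<open>hollow_top\<close> is fixed by
  \<open>e i\<close>, so \<open>r e_i \<mapsto> r m\<close> is defined on the left ideal of
  \<open>e i\<close> and is onto.\<close>

lemma hollow_cover:
 fixes X :: "('k, 'a) fd_module"
 assumes X: "fd X" "hollow X"
 shows "\<exists>i\<in>I. \<exists>f\<in>mhom R (Bas.PJ i) X. f ` car (Bas.PJ i) = car X"
proof -
 note Xl = fd_lm[OF X(1)]
 interpret X: left_module R X by (rule Xl)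
 obtain N i m where i: "i : I" and m: "m : car X" "e i .[X] m = m" and gen: "(%r. r .[X] m) ` car R = car X"
  by (rule hollow_top[OF Xl X], rule that)
 obtain \<phi> where \<phi>: "\<phi> : mhom R (Bas.pj i) (Bas.PJ i)" and b: "bij_betw \<phi> (car (Bas.pj i)) (car (Bas.PJ i))"
  using Bas.PJ(2)[OF i] by (rule isoE)
 let ?\<psi> = "inv_into (car (Bas.pj i)) \<phi>"
 note pl = fd_lm[OF Bas.pj_fd[OF i]] and Pl = fd_lm[OF Bas.PJ(1)[OF i]]
 have \<psi>: "?\<psi> : mhom R (Bas.PJ i) (Bas.pj i)" by (rule hom_inv[OF pl Pl \<phi> b])
 have f: "(%x. ?\<psi> x .[X] m) : mhom R (Bas.PJ i) X" by (rule hom_comp[OF \<psi> Bas.pj_map[OF i Xl m(1)]])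
 have "(%x. ?\<psi> x .[X] m) ` car (Bas.PJ i) = car X"
 proof
  show "(%x. ?\<psi> x .[X] m) ` car (Bas.PJ i) <= car X" by (rule image_subsetI) (rule hom_closed[OF f])
  show "car X <= (%x. ?\<psi> x .[X] m) ` car (Bas.PJ i)"
  proof
   fix y assume "y : car X"
   then have "y : (%r. r .[X] m) ` car R" using gen by simp
   then obtain r where r: "y = r .[X] m" "r : car R" by (rule imageE)
   have re: "r *[R] e i : car (Bas.pj i)" using r(2) by simp
   have "?\<psi> (\<phi> (r *[R] e i)) = r *[R] e i" by (rule bij_betw_inv_into_left[OF b re])
   then have y: "y = ?\<psi> (\<phi> (r *[R] e i)) .[X] m" using X.smult_assoc[OF r(2) e_closed[OF i] m(1)] m(2) r(1) by simp
   show "y : (%x. ?\<psi> x .[X] m) ` car (Bas.PJ i)" unfolding y by (rule imageI[OF hom_closed[OF \<phi> re]])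
  qed
 qed
 then show ?thesis using i f by blast
qed

text \<open>Every indecomposable module is an image of some \<open>PJ i\<close> and is determined up
  to isomorphism by the kernel. As \<open>PJ i\<close> is itself uniserial, it has finitely many
  submodules.\<close>

lemma nakayama_representation_finite:
 assumes nak: "nakayama_algebra R"
 shows "representation_finite R"
proof -
 define r where "r = {(M :: ('k, 'a) fd_module, N :: ('k, 'a) fd_module). indec M \<and> indec N \<and> isomorphic_modules R M N}"
 define A where "A = {M :: ('k, 'a) fd_module. indec M}"
 have r: "equiv A r" unfolding A_def r_def by (rule iso_equiv[OF fd_lm[OF indec_fd]])
 have r_iff: "(M, N) : r \<longleftrightarrow> indec M \<and> indec N \<and> isomorphic_modules R M N" for M N by (simp add: r_def)
 have A_iff: "M : A \<longleftrightarrow> indec M" for M by (simp add: A_def)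
 have uni: "uniserial R M" if "indec M" for M :: "('k, 'a) fd_module" using nak that unfolding nakayama_algebra_def by blast
 define cov where "cov X i N \<longleftrightarrow> i : I \<and> (\<exists>f\<in>mhom R (Bas.PJ i) X. f ` car (Bas.PJ i) = car X \<and>
   N = {x : car (Bas.PJ i). f x = 0[X]})" for X :: "('k, 'a) fd_module" and i N
 have ex: "\<exists>iN. cov X (fst iN) (snd iN)" if X: "indec X" for X :: "('k, 'a) fd_module"
 proof -
  obtain i f where "i : I" "f : mhom R (Bas.PJ i) X" "f ` car (Bas.PJ i) = car X"
   using hollow_cover[OF indec_fd[OF X] uniserial_hollow[OF indec_fd[OF X] indec_nonzero[OF X] uni[OF X]]] by blast
  then have "cov X i {x : car (Bas.PJ i). f x = 0[X]}" unfolding cov_def by blast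
  then show ?thesis by (intro exI[of _ "(i, {x : car (Bas.PJ i). f x = 0[X]})"]) simp
 qed
 have iso: "isomorphic_modules R X Y" if X: "indec X" and Y: "indec Y" and cX: "cov X i N" and cY: "cov Y i N" for X Y i N
 proof -
  obtain f where f: "f : mhom R (Bas.PJ i) X" "f ` car (Bas.PJ i) = car X" "N = {x : car (Bas.PJ i). f x = 0[X]}"
   using cX unfolding cov_def by blast
  obtain g where g: "g : mhom R (Bas.PJ i) Y" "g ` car (Bas.PJ i) = car Y" "N = {x : car (Bas.PJ i). g x = 0[Y]}"
   using cY unfolding cov_def by blast
  have i: "i : I" using cX unfolding cov_def by blast
  show ?thesis
   by (rule iso_of_kernel[OF fd_lm[OF Bas.PJ(1)[OF i]] fd_lm[OF indec_fd[OF X]] fd_lm[OF indec_fd[OF Y]] f(1,2) g(1,2)])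
    (use f(3) g(3) in blast)
 qed
 define c where "c C = (SOME iN. \<exists>X\<in>C. cov X (fst iN) (snd iN))" for C
 have c: "\<exists>X\<in>C. cov X (fst (c C)) (snd (c C))" if C: "C : A // r" for C
 proof -
  obtain X where X: "X : C" using in_quotient_imp_non_empty[OF r C] by blast
  have "indec X" using in_quotient_imp_subset[OF r C] X A_iff by blast
  from ex[OF this] X have "\<exists>iN. \<exists>X\<in>C. cov X (fst iN) (snd iN)" by blast
  then show ?thesis unfolding c_def by (rule someI_ex)
 qed
 have "inj_on c (A // r)"
 proof (rule inj_onI)
  fix C D assume C: "C : A // r" and D: "D : A // r" and e: "c C = c D"
  obtain X where X: "X : C" "cov X (fst (c C)) (snd (c C))" using c[OF C] by blast
  obtain Y where Y: "Y : D" "cov Y (fst (c C)) (snd (c C))" using c[OF D] e by auto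
  have i: "indec X" "indec Y" using in_quotient_imp_subset[OF r C] in_quotient_imp_subset[OF r D] X(1) Y(1) A_iff by blast+
  have "(X, Y) : r" using iso[OF i X(2) Y(2)] i r_iff by blast
  then show "C = D" using quotient_eqI[OF r C D X(1) Y(1)] by blast
 qed
 moreover have "c ` (A // r) <= (SIGMA i:I. {N. sub (Bas.PJ i) N})"
 proof (rule image_subsetI)
  fix C assume "C : A // r"
  from c[OF this] obtain X where X: "cov X (fst (c C)) (snd (c C))" and XC: "X : C" by blast
  have "indec X" using in_quotient_imp_subset[OF r \<open>C : A // r\<close>] XC A_iff by blast
  then have Xl: "lm X" by (rule fd_lm[OF indec_fd])
  have i: "fst (c C) : I" using X unfolding cov_def by blast
  obtain f where f: "f : mhom R (Bas.PJ (fst (c C))) X" "snd (c C) = {x : car (Bas.PJ (fst (c C))). f x = 0[X]}"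
   using X unfolding cov_def by blast
  have "sub (Bas.PJ (fst (c C))) (snd (c C))" unfolding f(2) by (rule sub_kernel[OF fd_lm[OF Bas.PJ(1)[OF i]] Xl f(1)])
  then show "c C : (SIGMA i:I. {N. sub (Bas.PJ i) N})" using i by (cases "c C") simp
 qed
 moreover have "finite (SIGMA i:I. {N. sub (Bas.PJ i) N})"
  by (rule finite_SigmaI[OF finite_I]) (rule uniserial_subs(1)[OF Bas.PJ(1) uni[OF Bas.indec_PJ]])
 ultimately have "finite (A // r)" by (rule inj_on_finite)
 then show ?thesis unfolding representation_finite_def iso_classes_def A_def r_def .
qed

lemma lc_algebra_local_colocal: "left_local_colocal_type R ==> lc_algebra K R I e J"
proof (rule lc_algebra.intro[OF split_algebra_axioms], rule lc_algebra_axioms.intro)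
 fix X :: "('k, 'a) fd_module"
 assume lc: "left_local_colocal_type R" and X: "indec X"
 show "hollow X \<or> uniform X"
  using lc X simple_top_hollow[OF indec_fd[OF X] indec_nonzero[OF X]] simple_socle_uniform[OF indec_fd[OF X] indec_nonzero[OF X]]
  unfolding left_local_colocal_type_def by blast
qed

lemma lc_algebra_nakayama: "nakayama_algebra R ==> lc_algebra K R I e J"
proof (rule lc_algebra.intro[OF split_algebra_axioms], rule lc_algebra_axioms.intro)
 fix X :: "('k, 'a) fd_module"
 assume n: "nakayama_algebra R" and X: "indec X"
 then have "uniserial R X" unfolding nakayama_algebra_def by blast
 from uniserial_hollow[OF indec_fd[OF X] indec_nonzero[OF X] this] show "hollow X \<or> uniform X" by blast
qed

end

section \<open>The magnitude of the module category\<close>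

context lc_algebra
begin

text \<open>Over the Auslander algebra the matrix for a list of projectives is, up to the
  relabelling \<open>\<sigma>\<close>, the transpose of the matrix of the modules. Neither operation
  changes the sum of the entries of the inverse.\<close>

lemma auslander_magnitude:
 fixes Ms :: "('k, 'a) fd_module list"
 assumes rep: "representatives R indec Ms"
 shows "has_magnitude K (auslander_algebra R Ms) (of_nat (card I))"
proof -
 note ri = representatives_indec[OF rep]
 interpret L: indec_list K R Ms
  by (rule indec_list.intro[OF fd_algebra_axioms], rule indec_list_axioms.intro) (rule ri(1), assumption, rule ri(2), assumption+)
 let ?G = "auslander_algebra R Ms" and ?n = "length Ms"
 interpret G: basic_algebra K ?G "{..<?n}" L.\<epsilon> by (rule L.\<Gamma>_basic)
 let ?h = "%i j. of_nat (hd (Ms ! i) (Ms ! j)) :: rat"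
 let ?H = "mat ?n ?n (%(i, j). ?h i j)"
 obtain W where W: "W : carrier_mat ?n ?n" "?H * W = 1\<^sub>m ?n" "W * ?H = 1\<^sub>m ?n"
  using mat_inverse_exists[of ?n ?h] hom_matrix_kernel[OF rep] by blast
 have HW: "(\<Sum>j<?n. ?h i j * W $$ (j, l)) = (if i = l then 1 else 0)" if "i < ?n" "l < ?n" for i l
 proof -
  have "(?H * W) $$ (i, l) = (\<Sum>j<?n. ?h i j * W $$ (j, l))" using that W(1) by (simp add: scalar_prod_def atLeast0LessThan)
  then show ?thesis using W(2) that by simp
 qed
 have WH: "(\<Sum>j<?n. W $$ (i, j) * ?h j l) = (if i = l then 1 else 0)" if "i < ?n" "l < ?n" for i l
 proof -
  have "(W * ?H) $$ (i, l) = (\<Sum>j<?n. W $$ (i, j) * ?h j l)" using that W(1) by (simp add: scalar_prod_def atLeast0LessThan)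
  then show ?thesis using W(3) that by simp
 qed
 \<comment> \<open>The row sums of the inverse matrix solve the equations of
   \<open>weight_sum\<close>, so they are the weights.\<close>
 have "(\<Sum>i<?n. \<Sum>j<?n. W $$ (i, j)) = of_nat (card I)"
 proof (rule weight_sum[OF rep])
  fix i assume i: "i < ?n"
  have "(\<Sum>j<?n. ?h i j * (\<Sum>l<?n. W $$ (j, l))) = (\<Sum>l<?n. \<Sum>j<?n. ?h i j * W $$ (j, l))"
   unfolding sum_distrib_left by (rule sum.swap)
  also have "\<dots> = (\<Sum>l<?n. if i = l then 1 else 0)" by (rule sum.cong) (use HW i in simp_all)
  also have "\<dots> = 1" using i by simp
  finally show "(\<Sum>j<?n. ?h i j * (\<Sum>l<?n. W $$ (j, l))) = 1" .
 qed
 then have total: "(\<Sum>i<?n. \<Sum>j<?n. W $$ (i, j)) = of_nat (card I)" .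
 show ?thesis
  unfolding has_magnitude_def
 proof (intro conjI allI impI)
  show "\<exists>Ps. representatives ?G (indecomposable_projective ?G) Ps" by (rule G.projective_representatives_exist)
  fix Ps assume Ps: "representatives ?G (indecomposable_projective ?G) Ps"
  let ?m = "length Ps"
  obtain \<sigma> where \<sigma>: "bij_betw \<sigma> {..<?m} {..<?n}" and d: "!!k l. k < ?m ==> l < ?m ==>
   G.hd (Ps ! k) (Ps ! l) = vectorspace.dim K ((restr ?G (G.pj (\<sigma> l))) on {x : car (G.pj (\<sigma> l)). L.\<epsilon> (\<sigma> k) *[?G] x = x})"
   by (rule G.projective_representatives[OF Ps], rule that)
  have \<sigma>n: "\<sigma> k < ?n" if "k < ?m" for k using bij_betwE[OF \<sigma>] that by simp
  have \<sigma>i: "\<sigma> k = \<sigma> l \<longleftrightarrow> k = l" if "k < ?m" "l < ?m" for k l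
   using bij_betw_imp_inj_on[OF \<sigma>] that unfolding inj_on_def by auto
  have re: "(\<Sum>k<?m. f (\<sigma> k)) = (\<Sum>i<?n. f i)" for f :: "nat => rat" by (rule sum.reindex_bij_betw[OF \<sigma>])
  have hG: "vectorspace.dim K (hom_space ?G (Ps ! k) (Ps ! l)) = hd (Ms ! \<sigma> l) (Ms ! \<sigma> k)" if k: "k < ?m" and l: "l < ?m" for k l
   using d[OF k l] L.corner_dim[OF \<sigma>n[OF k] \<sigma>n[OF l]] unfolding G.hd_def G.pj_def by simp
  let ?P = "hom_matrix K ?G Ps"
  have P: "?P = mat ?m ?m (%(k, l). ?h (\<sigma> l) (\<sigma> k))"
   unfolding hom_matrix_def by (rule eq_matI) (simp_all add: hG)
  let ?V = "mat ?m ?m (%(k, l). W $$ (\<sigma> l, \<sigma> k))"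
  show "\<exists>V\<in>carrier_mat ?m ?m. inverts_mat ?P V \<and> inverts_mat V ?P \<and> of_nat (card I) = (\<Sum>i<?m. \<Sum>j<?m. V $$ (i, j))"
  proof (rule bexI[of _ ?V], intro conjI)
   show "inverts_mat ?P ?V"
    unfolding inverts_mat_def P
   proof (rule eq_matI)
    fix k l assume "k < dim_row (1\<^sub>m (dim_row (mat ?m ?m (%(k, l). ?h (\<sigma> l) (\<sigma> k)))) :: rat mat)" "l < dim_col (1\<^sub>m (dim_row (mat ?m ?m (%(k, l). ?h (\<sigma> l) (\<sigma> k)))) :: rat mat)"
    then have k: "k < ?m" and l: "l < ?m" by simp_all
    have "(mat ?m ?m (%(k, l). ?h (\<sigma> l) (\<sigma> k)) * ?V) $$ (k, l) = (\<Sum>j<?m. W $$ (\<sigma> l, \<sigma> j) * ?h (\<sigma> j) (\<sigma> k))"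
     using k l by (simp add: scalar_prod_def atLeast0LessThan mult.commute)
    also have "\<dots> = (\<Sum>i<?n. W $$ (\<sigma> l, i) * ?h i (\<sigma> k))" by (rule re)
    also have "\<dots> = (if \<sigma> l = \<sigma> k then 1 else 0)" by (rule WH[OF \<sigma>n[OF l] \<sigma>n[OF k]])
    finally show "(mat ?m ?m (%(k, l). ?h (\<sigma> l) (\<sigma> k)) * ?V) $$ (k, l) = 1\<^sub>m (dim_row (mat ?m ?m (%(k, l). ?h (\<sigma> l) (\<sigma> k)))) $$ (k, l)"
     using k l \<sigma>i[OF l k] by auto
   qed simp_all
   show "inverts_mat ?V ?P"
    unfolding inverts_mat_def P
   proof (rule eq_matI)
    fix k l assume "k < dim_row (1\<^sub>m (dim_row ?V) :: rat mat)" "l < dim_col (1\<^sub>m (dim_row ?V) :: rat mat)"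
    then have k: "k < ?m" and l: "l < ?m" by simp_all
    have "(?V * mat ?m ?m (%(k, l). ?h (\<sigma> l) (\<sigma> k))) $$ (k, l) = (\<Sum>j<?m. ?h (\<sigma> l) (\<sigma> j) * W $$ (\<sigma> j, \<sigma> k))"
     using k l by (simp add: scalar_prod_def atLeast0LessThan mult.commute)
    also have "\<dots> = (\<Sum>i<?n. ?h (\<sigma> l) i * W $$ (i, \<sigma> k))" by (rule re)
    also have "\<dots> = (if \<sigma> l = \<sigma> k then 1 else 0)" by (rule HW[OF \<sigma>n[OF l] \<sigma>n[OF k]])
    finally show "(?V * mat ?m ?m (%(k, l). ?h (\<sigma> l) (\<sigma> k))) $$ (k, l) = 1\<^sub>m (dim_row ?V) $$ (k, l)"
     using k l \<sigma>i[OF l k] by auto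
   qed simp_all
   have "(\<Sum>i<?m. \<Sum>j<?m. ?V $$ (i, j)) = (\<Sum>i<?m. \<Sum>j<?m. W $$ (\<sigma> j, \<sigma> i))" by (intro sum.cong refl) simp
   also have "\<dots> = (\<Sum>i<?m. \<Sum>j<?n. W $$ (j, \<sigma> i))" by (rule sum.cong[OF refl re])
   also have "\<dots> = (\<Sum>i<?n. \<Sum>j<?n. W $$ (j, i))" by (rule re)
   also have "\<dots> = (\<Sum>i<?n. \<Sum>j<?n. W $$ (i, j))" by (rule sum.swap)
   finally show "of_nat (card I) = (\<Sum>i<?m. \<Sum>j<?m. ?V $$ (i, j))" using total by simp
  qed simp
 qed
qed

lemma module_category_magnitude:
 assumes "representation_finite R"
 shows "has_module_category_magnitude K R (of_nat (card I))"
 unfolding has_module_category_magnitude_def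
proof (intro conjI allI impI)
 show "\<exists>Ms. representatives R indec Ms"
  by (rule representatives_exist[OF _ assms[unfolded representation_finite_def]]) (rule fd_lm[OF indec_fd])
qed (rule auslander_magnitude)

end

theorem corollary4p6:
  fixes K :: "('k, 'c) ring_scheme"
    and Q :: "('v, 'e) pre_digraph"
    and I :: "('v \<times> 'e list \<times> 'v \<Rightarrow> 'k) set"
    and \<Lambda> :: "('k, ('v \<times> 'e list \<times> 'v \<Rightarrow> 'k) set) module"
    and n :: nat
  assumes "field K"
    and "fin_digraph Q"
    and "admissible_ideal K Q I"
    and "\<Lambda> = bound_path_algebra K Q I"
    and "algebra_rank \<Lambda> = n"
  shows "(representation_finite \<Lambda> \<and> left_local_colocal_type \<Lambda> \<longrightarrow>
            has_module_category_magnitude K \<Lambda> (of_nat n)) \<and>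
         (nakayama_algebra \<Lambda> \<longrightarrow>
            representation_finite \<Lambda> \<and> has_module_category_magnitude K \<Lambda> (of_nat n))"
proof -
 interpret bound_quiver K Q I
  by (rule bound_quiver.intro[OF assms(1,2)], rule bound_quiver_axioms.intro) (rule assms(3))
 interpret split_algebra K \<Lambda> "verts Q" vertex "\<phi> ` B"
  unfolding assms(4) by (rule \<Lambda>_split)
 have n: "n = card (verts Q)"
  using basic_algebra.algebra_rank_eq[OF split_basic] assms(5) by simp
 show ?thesis
  unfolding n
  using lc_algebra.module_category_magnitude[OF lc_algebra_local_colocal]
   lc_algebra.module_category_magnitude[OF lc_algebra_nakayama] nakayama_representation_finite
  by blast
qed

end
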